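(* Let $\mu\in\mathcal M_1(\mathcal S)$, let $K$ be continuous with $$H:=\sup_{v,w\in\mathcal M(\mathcal S\times\mathbb N)\colon\|v\|_1,\|w\|_1\le1}\langle v,Kw\rangle<\infty,$$ and let $T\in(0,\infty)$ satisfy $TH<\frac1{\mathrm e^2}\frac{\pi}{1+\pi}$. Then, under $\mathbb P^{(N)}_{\mathrm{Poi}_{N\mu}}$ (coagulation kernel $\frac1NK$), as $N\to\infty$ the process $(\frac1N\Xi_t)_{t\in[0,T]}$ converges in distribution to a deterministic path $\rho=(\rho_t)_{t\in[0,T]}$ in $\mathcal M(\mathcal S\times\mathbb N)$ that is a solution of the spatial Smoluchowski equation $$\partial_t\rho_t(\mathrm dx^*,m^* )=\sum_{m,m'\in\mathbb N\colon m+m'=m^*}\int_{\mathcal S}\int_{\mathcal S}\rho_t(\mathrm dx,m)\,\rho_t(\mathrm dx',m')\,\mathbf K\big((x,m),(x',m'),\mathrm dx^*\big)-\rho_t(\mathrm dx^*,m^* )\,K\rho_t(x^*,m^* ),$$ for $x^*\in\mathcal S$, $m^*\in\mathbb N$ and $t\in[0,T]$.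
   Context: Notation. $\mathcal S$ is a Polish space, $\mathbb N=\{1,2,\dots\}$, $\mathbb N_0=\{0,1,\dots\}$. $\mathcal M(\mathcal X)$ is the set of finite positive Borel measures on $\mathcal X$ with the weak topology; $\mathcal M_1(\mathcal X)$ the probability measures, $\mathcal M_{\mathbb N_0}(\mathcal X)$ the finite $\mathbb N_0$-valued (point) measures. $\langle\mathfrak m,g\rangle$ is the integral of $g$; for a measure $v$ on $\mathcal S\times\mathbb N$, $\|v\|_1=\sum_{m\in\mathbb N}m\,v(\mathcal S\times\{m\})$, and $v(\mathrm dx,m)$ denotes its restriction to mass $m$. $\mathrm{Poi}_\lambda$ is the law of a Poisson point process with intensity measure $\lambda$. Process. The coagulation kernel $K\colon(\mathcal S\times\mathbb N)^2\to[0,\infty)$ is measurable and symmetric; the placement kernel $\Upsilon$ is a Markov kernel from $(\mathcal S\times\mathbb N)^2$ to $\mathcal S$, symmetric in its first two arguments. $\mathbf K((x,m),(x',m'),\mathrm dz)=K((x,m),(x',m'))\,\Upsilon((x,m),(x',m'),\mathrm dz)$ and $K\phi(y)=\int K(y,y')\,\phi(\mathrm dy')$. The Marcus--Lushnikov process $\Xi=(\Xi_t)_{t\ge0}$ is the Markov jump process on $\mathcal M_{\mathbb N_0}(\mathcal S\times\mathbb N)$, $\Xi_t=\sum_i\delta_{(X_i(t),M_i(t))}$ (locations and masses of the particles), in which each unordered pair of particles at $(x,m)$, $(x',m')$ is, independently, at rate $K((x,m),(x',m'))$ replaced by one particle of mass $m+m'$ at a random location sampled from $\Upsilon((x,m),(x',m'),\cdot)$.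 $\mathbb P_k$ is its law when started from $k\in\mathcal M_{\mathbb N_0}(\mathcal S)$, all initial particles having mass one; under $\mathbb P_0$ the process is constantly zero. $\mathbb P_{\mathrm{Poi}_\lambda}=\int\mathrm{Poi}_\lambda(\mathrm dk)\,\mathbb P_k$. A superscript $(N)$ on $\mathbb P$ means that $K$ is replaced by $\frac1NK$ in the dynamics. Paths live in the space $\mathbb D_T(\mathcal M(\mathcal S\times\mathbb N))$ of càdlàg paths $[0,T]\to\mathcal M(\mathcal S\times\mathbb N)$ with the Skorohod $J_1$-topology. The Smoluchowski equation is understood in the weak sense in $x^*$: for every $m^*\in\mathbb N$ and every bounded continuous $g\colon\mathcal S\to\mathbb R$, $t\mapsto\int_{\mathcal S}\rho_t(\mathrm dx^*,m^* )\,g(x^* )$ is differentiable with derivative equal to the integral of $g$ against the right-hand side.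
   Formalization: The gain term carries an extra factor 1/2 (each unordered pair of merging particles counts once); without it the claim fails: for K=1 the limit has ∂_tρ_t(S,2)=1/2 at t=0, while the displayed sum over ordered (m,m') gives 1. *)

theory Defs
  imports "HOL-Probability.Probability" "HOL-Library.Multiset"
begin

section \<open>Finite Borel measures and the weak topology\<close>

text \<open>A topological space is given as a subset \<open>A\<close> of a type, with the subspace topology.\<close>

definition finite_measures :: "'a::topological_space set \<Rightarrow> 'a measure set" where
  "finite_measures A = {v. sets v = sets (restrict_space borel A) \<and> finite_measure v}"

definition weak_topology :: "'a::topological_space set \<Rightarrow> 'a measure topology" where
  "weak_topology A = topology_generated_by
     {{v \<in> finite_measures A. (\<integral>x. g x \<partial>v) \<in> U} | (g :: 'a \<Rightarrow> real) U.
        continuous_on A g \<and> bounded (g ` A) \<and> open U}"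

definition borel_of :: "'e topology \<Rightarrow> 'e measure" where
  "borel_of E = sigma (topspace E) {U. openin E U}"


section \<open>Skorohod space and convergence in distribution\<close>

text \<open>Paths \<open>[0,T] \<rightarrow> E\<close> are extensional functions, i.e. \<open>undefined\<close> outside of \<open>[0,T]\<close>.\<close>

definition cadlag_paths :: "real \<Rightarrow> 'e topology \<Rightarrow> (real \<Rightarrow> 'e) set" where
  "cadlag_paths T E = {f \<in> {0..T} \<rightarrow>\<^sub>E topspace E.
     (\<forall>t\<in>{0..<T}. limitin E f (f t) (at_right t)) \<and>
     (\<forall>t\<in>{0<..T}. \<exists>l. limitin E f l (at_left t))}"

definition time_changes :: "real \<Rightarrow> (real \<Rightarrow> real) set" where
  "time_changes T = {\<tau>. strict_mono_on {0..T} \<tau> \<and> continuous_on {0..T} \<tau> \<and> \<tau> ` {0..T} = {0..T}}"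

definition skorohod_dist :: "real \<Rightarrow> ('e \<Rightarrow> 'e \<Rightarrow> real) \<Rightarrow> (real \<Rightarrow> 'e) \<Rightarrow> (real \<Rightarrow> 'e) \<Rightarrow> real" where
  "skorohod_dist T d f g = Inf {r. 0 < r \<and>
     (\<exists>\<tau>\<in>time_changes T. \<forall>t\<in>{0..T}. \<bar>\<tau> t - t\<bar> \<le> r \<and> d (f t) (g (\<tau> t)) \<le> r)}"

definition compatible_metric :: "'e topology \<Rightarrow> 'e \<Rightarrow> 'e \<Rightarrow> real" where
  "compatible_metric E =
     (SOME d. Metric_space (topspace E) d \<and> Metric_space.mtopology (topspace E) d = E)"

text \<open>The \<open>J\<^sub>1\<close>-topology over a metrizable space \<open>E\<close>. It does not depend on which of
  the metrics inducing the topology of \<open>E\<close> is chosen, since the range of a cadlag path is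
  relatively compact. The weak topology over a Polish space is metrizable.\<close>

definition skorohod_topology :: "real \<Rightarrow> 'e topology \<Rightarrow> (real \<Rightarrow> 'e) topology" where
  "skorohod_topology T E = topology (\<lambda>U. U \<subseteq> cadlag_paths T E \<and>
     (\<forall>f\<in>U. \<exists>r>0. \<forall>g\<in>cadlag_paths T E. skorohod_dist T (compatible_metric E) f g < r \<longrightarrow> g \<in> U))"

lemma openin_skorohod_topology:
  "openin (skorohod_topology T E) U \<longleftrightarrow> U \<subseteq> cadlag_paths T E \<and>
     (\<forall>f\<in>U. \<exists>r>0. \<forall>g\<in>cadlag_paths T E. skorohod_dist T (compatible_metric E) f g < r \<longrightarrow> g \<in> U)"
proof -
  let ?D = "skorohod_dist T (compatible_metric E)"
  let ?op = "\<lambda>U. U \<subseteq> cadlag_paths T E \<and>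
     (\<forall>f\<in>U. \<exists>r>0. \<forall>g\<in>cadlag_paths T E. ?D f g < r \<longrightarrow> g \<in> U)"
  have int: "?op (U \<inter> V)" if UV: "?op U" "?op V" for U V
  proof (intro conjI ballI)
    show "U \<inter> V \<subseteq> cadlag_paths T E" using UV by blast
    fix f assume f: "f \<in> U \<inter> V"
    obtain r where r: "r > 0" "\<forall>g\<in>cadlag_paths T E. ?D f g < r \<longrightarrow> g \<in> U"
      using UV(1) f by blast
    obtain s where s: "s > 0" "\<forall>g\<in>cadlag_paths T E. ?D f g < s \<longrightarrow> g \<in> V"
      using UV(2) f by blast
    show "\<exists>r>0. \<forall>g\<in>cadlag_paths T E. ?D f g < r \<longrightarrow> g \<in> U \<inter> V"
      using r s by (intro exI[of _ "min r s"]) auto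
  qed
  have un: "?op (\<Union>\<U>)" if \<U>: "\<forall>U\<in>\<U>. ?op U" for \<U>
  proof (intro conjI ballI)
    show "\<Union>\<U> \<subseteq> cadlag_paths T E" using \<U> by blast
    fix f assume "f \<in> \<Union>\<U>"
    then obtain U where U: "U \<in> \<U>" "f \<in> U" by blast
    then obtain r where r: "r > 0" "\<forall>g\<in>cadlag_paths T E. ?D f g < r \<longrightarrow> g \<in> U"
      using \<U> by blast
    show "\<exists>r>0. \<forall>g\<in>cadlag_paths T E. ?D f g < r \<longrightarrow> g \<in> \<Union>\<U>"
      using r U(1) by (intro exI[of _ r]) auto
  qed
  have "istopology ?op"
    unfolding istopology_def using int un by blast
  then show ?thesis
    unfolding skorohod_topology_def by (simp only: topology_inverse')
qed

definition converges_in_distribution ::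
  "'e topology \<Rightarrow> (nat \<Rightarrow> 'w measure) \<Rightarrow> (nat \<Rightarrow> 'w \<Rightarrow> 'e) \<Rightarrow> 'e measure \<Rightarrow> bool" where
  "converges_in_distribution E \<Omega> X L \<longleftrightarrow>
     (\<forall>n>0. X n \<in> \<Omega> n \<rightarrow>\<^sub>M borel_of E) \<and>
     (\<forall>F :: 'e \<Rightarrow> real. continuous_map E euclideanreal F \<longrightarrow> bounded (F ` topspace E) \<longrightarrow>
        (\<lambda>n. \<integral>f. F f \<partial>distr (\<Omega> n) (borel_of E) (X n)) \<longlonglongrightarrow> (\<integral>f. F f \<partial>L))"


section \<open>Markov jump processes\<close>

text \<open>\<open>Q y B\<close> is the rate at which the process jumps from \<open>y\<close> into \<open>B\<close>. \<open>Y\<close> is the embedded chain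
  and \<open>\<sigma> n\<close> the holding time in \<open>Y n\<close>: given \<open>Y 0, ..., Y n\<close> and \<open>\<sigma> 0, ..., \<sigma> (n-1)\<close>, the holding
  time \<open>\<sigma> n\<close> is exponential with parameter \<open>q = Q (Y n) (space E)\<close> and, independently, \<open>Y (n+1)\<close> has
  law \<open>Q (Y n) / q\<close>. If \<open>q = 0\<close>, the right-hand side below vanishes (by \<open>x / 0 = 0\<close>),
  so that \<open>\<sigma> n\<close> is almost surely infinite.\<close>

definition markov_jump_process ::
  "'e measure \<Rightarrow> ('e \<Rightarrow> 'e set \<Rightarrow> real) \<Rightarrow> 'w measure \<Rightarrow> (real \<Rightarrow> 'w \<Rightarrow> 'e) \<Rightarrow> bool" where
  "markov_jump_process E Q \<Omega> X \<longleftrightarrow> prob_space \<Omega> \<and>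
     (\<exists>(Y :: nat \<Rightarrow> 'w \<Rightarrow> 'e) (\<sigma> :: nat \<Rightarrow> 'w \<Rightarrow> ennreal).
       (\<forall>n. Y n \<in> \<Omega> \<rightarrow>\<^sub>M E) \<and> (\<forall>n. \<sigma> n \<in> borel_measurable \<Omega>) \<and>
       (\<forall>\<omega>\<in>space \<Omega>. \<forall>t\<ge>0. \<exists>n. (\<Sum>i<n. \<sigma> i \<omega>) \<le> ennreal t \<and> ennreal t < (\<Sum>i<Suc n. \<sigma> i \<omega>) \<and>
          X t \<omega> = Y n \<omega>) \<and>
       (\<forall>n A C B. \<forall>s\<ge>0. (\<forall>i\<le>n. A i \<in> sets E) \<longrightarrow> (\<forall>i<n. C i \<in> sets borel) \<longrightarrow> B \<in> sets E \<longrightarrow>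
          (let H = {\<omega> \<in> space \<Omega>. (\<forall>i\<le>n. Y i \<omega> \<in> A i) \<and> (\<forall>i<n. \<sigma> i \<omega> \<in> C i)};
               q = (\<lambda>\<omega>. Q (Y n \<omega>) (space E))
           in measure \<Omega> {\<omega> \<in> H. \<sigma> n \<omega> \<le> ennreal s \<and> Y (Suc n) \<omega> \<in> B} =
              (\<integral>\<omega>. indicator H \<omega> * ((1 - exp (- q \<omega> * s)) * (Q (Y n \<omega>) B / q \<omega>)) \<partial>\<Omega>))))"


section \<open>Point measures and the Poisson point process\<close>

text \<open>Finite point measures on \<open>A\<close> are represented by the finite multisets of their atoms.\<close>

definition mset_measure :: "'a::topological_space set \<Rightarrow> 'a multiset \<Rightarrow> 'a measure" where
  "mset_measure A \<xi> = measure_of A (sets (restrict_space borel A))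
     (\<lambda>B. of_nat (size (filter_mset (\<lambda>y. y \<in> B) \<xi>)))"

definition point_measures :: "'a::topological_space set \<Rightarrow> 'a multiset measure" where
  "point_measures A =
     vimage_algebra {\<xi>. set_mset \<xi> \<subseteq> A} (mset_measure A) (borel_of (weak_topology A))"

definition poisson_point_process :: "'a measure \<Rightarrow> 'w measure \<Rightarrow> ('w \<Rightarrow> 'a multiset) \<Rightarrow> bool" where
  "poisson_point_process \<nu> \<Omega> X \<longleftrightarrow>
     (\<forall>\<omega>\<in>space \<Omega>. set_mset (X \<omega>) \<subseteq> space \<nu>) \<and>
     (\<forall>B\<in>sets \<nu>. \<forall>k. measure \<Omega> {\<omega> \<in> space \<Omega>. size (filter_mset (\<lambda>x. x \<in> B) (X \<omega>)) = k} =
        measure \<nu> B ^ k / fact k * exp (- measure \<nu> B)) \<and>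
     (\<forall>n B. B ` {..<n} \<subseteq> sets \<nu> \<longrightarrow> disjoint_family_on B {..<n} \<longrightarrow>
        prob_space.indep_vars \<Omega> (\<lambda>_. count_space UNIV)
          (\<lambda>i \<omega>. size (filter_mset (\<lambda>x. x \<in> B i) (X \<omega>))) {..<n::nat})"


section \<open>The Marcus--Lushnikov process\<close>

text \<open>Particles \<open>(x, m)\<close> have location \<open>x\<close> and mass \<open>m \<ge> 1\<close>.\<close>

definition particles :: "('s \<times> nat) set" where
  "particles = UNIV \<times> {1..}"

text \<open>Summing over ordered pairs of distinct particles counts each unordered pair twice.\<close>

definition coag_rate ::
  "('s \<times> nat \<Rightarrow> 's \<times> nat \<Rightarrow> real) \<Rightarrow> ('s \<times> nat \<Rightarrow> 's \<times> nat \<Rightarrow> 's::topological_space measure) \<Rightarrow>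
   ('s \<times> nat) multiset \<Rightarrow> ('s \<times> nat) multiset set \<Rightarrow> real" where
  "coag_rate K \<Upsilon> \<xi> B = 1/2 * (\<Sum>y\<in>#\<xi>. \<Sum>y'\<in>#\<xi> - {#y#}.
     K y y' * measure (\<Upsilon> y y') {z. \<xi> - {#y, y'#} + {#(z, snd y + snd y')#} \<in> B})"

definition marcus_lushnikov ::
  "('s \<times> nat \<Rightarrow> 's \<times> nat \<Rightarrow> real) \<Rightarrow> ('s \<times> nat \<Rightarrow> 's \<times> nat \<Rightarrow> 's::topological_space measure) \<Rightarrow>
   'w measure \<Rightarrow> (real \<Rightarrow> 'w \<Rightarrow> ('s \<times> nat) multiset) \<Rightarrow> bool" where
  "marcus_lushnikov K \<Upsilon> \<Omega> \<Xi> \<longleftrightarrow>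
     markov_jump_process (point_measures particles) (coag_rate K \<Upsilon>) \<Omega> \<Xi>"

text \<open>Under the law started from a Poisson point process on the space of locations, all initial
  particles have mass one.\<close>

definition marcus_lushnikov_Poi ::
  "('s \<times> nat \<Rightarrow> 's \<times> nat \<Rightarrow> real) \<Rightarrow> ('s \<times> nat \<Rightarrow> 's \<times> nat \<Rightarrow> 's::topological_space measure) \<Rightarrow>
   's measure \<Rightarrow> 'w measure \<Rightarrow> (real \<Rightarrow> 'w \<Rightarrow> ('s \<times> nat) multiset) \<Rightarrow> bool" where
  "marcus_lushnikov_Poi K \<Upsilon> \<nu> \<Omega> \<Xi> \<longleftrightarrow> marcus_lushnikov K \<Upsilon> \<Omega> \<Xi> \<and>
     (\<exists>k. poisson_point_process \<nu> \<Omega> k \<and>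
        (\<forall>\<omega>\<in>space \<Omega>. \<Xi> 0 \<omega> = image_mset (\<lambda>x. (x, 1)) (k \<omega>)))"


section \<open>The kernel bound and the Smoluchowski equation\<close>

definition norm1 :: "('s::topological_space \<times> nat) measure \<Rightarrow> ennreal" where
  "norm1 v = (\<Sum>m. of_nat (Suc m) * emeasure v (UNIV \<times> {Suc m}))"

definition coag_bound :: "('s::topological_space \<times> nat \<Rightarrow> 's \<times> nat \<Rightarrow> real) \<Rightarrow> ennreal" where
  "coag_bound K = (SUP (v, w) \<in> {(v, w). v \<in> finite_measures particles \<and> w \<in> finite_measures particles \<and>
       norm1 v \<le> 1 \<and> norm1 w \<le> 1}. \<integral>\<^sup>+y. (\<integral>\<^sup>+y'. ennreal (K y y') \<partial>w) \<partial>v)"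

text \<open>\<open>mass_slice v m\<close> is the measure \<open>v(dx, m)\<close> on the space of locations.\<close>

definition mass_slice :: "('s::topological_space \<times> nat) measure \<Rightarrow> nat \<Rightarrow> 's measure" where
  "mass_slice v m = distr (restrict_space v (UNIV \<times> {m})) borel fst"

definition merge_kernel ::
  "('s \<times> nat \<Rightarrow> 's \<times> nat \<Rightarrow> real) \<Rightarrow> ('s \<times> nat \<Rightarrow> 's \<times> nat \<Rightarrow> 's measure) \<Rightarrow>
   's \<times> nat \<Rightarrow> 's \<times> nat \<Rightarrow> 's measure" where
  "merge_kernel K \<Upsilon> y y' = scale_measure (ennreal (K y y')) (\<Upsilon> y y')"

text \<open>Integrals of a test function against the gain and the loss term. In the gain term every
  unordered pair of merging types \<open>(x, m)\<close>, \<open>(x', m')\<close> counts once, as it does in the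
  Marcus--Lushnikov process; hence the factor 1/2 in front of the sum over ordered pairs.
  Without it the equation would not conserve mass, and the process would not converge to a
  solution.\<close>

definition smoluchowski_gain ::
  "('s \<times> nat \<Rightarrow> 's \<times> nat \<Rightarrow> real) \<Rightarrow> ('s \<times> nat \<Rightarrow> 's \<times> nat \<Rightarrow> 's::topological_space measure) \<Rightarrow>
   ('s \<times> nat) measure \<Rightarrow> nat \<Rightarrow> ('s \<Rightarrow> real) \<Rightarrow> real" where
  "smoluchowski_gain K \<Upsilon> v n g = 1/2 * (\<Sum>(m, m') | 1 \<le> m \<and> 1 \<le> m' \<and> m + m' = n.
     \<integral>x. (\<integral>x'. (\<integral>z. g z \<partial>merge_kernel K \<Upsilon> (x, m) (x', m')) \<partial>mass_slice v m') \<partial>mass_slice v m)"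

definition smoluchowski_loss ::
  "('s::topological_space \<times> nat \<Rightarrow> 's \<times> nat \<Rightarrow> real) \<Rightarrow>
   ('s \<times> nat) measure \<Rightarrow> nat \<Rightarrow> ('s \<Rightarrow> real) \<Rightarrow> real" where
  "smoluchowski_loss K v n g = (\<integral>x. g x * (\<integral>y'. K (x, n) y' \<partial>v) \<partial>mass_slice v n)"

text \<open>Finiteness of the integral in the second condition, for every \<open>n\<close>, says that gain and loss
  are finite measures for every mass.\<close>

definition smoluchowski_solution ::
  "('s \<times> nat \<Rightarrow> 's \<times> nat \<Rightarrow> real) \<Rightarrow> ('s \<times> nat \<Rightarrow> 's \<times> nat \<Rightarrow> 's::topological_space measure) \<Rightarrow>
   real \<Rightarrow> (real \<Rightarrow> ('s \<times> nat) measure) \<Rightarrow> bool" where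
  "smoluchowski_solution K \<Upsilon> T \<rho> \<longleftrightarrow>
     (\<forall>t\<in>{0..T}. \<rho> t \<in> finite_measures particles) \<and>
     (\<forall>t\<in>{0..T}. \<forall>n\<ge>1.
        (\<integral>\<^sup>+x. (\<integral>\<^sup>+y'. ennreal (K (x, n) y') \<partial>\<rho> t) \<partial>mass_slice (\<rho> t) n) < \<infinity>) \<and>
     (\<forall>n\<ge>1. \<forall>g :: 's \<Rightarrow> real. continuous_on UNIV g \<longrightarrow> bounded (range g) \<longrightarrow>
        (\<forall>t\<in>{0..T}. ((\<lambda>t. \<integral>x. g x \<partial>mass_slice (\<rho> t) n) has_real_derivative
            (smoluchowski_gain K \<Upsilon> (\<rho> t) n g - smoluchowski_loss K (\<rho> t) n g))
          (at t within {0..T})))"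

end

theory Submission
 imports Defs "HOL-Real_Asymp.Real_Asymp"
begin

text \<open>The proof follows the factorial moments of the rescaled configuration. For a function
  \<open>h\<close> of finite configurations, \<open>conv (scaled N h) (%_. 1) u\<close> is the sum
  of \<open>h v / N ^ size v\<close> over the sub-configurations \<open>v\<close> of
  \<open>u\<close>. Under the kernel K/N the generator maps this functional to the same functional
  of \<open>L h - V h / N\<close> (\<open>generator_conv\<close>), where \<open>L\<close> raises the
  number of particles seen by one and the second term is a correction of order 1/N. Mergers conserve
  the total mass, so everything can first be localized to bounded total mass; Dynkin's formula,
  which comes from the forward equation of the jump process (\<open>forward\<close>,
  \<open>dynkin\<close>), then becomes a hierarchy of integral equations (\<open>hierarchy\<close>).

  By Mecke's formula the factorial moment of order k of the rescaled Poisson configuration is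
  \<nu>^k / k! (\<open>mecke\<close>, \<open>integral_initial\<close>). Iterating the hierarchy
  therefore suggests the limit \<open>R k h t\<close>, the series of t^n / n! times the initial
  moment of order k+n of L^n h. Its convergence rests on the weights \<open>W k i\<close>, which
  carry (k-1)!, the product of the masses and the i-th power of the total mass: \<open>L\<close>
  maps a function bounded by \<open>W k i\<close> to one bounded by 2 H \<open>W (k+1) (i+1)\<close>
  (\<open>L_bound\<close>), and the initial moment of \<open>W k i\<close> is at most k^i / k
  (\<open>moment_bound\<close>). The terms are thus of geometric order in e H T, and so are the
  remainders, with ratio 3 e H T (\<open>S_tail\<close>); the assumption on T makes this ratio less
  than 1 (\<open>small_time\<close>). Hence the moments converge to \<open>R\<close>, uniformly over
  all \<open>h\<close> with a given weight bound (\<open>\<F>_expansion\<close>,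
  \<open>mn_uniform\<close>).

  The structural point is that \<open>L\<close> is a derivation for the convolution
  \<open>conv\<close> of configuration functions (\<open>L_conv\<close>), so that exp(t L) is
  multiplicative. The initial moments are multiplicative as well (\<open>moment_conv\<close>), and
  so is \<open>R\<close> (\<open>R_conv\<close>): this is propagation of chaos. At order one
  \<open>R\<close> is integration against a finite measure \<rho>(t), at order two it is integration
  against the product of \<rho>(t) with itself (\<open>functional_measure\<close>,
  \<open>R_dbl\<close>, \<open>R_dbl_unbounded\<close>). Differentiating the series gives R(k)' =
  R(k+1) applied to \<open>L\<close>, which at k = 1 is the weak Smoluchowski equation
  (\<open>R_derivative\<close>, \<open>limit_derivative\<close>,
  \<open>smoluchowski_weak_form\<close>). The factorization also makes variances vanish
  (\<open>chebyshev\<close>).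

  To pass to paths, note that the sum of \<open>h\<close> over the particles decreases in time when
  \<open>h\<close> is subadditive under mergers, and that 3c + f and 3c - f are subadditive if |f|
  is at most c. Monotone paths close to a continuous function at finitely many times are close at
  all times (\<open>sup_control\<close>, \<open>sup_control_bounded\<close>). The weak topology is
  induced by countably many integrals (\<open>openin_weak_iff\<close>), and by compactness finitely
  many of them control any compatible metric near the path \<rho>
  (\<open>\<rho>_neighbourhood\<close>). So the rescaled paths are uniformly close to \<rho> with
  high probability, and the identity time change gives convergence in the Skorohod topology
  (\<open>converges_to_\<rho>\<close>). Measurability of the paths for its Borel sets comes from
  approximation by paths read off on a time grid (\<open>step_path_measurable\<close>).\<close>

abbreviation "BM \<equiv> borel_measurable"
notation pair_measure (infixr "<*>" 80)
notation measurable (infixr "->M" 60)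
notation iff (infixr "<->" 25)
syntax "_NN" :: "pttrn => 'a measure => ennreal => ennreal" ("NN (2_)|(_)./ _" [0, 110, 60] 60)
translations "NN x|M. f" == "CONST nn_integral M (%x. f)"
abbreviation "FM \<equiv> finite_measures"
abbreviation "WT \<equiv> weak_topology"
abbreviation "ind \<equiv> indicator"
abbreviation "CSU \<equiv> count_space UNIV"
lemmas mcomp = measurable_compose and LINT_cong = Bochner_Integration.integral_cong and NN_cong = nn_integral_cong

section \<open>Countably many coordinates for the weak topology\<close>

locale bump_space =
 fixes A :: "'a::second_countable_topology set" and \<B> :: "('a => real) set"
 assumes A_borel: "A : sets borel" and A_nonempty: "A ~= {}"
  and countable_bumps: "countable \<B>"
  and bump_cont: "b : \<B> ==> continuous_on UNIV b"
  and bump_range: "b : \<B> ==> b y : {0..1}"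
  and bump_ex: "open U ==> y : U ==> EX b:\<B>. b y = 1 & (ALL z. z \<notin> U --> b z = 0)"
begin

text \<open>Every nonnegative lower semicontinuous function on \<open>A\<close> is an increasing
  limit of such finite maxima, and with rational multiples there are only countably many of them.
  The inserted 0 serves the empty \<open>F\<close>.\<close>

definition max_bump :: "(rat \<times> ('a => real)) set => 'a => real" where
 "max_bump F y = Max (insert 0 ((%(p, b). of_rat p * b y) ` F))"

text \<open>The constant 1 makes the total mass itself a coordinate. Approximation from below
  controls integrals from below only; upper bounds are then obtained relative to the total
  mass.\<close>

definition test_set :: "('a => real) set" where
 "test_set = insert (%_. 1) (max_bump ` {F. finite F & F \<subseteq> {0..} \<times> \<B>})"

definition test_fun :: "nat => 'a => real" where
 "test_fun = from_nat_into test_set"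

lemma range_test_fun: "range test_fun = test_set"
proof -
 have "countable {F. finite F & F \<subseteq> {0::rat..} \<times> \<B>}" by (intro countable_Collect_finite_subset countable_SIGMA countable_bumps)
   (rule countable_subset[OF subset_UNIV], simp)
 then have "countable test_set" unfolding test_set_def by auto
 then show ?thesis unfolding test_fun_def by (intro range_from_nat_into) (auto simp: test_set_def)
qed

lemma max_bump_empty: "max_bump {} = (%_. 0)" by (simp add: max_bump_def fun_eq_iff)

lemma max_bump_insert:
 assumes "finite F"
 shows "max_bump (insert (p, b) F) y = max (of_rat p * b y) (max_bump F y)"
proof -
 have "insert 0 ((%(p, b). of_rat p * b y) ` insert (p, b) F) =
   insert (of_rat p * b y) (insert 0 ((%(p, b). of_rat p * b y) ` F))" by (auto simp: insert_commute)
 then show ?thesis unfolding max_bump_def using assms by (simp only:) (intro Max_insert; simp)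
qed

lemma max_bump_props:
 assumes "finite F" "F \<subseteq> {0..} \<times> \<B>"
 shows "continuous_on UNIV (max_bump F) & (EX c. ALL y. 0 <= max_bump F y & max_bump F y <= c)" using assms
proof (induction F)
 case empty
 then show ?case by (auto simp: max_bump_empty)
next
 case (insert x F)
 obtain p b where x: "x = (p, b)" by (cases x)
 have pb: "0 <= p" "b : \<B>" using insert.prems x by auto
 obtain c where c: "!!y. 0 <= max_bump F y & max_bump F y <= c" using insert by auto
 have eq: "max_bump (insert x F) = (%y. max (of_rat p * b y) (max_bump F y))" using insert.hyps x by (auto simp: max_bump_insert)
 have le_p: "of_rat p * b y <= of_rat p" for y using bump_range[OF pb(2), of y] pb(1) by (simp add: mult_left_le)
 have cont: "continuous_on UNIV (max_bump (insert x F))" unfolding eq using insert bump_cont[OF pb(2)] by (intro continuous_intros) auto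
 show ?case unfolding eq
 proof (intro conjI exI allI)
  show "continuous_on UNIV (%y. max (of_rat p * b y) (max_bump F y))" using cont unfolding eq .
  fix y
  have "max_bump F y <= c" "0 <= max_bump F y" "of_rat p * b y <= of_rat p" using c le_p by auto
  then show "0 <= max (of_rat p * b y) (max_bump F y)"
   "max (of_rat p * b y) (max_bump F y) <= max (of_rat p) c" by linarith+
 qed
qed

lemma test_set_props:
 assumes "f : test_set"
 shows "continuous_on UNIV f & (EX c. ALL y. \<bar>f y\<bar> <= c)"
proof (cases "f = (%_. 1)")
 case False
 then obtain F where F: "finite F" "F \<subseteq> {0..} \<times> \<B>" "f = max_bump F" using assms unfolding test_set_def by blast
 obtain c where "!!y. 0 <= max_bump F y & max_bump F y <= c" using max_bump_props[OF F(1,2)] by blast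
 then have "\<bar>f y\<bar> <= c" for y unfolding F(3) by (metis abs_of_nonneg)
 then show ?thesis using max_bump_props[OF F(1,2)] F(3) by blast
next
 case True
 then show ?thesis by (intro conjI exI[of _ 1]) auto
qed

lemma test_fun_cont: "continuous_on UNIV (test_fun i)" using test_set_props[of "test_fun i"] unfolding range_test_fun[symmetric] by blast

lemma test_fun_bounded: "EX c. ALL y. \<bar>test_fun i y\<bar> <= c" using test_set_props[of "test_fun i"] unfolding range_test_fun[symmetric] by blast

lemma test_fun_one: "EX i. test_fun i = (%_. 1)"
proof -
 have "(%_. 1) : range test_fun" unfolding range_test_fun by (simp add: test_set_def)
 then obtain i where "(%_. 1) = test_fun i" by (rule rangeE)
 then show ?thesis by (intro exI[of _ i]) simp
qed

text \<open>Enumerate all multiples p * b that stay below \<open>g\<close> on \<open>A\<close> and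
  take the maximum over the first n of them. For y in \<open>A\<close> and a rational p slightly
  below \<open>g y\<close>, lower semicontinuity gives a neighbourhood on which p is below
  \<open>g\<close>, and a bump living there with value 1 at y.\<close>

lemma lsc_approx:
 fixes g :: "'a => real"
 assumes lsc: "!!y c. y : A ==> c < g y ==> EX U. open U & y : U & (ALL z:U \<inter> A. c < g z)"
  and nonneg: "!!y. y : A ==> 0 <= g y"
 obtains s where "!!y. incseq (%n. test_fun (s n) y)"
  "!!y n. y : A ==> test_fun (s n) y <= g y" "!!n y. 0 <= test_fun (s n) y"
  "!!y. y : A ==> (%n. test_fun (s n) y) \<longlonglongrightarrow> g y"
proof -
 define S where "S = {(p, b). 0 <= p & b : \<B> & (ALL y:A. of_rat p * b y <= g y)}"
 obtain b0 where b0: "b0 : \<B>" using bump_ex[of UNIV undefined] by auto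
 have S: "S \<subseteq> {0..} \<times> \<B>" "(0, b0) : S" using b0 nonneg by (auto simp: S_def)
 have "countable S" using countable_subset[OF S(1)] countable_bumps by auto
 then have range_e: "range (from_nat_into S) = S" using S(2) by (intro range_from_nat_into) auto
 define e where "e = from_nat_into S"
 have range_e: "range e = S" using range_e by (simp add: e_def)
 define F where "F n = e ` {..n}" for n
 have F: "finite (F n)" "F n \<subseteq> {0..} \<times> \<B>" "F n \<subseteq> S" for n using range_e S(1) by (auto simp: F_def)
 have "EX i. test_fun i = max_bump (F n)" for n
 proof -
  have "max_bump (F n) : range test_fun" unfolding range_test_fun test_set_def using F by blast
  then show ?thesis by auto
 qed
 then obtain s where s: "!!n. test_fun (s n) = max_bump (F n)" by metis
 have le: "max_bump (F n) y <= g y" if "y : A" for n y unfolding max_bump_def using F(1,3)[of n] nonneg that by (subst Max_le_iff) (auto simp: S_def)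
 have inc: "incseq (%n. max_bump (F n) y)" for y unfolding max_bump_def using F(1) by (intro incseq_SucI Max_mono) (auto simp: F_def)
 have "(%n. max_bump (F n) y) \<longlonglongrightarrow> g y" if y: "y : A" for y
 proof (rule LIMSEQ_I)
  fix r :: real assume "0 < r"
  show "EX n0. ALL n>=n0. norm (max_bump (F n) y - g y) < r"
  proof -
   have "EX n0. g y - r < max_bump (F n0) y"
   proof (cases "g y - r < 0")
    case True
    have "0 <= max_bump (F 0) y" using max_bump_props[OF F(1,2)] by blast
    then show ?thesis using True by (intro exI[of _ 0]) auto
   next
    case False
    obtain p where p: "g y - r < of_rat p" "of_rat p < g y" using of_rat_dense[of "g y - r" "g y"] \<open>0 < r\<close> by auto
    then have p0: "0 <= p" using False by (simp add: order_less_imp_le) (metis False less_eq_real_def not_le order.trans zero_le_of_rat_iff)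
    obtain U where U: "open U" "y : U" "ALL z:U \<inter> A. of_rat p < g z" using lsc[OF y p(2)] by auto
    obtain b where b: "b : \<B>" "b y = 1" "!!z. z \<notin> U ==> b z = 0" using bump_ex[OF U(1,2)] by auto
    have "of_rat p * b z <= g z" if "z : A" for z
    proof (cases "z : U")
     case True
     have "of_rat p * b z <= of_rat p" using bump_range[OF b(1), of z] p0 by (simp add: mult_left_le)
     then show ?thesis using True U that by force
    qed (use b nonneg that in auto)
    then have "(p, b) : S" using p0 b by (auto simp: S_def)
    then obtain n0 where "e n0 = (p, b)" using range_e by (metis imageE)
    then have "(p, b) : F n0" by (auto simp: F_def intro!: image_eqI[of _ _ n0])
    then have "of_rat p * b y <= max_bump (F n0) y" unfolding max_bump_def using F(1) by (intro Max_ge) (auto intro!: image_eqI[of _ _ "(p, b)"])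
    then show ?thesis using p b by (intro exI[of _ n0]) auto
   qed
   then obtain n0 where n0: "g y - r < max_bump (F n0) y" by auto
   have "norm (max_bump (F n) y - g y) < r" if "n >= n0" for n using n0 incseqD[OF inc that, of y] le[OF y, of n] by auto
   then show ?thesis by auto
  qed
 qed
 then show ?thesis using le inc max_bump_props[OF F(1,2)] by (intro that[of s]; simp only: s; blast)
qed

lemma finite_measuresD:
 assumes "v : FM A"
 shows "sets v = sets (restrict_space borel A)" "finite_measure v" "space v = A" using assms sets_eq_imp_space_eq[of v "restrict_space borel A"]
 by (auto simp: finite_measures_def space_restrict_space)

lemma bounded_cont_integrable:
 fixes g :: "'a => real"
 assumes v: "v : FM A" and g: "continuous_on A g" "!!y. y : A ==> \<bar>g y\<bar> <= c"
 shows "integrable v g"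
proof -
 interpret finite_measure v using finite_measuresD[OF v] by simp
 have "g : BM v" using borel_measurable_continuous_on_restrict[OF g(1)] finite_measuresD(1)[OF v] by (simp cong: measurable_cong_sets)
 then show ?thesis using finite_measuresD[OF v] g(2) by (intro integrable_const_bound[of _ c]) auto
qed

definition coords :: "'a measure => nat => real" where
 "coords v i = (LINT y|v. test_fun i y)"

text \<open>Dominated convergence along \<open>lsc_approx\<close>. The index sequence does not
  depend on the measure, so that the integral is at once a limit and a supremum of fixed
  coordinates.\<close>

lemma lsc_integral:
 fixes g :: "'a => real"
 assumes lsc: "!!y c. y : A ==> c < g y ==> EX U. open U & y : U & (ALL z:U \<inter> A. c < g z)"
  and bd: "!!y. y : A ==> 0 <= g y" "!!y. y : A ==> g y <= c"
 obtains I where "!!v. v : FM A ==> (%n. coords v (I n)) \<longlonglongrightarrow> (LINT y|v. g y)"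
  "!!v n. v : FM A ==> coords v (I n) <= (LINT y|v. g y)"
proof -
 obtain s where s: "!!y. incseq (%n. test_fun (s n) y)"
  "!!y n. y : A ==> test_fun (s n) y <= g y" "!!n y. 0 <= test_fun (s n) y"
  "!!y. y : A ==> (%n. test_fun (s n) y) \<longlonglongrightarrow> g y" using lsc_approx[of g] lsc bd by metis
 have "(%n. coords v (s n)) \<longlonglongrightarrow> (LINT y|v. g y) & (ALL n. coords v (s n) <= (LINT y|v. g y))"
  if v: "v : FM A" for v
 proof -
  interpret finite_measure v using finite_measuresD[OF v] by simp
  have m: "test_fun i : BM v" for i using borel_measurable_continuous_on_restrict[OF continuous_on_subset[OF test_fun_cont]]
    finite_measuresD(1)[OF v] by (simp cong: measurable_cong_sets)
  have gm: "g : BM v" using s(4) unfolding finite_measuresD(3)[OF v, symmetric] by (rule borel_measurable_LIMSEQ_real[of v "%n. test_fun (s n)"]) (assumption | rule m)+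
  have gi: "integrable v g" using gm bd finite_measuresD(3)[OF v] by (intro integrable_const_bound[of _ c]) auto
  have ae: "AE y in v. \<bar>test_fun (s n) y\<bar> <= c" for n
  proof (rule AE_I2)
   fix y assume "y : space v"
   then have "test_fun (s n) y <= g y" "g y <= c" "0 <= test_fun (s n) y" using s(2,3) bd(2) finite_measuresD(3)[OF v] by auto
   then show "\<bar>test_fun (s n) y\<bar> <= c" by linarith
  qed
  have si: "integrable v (test_fun (s n))" for n using ae m by (intro integrable_const_bound[of _ c]) auto
  show ?thesis unfolding coords_def
  proof (intro conjI allI)
   have lim: "AE y in v. (%n. test_fun (s n) y) \<longlonglongrightarrow> g y" using s(4) finite_measuresD(3)[OF v] by (intro AE_I2) simp
   show "(%n. LINT y|v. test_fun (s n) y) \<longlonglongrightarrow> (LINT y|v. g y)" using ae by (intro integral_dominated_convergence[where w = "%_. c"] gm m lim) simp_all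
   show "(LINT y|v. test_fun (s n) y) <= (LINT y|v. g y)" for n using s(2) finite_measuresD(3)[OF v] by (intro integral_mono si gi) simp
  qed
 qed
 then show ?thesis using that by blast
qed

lemma cont_imp_lsc:
 fixes g :: "'a => real"
 assumes "continuous_on A g" "y : A" "c < g y"
 shows "EX U. open U & y : U & (ALL z:U \<inter> A. c < g z)"
proof -
 obtain U where "open U" "U \<inter> A = g -` {c<..} \<inter> A" using continuous_on_open_invariant[of A g] assms(1) by (metis open_greaterThan)
 then show ?thesis using assms by (intro exI[of _ U]) auto
qed

lemma open_limit:
 assumes U: "open U"
 obtains I where "!!v. v : FM A ==> (%n. coords v (I n)) \<longlonglongrightarrow> measure v (A \<inter> U)"
proof -
 have lsc: "EX V. open V & y : V & (ALL z:V \<inter> A. c < ind (A \<inter> U) z)"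
  if "y : A" "c < ind (A \<inter> U) y" for y and c :: real
 proof (cases "c < 0")
  case True
  then have "c < ind (A \<inter> U) z" for z by (simp add: indicator_def)
  then show ?thesis by (intro exI[of _ UNIV]) simp
 next
  case False
  then have "y : U" "c < 1" using that by (cases "y : U"; simp add: indicator_def)+
  then show ?thesis using U by (intro exI[of _ U]) (simp add: indicator_def)
 qed
 obtain I where I: "!!v. v : FM A ==> (%n. coords v (I n)) \<longlonglongrightarrow> (LINT y|v. ind (A \<inter> U) y)"
  using lsc_integral[of "ind (A \<inter> U)" 1] lsc by (metis indicator_le_1 indicator_pos_le)
 have "(LINT y|v. ind (A \<inter> U) y) = measure v (A \<inter> U)" if "v : FM A" for v using finite_measuresD(3)[OF that] by (simp add: Int_absorb2)
 then show ?thesis using I that by metis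
qed

lemma sets_restrict_borel_generator:
 "sets (restrict_space borel A) = sigma_sets A ((\<inter>) A ` Collect open)"
proof -
 have "sets borel = sigma_sets UNIV (Collect open)" by (simp add: borel_def)
 then show ?thesis using A_borel sigma_sets_Int[of A UNIV "Collect open"] by (simp only: sets_restrict_space) blast
qed

lemma Int_stable_open_Int: "Int_stable ((\<inter>) A ` Collect open)"
proof (rule Int_stableI)
 fix a b assume "a : (\<inter>) A ` Collect open" "b : (\<inter>) A ` Collect open"
 then obtain U V where "open U" "a = A \<inter> U" "open V" "b = A \<inter> V" by blast
 then show "a \<inter> b : (\<inter>) A ` Collect open" by (intro image_eqI[of _ _ "U \<inter> V"]) auto
qed

text \<open>The indicator of an open set is lower semicontinuous, so the coordinates determine the
  measure of every open set, and these form an intersection-stable generator.\<close>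

lemma coords_inj: "inj_on coords (FM A)"
proof (rule inj_onI)
 fix v w assume v: "v : FM A" and w: "w : FM A" and eq: "coords v = coords w"
 interpret v: finite_measure v using finite_measuresD[OF v] by simp
 interpret w: finite_measure w using finite_measuresD[OF w] by simp
 have *: "emeasure v (A \<inter> U) = emeasure w (A \<inter> U)" if U: "open U" for U
 proof -
  obtain I where I: "!!v. v : FM A ==> (%n. coords v (I n)) \<longlonglongrightarrow> measure v (A \<inter> U)" using open_limit[OF U] by blast
  have "measure v (A \<inter> U) = measure w (A \<inter> U)" using I[OF v] unfolding eq by (rule LIMSEQ_unique) (rule I[OF w])
  then show ?thesis by (simp add: v.emeasure_eq_measure w.emeasure_eq_measure)
 qed
 show "v = w"
 proof (rule measure_eqI_generator_eq[where E = "(\<inter>) A ` Collect open" and \<Omega> = A and A = "%_. A"])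
  show "Int_stable ((\<inter>) A ` Collect open)" by (rule Int_stable_open_Int)
  show "sets v = sigma_sets A ((\<inter>) A ` Collect open)" "sets w = sigma_sets A ((\<inter>) A ` Collect open)"
   using sets_restrict_borel_generator finite_measuresD[OF v] finite_measuresD[OF w] by auto
  show "range (%_. A) \<subseteq> (\<inter>) A ` Collect open" by (auto intro!: image_eqI[of _ _ UNIV])
 qed (use * in auto)
qed

lemma topspace_weak: "topspace (WT A) = FM A"
proof -
 have "{v : FM A. (LINT x|v. (%_. 0) x) : (UNIV :: real set)} \<in>
  {{v : FM A. (LINT x|v. g x) : U} | (g :: 'a => real) U.
    continuous_on A g & bounded (g ` A) & open U}" by (intro CollectI exI[of _ "%_. 0 :: real"] exI[of _ "UNIV :: real set"]) (auto simp: image_def)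
 then show ?thesis unfolding weak_topology_def topology_generated_by_topspace by blast
qed

lemma openin_weak_subbasic:
 fixes g :: "'a => real"
 assumes "continuous_on A g" "bounded (g ` A)" "open U"
 shows "openin (WT A) {v : FM A. (LINT x|v. g x) : U}" unfolding weak_topology_def using assms by (intro topology_generated_by_Basis) blast

lemma test_fun_integral_open:
 "open U ==> openin (WT A) {v : FM A. coords v i : U}" unfolding coords_def using test_fun_bounded[of i] by (intro openin_weak_subbasic continuous_on_subset[OF test_fun_cont]) (auto simp: bounded_iff)

lemma coords_continuous: "continuous_map (WT A) euclidean coords"
proof -
 have "continuous_map (WT A) (product_topology (%_. euclideanreal) UNIV) coords" unfolding continuous_map_componentwise_UNIV by (auto simp: continuous_map_def topspace_weak test_fun_integral_open)
 then show ?thesis by (simp add: euclidean_product_topology)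
qed

lemma lsc_integral_open:
 fixes g :: "'a => real"
 assumes g: "continuous_on A g" "!!y. y : A ==> 0 <= g y" "!!y. y : A ==> g y <= c"
 shows "EX V. open V & (ALL v:FM A. a < (LINT y|v. g y) <-> coords v : V)"
proof -
 obtain I where I: "!!v. v : FM A ==> (%n. coords v (I n)) \<longlonglongrightarrow> (LINT y|v. g y)"
  "!!v n. v : FM A ==> coords v (I n) <= (LINT y|v. g y)" using lsc_integral[of g c] cont_imp_lsc[OF g(1)] g(2,3) by metis
 have "open ((%x :: nat => real. x (I n)) -` {a<..})" for n by (intro open_vimage continuous_on_product_coordinates) simp
 then have "open (\<Union>n. (%x :: nat => real. x (I n)) -` {a<..})" by blast
 moreover have "a < (LINT y|v. g y) <-> (EX n. a < coords v (I n))" if "v : FM A" for v using order_tendstoD(1)[OF I(1)[OF that], of a] I(2)[OF that]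
  by (auto simp: eventually_sequentially intro: less_le_trans)
 ultimately show ?thesis by (intro exI[of _ "\<Union>n. (%x :: nat => real. x (I n)) -` {a<..}"]) simp
qed

text \<open>The shifted function c + g is nonnegative, so its integral can be bounded from below by
  an open condition. The integral of c is subtracted again by means of the coordinate of the
  constant 1; the union over \<open>b\<close> splits the inequality into a condition on either
  part.\<close>

lemma integral_greater_open:
 fixes g :: "'a => real"
 assumes g: "continuous_on A g" "bounded (g ` A)"
 shows "EX V. open V & (ALL v:FM A. a < (LINT y|v. g y) <-> coords v : V)"
proof -
 obtain c where c: "!!y. y : A ==> \<bar>g y\<bar> <= c" using g(2) by (auto simp: bounded_iff)
 obtain one where one: "test_fun one = (%_. 1)" using test_fun_one by auto
 have split: "(LINT y|v. c + g y) = c * coords v one + (LINT y|v. g y)"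
  if v: "v : FM A" for v
 proof -
  interpret finite_measure v using finite_measuresD[OF v] by simp
  show ?thesis using bounded_cont_integrable[OF v g(1) c] by (simp add: coords_def one)
 qed
 have "0 <= c + g y" "c + g y <= 2 * c" if "y : A" for y using c[OF that] by linarith+
 then have "EX V. open V & (ALL v:FM A. a < (LINT y|v. c + g y) <-> coords v : V)" for a by (intro lsc_integral_open[where c = "2 * c"] continuous_intros g) auto
 then obtain V where V: "!!a. open (V a)"
  "!!a v. v : FM A ==> a < (LINT y|v. c + g y) <-> coords v : V a" by metis
 have "open ((%x :: nat => real. c * x one) -` {..<b})" for b by (intro open_vimage continuous_intros continuous_on_product_coordinates)
 then have "open (\<Union>b. V (a + b) \<inter> (%x :: nat => real. c * x one) -` {..<b})" using V(1) by blast
 moreover have "a < (LINT y|v. g y) <->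
   coords v : (\<Union>b. V (a + b) \<inter> (%x :: nat => real. c * x one) -` {..<b})"
  if v: "v : FM A" for v
 proof -
  have "a < (LINT y|v. g y) <->
    (EX b. a + b < c * coords v one + (LINT y|v. g y) & c * coords v one < b)"
  proof
   assume "a < (LINT y|v. g y)"
   then show "EX b. a + b < c * coords v one + (LINT y|v. g y) & c * coords v one < b" by (intro exI[of _ "c * coords v one + ((LINT y|v. g y) - a) / 2"]) (simp add: field_simps)
  qed auto
  then show ?thesis using V(2)[OF v, symmetric] split[OF v] by auto
 qed
 ultimately show ?thesis by blast
qed

text \<open>Lower thresholds for \<open>g\<close> and for \<open>- g\<close> are open conditions on
  the coordinates, hence so is membership of the integral in an interval and in any open set. These
  conditions generate the weak topology.\<close>

lemma openin_weak_iff: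
 "openin (WT A) W <-> (EX V. open V & W = {v : FM A. coords v : V})"
proof
 assume "EX V. open V & W = {v : FM A. coords v : V}"
 then show "openin (WT A) W" using coords_continuous unfolding continuous_map_def topspace_weak by auto
next
 let ?P = "%W. EX V. open V & W = {v : FM A. coords v : V}"
 have basic: "?P {v : FM A. (LINT x|v. g x) : U}"
  if g: "continuous_on A g" "bounded (g ` A)" and U: "open U" for g :: "'a => real" and U
 proof -
  have "EX V. open V & (ALL v:FM A. a < (LINT y|v. g y) <-> coords v : V)" for a using g by (intro integral_greater_open)
  then obtain V where V: "!!a. open (V a)"
   "!!a v. v : FM A ==> a < (LINT y|v. g y) <-> coords v : V a" by metis
  have "bounded ((%x. - g x) ` A)" using g(2) by (auto simp: bounded_iff)
  then have "EX V. open V & (ALL v:FM A. - a < (LINT y|v. - g y) <-> coords v : V)" for a using g by (intro integral_greater_open continuous_intros)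
  then obtain V' where V': "!!a. open (V' a)"
   "!!a v. v : FM A ==> - a < (LINT y|v. - g y) <-> coords v : V' a" by metis
  have "open (\<Union>(a, b)\<in>{(a, b). {a<..<b} \<subseteq> U}. V a \<inter> V' b)" using V(1) V'(1) by (intro open_UN) auto
  moreover have "(LINT x|v. g x) : U <-> coords v : (\<Union>(a, b)\<in>{(a, b). {a<..<b} \<subseteq> U}. V a \<inter> V' b)"
   if v: "v : FM A" for v
  proof -
   have "(LINT x|v. g x) : U <-> (EX a b. {a<..<b} \<subseteq> U & a < (LINT x|v. g x) & (LINT x|v. g x) < b)"
   proof
    assume "(LINT x|v. g x) : U"
    then obtain e where e: "e > 0" "ball (LINT x|v. g x) e \<subseteq> U" using U open_contains_ball by blast
    have "{(LINT x|v. g x) - e<..<(LINT x|v. g x) + e} \<subseteq> U" using e(2) by (simp add: ball_eq_greaterThanLessThan)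
    moreover have "(LINT x|v. g x) - e < (LINT x|v. g x)" "(LINT x|v. g x) < (LINT x|v. g x) + e" using e(1) by simp_all
    ultimately show "EX a b. {a<..<b} \<subseteq> U & a < (LINT x|v. g x) & (LINT x|v. g x) < b" by blast
   qed auto
   then show ?thesis using V(2)[OF v, symmetric] V'(2)[OF v, symmetric] by auto
  qed
  ultimately show ?thesis by blast
 qed
 assume "openin (WT A) W"
 then have "generate_topology_on {{v : FM A. (LINT x|v. g x) : U} | (g :: 'a => real) U.
    continuous_on A g & bounded (g ` A) & open U} W" unfolding weak_topology_def openin_topology_generated_by_iff .
 then show "?P W"
 proof induction
  case Empty
  show ?case by (intro exI[of _ "{}"]) simp
 next
  case (Int a b)
  then obtain V V' where "open V" "a = {v : FM A. coords v : V}"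
   "open V'" "b = {v : FM A. coords v : V'}" by blast
  then show ?case by (intro exI[of _ "V \<inter> V'"]) auto
 next
  case (UN k)
  have "EX V. ALL a:k. open (V a) & a = {v : FM A. coords v : V a}" using UN by (intro bchoice) blast
  then obtain V where V: "!!a. a : k ==> open (V a)"
   "!!a. a : k ==> a = {v : FM A. coords v : V a}" by blast
  have "v : \<Union>k <-> v : FM A & coords v : \<Union>(V ` k)" for v
  proof -
   have "v : a <-> v : FM A & coords v : V a" if "a : k" for a by (subst V(2)[OF that]) simp
   then show ?thesis by blast
  qed
  then have "\<Union>k = {v : FM A. coords v : \<Union>(V ` k)}" by blast
  then show ?case using V(1) by (intro exI[of _ "\<Union>(V ` k)"]) blast
 next
  case (Basis s)
  then show ?case using basic by blast
 qed
qed

lemma metric_weak: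
 "Metric_space (FM A) (%v w. dist (coords v) (coords w))" (is ?metric)
 "Metric_space.mtopology (FM A) (%v w. dist (coords v) (coords w)) = WT A"
proof -
 let ?d = "%v w. dist (coords v) (coords w)"
 show m: ?metric
 proof
  show "(?d v w = 0) = (v = w)" if "v : FM A" "w : FM A" for v w using coords_inj that by (auto dest: inj_onD)
 qed (auto simp: dist_commute dist_triangle)
 interpret Metric_space "FM A" ?d by (rule m)
 have "openin mtopology W <-> openin (WT A) W" for W
 proof
  assume W: "openin (WT A) W"
  obtain V where V: "open V" "W = {v : FM A. coords v : V}" using W openin_weak_iff by blast
  have "EX r>0. mball v r \<subseteq> W" if v: "v : W" for v
  proof -
   obtain e where e: "e > 0" "ball (coords v) e \<subseteq> V" using V v open_contains_ball by blast
   have "mball v e \<subseteq> W" using e(2) V(2) by (auto simp: mball_def ball_def subset_iff)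
   then show ?thesis using e(1) by blast
  qed
  then show "openin mtopology W" unfolding openin_mtopology using V(2) by blast
 next
  assume "openin mtopology W"
  then have "W \<subseteq> FM A" "ALL v:W. EX r>0. mball v r \<subseteq> W" unfolding openin_mtopology by blast+
  then obtain r where r: "!!v. v : W ==> r v > 0 & mball v (r v) \<subseteq> W" and sub: "W \<subseteq> FM A" by metis
  have "W = {v : FM A. coords v : (\<Union>w\<in>W. ball (coords w) (r w))}"
  proof (intro equalityI subsetI)
   fix v assume "v : W"
   then have "v : FM A" "coords v : ball (coords v) (r v)" using r sub by auto
   then show "v : {v : FM A. coords v : (\<Union>w\<in>W. ball (coords w) (r w))}" using \<open>v : W\<close> by blast
  next
   fix v assume "v : {v : FM A. coords v : (\<Union>w\<in>W. ball (coords w) (r w))}"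
   then obtain w where w: "v : FM A" "w : W" "dist (coords w) (coords v) < r w" by auto
   then have "v : mball w (r w)" using sub by (auto simp: mball_def)
   then show "v : W" using r[OF w(2)] by blast
  qed
  moreover have "open (\<Union>w\<in>W. ball (coords w) (r w))" by blast
  ultimately show "openin (WT A) W" unfolding openin_weak_iff by blast
 qed
 then show "mtopology = WT A" by (simp add: topology_eq)
qed

text \<open>The choice in \<open>compatible_metric\<close> is made from a nonempty set because of
  \<open>metric_weak\<close>. The chosen metric need not be the one of \<open>metric_weak\<close>,
  so later arguments use only its topology.\<close>

lemma compatible_metric_weak:
 "Metric_space (FM A) (compatible_metric (WT A))"
 "Metric_space.mtopology (FM A) (compatible_metric (WT A)) = WT A"
proof -
 let ?P = "%d. Metric_space (topspace (WT A)) d \<and>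
  Metric_space.mtopology (topspace (WT A)) d = WT A"
 have "?P (compatible_metric (WT A))" unfolding compatible_metric_def by (rule someI_ex[where P = ?P]) (use metric_weak topspace_weak in auto)
 then show "Metric_space (FM A) (compatible_metric (WT A))"
  "Metric_space.mtopology (FM A) (compatible_metric (WT A)) = WT A" by (simp_all add: topspace_weak)
qed

lemma openin_borel_of: "openin E U ==> U : sets (borel_of E)" unfolding borel_of_def by (subst sets_measure_of) (auto dest: openin_subset)

lemma space_borel_of: "space (borel_of E) = topspace E" unfolding borel_of_def by (subst space_measure_of) (auto dest: openin_subset)

lemma measurable_borel_of:
 assumes "!!x. x : space M ==> f x : topspace E"
  and "!!U. openin E U ==> f -` U \<inter> space M : sets M"
 shows "f : M ->M borel_of E" unfolding borel_of_def by (rule measurable_measure_of) (use assms in \<open>auto dest: subsetD[OF openin_subset]\<close>)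

lemma coords_measurable: "(%v. coords v i) : BM (borel_of (WT A))"
proof (rule borel_measurableI)
 fix U :: "real set" assume "open U"
 then have "openin (WT A) {v : FM A. coords v i : U}" by (rule test_fun_integral_open)
 then have "{v : FM A. coords v i : U} : sets (borel_of (WT A))" by (rule openin_borel_of)
 then show "(%v. coords v i) -` U \<inter> space (borel_of (WT A)) : sets (borel_of (WT A))" by (rule back_subst[where P = "%S. S : sets _"]) (auto simp: space_borel_of topspace_weak)
qed

lemma measurable_weak_coords:
 assumes "!!x. x : space M ==> f x : FM A"
  and "!!i. (%x. coords (f x) i) : BM M"
 shows "f : M ->M borel_of (WT A)"
proof (rule measurable_borel_of)
 show "f x : topspace (WT A)" if "x : space M" for x using assms(1)[OF that] by (simp add: topspace_weak)
 fix U assume "openin (WT A) U"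
 then obtain V where V: "open V" "U = {v : FM A. coords v : V}" using openin_weak_iff by blast
 have "(%x. coords (f x)) : BM M" by (rule measurable_coordinatewise_then_product) (rule assms(2))
 then have "(%x. coords (f x)) -` V \<inter> space M : sets M" by (rule measurable_sets) (use V in simp)
 then show "f -` U \<inter> space M : sets M" by (rule back_subst[where P = "%S. S : sets M"]) (use V(2) assms(1) in auto)
qed

lemma emeasure_weak_measurable:
 assumes "B : sets (restrict_space borel A)"
 shows "(%v. emeasure v B) : BM (borel_of (WT A))"
proof -
 let ?W = "borel_of (WT A)"
 have sp: "space ?W = FM A" by (simp add: space_borel_of topspace_weak)
 note Int_stable_open_Int
 moreover have "(\<inter>) A ` Collect open \<subseteq> Pow A" by blast
 ultimately show ?thesis using assms unfolding sets_restrict_borel_generator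
 proof (induction rule: sigma_sets_induct_disjoint)
  case (basic B)
  then obtain U where U: "open U" "B = A \<inter> U" by blast
  obtain I where I: "!!v. v : FM A ==> (%n. coords v (I n)) \<longlonglongrightarrow> measure v B" using open_limit[OF U(1)] U(2) by blast
  have "(%v. measure v B) : BM ?W" by (rule borel_measurable_LIMSEQ_real[where u = "%n v. coords v (I n)"])
    (use I coords_measurable sp in auto)
  then have "(%v. ennreal (measure v B)) : BM ?W" by simp
  then show ?case by (rule measurable_cong[THEN iffD1, rotated])
    (metis finite_measure.emeasure_eq_measure finite_measuresD(2) sp)
 next
  case empty
  show ?case by simp
 next
  case (compl B)
  have A: "(%v. emeasure v A) : BM ?W"
  proof -
   obtain i where "test_fun i = (%_. 1)" using test_fun_one by blast
   then have eq: "emeasure v A = ennreal (coords v i)" if "v : space ?W" for v using finite_measuresD[of v] that by (simp add: coords_def sp finite_measure.emeasure_eq_measure)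
   show ?thesis by (rule measurable_cong[THEN iffD1, OF eq[symmetric]]) (use coords_measurable in auto)
  qed
  have "(%v. emeasure v A - emeasure v B) : BM ?W" using A compl.IH by simp
  then show ?case
  proof (rule measurable_cong[THEN iffD1, rotated])
   fix v assume "v : space ?W"
   then have v: "v : FM A" by (simp add: sp)
   interpret finite_measure v using finite_measuresD[OF v] by simp
   have "B : sets v" using compl.hyps finite_measuresD(1)[OF v] by (simp add: sets_restrict_borel_generator)
   then show "emeasure v A - emeasure v B = emeasure v (A - B)" using finite_measuresD(3)[OF v] emeasure_compl[of B v] by simp
  qed
 next
  case (union B)
  have "(%v. \<Sum>i. emeasure v (B i)) : BM ?W" using union.IH by simp
  then show ?case
  proof (rule measurable_cong[THEN iffD1, rotated])
   fix v assume "v : space ?W"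
   then have v: "v : FM A" by (simp add: sp)
   have "range B \<subseteq> sets v" using union.hyps finite_measuresD(1)[OF v] by (auto simp: sets_restrict_borel_generator)
   then show "(\<Sum>i. emeasure v (B i)) = emeasure v (\<Union>(range B))" using union.hyps(1) by (intro suminf_emeasure) auto
  qed
 qed
qed

end

lemma particles_borel: "(particles :: ('s::topological_space \<times> nat) set) : sets borel"
proof -
 have "{1..} = {0::nat<..}" by auto
 then show ?thesis unfolding particles_def by (intro borel_open open_Times) (simp_all only: open_UNIV open_greaterThan)
qed

lemma ex_bump_space: "\<exists>\<B>. bump_space (particles :: ('s::polish_space \<times> nat) set) \<B>"
proof -
 obtain D :: "'s set" where D: "countable D" "!!U. open U ==> U ~= {} ==> EX d:D. d : U" using countable_dense_exists by blast
 \<comment> \<open>A truncated tent around \<open>x\<close> on the layer of mass \<open>n\<close>: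
   it is 1 up to distance 1/(k+1) and 0 from distance 2/(k+1) on. With a centre within 1/(k+1) of
   \<open>y\<close> its support stays within 3/(k+1) of \<open>y\<close>, which explains the choice
   of \<open>k\<close> by \<open>e / 3\<close> below.\<close>
 define b :: "'s \<times> nat \<times> nat => 's \<times> nat => real" where
  "b = (%(x, k, n) p. max 0 (min 1 (2 - real (Suc k) * dist (fst p) x)) * of_bool (snd p = n))"
 have "bump_space particles (b ` (D \<times> UNIV))"
 proof
  show "(particles :: ('s \<times> nat) set) : sets borel" by (rule particles_borel)
  show "(particles :: ('s \<times> nat) set) ~= {}" by (auto simp: particles_def)
  show "countable (b ` (D \<times> UNIV))" using D(1) by auto
  fix f assume "f : b ` (D \<times> UNIV)"
  then obtain x k n where f: "f = b (x, k, n)" by auto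
  have "continuous_on UNIV ((%m. of_bool (m = n)) \<circ> snd :: 's \<times> nat => real)" by (intro continuous_on_compose continuous_on_snd continuous_on_id Topological_Spaces.continuous_on_discrete)
  then show "continuous_on UNIV f" unfolding f b_def by (auto simp: o_def intro!: continuous_intros)
  show "f y : {0..1}" for y unfolding f b_def by auto
 next
  fix U :: "('s \<times> nat) set" and p assume U: "open U" "p : U"
  obtain y n where p: "p = (y, n)" by (cases p)
  obtain V W where VW: "open V" "open W" "(y, n) : V \<times> W" "V \<times> W \<subseteq> U" using open_prod_elim[OF U] p by blast
  obtain e where e: "e > 0" "ball y e \<subseteq> V" using VW open_contains_ball by blast
  obtain k where k: "inverse (real (Suc k)) < e / 3" using reals_Archimedean[of "e / 3"] e by auto
  obtain x where x: "x : D" "dist y x < inverse (real (Suc k))"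
   using D(2)[of "ball y (inverse (real (Suc k)))"] by (metis ball_eq_empty centre_in_ball empty_iff inverse_positive_iff_positive mem_ball of_nat_0_less_iff open_ball zero_less_Suc)
  have "b (x, k, n) p = 1"
  proof -
   have "real (Suc k) * dist y x < real (Suc k) * inverse (real (Suc k))" using x(2) by (intro mult_strict_left_mono) auto
   then show ?thesis by (simp add: b_def p)
  qed
  moreover have "b (x, k, n) z = 0" if z: "z \<notin> U" for z
  proof (rule ccontr)
   assume "b (x, k, n) z ~= 0"
   then have *: "snd z = n" "real (Suc k) * dist (fst z) x < 2" by (auto simp: b_def max_def min_def split: if_splits)
   have "dist (fst z) x < 2 * inverse (real (Suc k))" using *(2) by (simp add: field_simps)
   then have "dist y (fst z) < e" using x(2) k dist_triangle[of y "fst z" x] by (simp add: dist_commute)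
   then have "z : V \<times> W" using e VW(3) *(1) by (cases z) auto
   then show False using z VW(4) by blast
  qed
  ultimately show "EX f:b ` (D \<times> UNIV). f p = 1 & (ALL z. z \<notin> U --> f z = 0)" using x(1) by (intro bexI[of _ "b (x, k, n)"]) auto
 qed
 then show ?thesis by blast
qed

section \<open>Functionals with the properties of a nonnegative integral\<close>

text \<open>Functionals that behave like integration against a measure. They are determined by their
 values on indicators.\<close>

definition nn_functional :: "'e measure => (('e => ennreal) => ennreal) => bool" where
 "nn_functional E \<Phi> <-> (ALL f g. (ALL y:space E. f y = g y) --> \<Phi> f = \<Phi> g) \<and>
  (ALL c. ALL f:BM E. \<Phi> (%y. c * f y) = c * \<Phi> f) \<and>
  (ALL f:BM E. ALL g:BM E. \<Phi> (%y. f y + g y) = \<Phi> f + \<Phi> g) \<and>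
  (ALL U. (ALL i::nat. U i : BM E) --> incseq U --> \<Phi> (%y. SUP i. U i y) = (SUP i. \<Phi> (U i)))"

lemma nn_functionalI:
 assumes "!!f g. (!!y. y : space E ==> f y = g y) ==> \<Phi> f = \<Phi> g"
  and "!!c f. f : BM E ==> \<Phi> (%y. c * f y) = c * \<Phi> f"
  and "!!f g. f : BM E ==> g : BM E ==> \<Phi> (%y. f y + g y) = \<Phi> f + \<Phi> g"
  and "!!U. (!!i::nat. U i : BM E) ==> incseq U ==> \<Phi> (%y. SUP i. U i y) = (SUP i. \<Phi> (U i))"
 shows "nn_functional E \<Phi>" unfolding nn_functional_def using assms by blast

lemma nn_functionalD:
 assumes "nn_functional E \<Phi>"
 shows "(!!y. y : space E ==> f y = g y) ==> \<Phi> f = \<Phi> g"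
  and "f : BM E ==> \<Phi> (%y. c * f y) = c * \<Phi> f"
  and "f : BM E ==> g : BM E ==> \<Phi> (%y. f y + g y) = \<Phi> f + \<Phi> g"
  and "(!!i::nat. U i : BM E) ==> incseq U ==> \<Phi> (%y. SUP i. U i y) = (SUP i. \<Phi> (U i))" using assms unfolding nn_functional_def by blast+

text \<open>Monotone continuity along the sequence f, g, g, g, ...\<close>

lemma nn_functional_mono:
 assumes "nn_functional E \<Phi>" "f : BM E" "g : BM E" "f <= g"
 shows "\<Phi> f <= \<Phi> g"
proof -
 let ?U = "%i::nat. if i = 0 then f else g"
 have "(%y. SUP i. ?U i y) = g" using assms(4) by (intro ext antisym SUP_least SUP_upper2[of 1]) (auto simp: le_fun_def)
 then have "\<Phi> g = (SUP i. \<Phi> (?U i))" using nn_functionalD(4)[OF assms(1), of ?U] assms(2-4) by (auto simp: incseq_def)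
 then show ?thesis using SUP_upper[of 0 UNIV "%i. \<Phi> (?U i)"] by simp
qed

lemma incseq_functional: "nn_functional E \<Phi> ==> (!!i. U i : BM E) ==> incseq U ==> incseq (%i. \<Phi> (U i))"
 by (auto intro!: incseq_SucI nn_functional_mono[where \<Phi> = \<Phi> and E = E] dest: incseq_SucD)

lemma nn_functional_eqI:
 assumes \<Phi>: "nn_functional E \<Phi>" and \<Psi>: "nn_functional E \<Psi>" and "!!B. B : sets E ==> \<Phi> (ind B) = \<Psi> (ind B)"
  and "F : BM E"
 shows "\<Phi> F = \<Psi> F" using assms(4)
proof (induction rule: borel_measurable_induct)
 case (cong f g)
 then show ?case using nn_functionalD(1)[OF \<Phi>, of f g] nn_functionalD(1)[OF \<Psi>, of f g] by simp
next
 case (mult u c)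
 then show ?case using nn_functionalD(2)[OF \<Phi>] nn_functionalD(2)[OF \<Psi>] by simp
next
 case (add u v)
 then show ?case using nn_functionalD(3)[OF \<Phi>] nn_functionalD(3)[OF \<Psi>] by simp
next
 case (seq U)
 moreover have "(SUP i. U i) = (%y. SUP i. U i y)" by (rule ext) (simp only: SUP_apply)
 ultimately show ?case using nn_functionalD(4)[OF \<Phi>, of U] nn_functionalD(4)[OF \<Psi>, of U] by simp
qed (rule assms(3))

lemma nn_functional_zero: "nn_functional E (%F. 0)" by (simp add: nn_functional_def)

lemma nn_functional_eval: "y : space E ==> nn_functional E (%F. F y)" by (simp add: nn_functional_def)

lemma nn_functional_add:
 assumes \<Phi>: "nn_functional E \<Phi>" and \<Psi>: "nn_functional E \<Psi>"
 shows "nn_functional E (%F. \<Phi> F + \<Psi> F)"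
proof (rule nn_functionalI)
 fix U :: "nat => 'a => ennreal" assume U: "!!i. U i : BM E" "incseq U"
 show "\<Phi> (%y. SUP i. U i y) + \<Psi> (%y. SUP i. U i y) = (SUP i. \<Phi> (U i) + \<Psi> (U i))" unfolding nn_functionalD(4)[OF \<Phi> U] nn_functionalD(4)[OF \<Psi> U]
  by (intro ennreal_SUP_add[symmetric] incseq_functional[OF \<Phi> U] incseq_functional[OF \<Psi> U])
next
 show "\<Phi> f + \<Psi> f = \<Phi> g + \<Psi> g" if "!!y. y : space E ==> f y = g y" for f g using nn_functionalD(1)[OF \<Phi> that] nn_functionalD(1)[OF \<Psi> that] by simp
qed (simp_all add: nn_functionalD(2,3)[OF \<Phi>] nn_functionalD(2,3)[OF \<Psi>] distrib_left ac_simps)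

lemma nn_functional_cmult:
 assumes \<Phi>: "nn_functional E \<Phi>"
 shows "nn_functional E (%F. c * \<Phi> F)"
proof (rule nn_functionalI)
 show "c * \<Phi> f = c * \<Phi> g" if "!!y. y : space E ==> f y = g y" for f g using nn_functionalD(1)[OF \<Phi> that] by simp
qed (simp_all add: nn_functionalD(2-4)[OF \<Phi>] SUP_mult_left_ennreal distrib_left ac_simps)

lemma nn_functional_sum_mset:
 "(!!x. x \<in># \<eta> ==> nn_functional E (\<Phi> x)) ==> nn_functional E (%F. \<Sum>x\<in>#\<eta>. \<Phi> x F)" by (induction \<eta>) (auto intro: nn_functional_zero nn_functional_add)

lemma nn_functional_integral:
 assumes \<Phi>: "!!x. x : space M ==> nn_functional E (\<Phi> x)"
  and m: "!!F. F : BM E ==> (%x. \<Phi> x F) : BM M"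
 shows "nn_functional E (%F. NN x|M. \<Phi> x F)"
proof (rule nn_functionalI)
 fix U :: "nat => 'b => ennreal" assume U: "!!i. U i : BM E" "incseq U"
 have "(NN x|M. \<Phi> x (%y. SUP i. U i y)) = (NN x|M. (SUP i. \<Phi> x (U i)))" using U by (intro NN_cong nn_functionalD(4)[OF \<Phi>])
 also have "\<dots> = (SUP i. NN x|M. \<Phi> x (U i))" using incseq_SucD[OF incseq_functional[OF \<Phi> U]] m[OF U(1)] by (intro nn_integral_monotone_convergence_SUP_AE AE_I2) auto
 finally show "(NN x|M. \<Phi> x (%y. SUP i. U i y)) = \<dots>" .
next
 show "(NN x|M. \<Phi> x f) = (NN x|M. \<Phi> x g)" if "!!y. y : space E ==> f y = g y" for f g using that by (intro NN_cong nn_functionalD(1)[OF \<Phi>])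
qed (simp_all add: m nn_functionalD(2,3)[OF \<Phi>] nn_integral_add[symmetric] nn_integral_cmult[symmetric] cong: NN_cong)

section \<open>Finite configurations and measurability of functions of them\<close>

lemma countable_multisets: "countable (UNIV :: 'a::countable multiset set)"
proof -
 have "UNIV = mset ` (UNIV :: 'a list set)" using ex_mset by (metis UNIV_eq_I rangeI)
 then show ?thesis by (metis countableI_type countable_image)
qed

lemma measurable_multiset_count_space:
 "(f :: 'b => 'a::countable multiset) : M ->M CSU <->
  (\<forall>\<kappa>. f -` {\<kappa>} \<inter> space M : sets M)" using measurable_count_space_eq_countable[OF countable_multisets] by auto

text \<open>A sum over a marked particle together with the remaining configuration, as in the
  reduced Campbell measure. Passing on the remainder instead of \<open>u\<close> lets such sums be
  iterated over distinct particles.\<close>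

definition sub_sum :: "('a => 'a multiset => 'b::comm_monoid_add) => 'a multiset => 'b" where
 "sub_sum G u = (\<Sum>y\<in>#u. G y (u - {#y#}))"

lemma sub_sum_empty[simp]: "sub_sum G {#} = 0" by (simp add: sub_sum_def)

lemma sub_sum_add_mset: "sub_sum G (add_mset x u) = G x u + sub_sum (%y v. G y (add_mset x v)) u"
proof -
 have "image_mset (%y. G y (add_mset x u - {#y#})) u = image_mset (%y. G y (add_mset x (u - {#y#}))) u"
  by (intro image_mset_cong) (simp add: add_mset_diff_bothsides[symmetric] mset_add multi_drop_mem_not_eq diff_union_swap)
 then show ?thesis by (simp add: sub_sum_def)
qed

lemma mset_measure_distr:
 assumes "set xs \<subseteq> A"
 shows "mset_measure A (mset xs) = distr (count_space {..<length xs}) (restrict_space borel A) ((!) xs)"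
proof -
 let ?D = "distr (count_space {..<length xs}) (restrict_space borel A) ((!) xs)"
 have m: "(!) xs : count_space {..<length xs} ->M restrict_space borel A" using assms by (auto simp: space_restrict_space dest: nth_mem)
 have em: "emeasure ?D B = of_nat (size (filter_mset (%y. y : B) (mset xs)))"
  if "B : sets (restrict_space borel A)" for B
 proof -
  have "emeasure ?D B = emeasure (count_space {..<length xs}) {i. i < length xs & xs ! i : B}" using that m by (subst emeasure_distr) (auto simp: Int_def vimage_def conj_commute)
  also have "\<dots> = of_nat (card {i. i < length xs & xs ! i : B})" by (subst emeasure_count_space) auto
  also have "card {i. i < length xs & xs ! i : B} = size (filter_mset (%y. y : B) (mset xs))" by (simp only: mset_filter[symmetric] size_mset length_filter_conv_card)
  finally show ?thesis .
 qed
 have sp: "space ?D = A" by (simp add: space_restrict_space)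
 have "mset_measure A (mset xs) = measure_of A (sets ?D) (emeasure ?D)" unfolding mset_measure_def sets_distr
  by (rule measure_of_eq) (use em sets.space_closed[of "restrict_space borel A"] in \<open>auto simp: space_restrict_space
   sigma_algebra.sigma_sets_eq[OF sets.sigma_algebra_axioms, of "restrict_space borel A", simplified space_restrict_space, simplified]\<close>)
 also have "\<dots> = ?D" using measure_of_of_measure[of ?D] unfolding sp .
 finally show ?thesis .
qed

lemma mset_measure_facts:
 assumes "set_mset u \<subseteq> A"
 shows sets_mset_measure: "sets (mset_measure A u) = sets (restrict_space borel A)"
  and finite_mset_measure: "mset_measure A u : FM A"
  and nn_integral_mset_measure: "f : BM (restrict_space borel A) ==>
   (NN y|(mset_measure A u). f y) = (\<Sum>y\<in>#u. f y)"
  and integral_mset_measure: "g : BM (restrict_space borel A) ==>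
   (LINT y|(mset_measure A u). g y) = (\<Sum>y\<in>#u. g y :: real)"
  and emeasure_mset_measure: "B : sets (restrict_space borel A) ==>
   emeasure (mset_measure A u) B = of_nat (size (filter_mset (%y. y : B) u))"
proof -
 obtain xs where xs: "u = mset xs" using ex_mset by metis
 then have sub: "set xs \<subseteq> A" using assms by simp
 have m: "(!) xs : count_space {..<length xs} ->M restrict_space borel A" using sub by (auto simp: space_restrict_space dest: nth_mem)
 have sum: "(\<Sum>y\<in>#u. h y) = (\<Sum>i<length xs. h (xs ! i))" for h :: "_ => 'z::comm_monoid_add" unfolding xs mset_map[symmetric] sum_mset_sum_list
  by (simp add: sum_list_sum_nth atLeast0LessThan)
 show s: "sets (mset_measure A u) = sets (restrict_space borel A)" unfolding xs mset_measure_distr[OF sub] by simp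
 have "finite_measure (mset_measure A u)" unfolding xs mset_measure_distr[OF sub] by (rule finite_measure.finite_measure_distr) (use m in \<open>auto intro: finite_measure_count_space\<close>)
 then show "mset_measure A u : FM A" using s by (simp add: finite_measures_def)
 show nn: "(NN y|(mset_measure A u). f y) = (\<Sum>y\<in>#u. f y)"
  if "f : BM (restrict_space borel A)" for f unfolding sum unfolding xs mset_measure_distr[OF sub] using that m by (simp add: nn_integral_distr nn_integral_count_space_finite)
 show "(LINT y|(mset_measure A u). g y) = (\<Sum>y\<in>#u. g y :: real)"
  if "g : BM (restrict_space borel A)" for g :: "_ => real" unfolding sum unfolding xs mset_measure_distr[OF sub] using that m by (simp add: integral_distr lebesgue_integral_count_space_finite)
 show "emeasure (mset_measure A u) B = of_nat (size (filter_mset (%y. y : B) u))"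
  if B: "B : sets (restrict_space borel A)"
 proof -
  have "emeasure (mset_measure A u) B = (NN y|(mset_measure A u). ind B y)" using B s by simp
  also have "\<dots> = (\<Sum>y\<in>#u. ind B y)" using B by (intro nn) simp
  also have "\<dots> = of_nat (size (filter_mset (%y. y : B) u))" by (induction u) auto
  finally show ?thesis .
 qed
qed

context bump_space
begin

definition base :: "nat => 'a set" where
 "base = from_nat_into (SOME B. countable B & topological_basis B)"

lemma base: "open (base i)" "open U ==> y : U ==> EX i. y : base i & base i \<subseteq> U"
proof -
 define B :: "'a set set" where "B = (SOME B. countable B & topological_basis B)"
 have B: "countable B" "topological_basis B" unfolding B_def using someI_ex[of "%B :: 'a set set. countable B & topological_basis B"] ex_countable_basis by blast+
 have "B ~= {}"
 proof
  assume "B = {}"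
  then show False using topological_basisE[OF B(2) open_UNIV UNIV_I] by blast
 qed
 then have r: "range base = B" unfolding base_def B_def[symmetric] using B(1) by (simp add: range_from_nat_into)
 show "open (base i)" using topological_basis_open[OF B(2)] r by blast
 show "EX i. y : base i & base i \<subseteq> U" if "open U" "y : U" using topological_basisE[OF B(2) that] r by (metis rangeE)
qed

text \<open>The binary digits of \<open>code r y\<close> record which of the first \<open>r\<close>
  basic open sets contain \<open>y\<close>. Longer codes refine shorter ones
  (\<open>code_div\<close>), there are finitely many codes of each length, and all lengths together
  generate the Borel sets.\<close>

primrec code :: "nat => 'a => nat" where
 "code 0 y = 0"
| "code (Suc r) y = 2 * code r y + of_bool (y : base r)"

lemma base_code: "y : base i <-> odd (code (Suc i) y)" by simp

lemma code_div: "r <= s ==> code s y div 2 ^ (s - r) = code r y" by (induction s rule: dec_induct) (simp_all add: Suc_diff_le div_mult2_eq)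

lemma code_less: "code r y < 2 ^ r" by (induction r) auto

abbreviation pts :: "'a multiset => bool" where "pts \<zeta> \<equiv> set_mset \<zeta> \<subseteq> A"

abbreviation PA :: "'a measure" where "PA \<equiv> restrict_space borel A"

abbreviation PM :: "'a multiset measure" where "PM \<equiv> point_measures A"

lemma space_PA[simp]: "space PA = A" by (simp add: space_restrict_space)

lemma space_PM[simp]: "space PM = {u. pts u}" by (simp add: point_measures_def)

lemma code_measurable[measurable]: "code r : PA ->M CSU"
proof (induction r)
 case (Suc r)
 have [measurable]: "base r : sets borel" by (rule borel_open[OF base(1)])
 have "(%y. of_bool (y : base r) :: nat) : PA ->M CSU" by (intro measurable_restrict_space1) measurable
 with Suc show ?case by simp
qed simp

lemma measurable_PA:
 assumes f: "!!x. x : space M ==> f x : A" and code: "!!r. (%x. code r (f x)) : M ->M CSU"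
 shows "f : M ->M PA"
proof (rule measurable_restrict_space2)
 show "f : BM M"
 proof (rule borel_measurableI)
  fix U :: "'a set" assume "open U"
  then have "f -` U = (\<Union>i\<in>{i. base i \<subseteq> U}. f -` base i)" using base(2)[of U] by blast
  then have "f -` U \<inter> space M = (\<Union>i\<in>{i. base i \<subseteq> U}. (%x. code (Suc i) (f x)) -` {c. odd c} \<inter> space M)" by (auto simp: base_code simp del: code.simps)
  also have "\<dots> : sets M" by (intro sets.countable_UN' image_subsetI measurable_sets[OF code]) simp_all
  finally show "f -` U \<inter> space M : sets M" .
 qed
qed (use f in auto)

lemma cell_in_sets: "{y : A. code r y = c} : sets PA" using measurable_sets[OF code_measurable, of "{c}" r] by (rule back_subst[where P = "%S. S : sets PA"]) auto

lemma mset_measure_measurable: "mset_measure A : PM ->M borel_of (WT A)" unfolding point_measures_def by (rule measurable_vimage_algebra1)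
  (use finite_mset_measure in \<open>auto simp: space_borel_of topspace_weak\<close>)

lemma count_measurable:
 assumes "B : sets PA"
 shows "(%u. size (filter_mset (%y. y : B) u)) : PM ->M CSU"
proof (subst measurable_count_space_eq2_countable, safe)
 fix n :: nat
 have "(%u. emeasure (mset_measure A u) B) : BM PM" by (rule mcomp[OF mset_measure_measurable emeasure_weak_measurable[OF assms]])
 then have "(%u. emeasure (mset_measure A u) B) -` {of_nat n} \<inter> space PM : sets PM" by (rule measurable_sets) simp
 then show "(%u. size (filter_mset (%y. y : B) u)) -` {n} \<inter> space PM : sets PM" by (rule back_subst[where P = "%S. S : sets PM"])
   (auto simp: emeasure_mset_measure assms)
qed simp_all

lemma codes_measurable[measurable]: "image_mset (code r) : PM ->M CSU"
proof (unfold measurable_multiset_count_space, rule allI)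
 fix \<kappa> :: "nat multiset"
 have *: "(%u. size (filter_mset (%y. y : {y : A. code r y = c}) u)) -` {count \<kappa> c} \<inter> space PM : sets PM" for c by (rule measurable_sets[OF count_measurable])
   (use measurable_sets[OF code_measurable, of "{c}" r] in \<open>auto simp: vimage_def Int_def conj_commute\<close>)
 have "count (image_mset (code r) u) c = size (filter_mset (%y. y : {y : A. code r y = c}) u)"
  if "pts u" for u c using that by (induction u) auto
 then have "image_mset (code r) -` {\<kappa>} \<inter> space PM =
   (\<Inter>c. (%u. size (filter_mset (%y. y : {y : A. code r y = c}) u)) -` {count \<kappa> c} \<inter> space PM)" by (auto simp: multiset_eq_iff)
 also have "\<dots> : sets PM" using * by (intro sets.countable_INT' countableI_type) auto
 finally show "image_mset (code r) -` {\<kappa>} \<inter> space PM : sets PM" .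
qed

text \<open>The counterpart of \<open>measurable_PA\<close> for configurations. Replacing each
  particle by a fixed representative of its cell at level \<open>r\<close> gives points that
  converge to it as \<open>r\<close> grows, so each coordinate of the point measure is a limit of
  functions of the multiset of codes, which takes countably many values.\<close>

lemma measurable_PM:
 assumes f: "!!x. x : space M ==> pts (f x)"
  and codes: "!!r. (%x. image_mset (code r) (f x)) : M ->M CSU"
 shows "f : M ->M PM" unfolding point_measures_def
proof (rule measurable_vimage_algebra2)
 define rep where "rep r c = (SOME y. y : A & code r y = c)" for r c
 have rep: "rep r (code r y) : A & code r (rep r (code r y)) = code r y" if "y : A" for r y unfolding rep_def by (rule someI_ex) (use that in blast)
 have lim: "(%r. rep r (code r y)) \<longlonglongrightarrow> y" if y: "y : A" for y
 proof (rule topological_tendstoI)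
  fix U assume "open U" "y : U"
  then obtain i where i: "y : base i" "base i \<subseteq> U" using base(2) by blast
  have "rep r (code r y) : U" if "Suc i <= r" for r
  proof -
   have "code (Suc i) (rep r (code r y)) = code (Suc i) y" using code_div[OF that] rep[OF y, of r] by metis
   then show ?thesis using i base_code by (metis subsetD)
  qed
  then show "\<forall>\<^sub>F r in sequentially. rep r (code r y) : U" by (auto simp: eventually_sequentially)
 qed
 show "(%x. mset_measure A (f x)) : M ->M borel_of (WT A)"
 proof (rule measurable_weak_coords)
  fix i
  have m: "test_fun i : BM PA" by (rule borel_measurable_continuous_on_restrict[OF continuous_on_subset[OF test_fun_cont]]) simp
  have "(%r. \<Sum>y\<in>#u. test_fun i (rep r (code r y))) \<longlonglongrightarrow> (\<Sum>y\<in>#u. test_fun i y)" if "pts u" for u using that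
  proof (induction u)
   case (add x u)
   then have "(%r. test_fun i (rep r (code r x))) \<longlonglongrightarrow> test_fun i x" by (intro continuous_on_tendsto_compose[OF test_fun_cont lim]) auto
   then show ?case using add by (auto intro: tendsto_add)
  qed simp
  then have "(%r. \<Sum>c\<in>#image_mset (code r) (f x). test_fun i (rep r c)) \<longlonglongrightarrow> coords (mset_measure A (f x)) i"
   if "x : space M" for x using f[OF that] m by (simp add: coords_def integral_mset_measure multiset.map_comp o_def)
  then show "(%x. coords (mset_measure A (f x)) i) : BM M" by (rule borel_measurable_LIMSEQ_real) (assumption, rule mcomp[OF codes], simp)
 qed (use f finite_mset_measure in blast)
qed (use f in auto)

lemma union_measurable[measurable]: "(%(u, v). u + v) : PM <*> PM ->M PM"
proof (rule measurable_PM)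
 fix r
 have "(%p. c + image_mset (code r) (snd p)) : PM <*> PM ->M CSU" for c by (rule mcomp[OF mcomp[OF measurable_snd codes_measurable]]) simp
 from measurable_compose_countable'[OF this mcomp[OF measurable_fst codes_measurable] countable_multisets]
 show "(%x. image_mset (code r) (case x of (u, v) => u + v)) : PM <*> PM ->M CSU" by (simp add: case_prod_beta)
qed (auto simp: space_pair_measure)

lemma single_measurable[measurable]: "(%y. {#y#}) : PA ->M PM" by (rule measurable_PM) (auto intro: mcomp[OF code_measurable])

lemma add_mset_measurable[measurable]: "(%(y, u). add_mset y u) : PA <*> PM ->M PM"
proof -
 have "(%p. ({#fst p#}, snd p)) : PA <*> PM ->M PM <*> PM" by measurable
 from mcomp[OF this union_measurable] show ?thesis by (simp add: case_prod_beta')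
qed

lemma size_measurable[measurable]: "size : PM ->M CSU"
proof -
 have "(%u. size (image_mset (code 0) u)) : PM ->M CSU" by (rule mcomp[OF codes_measurable]) simp
 then show ?thesis by simp
qed

text \<open>A measurable selection: of all particles, take the one with the least sequence of codes.\<close>

definition sel :: "'a multiset => 'a" where
 "sel u = (SOME y. if u = {#} then y : A else y \<in># u & (ALL r. code r y = Min (code r ` set_mset u)))"

text \<open>For each \<open>r\<close> some particle has the least code, and by pigeonhole one
  particle has it for infinitely many \<open>r\<close>. Since a longer code determines the shorter
  ones monotonically, this particle is minimal at every level.\<close>

lemma sel:
 assumes "u ~= {#}"
 shows "sel u \<in># u & (ALL r. code r (sel u) = Min (code r ` set_mset u))"
proof -
 have "EX y. y \<in># u & code r y = Min (code r ` set_mset u)" for r using Min_in[of "code r ` set_mset u"] assms by (simp add: image_iff) metis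
 then obtain y where y: "!!r. y r \<in># u" "!!r. code r (y r) = Min (code r ` set_mset u)" by metis
 have "finite (range y)" using y(1) by (auto intro: finite_subset[of _ "set_mset u"])
 then obtain r0 where inf: "infinite {r. y r = y r0}" using pigeonhole_infinite[of UNIV y] by auto
 have "Min (code r ` set_mset u) = code r (y r0)" for r
 proof (rule Min_eqI)
  obtain s where s: "r <= s" "y s = y r0" using inf by (auto simp: infinite_nat_iff_unbounded_le)
  fix c assume "c : code r ` set_mset u"
  then obtain z where z: "z \<in># u" "c = code r z" by blast
  then have "code s (y r0) <= code s z" using y(2)[of s] s(2) by simp
  from div_le_mono[OF this, of "2 ^ (s - r)"] show "code r (y r0) <= c" using z by (simp add: code_div[OF s(1)])
 qed (use y(1) in auto)
 then have "EX y. y \<in># u & (ALL r. code r y = Min (code r ` set_mset u))" using y(1) by metis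
 then show ?thesis unfolding sel_def if_not_P[OF assms] by (rule someI_ex)
qed

lemma sel_empty: "sel {#} : A" unfolding sel_def using A_nonempty by (simp add: some_in_eq)

lemma sel_measurable[measurable]: "sel : PM ->M PA"
proof (rule measurable_PA)
 fix r
 have "(%u. (%\<kappa>. if \<kappa> = {#} then code r (sel {#}) else Min (set_mset \<kappa>)) (image_mset (code r) u)) : PM ->M CSU" by (rule mcomp[OF codes_measurable]) simp
 moreover have "(%u. (%\<kappa>. if \<kappa> = {#} then code r (sel {#}) else Min (set_mset \<kappa>)) (image_mset (code r) u)) = (%u. code r (sel u))" using sel by (auto simp: fun_eq_iff)
 ultimately show "(%u. code r (sel u)) : PM ->M CSU" by simp
next
 show "sel u : A" if "u : space PM" for u using that sel[of u] sel_empty by (cases "u = {#}") auto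
qed

lemma rest_measurable[measurable]: "(%u. u - {#sel u#}) : PM ->M PM"
proof (rule measurable_PM)
 fix r
 have "(%u. (%\<kappa>. \<kappa> - {#Min (set_mset \<kappa>)#}) (image_mset (code r) u)) : PM ->M CSU" by (rule mcomp[OF codes_measurable]) simp
 moreover have "(%\<kappa>. \<kappa> - {#Min (set_mset \<kappa>)#}) (image_mset (code r) u) = image_mset (code r) (u - {#sel u#})" for u
  using sel[of u] by (cases "u = {#}") (auto simp: image_mset_Diff)
 ultimately show "(%u. image_mset (code r) (u - {#sel u#})) : PM ->M CSU" by simp
qed (auto dest: in_diffD)

text \<open>Induction on the number of particles, peeling off the measurably selected particle
  \<open>sel u\<close>. In \<open>?F\<close>, \<open>\<eta>\<close> collects the particles already
  removed, which still belong to the remainder seen by \<open>G\<close>.\<close>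

lemma sub_sum_measurable:
 fixes G :: "'z => 'a => 'a multiset => 'b :: {second_countable_topology, topological_comm_monoid_add}"
 assumes G: "(%(z, y, e). G z y e) : BM (Z <*> (PA <*> PM))"
 shows "(%(z, u). sub_sum (G z) u) : BM (Z <*> PM)"
proof -
 let ?F = "%n (z, \<eta>, u). if size u = n then sub_sum (%y e. G z y (\<eta> + e)) u else 0"
 let ?M = "Z <*> (PM <*> PM)"
 have F: "?F n : BM ?M" for n
 proof (induction n)
  case 0
  have "?F 0 = (%_. 0)" by auto
  then show ?case by simp
 next
  case (Suc n)
  have 1: "(%(z, \<eta>, u). (z, sel u, \<eta> + (u - {#sel u#}))) : ?M ->M Z <*> (PA <*> PM)"
   and 2: "(%(z, \<eta>, u). (z, add_mset (sel u) \<eta>, u - {#sel u#})) : ?M ->M ?M" by measurable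
  have "(%p. if size (snd (snd p)) = Suc n then (%(z, y, e). G z y e) ((%(z, \<eta>, u). (z, sel u, \<eta> + (u - {#sel u#}))) p) +
    ?F n ((%(z, \<eta>, u). (z, add_mset (sel u) \<eta>, u - {#sel u#})) p) else 0) : BM ?M" using mcomp[OF 1 G] mcomp[OF 2 Suc.IH] by (intro measurable_If borel_measurable_add) auto
  moreover have "(if size (snd (snd p)) = Suc n then (%(z, y, e). G z y e) ((%(z, \<eta>, u). (z, sel u, \<eta> + (u - {#sel u#}))) p) +
    ?F n ((%(z, \<eta>, u). (z, add_mset (sel u) \<eta>, u - {#sel u#})) p) else 0) = ?F (Suc n) p" for p
  proof (cases "size (snd (snd p)) = Suc n")
   case True
   obtain z \<eta> u where p: "p = (z, \<eta>, u)" by (cases p)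
   define y where "y = sel u"
   have "u ~= {#}" using True p by auto
   then obtain e where e: "u = add_mset y e" using sel[of u] unfolding y_def by (meson multi_member_split)
   have "sub_sum (%y e. G z y (\<eta> + e)) u = G z y (\<eta> + e) + sub_sum (%v e. G z v (\<eta> + add_mset y e)) e"
    "u - {#y#} = e" "size e = n" using e True p by (auto simp: sub_sum_add_mset)
   then show ?thesis using True by (simp add: p y_def[symmetric])
  qed (simp add: case_prod_beta)
  ultimately show ?case by simp
 qed
 have "(%p. ?F n ((%(z, u). (z, {#}, u)) p)) : BM (Z <*> PM)" for n by (rule mcomp[OF _ F]) measurable
 from measurable_compose_countable[where f = "%n p. ?F n ((%(z, u). (z, {#}, u)) p)", OF this
   mcomp[OF measurable_snd size_measurable]]
 show ?thesis by (simp add: case_prod_beta')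
qed

lemma sub_sum_measurable1:
 fixes G :: "'a => 'a multiset => 'b :: {second_countable_topology, topological_comm_monoid_add}"
 assumes "(%(y, v). G y v) : BM (PA <*> PM)"
 shows "sub_sum G : BM PM"
proof -
 let ?U = "count_space (UNIV :: unit set)"
 have "(%(u :: unit, y, v). G y v) : BM (?U <*> (PA <*> PM))" using mcomp[OF measurable_snd[of ?U "PA <*> PM"] assms] by (simp add: case_prod_beta')
 from mcomp[OF measurable_Pair1'[of "()" ?U PM] sub_sum_measurable[OF this]]
 show ?thesis by simp
qed

lemma sum_measurable:
 fixes f :: "'a => real"
 assumes "f : BM PA"
 shows "(%u. \<Sum>x\<in>#u. f x) : BM PM"
proof -
 have "sub_sum (%y _. f y) : BM PM" by (rule sub_sum_measurable1) (use mcomp[OF measurable_fst assms] in \<open>simp add: case_prod_beta'\<close>)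
 then show ?thesis by (simp add: sub_sum_def[abs_def])
qed

end

section \<open>Markov jump processes and their forward equation\<close>

lemma nn_integral_exp_Icc:
 fixes q s c :: real
 assumes "0 <= q" "0 <= s" "0 <= c" "q = 0 ==> c = 0"
 shows "(NN r|lborel. ind {0..s} r * ennreal (exp (- q * r) * c)) = ennreal ((1 - exp (- q * s)) * (c / q))"
proof (cases "q = 0")
 case False
 have "(NN r|lborel. ennreal (exp (- q * r) * c) * ind {0..s} r) =
   ennreal (- exp (- q * s) * (c / q) - - exp (- q * 0) * (c / q))" by (rule nn_integral_FTC_Icc[where F = "%r. - exp (- q * r) * (c / q)"])
   (use assms False in \<open>auto intro!: derivative_eq_intros simp: field_simps\<close>)
 then show ?thesis by (simp add: mult.commute algebra_simps)
qed (use assms in simp)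

locale jump_process = prob_space Om for Om :: "'w measure" +
 fixes E :: "'e measure" and Q :: "'e => 'e set => real"
  and Y :: "nat => 'w => 'e" and \<sigma> :: "nat => 'w => ennreal" and X :: "real => 'w => 'e"
 assumes Y_measurable[measurable]: "!!n. Y n : Om ->M E"
  and \<sigma>_measurable[measurable]: "!!n. \<sigma> n : BM Om"
  and path: "!!\<omega> t. \<omega> : space Om ==> 0 <= t ==>
   EX n. (\<Sum>i<n. \<sigma> i \<omega>) <= ennreal t & ennreal t < (\<Sum>i<Suc n. \<sigma> i \<omega>) & X t \<omega> = Y n \<omega>"
  and law: "!!n A C B s. 0 <= s ==> (!!i. i <= n ==> A i : sets E) ==> (!!i. i < n ==> C i : sets borel) ==> B : sets E ==>
   measure Om {\<omega> : {\<omega> : space Om. (ALL i<=n. Y i \<omega> : A i) & (ALL i<n. \<sigma> i \<omega> : C i)}. \<sigma> n \<omega> <= ennreal s & Y (Suc n) \<omega> : B} =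
   (LINT \<omega>|Om. ind {\<omega> : space Om. (ALL i<=n. Y i \<omega> : A i) & (ALL i<n. \<sigma> i \<omega> : C i)} \<omega> *
    ((1 - exp (- Q (Y n \<omega>) (space E) * s)) * (Q (Y n \<omega>) B / Q (Y n \<omega>) (space E))))"
  and Q_measurable: "!!B. B : sets E ==> (%y. Q y B) : BM E"
  and Q_nonneg: "!!y B. y : space E ==> B : sets E ==> 0 <= Q y B"
  and Q_mono: "!!y B. y : space E ==> B : sets E ==> Q y B <= Q y (space E)"
begin

definition \<tau> :: "nat => 'w => ennreal" where
 "\<tau> n w = (\<Sum>i<n. \<sigma> i w)"

abbreviation q :: "'e => real" where "q y \<equiv> Q y (space E)"

lemma Q_bounds: "y : space E ==> B : sets E ==> 0 <= q y & 0 <= Q y B & Q y B <= q y" using Q_nonneg[of y] Q_mono by simp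

lemma Y_space: "w : space Om ==> Y n w : space E" using measurable_space[OF Y_measurable] by blast

definition rects :: "nat => 'w set set" where
 "rects n = {{w : space Om. (ALL i<=n. Y i w : A i) & (ALL i<n. \<sigma> i w : C i)} | A C.
  (ALL i<=n. A i : sets E) & (ALL i<n. C i : sets borel)}"

text \<open>The history up to the \<open>n\<close>-th state.\<close>

definition hist :: "nat => 'w measure" where
 "hist n = sigma (space Om) (rects n)"

lemma rects_Pow: "rects n \<subseteq> Pow (space Om)" by (auto simp: rects_def)

lemma space_hist: "space (hist n) = space Om" and sets_hist: "sets (hist n) = sigma_sets (space Om) (rects n)" unfolding hist_def by (rule space_measure_of sets_measure_of, rule rects_Pow)+

lemma rects_hist: "R : rects n ==> R : sets (hist n)" unfolding sets_hist by (rule sigma_sets.Basic)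

lemma rectI: "(!!i. i <= n ==> A i : sets E) ==> (!!i. i < n ==> C i : sets borel) ==>
  {w : space Om. (ALL i<=n. Y i w : A i) & (ALL i<n. \<sigma> i w : C i)} : rects n" unfolding rects_def by blast

lemma space_rects: "space Om : rects n" using rectI[of n "%_. space E" "%_. UNIV"] Y_space by (simp cong: conj_cong)

lemma Y_hist: "i <= n ==> Y i : hist n ->M E"
proof (rule measurableI)
 fix B assume B: "B : sets E" and i: "i <= n"
 have "Y i -` B \<inter> space (hist n) = {w : space Om. (ALL j<=n. Y j w : (if j = i then B else space E)) & (ALL j<n. \<sigma> j w : UNIV)}" using i Y_space by (auto simp: space_hist)
 also have "\<dots> : sets (hist n)" using B by (intro rects_hist rectI) auto
 finally show "Y i -` B \<inter> space (hist n) : sets (hist n)" .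
qed (simp add: space_hist Y_space)

lemma \<sigma>_hist: "i < n ==> \<sigma> i : BM (hist n)"
proof (rule measurableI)
 fix B :: "ennreal set" assume B: "B : sets borel" and i: "i < n"
 have "\<sigma> i -` B \<inter> space (hist n) = {w : space Om. (ALL j<=n. Y j w : space E) & (ALL j<n. \<sigma> j w : (if j = i then B else UNIV))}" using i Y_space by (auto simp: space_hist)
 also have "\<dots> : sets (hist n)" using B by (intro rects_hist rectI) auto
 finally show "\<sigma> i -` B \<inter> space (hist n) : sets (hist n)" .
qed simp

lemma \<tau>_hist: "\<tau> n : BM (hist n)" unfolding \<tau>_def by (intro borel_measurable_sum \<sigma>_hist) simp

lemma \<tau>_measurable[measurable]: "\<tau> n : BM Om" unfolding \<tau>_def by (intro borel_measurable_sum \<sigma>_measurable)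

lemma rects_sets: "R : rects n ==> R : sets Om"
proof -
 assume "R : rects n"
 then obtain A C where R: "R = {w : space Om. (ALL i:{..n}. Y i w : A i) & (ALL i:{..<n}. \<sigma> i w : C i)}"
  "ALL i<=n. A i : sets E" "ALL i<n. C i : sets borel" unfolding rects_def by auto
 show ?thesis unfolding R(1) using R(2,3) measurable_sets[OF Y_measurable] measurable_sets[OF \<sigma>_measurable]
  by (intro sets.sets_Collect_conj sets.sets_Collect_finite_All) (auto simp: vimage_def Int_def conj_commute)
qed

lemma id_hist: "(%w. w) : Om ->M hist n" unfolding hist_def using rects_sets sets.sets_into_space[OF rects_sets] by (intro measurable_measure_of rects_Pow) (auto simp: Int_absorb2)

lemma id_hist_pair: "(%p. p) : Om <*> lborel ->M hist n <*> borel" using measurable_Pair[OF mcomp[OF measurable_fst id_hist] measurable_snd[of Om lborel, unfolded measurable_lborel1]] by simp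

lemma q_measurable[measurable]: "q : BM E" by (rule Q_measurable) simp

lemma Int_stable_rects: "Int_stable (rects n)"
proof (rule Int_stableI)
 fix a b assume "a : rects n" "b : rects n"
 then obtain A C A' C' where *: "a = {w : space Om. (ALL i<=n. Y i w : A i) & (ALL i<n. \<sigma> i w : C i)}"
  "ALL i<=n. A i : sets E" "ALL i<n. C i : sets borel"
  "b = {w : space Om. (ALL i<=n. Y i w : A' i) & (ALL i<n. \<sigma> i w : C' i)}"
  "ALL i<=n. A' i : sets E" "ALL i<n. C' i : sets borel" unfolding rects_def by blast
 have "a \<inter> b = {w : space Om. (ALL i<=n. Y i w : A i \<inter> A' i) & (ALL i<n. \<sigma> i w : C i \<inter> C' i)}" unfolding * by blast
 also have "\<dots> : rects n" using * by (intro rectI) auto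
 finally show "a \<inter> b : rects n" .
qed

text \<open>Given the history, the next jump leads into \<open>B\<close> after an exponential waiting time. Both sides
 are integrals of \<open>f\<close> against measures that agree on the products of rectangles and half-lines,
 and there the claim is the assumed law.\<close>

lemma nn_integral_step:
 assumes B: "B : sets E" and f: "f : BM (hist n <*> borel)"
 shows "(NN w|Om. ind {w : space Om. \<sigma> n w < top & Y (Suc n) w : B} w * f (w, enn2real (\<sigma> n w))) =
  (NN w|Om. (NN r|lborel. ind {0..} r * ennreal (exp (- q (Y n w) * r) * Q (Y n w) B) * f (w, r)))" (is "?l f = ?r f")
proof -
 let ?S = "{w : space Om. \<sigma> n w < top & Y (Suc n) w : B}" and ?g = "%w. (w, enn2real (\<sigma> n w))"
 let ?d = "%(w, r). ind {0..} r * ennreal (exp (- q (Y n w) * r) * Q (Y n w) B)" and ?N = "hist n <*> (borel :: real measure)"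
 define M1 where "M1 = distr (density Om (ind ?S)) ?N ?g"
 define M2 where "M2 = distr (density (Om <*> lborel) ?d) ?N (%p. p)"
 have g: "?g : Om ->M ?N" by (rule measurable_Pair[OF id_hist borel_measurable_enn2real[OF \<sigma>_measurable]])
 note [measurable] = B Q_measurable[OF B]
 have S: "?S : sets Om" by measurable
 note id = id_hist_pair[of n]
 have d: "?d : BM (Om <*> lborel)" by measurable
 have i1: "integral\<^sup>N M1 f = ?l f" if "f : BM ?N" for f unfolding M1_def using that g S mcomp[OF g that] by (subst nn_integral_distr) (simp_all add: nn_integral_density)
 have i2: "integral\<^sup>N M2 f = ?r f" if "f : BM ?N" for f unfolding M2_def using that id d mcomp[OF id that]
  by (subst nn_integral_distr) (simp_all add: nn_integral_density lborel.nn_integral_fst[symmetric] case_prod_beta')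
 let ?G = "{a \<times> b | a b. a : rects n & b : range (%s::real. {..s})}"
 have eq: "?l (ind (R \<times> {..s})) = ?r (ind (R \<times> {..s}))" if R: "R : rects n" for R s
 proof -
  have "?l (ind (R \<times> {..s})) = emeasure Om {w : R. 0 <= s & \<sigma> n w <= ennreal s & Y (Suc n) w : B}"
  proof -
   have e: "x < top & enn2real x <= s <-> 0 <= s & x <= ennreal s" for x by (cases x) (auto simp: enn2real_ennreal top_unique intro: order_trans)
   have "w : ?S & ?g w : R \<times> {..s} <-> w : {w : R. 0 <= s & \<sigma> n w <= ennreal s & Y (Suc n) w : B}" for w using e[of "\<sigma> n w"] sets.sets_into_space[OF rects_sets[OF R]] by auto
   then have "?l (ind (R \<times> {..s})) = (NN w|Om. ind {w : R. 0 <= s & \<sigma> n w <= ennreal s & Y (Suc n) w : B} w)" by (intro NN_cong) (auto simp: indicator_def)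
   moreover have "{w : R. 0 <= s & \<sigma> n w <= ennreal s & Y (Suc n) w : B} = R \<inter> {w : space Om. 0 <= s & \<sigma> n w <= ennreal s & Y (Suc n) w : B}"
    using sets.sets_into_space[OF rects_sets[OF R]] by auto
   moreover have "\<dots> : sets Om" by (intro sets.Int rects_sets[OF R]) measurable
   ultimately show ?thesis by simp
  qed
  also have "\<dots> = (NN w|Om. ind R w * (NN r|lborel. ind {0..s} r * ennreal (exp (- q (Y n w) * r) * Q (Y n w) B)))"
  proof (cases "0 <= s")
   case s: True
   obtain A C where AC: "R = {w : space Om. (ALL i<=n. Y i w : A i) & (ALL i<n. \<sigma> i w : C i)}"
    "ALL i<=n. A i : sets E" "ALL i<n. C i : sets borel" using R unfolding rects_def by blast
   let ?h = "%w. ind R w * ((1 - exp (- q (Y n w) * s)) * (Q (Y n w) B / q (Y n w)))"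
   have b: "0 <= (1 - exp (- q (Y n w) * s)) * (Q (Y n w) B / q (Y n w))" "(1 - exp (- q (Y n w) * s)) * (Q (Y n w) B / q (Y n w)) <= 1"
    if "w : space Om" for w
   proof -
    have r: "0 <= Q (Y n w) B / q (Y n w)" "Q (Y n w) B / q (Y n w) <= 1" and e: "0 <= 1 - exp (- q (Y n w) * s)" using Q_bounds[OF Y_space[OF that, of n] B] s by (auto simp: divide_le_eq_1)
    show "0 <= (1 - exp (- q (Y n w) * s)) * (Q (Y n w) B / q (Y n w))" "(1 - exp (- q (Y n w) * s)) * (Q (Y n w) B / q (Y n w)) <= 1"
     using mult_nonneg_nonneg[OF e r(1)] mult_le_one[OF _ r] by simp_all
   qed
   have "measure Om {w : R. 0 <= s & \<sigma> n w <= ennreal s & Y (Suc n) w : B} = (LINT w|Om. ?h w)" unfolding AC(1) using law[OF s, of n A C B] AC(2,3) B s by simp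
   then have "emeasure Om {w : R. 0 <= s & \<sigma> n w <= ennreal s & Y (Suc n) w : B} = ennreal (LINT w|Om. ?h w)" by (simp add: emeasure_eq_measure)
   also have "\<dots> = (NN w|Om. ennreal (?h w))"
   proof (rule nn_integral_eq_integral[symmetric])
    have "?h : BM Om" using mcomp[OF Y_measurable Q_measurable] B rects_sets[OF R] by (intro borel_measurable_times borel_measurable_diff borel_measurable_divide) auto
    then show "integrable Om ?h" using b by (intro integrable_const_bound[of _ 1]) (auto intro!: AE_I2 simp: indicator_def simp del: times_divide_eq_right)
   qed (use b in \<open>auto intro!: AE_I2 simp: indicator_def\<close>)
   also have "\<dots> = (NN w|Om. ind R w * (NN r|lborel. ind {0..s} r * ennreal (exp (- q (Y n w) * r) * Q (Y n w) B)))"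
   proof (intro NN_cong)
    fix w assume "w : space Om"
    then have "0 <= q (Y n w)" "0 <= Q (Y n w) B" "q (Y n w) = 0 ==> Q (Y n w) B = 0" using Q_bounds[OF Y_space B, of w n] by auto
    from nn_integral_exp_Icc[OF this(1) s this(2,3)]
    show "ennreal (?h w) = ind R w * (NN r|lborel. ind {0..s} r * ennreal (exp (- q (Y n w) * r) * Q (Y n w) B))" by (cases "w : R") simp_all
   qed
   finally show ?thesis .
  qed simp
  also have "\<dots> = ?r (ind (R \<times> {..s}))" by (intro NN_cong) (auto simp: indicator_def intro!: NN_cong)
  finally show ?thesis .
 qed
 have Gs: "sets ?N = sigma_sets (space Om \<times> UNIV) ?G"
 proof -
  have "sets (borel :: real measure) = sigma_sets UNIV (range (%s. {..s}))" unfolding borel_eq_atMost by (subst sets_measure_of) auto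
  moreover have "\<Union> (range (%k::nat. {..real k})) = UNIV" by (auto intro: real_arch_simple)
  ultimately have "sets ?N = sets (sigma (space (hist n) \<times> space (borel :: real measure)) ?G)" using rects_Pow space_rects
   by (intro sets_pair_eq[where Ca = "{space Om}" and Cb = "range (%k::nat. {..real k})"]) (auto simp: space_hist sets_hist)
  then show ?thesis using rects_Pow by (subst (asm) sets_measure_of) (auto simp: space_hist)
 qed
 have GN: "a : ?G ==> a : sets ?N" for a unfolding Gs by (rule sigma_sets.Basic)
 have "M1 = M2"
 proof (rule measure_eqI_generator_eq[where E = ?G and \<Omega> = "space Om \<times> UNIV" and A = "%k::nat. space Om \<times> {..real k}"])
  show "Int_stable ?G"
  proof (rule Int_stableI)
   fix x y assume "x : ?G" "y : ?G"
   then obtain a s a' s' where "x = a \<times> {..s}" "y = a' \<times> {..s'}" "a : rects n" "a' : rects n" by blast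
   then show "x \<inter> y : ?G" using Int_stable_rects[of n, unfolded Int_stable_def] by (intro CollectI exI[of _ "a \<inter> a'"] exI[of _ "{..min s s'}"]) auto
  qed
  show "?G \<subseteq> Pow (space Om \<times> UNIV)" using rects_Pow by auto
  show "emeasure M1 a = emeasure M2 a" if a: "a : ?G" for a
  proof -
   obtain R s where R: "a = R \<times> {..s}" "R : rects n" using a by blast
   have "integral\<^sup>N M1 (ind a) = integral\<^sup>N M2 (ind a)" using eq[OF R(2)] GN[OF a] unfolding R(1) by (subst i1, simp, subst i2) simp_all
   then show ?thesis using GN[OF a] by (simp add: M1_def M2_def)
  qed
  show "range (%k::nat. space Om \<times> {..real k}) \<subseteq> ?G" using space_rects by auto
  show "(\<Union>k::nat. space Om \<times> {..real k}) = space Om \<times> UNIV" by (auto intro: real_arch_simple)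
  have "emeasure M1 (space M1) = ?l (%_. 1)" using i1[of "%_. 1"] by simp
  also have "\<dots> <= (NN w|Om. 1)" by (intro nn_integral_mono) (simp add: indicator_def)
  finally have "emeasure M1 a ~= \<infinity>" for a using emeasure_space[of M1 a] by (auto simp: emeasure_space_1 top_unique)
  then show "emeasure M1 (space Om \<times> {..real k}) ~= \<infinity>" for k .
 qed (simp_all add: M1_def M2_def Gs)
 then show ?thesis using i1[OF f] i2[OF f] by simp
qed

text \<open>The complement of the assumed law with \<open>B\<close> the whole space. Where the rate
  is 0, the convention x / 0 = 0 yields jump probability 0, in agreement with survival probability
  exp 0 = 1.\<close>

lemma nn_integral_survival:
 assumes r: "0 <= r" and g: "g : BM (hist n)"
 shows "(NN w|Om. ind {w : space Om. ennreal r < \<sigma> n w} w * g w) = (NN w|Om. ennreal (exp (- q (Y n w) * r)) * g w)"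
proof -
 let ?S = "{w : space Om. ennreal r < \<sigma> n w}" and ?e = "%w. exp (- q (Y n w) * r)"
 define M1 where "M1 = distr (density Om (ind ?S)) (hist n) (%w. w)"
 define M2 where "M2 = distr (density Om (%w. ennreal (?e w))) (hist n) (%w. w)"
 have S: "?S : sets Om" by measurable
 have e: "?e : BM Om" using mcomp[OF Y_measurable Q_measurable[OF sets.top]] by measurable
 have i: "integral\<^sup>N M1 g = (NN w|Om. ind ?S w * g w)" "integral\<^sup>N M2 g = (NN w|Om. ennreal (?e w) * g w)"
  if "g : BM (hist n)" for g unfolding M1_def M2_def using that id_hist S e mcomp[OF id_hist that] by (simp_all add: nn_integral_distr nn_integral_density)
 have "M1 = M2"
 proof (rule measure_eqI_generator_eq[where E = "rects n" and \<Omega> = "space Om" and A = "%_. space Om"])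
  fix R assume R: "R : rects n"
  note Rs = rects_sets[OF R]
  obtain A C where AC: "R = {w : space Om. (ALL i<=n. Y i w : A i) & (ALL i<n. \<sigma> i w : C i)}"
   "ALL i<=n. A i : sets E" "ALL i<n. C i : sets borel" using R unfolding rects_def by blast
  have le: "{w : R. \<sigma> n w <= ennreal r} = R \<inter> {w : space Om. \<sigma> n w <= ennreal r}" using sets.sets_into_space[OF Rs] by auto
  have int: "integrable Om (%w. ind R w * ?e w)" using Q_bounds[OF Y_space sets.top] r Rs e by (intro integrable_const_bound[of _ 1]) (auto intro!: AE_I2 simp: indicator_def)
  have "measure Om {w : R. \<sigma> n w <= ennreal r} = (LINT w|Om. ind R w * (1 - ?e w))"
  proof -
   have "{w : R. \<sigma> n w <= ennreal r} = {w : R. \<sigma> n w <= ennreal r & Y (Suc n) w : space E}" using Y_space AC(1) by auto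
   then show ?thesis using law[OF r, of n A C "space E"] AC by (auto intro!: LINT_cong)
  qed
  also have "\<dots> = measure Om R - (LINT w|Om. ind R w * ?e w)" using int Rs by (simp add: right_diff_distrib emeasure_eq_measure)
  also have "measure Om {w : R. \<sigma> n w <= ennreal r} = measure Om R - measure Om (R - {w : R. \<sigma> n w <= ennreal r})"
   using finite_measure_Diff[of R "{w : R. \<sigma> n w <= ennreal r}"] Rs unfolding le by simp
  also have "R - {w : R. \<sigma> n w <= ennreal r} = R \<inter> ?S" using sets.sets_into_space[OF Rs] by auto
  finally have "measure Om (R \<inter> ?S) = (LINT w|Om. ind R w * ?e w)" by simp
  then have "emeasure Om (R \<inter> ?S) = (NN w|Om. ennreal (ind R w * ?e w))" using int by (simp add: emeasure_eq_measure nn_integral_eq_integral)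
  then have "(NN w|Om. ind ?S w * ind R w) = (NN w|Om. ennreal (?e w) * ind R w)" using Rs S by (simp add: indicator_inter_arith[symmetric] Int_commute ennreal_mult' ennreal_indicator mult.commute)
  then have "integral\<^sup>N M1 (ind R) = integral\<^sup>N M2 (ind R)" using rects_hist[OF R] by (simp add: i)
  then show "emeasure M1 R = emeasure M2 R" using rects_hist[OF R] by (simp add: M1_def M2_def)
 next
  have "emeasure M1 (space M1) = (NN w|Om. ind ?S w * 1)" using i(1)[of "%_. 1"] by simp
  also have "\<dots> <= (NN w|Om. 1)" by (intro nn_integral_mono) (simp add: indicator_def)
  finally have "emeasure M1 (space M1) <= (NN w|Om. 1)" .
  then show "emeasure M1 (space Om) ~= \<infinity>" using emeasure_space[of M1 "space Om"] by (auto simp: emeasure_space_1 top_unique)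
 qed (use rects_Pow space_rects in \<open>simp_all add: Int_stable_rects M1_def M2_def sets_hist\<close>)
 then show ?thesis using i[OF g] by simp
qed

lemma \<tau>_Suc: "\<tau> (Suc n) w = \<tau> n w + \<sigma> n w" by (simp add: \<tau>_def)

lemma \<tau>_mono: "m <= n ==> \<tau> m w <= \<tau> n w" unfolding \<tau>_def by (intro sum_mono2) auto

abbreviation at_state :: "nat => real => 'w set" where
 "at_state n t \<equiv> {w. \<tau> n w <= ennreal t & ennreal t < \<tau> (Suc n) w}"

lemma at_state_mono:
 assumes "w : at_state n s" "w : at_state m t" "s <= t"
 shows "n <= m"
proof (rule ccontr)
 assume "\<not> n <= m"
 then have "\<tau> (Suc m) w <= \<tau> n w" by (intro \<tau>_mono) simp
 then show False using assms ennreal_leI[OF assms(3)] by (auto dest: order_trans less_le_trans)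
qed

lemma X_eq:
 assumes "w : space Om" "0 <= t"
 shows "EX n. w : at_state n t" "w : at_state n t ==> X t w = Y n w"
proof -
 obtain n where n: "w : at_state n t" "X t w = Y n w" using path[OF assms] unfolding \<tau>_def by blast
 then show "EX n. w : at_state n t" by blast
 show "X t w = Y n w" if "w : at_state n t" for n using at_state_mono[OF that n(1)] at_state_mono[OF n(1) that] n(2) by simp
qed

lemma X_sum:
 fixes F :: "'e => ennreal"
 assumes "w : space Om" "0 <= t"
 shows "F (X t w) = (\<Sum>n. ind (at_state n t) w * F (Y n w))"
proof -
 obtain n where n: "w : at_state n t" using X_eq(1)[OF assms] by blast
 have "(\<Sum>k. ind (at_state k t) w * F (Y k w)) = (\<Sum>k\<in>{n}. ind (at_state k t) w * F (Y k w))"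
  using at_state_mono[OF n] at_state_mono[OF _ n] by (intro suminf_finite) (force simp: indicator_def)+
 moreover have "ind (at_state n t) w = (1 :: ennreal)" using n by (simp add: indicator_def)
 ultimately show ?thesis using X_eq(2)[OF assms n] by (simp only: sum.insert_remove sum.empty finite.emptyI) simp
qed

lemma at_state_measurable:
 "(%p. ind (at_state n (fst p)) (snd p) :: ennreal) : BM (borel <*> Om)"
proof -
 have "(%p. \<tau> k (snd p)) : BM (borel <*> Om)" for k by (rule mcomp[OF measurable_snd \<tau>_measurable])
 moreover have "(%p. ennreal (fst p)) : BM (borel <*> Om)" by (rule mcomp[OF measurable_fst measurable_ennreal])
 ultimately have "{p : space (borel <*> Om). \<tau> n (snd p) <= ennreal (fst p) & ennreal (fst p) < \<tau> (Suc n) (snd p)} : sets (borel <*> Om)"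
  by (intro sets.sets_Collect_conj borel_measurable_le borel_measurable_less)
 from borel_measurable_indicator[OF this] show ?thesis by (rule measurable_cong[THEN iffD1, rotated]) (simp add: indicator_def)
qed

lemma at_state_Y_measurable:
 fixes F :: "'e => ennreal"
 assumes "F : BM E"
 shows "(%p. ind {0..t} (fst p) * (ind (at_state n (fst p)) (snd p) * F (Y n (snd p)))) : BM (borel <*> Om)"
 by (intro borel_measurable_times_ennreal at_state_measurable mcomp[OF measurable_fst borel_measurable_indicator]
   mcomp[OF measurable_snd mcomp[OF Y_measurable assms]]) auto

lemma X_measurable_pair:
 fixes F :: "'e => ennreal"
 assumes F: "F : BM E"
 shows "(%p. ind {0..t} (fst p) * F (X (fst p) (snd p))) : BM (borel <*> Om)"
proof -
 have "(%p. \<Sum>n. ind {0..t} (fst p) * (ind (at_state n (fst p)) (snd p) * F (Y n (snd p)))) : BM (borel <*> Om)" by (intro borel_measurable_suminf_order at_state_Y_measurable F)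
 then show ?thesis
 proof (rule measurable_cong[THEN iffD1, rotated])
  fix p assume "p : space ((borel :: real measure) <*> Om)"
  then have "snd p : space Om" by (auto simp: space_pair_measure)
  then show "(\<Sum>n. ind {0..t} (fst p) * (ind (at_state n (fst p)) (snd p) * F (Y n (snd p)))) = ind {0..t} (fst p) * F (X (fst p) (snd p))"
   using X_sum[of "snd p" "fst p" F] by (cases "0 <= fst p") simp_all
 qed
qed

lemma X_measurable:
 assumes t: "0 <= t"
 shows "X t : Om ->M E"
proof (rule measurableI)
 show "X t w : space E" if "w : space Om" for w using X_eq[OF that t] Y_space[OF that] by metis
 fix B assume "B : sets E"
 then have "(%w. ind B (X t w) :: ennreal) : BM Om" using mcomp[OF measurable_Pair1'[of t borel Om] X_measurable_pair[of "ind B" t]] t by simp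
 from measurable_sets[OF this, of "{1}"] show "X t -` B \<inter> space Om : sets Om" by (auto simp: vimage_def indicator_def of_bool_def split: if_splits)
qed

text \<open>The jumps from \<open>y\<close> into \<open>B\<close> occur at rate \<open>Q y B\<close>. Summing over the states, it suffices to
 treat the jump out of \<open>Y n\<close>. There both sides reduce to the integral of
 \<open>exp (- q r) * Q (Y n) B\<close> over the waiting times \<open>r\<close> with \<open>\<tau> n + r <= t\<close>.\<close>

lemma compensator:
 assumes B: "B : sets E" and t: "0 <= t" and \<psi>: "\<psi> : BM E"
 shows "(\<Sum>n. NN e|Om. ind {e. \<tau> (Suc n) e <= ennreal t & Y (Suc n) e : B} e * \<psi> (Y n e)) =
  (NN s|lborel. ind {0..t} s * (NN e|Om. ennreal (Q (X s e) B) * \<psi> (X s e)))"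
proof -
 interpret P: pair_sigma_finite Om lborel by unfold_locales
 interpret P': pair_sigma_finite lborel Om by unfold_locales
 let ?\<phi> = "%y. ennreal (Q y B) * \<psi> y"
 have \<phi>: "?\<phi> : BM E" using Q_measurable[OF B] \<psi> by measurable
 have lb: "sets (lborel <*> Om) = sets (borel <*> Om)" "sets (Om <*> lborel) = sets (Om <*> borel)" by (intro sets_pair_measure_cong; simp)+
 note lb = measurable_cong_sets[OF lb(1) refl] measurable_cong_sets[OF lb(2) refl]
 have step: "(NN e|Om. ind {e. \<tau> (Suc n) e <= ennreal t & Y (Suc n) e : B} e * \<psi> (Y n e)) =
   (NN e|Om. (NN s|lborel. ind {0..t} s * (ind (at_state n s) e * ?\<phi> (Y n e))))" for n
 proof -
  \<comment> \<open>Indicator that a jump after waiting time \<open>r\<close> in the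
    \<open>n\<close>-th state still happens by time \<open>t\<close>.\<close>
  define w where "w e r = (ind {..<top} (\<tau> n e) * ind {..t} (enn2real (\<tau> n e) + r) :: ennreal)" for e r
  have wm: "(%p. w (fst p) (snd p)) : BM (hist n <*> borel)"
  proof -
   have a: "(%e. ind {..<top} (\<tau> n e) :: ennreal) : BM (hist n)" by (rule mcomp[OF \<tau>_hist]) simp
   have b: "(%p. enn2real (\<tau> n (fst p)) + snd p) : BM (hist n <*> borel)" by (intro borel_measurable_add measurable_snd mcomp[OF measurable_fst borel_measurable_enn2real[OF \<tau>_hist]])
   have "(ind {..t} :: real => ennreal) : BM borel" by simp
   then show ?thesis unfolding w_def by (intro borel_measurable_times_ennreal mcomp[OF measurable_fst a] mcomp[OF b])
  qed
  have Yh: "Y n : hist n ->M E" by (rule Y_hist) simp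
  note [measurable] = Q_measurable[OF B] \<psi>
  note wF = borel_measurable_times_ennreal[OF wm mcomp[OF measurable_fst mcomp[OF Yh]]]
  have w\<phi>[measurable]: "(%(e, r). w e r * ?\<phi> (Y n e)) : BM (Om <*> lborel)" using mcomp[OF id_hist_pair wF[OF \<phi>]] by (simp add: case_prod_beta')
  have Fubini: "(NN e|Om. (NN r|lborel. ind {0..} r * (h e r * (w e r * ?\<phi> (Y n e))))) =
    (NN r|lborel. (NN e|Om. ind {0..} r * (h e r * (w e r * ?\<phi> (Y n e)))))"
   if "(%(e, r). h e r) : BM (Om <*> lborel)" for h :: "'w => real => ennreal"
  proof -
   have "(%p. ind {0..} (snd p) :: ennreal) : BM (Om <*> (lborel :: real measure))" by (rule mcomp[OF measurable_snd]) simp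
   from borel_measurable_times_ennreal[OF this borel_measurable_times_ennreal[OF that w\<phi>]]
   have "(%(e, r). ind {0..} r * (h e r * (w e r * ?\<phi> (Y n e)))) : BM (Om <*> lborel)" by (simp add: case_prod_beta')
   from P.Fubini'[OF this] show ?thesis by simp
  qed
  have split: "\<tau> (Suc n) e <= ennreal t <-> \<sigma> n e < top & \<tau> n e < top & enn2real (\<tau> n e) + enn2real (\<sigma> n e) <= t" for e
   unfolding \<tau>_Suc using t by (cases "\<tau> n e"; cases "\<sigma> n e") (auto simp: enn2real_ennreal top_unique simp flip: ennreal_plus)
  have "(NN e|Om. ind {e. \<tau> (Suc n) e <= ennreal t & Y (Suc n) e : B} e * \<psi> (Y n e)) =
    (NN e|Om. ind {e : space Om. \<sigma> n e < top & Y (Suc n) e : B} e * (w e (enn2real (\<sigma> n e)) * \<psi> (Y n e)))" by (intro NN_cong) (auto simp: split w_def indicator_def)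
  also have "\<dots> = (NN e|Om. (NN r|lborel. ind {0..} r * ennreal (exp (- q (Y n e) * r) * Q (Y n e) B) * (w e r * \<psi> (Y n e))))" using nn_integral_step[OF B wF[OF \<psi>]] by simp
  also have "\<dots> = (NN e|Om. (NN r|lborel. ind {0..} r * (ennreal (exp (- q (Y n e) * r)) * (w e r * ?\<phi> (Y n e)))))"
   using Q_bounds[OF Y_space B] by (intro NN_cong) (simp add: ennreal_mult ac_simps)
  also have "\<dots> = (NN r|lborel. (NN e|Om. ind {0..} r * (ennreal (exp (- q (Y n e) * r)) * (w e r * ?\<phi> (Y n e)))))" by (rule Fubini) measurable
  \<comment> \<open>The factor exp (- q r) is the conditional probability of waiting longer than
    \<open>r\<close>. This turns the law of a jump time into the time spent in the
    \<open>n\<close>-th state; afterwards the substitution s = \<tau>(n) + r leads back to absolute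
    time.\<close>
  also have "\<dots> = (NN r|lborel. (NN e|Om. ind {0..} r * (ind {e : space Om. ennreal r < \<sigma> n e} e * (w e r * ?\<phi> (Y n e)))))"
  proof (rule NN_cong)
   fix r :: real
   have "(%e. w e r * ?\<phi> (Y n e)) : BM (hist n)" using mcomp[OF measurable_Pair2' wF[OF \<phi>], of r] by simp
   from nn_integral_survival[OF _ this, of r]
   show "(NN e|Om. ind {0..} r * (ennreal (exp (- q (Y n e) * r)) * (w e r * ?\<phi> (Y n e)))) =
    (NN e|Om. ind {0..} r * (ind {e : space Om. ennreal r < \<sigma> n e} e * (w e r * ?\<phi> (Y n e))))" by (cases "0 <= r") simp_all
  qed
  also have "\<dots> = (NN e|Om. (NN r|lborel. ind {0..} r * (ind {e : space Om. ennreal r < \<sigma> n e} e * (w e r * ?\<phi> (Y n e)))))" by (rule Fubini[symmetric]) measurable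
  also have "\<dots> = (NN e|Om. (NN s|lborel. ind {0..t} s * (ind (at_state n s) e * ?\<phi> (Y n e))))"
  proof (rule NN_cong)
   fix e assume e: "e : space Om"
   show "(NN r|lborel. ind {0..} r * (ind {e : space Om. ennreal r < \<sigma> n e} e * (w e r * ?\<phi> (Y n e)))) =
    (NN s|lborel. ind {0..t} s * (ind (at_state n s) e * ?\<phi> (Y n e)))"
   proof (cases "\<tau> n e")
    case (real a)
    have "(%s. ind {0..t} s * (ind (at_state n s) e * ?\<phi> (Y n e))) : BM borel" using mcomp[OF measurable_Pair2' at_state_Y_measurable[OF \<phi>, of t n], of e] e by simp
    from nn_integral_real_affine[OF this, of 1 a]
    have "(NN s|lborel. ind {0..t} s * (ind (at_state n s) e * ?\<phi> (Y n e))) =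
     (NN r|lborel. ind {0..t} (a + r) * (ind (at_state n (a + r)) e * ?\<phi> (Y n e)))" by simp
    also have "\<dots> = (NN r|lborel. ind {0..} r * (ind {e : space Om. ennreal r < \<sigma> n e} e * (w e r * ?\<phi> (Y n e))))"
    proof (intro NN_cong)
     fix r :: real
     have "e : at_state n (a + r) <-> ennreal r < \<sigma> n e" if "0 <= r" using real that ennreal_add_left_cancel_less[of "ennreal a" "ennreal r" "\<sigma> n e"] by (simp add: \<tau>_Suc)
     moreover have "e \<notin> at_state n (a + r)" if "r < 0" "0 <= a + r" using that real by (simp add: ennreal_le_iff)
     ultimately show "ind {0..t} (a + r) * (ind (at_state n (a + r)) e * ?\<phi> (Y n e)) =
      ind {0..} r * (ind {e : space Om. ennreal r < \<sigma> n e} e * (w e r * ?\<phi> (Y n e)))" using real e by (cases "0 <= r"; cases "0 <= a + r") (auto simp: w_def indicator_def)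
    qed
    finally show ?thesis by simp
   qed (simp add: w_def top_unique)
  qed
  finally show ?thesis .
 qed
 let ?g = "%n p. ind {0..t} (fst p) * (ind (at_state n (fst p)) (snd p) * ?\<phi> (Y n (snd p)))"
 have g: "?g n : BM (lborel <*> Om)" for n unfolding lb by (rule at_state_Y_measurable[OF \<phi>])
 have "(\<Sum>n. NN e|Om. ind {e. \<tau> (Suc n) e <= ennreal t & Y (Suc n) e : B} e * \<psi> (Y n e)) = (\<Sum>n. NN p|(lborel <*> Om). ?g n p)"
  unfolding step P'.nn_integral_snd[OF g, symmetric] by simp
 also have "\<dots> = (NN p|(lborel <*> Om). (\<Sum>n. ?g n p))" by (rule nn_integral_suminf[OF g, symmetric])
 also have "\<dots> = (NN s|lborel. (NN e|Om. (\<Sum>n. ?g n (s, e))))" by (intro nn_integral_fst[symmetric] borel_measurable_suminf_order g)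
 also have "\<dots> = (NN s|lborel. ind {0..t} s * (NN e|Om. ?\<phi> (X s e)))" using X_sum[where F = ?\<phi>] by (intro NN_cong) (auto simp: indicator_def intro!: NN_cong)
 finally show ?thesis .
qed

text \<open>A balance of visits: being in \<open>B\<close> at time \<open>t\<close> is the number of
  entrances into \<open>B\<close> by time \<open>t\<close> minus the number of exits, the initial
  state counting as an entrance. Exits and entrances after time 0 have their compensators by
  \<open>compensator\<close>. The equation is written with sums only, since the terms may be
  infinite.\<close>

lemma forward_set:
 assumes B: "B : sets E" and t: "0 <= t"
 shows "(NN w|Om. ind B (X t w)) + (NN s|lborel. ind {0..t} s * (NN w|Om. ennreal (q (X s w)) * ind B (X s w))) =
  (NN w|Om. ind B (X 0 w)) + (NN s|lborel. ind {0..t} s * (NN w|Om. ennreal (Q (X s w) B)))"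
proof -
 note [measurable] = B
 have *: "(NN w|Om. ind B (X t w)) + (NN s|lborel. ind {0..t} s * (NN w|Om. ennreal (q (X s w)) * ind B (X s w))) =
  (NN w|Om. ind B (Y 0 w)) + (NN s|lborel. ind {0..t} s * (NN w|Om. ennreal (Q (X s w) B)))"
  if t: "0 <= t" for t
 proof -
  let ?a = "%n. NN w|Om. ind {w : space Om. \<tau> n w <= ennreal t & Y n w : B} w"
  let ?b = "%n. NN w|Om. ind {w : space Om. \<tau> (Suc n) w <= ennreal t & Y n w : B} w"
  let ?c = "%n. NN w|Om. ind {w : space Om. w : at_state n t & Y n w : B} w"
  have "?c n + ?b n = ?a n" for n
  proof -
   have "ind {w : space Om. w : at_state n t & Y n w : B} w + ind {w : space Om. \<tau> (Suc n) w <= ennreal t & Y n w : B} w =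
     (ind {w : space Om. \<tau> n w <= ennreal t & Y n w : B} w :: ennreal)" for w using order_trans[OF \<tau>_mono[of n "Suc n" w], of "ennreal t"] by (auto simp: indicator_def not_less)
   then show ?thesis by (subst nn_integral_add[symmetric]) auto
  qed
  moreover have "(NN w|Om. ind B (X t w)) = (NN w|Om. (\<Sum>n. ind {w : space Om. w : at_state n t & Y n w : B} w))"
   using X_sum[of _ t "ind B"] t by (intro NN_cong) (auto simp: indicator_def intro!: suminf_cong)
  then have "(NN w|Om. ind B (X t w)) = (\<Sum>n. ?c n)" by (subst (asm) nn_integral_suminf) auto
  ultimately have "(NN w|Om. ind B (X t w)) + (\<Sum>n. ?b n) = (\<Sum>n. ?a n)" by (simp add: suminf_add)
  also have "\<dots> = ?a 0 + (\<Sum>n. ?a (Suc n))" using suminf_offset[of ?a 1] by (simp add: add.commute)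
  also have "?a 0 = (NN w|Om. ind B (Y 0 w))" by (intro NN_cong) (simp add: \<tau>_def indicator_def)
  also have "(\<Sum>n. ?b n) = (\<Sum>n. NN w|Om. ind {w. \<tau> (Suc n) w <= ennreal t & Y (Suc n) w : space E} w * ind B (Y n w))" by (intro suminf_cong NN_cong) (auto simp: indicator_def Y_space)
  also have "\<dots> = (NN s|lborel. ind {0..t} s * (NN w|Om. ennreal (q (X s w)) * ind B (X s w)))" by (rule compensator[OF sets.top t]) simp
  also have "(\<Sum>n. ?a (Suc n)) = (\<Sum>n. NN w|Om. ind {w. \<tau> (Suc n) w <= ennreal t & Y (Suc n) w : B} w * 1)" by (intro suminf_cong NN_cong) (auto simp: indicator_def)
  also have "\<dots> = (NN s|lborel. ind {0..t} s * (NN w|Om. ennreal (Q (X s w) B) * 1))" by (rule compensator[OF B t]) simp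
  finally show ?thesis by simp
 qed
 have zero: "(NN s|lborel. ind {0..0} s * f s) = 0" for f :: "real => ennreal"
  by (rule trans[OF nn_integral_cong_AE[where v = "%_. 0"]]) (use AE_lborel_singleton[of "0 :: real"] in \<open>eventually_elim, auto simp: indicator_def\<close>)
 \<comment> \<open>\<open>X 0\<close> and \<open>Y 0\<close> can differ where the first holding time
   is 0. The balance at time 0, where both time integrals vanish, shows that their laws agree
   nevertheless.\<close>
 have "(NN w|Om. ind B (X 0 w)) = (NN w|Om. ind B (Y 0 w))" using *[of 0] by (simp only: zero) simp
 then show ?thesis using *[OF t] by simp
qed

lemma time_functional:
 assumes \<Phi>: "!!y. y : space E ==> nn_functional E (\<Phi> y)"
  and m: "!!F. F : BM E ==> (%y. \<Phi> y F) : BM E"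
 shows "nn_functional E (%F. NN s|lborel. ind {0..t} s * (NN w|Om. \<Phi> (X s w) F))"
proof (rule nn_functional_integral)
 show "nn_functional E (%F. ind {0..t} s * (NN w|Om. \<Phi> (X s w) F))" for s
 proof (cases "0 <= s")
  case True
  then show ?thesis by (intro nn_functional_cmult nn_functional_integral \<Phi> measurable_space[OF X_measurable] mcomp[OF X_measurable m])
 qed (simp add: nn_functional_zero)
 fix F :: "'e => ennreal" assume "F : BM E"
 from X_measurable_pair[OF m[OF this], of t]
 have "(%s. NN w|Om. ind {0..t} s * \<Phi> (X s w) F) : BM borel" using borel_measurable_nn_integral_fst by fastforce
 moreover have "(NN w|Om. ind {0..t} s * \<Phi> (X s w) F) = ind {0..t} s * (NN w|Om. \<Phi> (X s w) F)" for s by (simp add: indicator_def)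
 ultimately show "(%s. ind {0..t} s * (NN w|Om. \<Phi> (X s w) F)) : BM lborel" by simp
qed

lemma forward:
 fixes \<Q> :: "('e => ennreal) => 'e => ennreal"
 assumes \<Q>: "!!y. y : space E ==> nn_functional E (%F. \<Q> F y)"
  and \<Q>_indicator: "!!y B. y : space E ==> B : sets E ==> \<Q> (ind B) y = ennreal (Q y B)"
  and \<Q>_measurable: "!!F. F : BM E ==> \<Q> F : BM E"
  and F: "F : BM E" and t: "0 <= t"
 shows "(NN w|Om. F (X t w)) + (NN s|lborel. ind {0..t} s * (NN w|Om. ennreal (q (X s w)) * F (X s w))) =
  (NN w|Om. F (X 0 w)) + (NN s|lborel. ind {0..t} s * (NN w|Om. \<Q> F (X s w)))" (is "?l F = ?r F")
proof (rule nn_functional_eqI[where \<Phi> = ?l and \<Psi> = ?r])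
 have e: "nn_functional E (%F. NN w|Om. F (X s w))" if "0 <= s" for s using X_measurable[OF that] by (intro nn_functional_integral nn_functional_eval) (auto intro: measurable_space mcomp)
 show "nn_functional E ?l" using time_functional[where \<Phi> = "%y F. ennreal (q y) * F y"] by (intro nn_functional_add e t) (simp add: nn_functional_cmult nn_functional_eval)
 show "nn_functional E ?r" using time_functional[where \<Phi> = "%y F. \<Q> F y"] by (intro nn_functional_add e) (simp_all add: \<Q> \<Q>_measurable)
 fix B assume B: "B : sets E"
 have "ind {0..t} s * (NN w|Om. \<Q> (ind B) (X s w)) = ind {0..t} s * (NN w|Om. ennreal (Q (X s w) B))" for s
  using \<Q>_indicator[OF measurable_space[OF X_measurable] B] by (cases "s : {0..t}") (auto intro!: NN_cong)
 then show "?l (ind B) = ?r (ind B)" using forward_set[OF B t] by (simp only:)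
qed (rule F)

text \<open>An increase of \<open>G\<close> in one jump crosses some rational level
  \<open>c\<close>, and for each \<open>c\<close> and each \<open>n\<close> such a jump has rate 0.
  Countably many null sets are discarded.\<close>

lemma AE_decreasing:
 fixes G :: "'e => real"
 assumes G[measurable]: "G : BM E"
  and dec: "!!y c. y : space E ==> G y <= c ==> Q y {z : space E. c < G z} = 0"
 shows "AE w in Om. ALL s t. 0 <= s --> s <= t --> G (X t w) <= G (X s w)"
proof -
 have "AE w in Om. \<not> (G (Y n w) <= c & \<sigma> n w < top & c < G (Y (Suc n) w))" for n and c :: real
 proof -
  let ?B = "{z : space E. c < G z}" and ?f = "%p. ind {..c} (G (Y n (fst p))) :: ennreal"
  have "(%p. G (Y n (fst p))) : BM (hist n <*> (borel :: real measure))" by (rule mcomp[OF measurable_fst mcomp[OF Y_hist G]]) simp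
  then have f: "?f : BM (hist n <*> (borel :: real measure))" by (rule mcomp) simp
  have B[measurable]: "?B : sets E" by measurable
  have "(NN r|lborel. ind {0..} r * ennreal (exp (- q (Y n w) * r) * Q (Y n w) ?B) * ?f (w, r)) = 0" if "w : space Om" for w using dec[OF Y_space[OF that]] by (cases "G (Y n w) <= c") simp_all
  then have "(NN w|Om. ind {w : space Om. \<sigma> n w < top & Y (Suc n) w : ?B} w * ind {..c} (G (Y n w))) = 0" using nn_integral_step[OF B f] by (simp cong: NN_cong)
  moreover have "(%w. ind {w : space Om. \<sigma> n w < top & Y (Suc n) w : ?B} w * ind {..c} (G (Y n w)) :: ennreal) : BM Om" by measurable
  ultimately have "AE w in Om. ind {w : space Om. \<sigma> n w < top & Y (Suc n) w : ?B} w * ind {..c} (G (Y n w)) = (0 :: ennreal)" by (simp add: nn_integral_0_iff_AE)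
  then show ?thesis using AE_space by eventually_elim (auto simp: indicator_def Y_space split: if_splits)
 qed
 then have "AE w in Om. ALL n. ALL c::rat. \<not> (G (Y n w) <= of_rat c & \<sigma> n w < top & of_rat c < G (Y (Suc n) w))" unfolding AE_all_countable by blast
 then show ?thesis using AE_space
 proof eventually_elim
  case (elim w)
  show ?case
  proof (intro allI impI)
   fix s t :: real assume st: "0 <= s" "s <= t"
   obtain n where n: "w : at_state n s" using X_eq(1)[of w s] elim st by blast
   obtain m where m: "w : at_state m t" using X_eq(1)[of w t] elim st by force
   have step: "G (Y (Suc k) w) <= G (Y k w)" if "Suc k <= m" for k
   proof (rule ccontr)
    assume "\<not> G (Y (Suc k) w) <= G (Y k w)"
    then obtain c where "G (Y k w) < of_rat c" "of_rat c < G (Y (Suc k) w)" using of_rat_dense not_le by blast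
    moreover have "\<tau> (Suc k) w < top" using order_trans[OF \<tau>_mono[OF that, of w], of "ennreal t"] m le_less_trans[OF _ ennreal_less_top] by blast
    ultimately show False using elim(1) less_imp_le unfolding \<tau>_Suc by (auto dest!: less_imp_le)
   qed
   have "G (Y m w) <= G (Y n w)" using at_state_mono[OF n m st(2)] by (rule dec_induct) (simp, meson Suc_leI order_trans step)
   then show "G (X t w) <= G (X s w)" using X_eq(2)[OF _ _ n] X_eq(2)[OF _ _ m] elim st by simp
  qed
 qed
qed

end

section \<open>Convolution of configuration functions and sums over pairs\<close>

definition conv_step ::
 "'a => (('a multiset => real) => ('a multiset => real) => real) => ('a multiset => real) => ('a multiset => real) => real" where
 "conv_step x \<Phi> g h = \<Phi> (%v. g (add_mset x v)) h + \<Phi> g (%v. h (add_mset x v))"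

text \<open>\<open>conv g h u\<close> sums \<open>g v * h (u - v)\<close> over the sub-multisets \<open>v\<close> of \<open>u\<close>, counted as index sets.\<close>

definition conv :: "('a multiset => real) => ('a multiset => real) => 'a multiset => real" where
 "conv g h u = fold_mset conv_step (%g h. g {#} * h {#}) u g h"

interpretation conv_step: comp_fun_commute conv_step by standard (auto simp: fun_eq_iff conv_step_def add_mset_commute)

lemma conv_empty[simp]: "conv g h {#} = g {#} * h {#}" by (simp add: conv_def)

lemma conv_add_mset:
 "conv g h (add_mset x u) = conv (%v. g (add_mset x v)) h u + conv g (%v. h (add_mset x v)) u" unfolding conv_def by (simp add: conv_step_def)

lemma conv_cong:
 assumes "!!v. v \<subseteq># u ==> g v = g' v" "!!v. v \<subseteq># u ==> h v = h' v"
 shows "conv g h u = conv g' h' u" using assms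
proof (induction u arbitrary: g h g' h')
 case (add x u)
 have "v \<subseteq># add_mset x u" "add_mset x v \<subseteq># add_mset x u" if "v \<subseteq># u" for v using that by (auto intro: subset_mset.order_trans)
 then show ?case unfolding conv_add_mset using add.prems by (intro arg_cong2[where f = "(+)"] add.IH) auto
qed simp

lemma conv_commute: "conv g h u = conv h g u" by (induction u arbitrary: g h) (auto simp: conv_add_mset)

lemma conv_add_left: "conv (%v. g v + g' v) h u = conv g h u + conv g' h u" by (induction u arbitrary: g g' h) (auto simp: conv_add_mset algebra_simps)

lemma conv_cmult_left: "conv (%v. c * g v) h u = c * conv g h u" by (induction u arbitrary: g h) (auto simp: conv_add_mset algebra_simps)

lemma conv_zero_left[simp]: "conv (%v. 0) h u = 0" using conv_cmult_left[of 0 "%_. 0"] by simp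

lemma conv_diff_left: "conv (%v. g v - g' v) h u = conv g h u - conv g' h u" using conv_add_left[of g "%v. -1 * g' v"] unfolding conv_cmult_left by simp

lemma conv_add_right: "conv g (%v. h v + h' v) u = conv g h u + conv g h' u" unfolding conv_commute[of g] by (rule conv_add_left)

lemma conv_cmult_right: "conv g (%v. c * h v) u = c * conv g h u" unfolding conv_commute[of g] by (rule conv_cmult_left)

lemma conv_mono_left:
 assumes "!!v. v \<subseteq># u ==> g v <= g' v" "!!v. 0 <= h v"
 shows "conv g h u <= conv g' h u" using assms
proof (induction u arbitrary: g g' h)
 case (add x u)
 have "v \<subseteq># add_mset x u" "add_mset x v \<subseteq># add_mset x u" if "v \<subseteq># u" for v using that by (auto intro: subset_mset.order_trans)
 then show ?case unfolding conv_add_mset using add.prems by (intro add_mono add.IH) auto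
qed (simp add: mult_right_mono)

lemma conv_nonneg: "(!!v. v \<subseteq># u ==> 0 <= g v) ==> (!!v. 0 <= h v) ==> 0 <= conv g h u" using conv_mono_left[of u "%_. 0" g h] by simp

lemma conv_abs_le:
 assumes "!!v. v \<subseteq># u ==> \<bar>g v\<bar> <= g' v" "!!v. 0 <= h v"
 shows "\<bar>conv g h u\<bar> <= conv g' h u"
proof -
 have "conv g h u <= conv g' h u" "conv (%v. - 1 * g v) h u <= conv g' h u" using assms by (auto intro!: conv_mono_left simp: abs_le_iff)
 then show ?thesis unfolding conv_cmult_left by simp
qed

lemma conv_abs_le_power:
 assumes "!!v. v \<subseteq># u ==> \<bar>g v\<bar> <= a" "!!v. v \<subseteq># u ==> \<bar>h v\<bar> <= b"
 shows "\<bar>conv g h u\<bar> <= a * b * 2 ^ size u" using assms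
proof (induction u arbitrary: g h)
 case empty
 then show ?case using mult_mono[of "\<bar>g {#}\<bar>" a "\<bar>h {#}\<bar>" b] abs_ge_zero[of "g {#}"] by (simp add: abs_mult del: abs_ge_zero)
next
 case (add x u)
 have "v \<subseteq># add_mset x u" "add_mset x v \<subseteq># add_mset x u" if "v \<subseteq># u" for v using that by (auto intro: subset_mset.order_trans)
 then have "\<bar>conv (%v. g (add_mset x v)) h u\<bar> <= a * b * 2 ^ size u" "\<bar>conv g (%v. h (add_mset x v)) u\<bar> <= a * b * 2 ^ size u" using add.prems by (intro add.IH; auto)+
 then show ?case unfolding conv_add_mset by simp
qed

lemma conv_one_one: "conv (%_. 1) (%_. 1) u = 2 ^ size u" by (induction u) (auto simp: conv_add_mset)

lemma conv_tendsto:
 assumes "!!v. v \<subseteq># u ==> (%n. g n v) \<longlonglongrightarrow> g' v"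
 shows "(%n. conv (g n) h u) \<longlonglongrightarrow> conv g' h u" using assms
proof (induction u arbitrary: g g' h)
 case (add x u)
 have "v \<subseteq># add_mset x u" "add_mset x v \<subseteq># add_mset x u" if "v \<subseteq># u" for v using that by (auto intro: subset_mset.order_trans)
 then show ?case unfolding conv_add_mset using add.prems by (intro tendsto_add add.IH) auto
qed (auto intro: tendsto_mult_right)

lemma conv_integral:
 assumes "!!v. v \<subseteq># u ==> integrable M (%z. G z v)"
 shows "integrable M (%z. conv (G z) h u)" "(LINT z|M. conv (G z) h u) = conv (%v. LINT z|M. G z v) h u"
proof -
 have "integrable M (%z. conv (G z) h u) & (LINT z|M. conv (G z) h u) = conv (%v. LINT z|M. G z v) h u" using assms
 proof (induction u arbitrary: G h)
  case (add x u)
  have "v \<subseteq># add_mset x u" "add_mset x v \<subseteq># add_mset x u" if "v \<subseteq># u" for v using that by (auto intro: subset_mset.order_trans)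
  then have 1: "integrable M (%z. conv (%v. G z (add_mset x v)) h u) \<and>
    (LINT z|M. conv (%v. G z (add_mset x v)) h u) = conv (%v. LINT z|M. G z (add_mset x v)) h u"
   and 2: "integrable M (%z. conv (G z) (%v. h (add_mset x v)) u) \<and>
    (LINT z|M. conv (G z) (%v. h (add_mset x v)) u) = conv (%v. LINT z|M. G z v) (%v. h (add_mset x v)) u" using add.prems by (intro add.IH; blast)+
  then show ?case unfolding conv_add_mset by simp
 qed simp
 then show "integrable M (%z. conv (G z) h u)" "(LINT z|M. conv (G z) h u) = conv (%v. LINT z|M. G z v) h u" by auto
qed

lemma sub_sum_cong:
 "(!!y. y \<in># u ==> G y (u - {#y#}) = G' y (u - {#y#})) ==> sub_sum G u = sub_sum G' u" unfolding sub_sum_def by (intro arg_cong[where f = sum_mset] image_mset_cong) auto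

lemma sub_sum_add: "sub_sum (%y v. G y v + G' y v) u = sub_sum G u + sub_sum G' u" by (simp add: sub_sum_def sum_mset.distrib)

lemma sub_sum_cmult: "sub_sum (%y v. c * G y v) u = (c * sub_sum G u :: real)" by (simp add: sub_sum_def sum_mset_distrib_left)

lemma sub_sum_mono:
 fixes G :: "'a => 'a multiset => real"
 shows "(!!y. y \<in># u ==> G y (u - {#y#}) <= G' y (u - {#y#})) ==> sub_sum G u <= sub_sum G' u" unfolding sub_sum_def by (rule sum_mset_mono)

text \<open>Marking a particle and putting it into the first factor of a splitting is the same as
  splitting and then marking a particle of the first factor. This is what moves operators built from
  marked particles through \<open>conv\<close>.\<close>

lemma sub_sum_conv_left: "sub_sum (%y. conv (H y) h) u = conv (sub_sum H) h u"
proof (induction u arbitrary: H h)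
 case (add x u)
 have "sub_sum (%y. conv (H y) h) (add_mset x u) = conv (H x) h u +
   (sub_sum (%y. conv (%v. H y (add_mset x v)) h) u + sub_sum (%y. conv (H y) (%v. h (add_mset x v))) u)" by (simp add: sub_sum_add_mset conv_add_mset sub_sum_add)
 also have "\<dots> = conv (%v. H x v + sub_sum (%y v. H y (add_mset x v)) v) h u + conv (sub_sum H) (%v. h (add_mset x v)) u" unfolding add.IH conv_add_left by simp
 also have "\<dots> = conv (sub_sum H) h (add_mset x u)" by (simp add: conv_add_mset sub_sum_add_mset)
 finally show ?case .
qed simp

lemma sub_sum_conv_right: "sub_sum (%y. conv g (H y)) u = conv g (sub_sum H) u" unfolding conv_commute[of g] by (rule sub_sum_conv_left)

text \<open>\<open>pair_sum D u\<close> sums \<open>D a b v\<close> over the unordered pairs \<open>{a, b}\<close> of \<open>u\<close>, where \<open>v\<close> is what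
 remains of \<open>u\<close>.\<close>

definition pair_sum :: "('a => 'a => 'a multiset => real) => 'a multiset => real" where
 "pair_sum D u = 1 / 2 * sub_sum (%a. sub_sum (%b. D a b)) u"

lemma remove_pair:
 assumes "a \<in># u" "b \<in># u - {#a#}"
 shows "add_mset a (add_mset b (u - {#a#} - {#b#})) = u" using assms by (metis insert_DiffM)

lemma pair_sum_cong:
 assumes "!!a b v. add_mset a (add_mset b v) = u ==> D a b v = D' a b v"
 shows "pair_sum D u = pair_sum D' u" unfolding pair_sum_def by (intro arg_cong[where f = "(*) (1 / 2)"] sub_sum_cong assms remove_pair)

lemma pair_sum_mono:
 assumes "!!a b v. add_mset a (add_mset b v) = u ==> D a b v <= D' a b v"
 shows "pair_sum D u <= pair_sum D' u" unfolding pair_sum_def by (intro mult_left_mono sub_sum_mono assms remove_pair) simp_all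

lemma pair_sum_add: "pair_sum (%a b v. D a b v + D' a b v) u = pair_sum D u + pair_sum D' u"
proof -
 have "sub_sum (%b v. D a b v + D' a b v) = (%v. sub_sum (D a) v + sub_sum (D' a) v)" for a by (rule ext) (rule sub_sum_add)
 then show ?thesis by (simp add: pair_sum_def sub_sum_add algebra_simps)
qed

lemma pair_sum_cmult: "pair_sum (%a b v. c * D a b v) u = c * pair_sum D u"
proof -
 have "sub_sum (%b v. c * D a b v) = (%v. c * sub_sum (D a) v)" for a by (rule ext) (rule sub_sum_cmult)
 then show ?thesis by (simp add: pair_sum_def sub_sum_cmult)
qed

lemma pair_sum_zero: "pair_sum (%a b v. 0) u = 0" using pair_sum_cmult[of 0 "%a b v. 0"] by simp

lemma pair_sum_diff: "pair_sum (%a b v. D a b v - D' a b v) u = pair_sum D u - pair_sum D' u" using pair_sum_add[of D "%a b v. - 1 * D' a b v"] unfolding pair_sum_cmult by simp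

lemma pair_sum_nonneg:
 "(!!a b v. add_mset a (add_mset b v) = u ==> 0 <= D a b v) ==> 0 <= pair_sum D u" using pair_sum_mono[of u "%_ _ _. 0" D] by (simp add: pair_sum_zero)

lemma pair_sum_abs_le:
 assumes "!!a b v. add_mset a (add_mset b v) = u ==> \<bar>D a b v\<bar> <= D' a b v"
 shows "\<bar>pair_sum D u\<bar> <= pair_sum D' u"
proof -
 have "pair_sum D u <= pair_sum D' u" "pair_sum (%a b v. - 1 * D a b v) u <= pair_sum D' u" using assms by (auto intro!: pair_sum_mono simp: abs_le_iff)
 then show ?thesis unfolding pair_sum_cmult by simp
qed

lemma pair_sum_conv_left: "pair_sum (%a b. conv (D a b) h) u = conv (pair_sum D) h u" unfolding pair_sum_def sub_sum_conv_left conv_cmult_left by simp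

lemma pair_sum_conv_right: "pair_sum (%a b. conv g (D a b)) u = conv g (pair_sum D) u" unfolding pair_sum_def sub_sum_conv_right conv_cmult_right by simp

text \<open>Every particle belongs to \<open>size u - 1\<close> pairs.\<close>

lemma pair_sum_mass:
 fixes m :: "'a => real"
 shows "pair_sum (%a b v. m a + m b) u = (real (size u) - 1) * (\<Sum>y\<in>#u. m y)"
proof -
 have c: "sub_sum (%b v. c + m b) v = real (size v) * c + (\<Sum>y\<in>#v. m y)" for c v by (simp add: sub_sum_def sum_mset.distrib)
 have "sub_sum (%a v. real (size v) * m a + (\<Sum>y\<in>#v. m y)) u = sub_sum (%a v. (real (size u) - 2) * m a + (\<Sum>y\<in>#u. m y)) u"
 proof (rule sub_sum_cong)
  fix y assume "y \<in># u"
  then obtain v where "u = add_mset y v" by (metis mset_add)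
  then show "real (size (u - {#y#})) * m y + (\<Sum>y\<in>#u - {#y#}. m y) = (real (size u) - 2) * m y + (\<Sum>y\<in>#u. m y)" by (simp add: algebra_simps)
 qed
 also have "\<dots> = (real (size u) - 2) * (\<Sum>y\<in>#u. m y) + real (size u) * (\<Sum>y\<in>#u. m y)" by (simp add: sub_sum_def sum_mset.distrib sum_mset_distrib_left)
 finally show ?thesis unfolding pair_sum_def c by (simp add: algebra_simps)
qed

text \<open>Twice the sum over pairs is the square of the total without its diagonal.\<close>

lemma pair_sum_prod_le:
 fixes m :: "'a => real"
 assumes "!!y. 0 <= m y"
 shows "pair_sum (%a b v. m a * m b) u <= (\<Sum>y\<in>#u. m y)\<^sup>2 / 2"
proof -
 have c: "sub_sum (%b v. c * m b) v = c * (\<Sum>y\<in>#v. m y)" for c v by (simp add: sub_sum_def sum_mset_distrib_left)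
 have "sub_sum (%a v. m a * (\<Sum>y\<in>#v. m y)) u <= sub_sum (%a v. (\<Sum>y\<in>#u. m y) * m a) u"
 proof (rule sub_sum_mono)
  fix y assume "y \<in># u"
  then obtain v where "u = add_mset y v" by (metis mset_add)
  then show "m y * (\<Sum>y\<in>#u - {#y#}. m y) <= (\<Sum>y\<in>#u. m y) * m y" using assms[of y] by (simp add: algebra_simps)
 qed
 also have "\<dots> = (\<Sum>y\<in>#u. m y)\<^sup>2" by (simp add: sub_sum_def sum_mset_distrib_left power2_eq_square)
 finally show ?thesis unfolding pair_sum_def c by simp
qed

text \<open>The parameter in the integrand is absorbed by pushing \<open>L x\<close> forward to the
  pairs (x, y).\<close>

lemma integral_measurable_subprob_algebra2:
 fixes f :: "'a => 'b => real"
 assumes f[measurable]: "(%(x, y). f x y) : BM (M <*> N)"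
  and N[measurable]: "L : measurable M (subprob_algebra N)"
 shows "(%x. integral\<^sup>L (L x) (f x)) : BM M"
proof -
 have "(%x. distr (L x) (M <*> N) (%y. (x, y))) : M ->M subprob_algebra (M <*> N)" by (rule measurable_distr2[OF _ N]) simp
 from mcomp[OF this integral_measurable_subprob_algebra[OF f]]
 have "(%x. integral\<^sup>L (distr (L x) (M <*> N) (%y. (x, y))) (%(x, y). f x y)) : BM M" .
 then show ?thesis
 proof (rule measurable_cong[THEN iffD1, rotated])
  fix x assume x: "x : space M"
  then have "sets (L x) = sets N" using subprob_measurableD(2)[OF N] by blast
  then have "(%y. (x, y)) : L x ->M M <*> N" using x by (simp cong: measurable_cong_sets)
  then show "integral\<^sup>L (distr (L x) (M <*> N) (%y. (x, y))) (%(x, y). f x y) = integral\<^sup>L (L x) (f x)" using integral_distr[OF _ f, of "%y. (x, y)" "L x"] by simp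
 qed
qed

context bump_space
begin

text \<open>Peeling as in \<open>sub_sum_measurable\<close>, now with two accumulators: the selected
  particle goes to either factor.\<close>

lemma conv_measurable:
 assumes g: "g : BM PM" and h: "h : BM PM"
 shows "conv g h : BM PM"
proof -
 let ?F = "%n (\<eta>, \<theta>, u). if size u = n then conv (%v. g (\<eta> + v)) (%v. h (\<theta> + v)) u else 0"
 let ?M = "PM <*> (PM <*> PM)"
 have F: "?F n : BM ?M" for n
 proof (induction n)
  case 0
  have [measurable]: "Measurable.pred PM (%u. u = {#})" using mcomp[OF size_measurable, of "%n. n = 0"] by simp
  have "?F 0 = (%p. if snd (snd p) = {#} then g (fst p) * h (fst (snd p)) else 0)" by (auto simp: fun_eq_iff)
  then show ?case using g h by simp
 next
  case (Suc n)
  have 1: "(%(\<eta>, \<theta>, u). (add_mset (sel u) \<eta>, \<theta>, u - {#sel u#})) : ?M ->M ?M"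
   and 2: "(%(\<eta>, \<theta>, u). (\<eta>, add_mset (sel u) \<theta>, u - {#sel u#})) : ?M ->M ?M" by measurable
  have "(%p. if size (snd (snd p)) = Suc n then ?F n ((%(\<eta>, \<theta>, u). (add_mset (sel u) \<eta>, \<theta>, u - {#sel u#})) p) +
    ?F n ((%(\<eta>, \<theta>, u). (\<eta>, add_mset (sel u) \<theta>, u - {#sel u#})) p) else 0) : BM ?M"
   using mcomp[OF 1 Suc.IH] mcomp[OF 2 Suc.IH] by (intro measurable_If borel_measurable_add) auto
  moreover have "(if size (snd (snd p)) = Suc n then ?F n ((%(\<eta>, \<theta>, u). (add_mset (sel u) \<eta>, \<theta>, u - {#sel u#})) p) +
    ?F n ((%(\<eta>, \<theta>, u). (\<eta>, add_mset (sel u) \<theta>, u - {#sel u#})) p) else 0) = ?F (Suc n) p" for p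
  proof (cases "size (snd (snd p)) = Suc n")
   case True
   obtain \<eta> \<theta> u where p: "p = (\<eta>, \<theta>, u)" by (cases p)
   define y where "y = sel u"
   have "u ~= {#}" using True p by auto
   then obtain v where v: "u = add_mset y v" using sel[of u] unfolding y_def by (meson multi_member_split)
   have "conv (%v. g (\<eta> + v)) (%v. h (\<theta> + v)) u =
     conv (%v. g (\<eta> + add_mset y v)) (%v. h (\<theta> + v)) v + conv (%v. g (\<eta> + v)) (%v. h (\<theta> + add_mset y v)) v"
    "u - {#y#} = v" "size v = n" using v True p by (auto simp: conv_add_mset)
   then show ?thesis using True by (simp add: p y_def[symmetric])
  qed (simp add: case_prod_beta)
  ultimately show ?case by simp
 qed
 have "(%u. ?F n ({#}, {#}, u)) : BM PM" for n by (rule mcomp[OF _ F]) simp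
 from measurable_compose_countable[where f = "%n u. ?F n ({#}, {#}, u)", OF this size_measurable] show ?thesis by simp
qed

end

section \<open>The coagulation operator on configuration functions\<close>

locale coag_kernel = bump_space A \<B> for A :: "'a::second_countable_topology set" and \<B> +
 fixes K :: "'a => 'a => real" and J :: "'a => 'a => 'a measure" and mass :: "'a => nat" and H :: real
 assumes K_measurable: "(%(a, b). K a b) : BM (PA <*> PA)"
  and K_nonneg: "a : A ==> b : A ==> 0 <= K a b"
  and K_le: "a : A ==> b : A ==> K a b <= H * (real (mass a) * real (mass b))"
  and J_measurable: "(%(a, b). J a b) : PA <*> PA ->M prob_algebra PA"
  and J_mass: "a : A ==> b : A ==> AE z in J a b. mass z = mass a + mass b"
  and mass_measurable: "mass : PA ->M CSU"
  and mass_pos: "a : A ==> 1 <= mass a"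
  and H_nonneg: "0 <= H"
begin

lemma J_prob: "a : A ==> b : A ==> prob_space (J a b)"
 and J_sets: "a : A ==> b : A ==> sets (J a b) = sets PA"
 and J_space: "a : A ==> b : A ==> space (J a b) = A"
proof -
 assume "a : A" "b : A"
 then have "(a, b) : space (PA <*> PA)" by (simp add: space_pair_measure)
 then have "(case (a, b) of (a, b) => J a b) : space (prob_algebra PA)" by (rule measurable_space[OF J_measurable])
 then show "prob_space (J a b)" "sets (J a b) = sets PA" by (auto simp: space_prob_algebra)
 then show "space (J a b) = A" using sets_eq_imp_space_eq[of "J a b" PA] by simp
qed

definition total :: "'a multiset => nat" where
 "total u = (\<Sum>y\<in>#u. mass y)"

lemma total_simps[simp]: "total {#} = 0" "total (add_mset x u) = mass x + total u" by (simp_all add: total_def)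

definition mprod :: "'a multiset => real" where
 "mprod u = (\<Prod>y\<in>#u. real (mass y))"

lemma mprod_simps[simp]: "mprod {#} = 1" "mprod (add_mset x u) = real (mass x) * mprod u" by (simp_all add: mprod_def)

lemma mprod_nonneg: "0 <= mprod u" by (induction u) auto

lemma size_le_total: "pts u ==> size u <= total u" by (induction u) (use mass_pos in fastforce)+

lemma mprod_le: "mprod u <= 2 ^ total u"
proof (induction u)
 case (add x u)
 have "real (mass x) <= 2 ^ mass x" using of_nat_less_two_power[of "mass x", where 'a = real] by simp
 then show ?case using add mprod_nonneg[of u] by (simp add: power_add mult_mono)
qed simp

text \<open>As mergers conserve the total mass, a bound by an arbitrary function of the total mass
  survives all operators below and makes every expectation localized to bounded total mass
  finite.\<close>

definition tame :: "('a multiset => real) => bool" where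
 "tame h <-> h : BM PM & (EX w :: nat => real. ALL u. pts u --> \<bar>h u\<bar> <= w (total u))"

lemma tame_measurable: "tame h ==> h : BM PM" by (simp add: tame_def)

lemma tame_bound:
 assumes "tame h"
 obtains w :: "nat => real" where "mono w" "!!u. pts u ==> \<bar>h u\<bar> <= w (total u)" "!!n. 0 <= w n"
proof -
 obtain w :: "nat => real" where w: "!!u. pts u ==> \<bar>h u\<bar> <= w (total u)" using assms by (auto simp: tame_def)
 define v where "v n = (\<Sum>j\<le>n. \<bar>w j\<bar>)" for n
 have "mono v" unfolding v_def by (intro monoI sum_mono2) auto
 moreover have "\<bar>h u\<bar> <= v (total u)" if "pts u" for u
 proof -
  have "\<bar>w (total u)\<bar> <= v (total u)" unfolding v_def by (rule member_le_sum) auto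
  then show ?thesis using w[OF that] by linarith
 qed
 moreover have "0 <= v n" for n unfolding v_def by (intro sum_nonneg) auto
 ultimately show ?thesis by (rule that)
qed

lemma tameI:
 "h : BM PM ==> (!!u. pts u ==> \<bar>h u\<bar> <= w (total u)) ==> tame h" unfolding tame_def by blast

lemma tame_add: "tame g ==> tame h ==> tame (%u. g u + h u)"
proof -
 assume gh: "tame g" "tame h"
 obtain w where w: "!!u. pts u ==> \<bar>g u\<bar> <= w (total u)" by (rule tame_bound[OF gh(1)]) blast
 obtain v where v: "!!u. pts u ==> \<bar>h u\<bar> <= v (total u)" by (rule tame_bound[OF gh(2)]) blast
 show ?thesis
 proof (rule tameI)
  show "\<bar>g u + h u\<bar> <= (%n. w n + v n) (total u)" if "pts u" for u using w[OF that] v[OF that] by simp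
 qed (use gh tame_measurable in auto)
qed

lemma tame_mult: "tame g ==> tame h ==> tame (%u. g u * h u)"
proof -
 assume gh: "tame g" "tame h"
 obtain w where w: "!!u. pts u ==> \<bar>g u\<bar> <= w (total u)" by (rule tame_bound[OF gh(1)]) blast
 obtain v where v: "!!u. pts u ==> \<bar>h u\<bar> <= v (total u)" "!!n. 0 <= v n" by (rule tame_bound[OF gh(2)]) blast
 show ?thesis
 proof (rule tameI)
  show "\<bar>g u * h u\<bar> <= (%n. \<bar>w n\<bar> * v n) (total u)" if "pts u" for u using w[OF that] v(1)[OF that] unfolding abs_mult by (intro mult_mono) auto
 qed (use gh tame_measurable in auto)
qed

lemma tame_const: "tame (%_. c)" by (rule tameI[where w = "%_. \<bar>c\<bar>"]) auto

lemma tame_cmult: "tame h ==> tame (%u. c * h u)" by (rule tame_mult[OF tame_const])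

lemma tame_diff: "tame g ==> tame h ==> tame (%u. g u - h u)" using tame_add[of g "%u. -1 * h u"] tame_cmult[of h "-1"] by simp

lemma tame_conv:
 assumes "tame g" "tame h"
 shows "tame (conv g h)"
proof -
 obtain w where w: "mono w" "!!u. pts u ==> \<bar>g u\<bar> <= w (total u)" "!!n. 0 <= w n" by (rule tame_bound[OF assms(1)]) blast
 obtain v where v: "mono v" "!!u. pts u ==> \<bar>h u\<bar> <= v (total u)" "!!n. 0 <= v n" by (rule tame_bound[OF assms(2)]) blast
 show ?thesis
 proof (rule tameI)
  show "conv g h : BM PM" using assms by (intro conv_measurable tame_measurable)
  fix u assume u: "pts u"
  have "\<bar>g e\<bar> <= w (total u)" "\<bar>h e\<bar> <= v (total u)" if "e \<subseteq># u" for e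
  proof -
   have "pts e" using set_mset_mono[OF that] u by blast
   moreover have "total e <= total u" using that by (auto simp: total_def mset_subset_eq_exists_conv)
   ultimately show "\<bar>g e\<bar> <= w (total u)" "\<bar>h e\<bar> <= v (total u)" using w(2)[of e] v(2)[of e] monoD[OF w(1)] monoD[OF v(1)] order_trans by blast+
  qed
  then have "\<bar>conv g h u\<bar> <= w (total u) * v (total u) * 2 ^ size u" by (rule conv_abs_le_power)
  also have "\<dots> <= w (total u) * v (total u) * 2 ^ total u" using size_le_total[OF u] w(3) v(3) by (intro mult_left_mono power_increasing mult_nonneg_nonneg) auto
  finally show "\<bar>conv g h u\<bar> <= (%n. w n * v n * 2 ^ n) (total u)" .
 qed
qed

lemma add_mset_space: "y : A ==> pts v ==> pts (add_mset y v)" by simp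

lemma add_measurable:
 assumes "pts v"
 shows "(%z. add_mset z v) : PA ->M PM" using mcomp[OF measurable_Pair2'[of v PM PA] add_mset_measurable] assms by simp

lemma J_integrable:
 assumes "tame h" "a : A" "b : A" "pts v"
 shows "integrable (J a b) (%z. h (add_mset z v))"
proof -
 interpret prob_space "J a b" by (rule J_prob[OF assms(2,3)])
 obtain w where w: "!!u. pts u ==> \<bar>h u\<bar> <= w (total u)" by (rule tame_bound[OF assms(1)]) blast
 show ?thesis
 proof (rule integrable_const_bound)
  show "AE z in J a b. norm (h (add_mset z v)) <= w (mass a + mass b + total v)" using J_mass[OF assms(2,3)] AE_space
  proof eventually_elim
   case (elim z)
   then have "pts (add_mset z v)" using assms J_space by auto
   from w[OF this] show ?case using elim by simp
  qed
  have "(%z. h (add_mset z v)) : BM PA" by (rule mcomp[OF add_measurable[OF assms(4)] tame_measurable[OF assms(1)]])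
  then show "(%z. h (add_mset z v)) : BM (J a b)" using J_sets[OF assms(2,3)] by (simp cong: measurable_cong_sets)
 qed
qed

definition jint :: "('a multiset => real) => 'a => 'a => 'a multiset => real" where
 "jint h a b v = (LINT z|(J a b). h (add_mset z v))"

lemma pair_sum_measurable:
 assumes "(%(a, b, v). D a b v) : BM (PA <*> (PA <*> PM))"
 shows "pair_sum D : BM PM" unfolding pair_sum_def[abs_def] by (intro borel_measurable_times sub_sum_measurable1 sub_sum_measurable assms) simp

lemma jint_measurable:
 assumes "h : BM PM"
 shows "(%(a, b, v). jint h a b v) : BM (PA <*> (PA <*> PM))"
proof -
 let ?M = "PA <*> (PA <*> PM)"
 have "(%p. (snd p, snd (snd (fst p)))) : ?M <*> PA ->M PA <*> PM" by measurable
 from mcomp[OF mcomp[OF this add_mset_measurable] assms]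
 have 1: "(%(p, z). h (add_mset z (snd (snd p)))) : BM (?M <*> PA)" by (simp add: case_prod_beta')
 have "(%p. (fst p, fst (snd p))) : ?M ->M PA <*> PA" by measurable
 from measurable_prob_algebraD[OF mcomp[OF this J_measurable]]
 have 2: "(%p. J (fst p) (fst (snd p))) : ?M ->M subprob_algebra PA" by simp
 show ?thesis using integral_measurable_subprob_algebra2[OF 1 2] by (simp add: jint_def case_prod_beta')
qed

text \<open>The argument \<open>u\<close> has one particle more than the configurations on which
  \<open>h\<close> is evaluated: the pair is replaced by its merger in the gain, and by one of its
  members in the two losses. A loss term with both members present is missing; it is of lower order
  in N and enters through \<open>V\<close> in \<open>generator_conv\<close>.\<close>

definition L :: "('a multiset => real) => 'a multiset => real" where
 "L h = pair_sum (%a b v. K a b * (jint h a b v - h (add_mset a v) - h (add_mset b v)))"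

definition Lplus :: "('a multiset => real) => 'a multiset => real" where
 "Lplus h = pair_sum (%a b v. K a b * jint h a b v)"

definition V :: "'a multiset => real" where
 "V = pair_sum (%a b v. K a b)"

lemma K_measurable3: "(%(a, b, v). K a b) : BM (PA <*> (PA <*> PM))"
proof -
 have "(%p. (fst p, fst (snd p))) : PA <*> (PA <*> PM) ->M PA <*> PA" by measurable
 from mcomp[OF this K_measurable] show ?thesis by (simp add: case_prod_beta')
qed

lemma add_measurable3:
 assumes "h : BM PM"
 shows "(%(a, b, v). h (add_mset a v)) : BM (PA <*> (PA <*> PM))"
  "(%(a, b, v). h (add_mset b v)) : BM (PA <*> (PA <*> PM))"
proof -
 have "(%p. (fst p, snd (snd p))) : PA <*> (PA <*> PM) ->M PA <*> PM" by measurable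
 from mcomp[OF mcomp[OF this add_mset_measurable] assms]
 show "(%(a, b, v). h (add_mset a v)) : BM (PA <*> (PA <*> PM))" by (simp add: case_prod_beta')
 from mcomp[OF mcomp[OF measurable_snd add_mset_measurable] assms]
 show "(%(a, b, v). h (add_mset b v)) : BM (PA <*> (PA <*> PM))" by (simp add: case_prod_beta')
qed

lemma L_measurable: "h : BM PM ==> L h : BM PM" unfolding L_def using K_measurable3 jint_measurable[of h] add_measurable3[of h] by (intro pair_sum_measurable) (simp add: case_prod_beta')

lemma Lplus_measurable: "h : BM PM ==> Lplus h : BM PM" unfolding Lplus_def using K_measurable3 jint_measurable[of h] by (intro pair_sum_measurable) (simp add: case_prod_beta')

lemma V_measurable: "V : BM PM" unfolding V_def by (rule pair_sum_measurable[OF K_measurable3])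

lemma V_bounds:
 assumes "pts u"
 shows "0 <= V u" "V u <= H / 2 * (real (total u))\<^sup>2"
proof -
 have sub: "a : A" "b : A" if "add_mset a (add_mset b v) = u" for a b v using assms that by auto
 show "0 <= V u" unfolding V_def using sub K_nonneg by (intro pair_sum_nonneg) blast
 have "V u <= pair_sum (%a b v. H * (real (mass a) * real (mass b))) u" unfolding V_def using sub K_le by (intro pair_sum_mono) blast
 also have "\<dots> = H * pair_sum (%a b v. real (mass a) * real (mass b)) u" by (rule pair_sum_cmult)
 also have "\<dots> <= H * ((\<Sum>y\<in>#u. real (mass y))\<^sup>2 / 2)" using H_nonneg by (intro mult_left_mono pair_sum_prod_le) auto
 also have "(\<Sum>y\<in>#u. real (mass y)) = real (total u)" by (simp add: total_def of_nat_sum_mset image_mset.compositionality o_def)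
 finally show "V u <= H / 2 * (real (total u))\<^sup>2" by simp
qed

lemma jint_bound:
 assumes "a : A" "b : A" "pts v" "tame h"
  and h: "!!z. z : A ==> mass z = mass a + mass b ==> \<bar>h (add_mset z v)\<bar> <= c"
 shows "\<bar>jint h a b v\<bar> <= c"
proof -
 interpret prob_space "J a b" by (rule J_prob[OF assms(1,2)])
 have i: "integrable (J a b) (%z. h (add_mset z v))" by (rule J_integrable[OF assms(4,1,2,3)])
 have "\<bar>jint h a b v\<bar> <= (LINT z|(J a b). \<bar>h (add_mset z v)\<bar>)" unfolding jint_def by (rule integral_abs_bound)
 also have "\<dots> <= (LINT z|(J a b). c)"
 proof (rule integral_mono_AE)
  show "AE z in J a b. \<bar>h (add_mset z v)\<bar> <= c" using J_mass[OF assms(1,2)] AE_space by eventually_elim (use h J_space[OF assms(1,2)] in auto)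
 qed (use i in auto)
 finally show ?thesis by (simp add: prob_space)
qed

lemma tame_L:
 assumes "tame h"
 shows "tame (L h)"
proof -
 obtain w where w: "mono w" "!!u. pts u ==> \<bar>h u\<bar> <= w (total u)" "!!n. 0 <= w n" by (rule tame_bound[OF assms]) blast
 show ?thesis
 proof (rule tameI)
  show "L h : BM PM" by (rule L_measurable[OF tame_measurable[OF assms]])
  fix u assume u: "pts u"
  have "\<bar>L h u\<bar> <= pair_sum (%a b v. 3 * w (total u) * K a b) u" unfolding L_def
  proof (rule pair_sum_abs_le)
   fix a b v assume eq: "add_mset a (add_mset b v) = u"
   then have ab: "a : A" "b : A" "pts v" using u by auto
   have t: "total u = mass a + mass b + total v" using eq by auto
   have "\<bar>jint h a b v\<bar> <= w (total u)"
   proof (rule jint_bound[OF ab assms])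
    fix z assume "z : A" "mass z = mass a + mass b"
    then show "\<bar>h (add_mset z v)\<bar> <= w (total u)" using w(2)[of "add_mset z v"] ab t by simp
   qed
   moreover have "\<bar>h (add_mset c v)\<bar> <= w (total u)" if "c = a | c = b" for c
   proof -
    have "\<bar>h (add_mset c v)\<bar> <= w (total (add_mset c v))" using w(2)[of "add_mset c v"] ab that by auto
    also have "\<dots> <= w (total u)" using w(1) t that by (intro monoD[OF w(1)]) auto
    finally show ?thesis .
   qed
   ultimately have "\<bar>jint h a b v - h (add_mset a v) - h (add_mset b v)\<bar> <= 3 * w (total u)" by (smt (verit, best))
   then show "\<bar>K a b * (jint h a b v - h (add_mset a v) - h (add_mset b v))\<bar> <= 3 * w (total u) * K a b" using K_nonneg[OF ab(1,2)] by (simp add: abs_mult mult.commute mult_left_mono)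
  qed
  also have "\<dots> = 3 * w (total u) * V u" unfolding V_def by (rule pair_sum_cmult)
  also have "\<dots> <= 3 * w (total u) * (H / 2 * (real (total u))\<^sup>2)" using V_bounds[OF u] w(3) by (intro mult_left_mono) auto
  finally show "\<bar>L h u\<bar> <= (%n. 3 * w n * (H / 2 * (real n)\<^sup>2)) (total u)" .
 qed
qed

lemma tame_V: "tame V" by (rule tameI[OF V_measurable, of "%n. H / 2 * (real n)\<^sup>2"]) (use V_bounds in auto)

text \<open>This family is closed under \<open>L\<close> up to constants: summing mass a + mass b
  over the pairs of k+1 particles gives k times the total mass, which turns (k-1)! into k! and
  raises both indices by one.\<close>

definition W :: "nat => nat => 'a multiset => real" where
 "W k i u = (if size u = k then fact (k - 1) * mprod u * real (total u) ^ i else 0)"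

lemma W_nonneg: "0 <= W k i u" by (simp add: W_def mprod_nonneg)

lemma total_measurable: "(%u. real (total u)) : BM PM"
 and mprod_measurable: "mprod : BM PM"
proof -
 have sum: "(%u. \<Sum>y\<in>#u. f (mass y)) : BM PM" for f :: "nat => real" by (rule sum_measurable[OF mcomp[OF mass_measurable]]) simp
 show "(%u. real (total u)) : BM PM" using sum[of real] by (simp add: total_def of_nat_sum_mset image_mset.compositionality o_def)
 have "(%u. exp (\<Sum>y\<in>#u. ln (real (mass y)))) : BM PM" using sum[of "%n. ln (real n)"] by simp
 then show "mprod : BM PM"
 proof (rule measurable_cong[THEN iffD1, rotated])
  fix u assume "u : space PM"
  then have "pts u" by simp
  then show "exp (\<Sum>y\<in>#u. ln (real (mass y))) = mprod u"
  proof (induction u)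
   case (add x u)
   then have "0 < real (mass x)" using mass_pos[of x] by auto
   then show ?case using add by (simp add: exp_add)
  qed simp
 qed
qed

lemma tame_W: "tame (W k i)"
proof (rule tameI)
 have "(%u. of_bool (size u = k) * (fact (k - 1) * mprod u * real (total u) ^ i)) : BM PM" using mprod_measurable total_measurable
  by (intro borel_measurable_times borel_measurable_power mcomp[OF size_measurable]) auto
 moreover have "W k i = (%u. of_bool (size u = k) * (fact (k - 1) * mprod u * real (total u) ^ i))" by (auto simp: W_def)
 ultimately show "W k i : BM PM" by simp
 show "\<bar>W k i u\<bar> <= (%n. fact (k - 1) * 2 ^ n * real n ^ i) (total u)" if "pts u" for u using mprod_le[of u] mprod_nonneg[of u] by (auto simp: W_def intro!: mult_right_mono)
qed

text \<open>The bound on \<open>K a b\<close> supplies the masses of \<open>a\<close> and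
  \<open>b\<close> missing from the product over the shortened configuration, while the particle
  \<open>x\<close> put in their place contributes its own mass. Here \<open>x\<close> may be the
  merged particle or one of the pair.\<close>

lemma W_jump_weight:
 assumes u: "pts u" and eq: "add_mset a (add_mset b v) = u" and k: "1 <= k"
  and c: "0 <= c" and x: "mass x <= mass a + mass b"
 shows "K a b * (c * W k i (add_mset x v)) \<le>
  (if size u = Suc k then H * c * fact (k - 1) * mprod u * real (total u) ^ i * real (mass x) else 0)"
proof (cases "size u = Suc k")
 case True
 have ab: "a : A" "b : A" "pts v" using u eq by auto
 have m: "mprod u = real (mass a) * real (mass b) * mprod v" using eq by auto
 have t: "total u = mass a + mass b + total v" using eq by auto
 have W: "W k i (add_mset x v) = fact (k - 1) * (real (mass x) * mprod v) * real (mass x + total v) ^ i" using True eq by (auto simp: W_def)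
 have "W k i (add_mset x v) <= fact (k - 1) * (real (mass x) * mprod v) * real (total u) ^ i" unfolding W using x t mprod_nonneg[of v] by (intro mult_left_mono power_mono) auto
 then have "K a b * (c * W k i (add_mset x v)) \<le>
   (H * (real (mass a) * real (mass b))) * (c * (fact (k - 1) * (real (mass x) * mprod v) * real (total u) ^ i))" using K_le[OF ab(1,2)] K_nonneg[OF ab(1,2)] c W_nonneg[of k i "add_mset x v"] H_nonneg
  by (intro mult_mono mult_left_mono mult_nonneg_nonneg) auto
 also have "\<dots> = H * c * fact (k - 1) * mprod u * real (total u) ^ i * real (mass x)" unfolding m by (simp add: ac_simps)
 finally show ?thesis using True by simp
next
 case False
 then have "W k i (add_mset x v) = 0" using eq k by (auto simp: W_def)
 then show ?thesis using False by simp
qed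

lemma pair_sum_W:
 assumes k: "1 <= k"
 shows "pair_sum (%a b v. if size u = Suc k then c * fact (k - 1) * mprod u * real (total u) ^ i * (real (mass a) + real (mass b)) else 0) u =
  c * W (Suc k) (Suc i) u"
proof (cases "size u = Suc k")
 case True
 have "fact k = real k * (fact (k - 1) :: real)" using k by (simp add: fact_reduce)
 moreover have "(\<Sum>y\<in>#u. real (mass y)) = real (total u)" by (simp add: total_def of_nat_sum_mset image_mset.compositionality o_def)
 ultimately show ?thesis using True by (simp add: pair_sum_cmult pair_sum_mass W_def)
next
 case False
 then show ?thesis by (simp add: pair_sum_zero W_def)
qed

text \<open>\<open>W\<close> depends on the merged particle only through its mass, so one particle
  of this mass suffices to express bounds on averages over \<open>J a b\<close>.\<close>

lemma J_mass_ex: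
 assumes "a : A" "b : A"
 obtains x where "mass x = mass a + mass b"
proof -
 interpret prob_space "J a b" by (rule J_prob[OF assms])
 have "EX x. mass x = mass a + mass b"
 proof (rule ccontr)
  assume no: "\<nexists>x. mass x = mass a + mass b"
  have "AE z in J a b. False" using J_mass[OF assms] by eventually_elim (use no in blast)
  then show False by simp
 qed
 then show ?thesis using that by blast
qed

lemma jint_W_bound:
 assumes "a : A" "b : A" "pts v" and x: "mass x = mass a + mass b"
  and h: "tame h" "!!u. pts u ==> \<bar>h u\<bar> <= c * W k i u"
 shows "\<bar>jint h a b v\<bar> <= c * W k i (add_mset x v)"
proof (rule jint_bound[OF assms(1-3) h(1)])
 fix z assume z: "z : A" "mass z = mass a + mass b"
 have "W k i (add_mset z v) = W k i (add_mset x v)" using z x by (simp add: W_def)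
 then show "\<bar>h (add_mset z v)\<bar> <= c * W k i (add_mset x v)" using h(2)[of "add_mset z v"] assms(3) z by simp
qed

lemma Lplus_W:
 assumes u: "pts u" and k: "1 <= k"
 shows "Lplus (W k i) u <= H * W (Suc k) (Suc i) u"
proof -
 have "Lplus (W k i) u <= pair_sum (%a b v. if size u = Suc k then H * fact (k - 1) * mprod u * real (total u) ^ i * (real (mass a) + real (mass b)) else 0) u" unfolding Lplus_def
 proof (rule pair_sum_mono)
  fix a b v assume eq: "add_mset a (add_mset b v) = u"
  then have ab: "a : A" "b : A" "pts v" using u by auto
  obtain x where x1: "mass x = mass a + mass b" by (rule J_mass_ex[OF ab(1,2)])
  have "\<bar>jint (W k i) a b v\<bar> <= 1 * W k i (add_mset x v)" using W_nonneg by (intro jint_W_bound[OF ab x1 tame_W]) simp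
  then have x: "mass x = mass a + mass b" "jint (W k i) a b v <= W k i (add_mset x v)" using x1 by auto
  have "K a b * jint (W k i) a b v <= K a b * (1 * W k i (add_mset x v))" using x K_nonneg[OF ab(1,2)] by (simp add: mult_left_mono)
  also have "\<dots> <= (if size u = Suc k then H * 1 * fact (k - 1) * mprod u * real (total u) ^ i * real (mass x) else 0)" using x by (intro W_jump_weight[OF u eq k]) auto
  finally show "K a b * jint (W k i) a b v <= (if size u = Suc k then H * fact (k - 1) * mprod u * real (total u) ^ i * (real (mass a) + real (mass b)) else 0)"
   unfolding x(1) by (simp only: mult_1_right of_nat_add)
 qed
 also have "\<dots> = H * W (Suc k) (Suc i) u" by (rule pair_sum_W[OF k])
 finally show ?thesis .
qed

text \<open>The gain contributes the weight mass a + mass b, and the two losses together contribute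
  it once more; hence the factor 2, against the factor 1 for the gain alone in
  \<open>Lplus_W\<close>.\<close>

lemma L_bound:
 assumes u: "pts u" and k: "1 <= k" and h: "tame h" and c: "0 <= c"
  and le: "!!u. pts u ==> \<bar>h u\<bar> <= c * W k i u"
 shows "\<bar>L h u\<bar> <= 2 * H * c * W (Suc k) (Suc i) u"
proof -
 have "\<bar>L h u\<bar> <= pair_sum (%a b v. if size u = Suc k then (2 * H * c) * fact (k - 1) * mprod u * real (total u) ^ i * (real (mass a) + real (mass b)) else 0) u" unfolding L_def
 proof (rule pair_sum_abs_le)
  fix a b v assume eq: "add_mset a (add_mset b v) = u"
  then have ab: "a : A" "b : A" "pts v" using u by auto
  obtain x where x1: "mass x = mass a + mass b" by (rule J_mass_ex[OF ab(1,2)])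
  have x: "mass x = mass a + mass b" "\<bar>jint h a b v\<bar> <= c * W k i (add_mset x v)" using jint_W_bound[OF ab x1 h le] x1 by auto
  let ?B = "%x. if size u = Suc k then H * c * fact (k - 1) * mprod u * real (total u) ^ i * real (mass x) else 0"
  have "\<bar>h (add_mset a v)\<bar> <= c * W k i (add_mset a v)" "\<bar>h (add_mset b v)\<bar> <= c * W k i (add_mset b v)" using le ab by auto
  then have "\<bar>jint h a b v - h (add_mset a v) - h (add_mset b v)\<bar> \<le>
    c * W k i (add_mset x v) + c * W k i (add_mset a v) + c * W k i (add_mset b v)" using x(2) by linarith
  then have "\<bar>K a b * (jint h a b v - h (add_mset a v) - h (add_mset b v))\<bar> \<le>
    K a b * (c * W k i (add_mset x v)) + K a b * (c * W k i (add_mset a v)) + K a b * (c * W k i (add_mset b v))" using K_nonneg[OF ab(1,2)] by (simp add: abs_mult mult_left_mono flip: distrib_left)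
  also have "\<dots> <= ?B x + ?B a + ?B b" using x(1) by (intro add_mono W_jump_weight[OF u eq k c]) auto
  also have "\<dots> = (if size u = Suc k then (2 * H * c) * fact (k - 1) * mprod u * real (total u) ^ i * (real (mass a) + real (mass b)) else 0)" using x(1) by (simp add: algebra_simps)
  finally show "\<bar>K a b * (jint h a b v - h (add_mset a v) - h (add_mset b v))\<bar> <= \<dots>" .
 qed
 also have "\<dots> = 2 * H * c * W (Suc k) (Suc i) u" by (rule pair_sum_W[OF k])
 finally show ?thesis .
qed

text \<open>\<open>L\<close> is a derivation for \<open>conv\<close>; this is what makes the limiting dynamics factorize.\<close>

lemma L_conv:
 assumes g: "tame g" and h: "tame h" and u: "pts u"
 shows "L (conv g h) u = conv (L g) h u + conv g (L h) u"
proof -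
 let ?D = "%g a b v. K a b * (jint g a b v - g (add_mset a v) - g (add_mset b v))"
 have "L (conv g h) u = pair_sum (%a b v. conv (?D g a b) h v + conv g (?D h a b) v) u" unfolding L_def
 proof (rule pair_sum_cong)
  fix a b v assume eq: "add_mset a (add_mset b v) = u"
  then have ab: "a : A" "b : A" "pts v" using u by auto
  have sub: "pts v'" if "v' \<subseteq># v" for v' using set_mset_mono[OF that] ab by auto
  have ig: "integrable (J a b) (%z. g (add_mset z v'))" "integrable (J a b) (%z. h (add_mset z v'))" if "v' \<subseteq># v" for v'
   using J_integrable[OF g ab(1,2) sub[OF that]] J_integrable[OF h ab(1,2) sub[OF that]] by auto
  \<comment> \<open>Each term of \<open>L\<close> inserts a single particle, \<open>z\<close>,
    \<open>a\<close> or \<open>b\<close>, into \<open>v\<close>, and this particle falls into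
    exactly one of the two factors. There are no mixed terms, which is the product rule.\<close>
  have "jint (conv g h) a b v = (LINT z|(J a b). conv (%v. g (add_mset z v)) h v + conv (%v. h (add_mset z v)) g v)" unfolding jint_def conv_add_mset by (simp only: conv_commute[of g])
  also have "\<dots> = conv (jint g a b) h v + conv (jint h a b) g v" using conv_integral[of v "J a b" "%z v. g (add_mset z v)" h] conv_integral[of v "J a b" "%z v. h (add_mset z v)" g] ig
   by (simp add: jint_def[abs_def])
  finally have 1: "jint (conv g h) a b v = conv (jint g a b) h v + conv (jint h a b) g v" .
  have D: "conv (?D g a b) h v = K a b * (conv (jint g a b) h v - conv (%v. g (add_mset a v)) h v - conv (%v. g (add_mset b v)) h v)" for g h unfolding conv_cmult_left conv_diff_left ..
  have c: "conv g h (add_mset x v) = conv (%v. g (add_mset x v)) h v + conv (%v. h (add_mset x v)) g v" for x unfolding conv_add_mset by (simp only: conv_commute[of g])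
  show "?D (conv g h) a b v = conv (?D g a b) h v + conv g (?D h a b) v" unfolding conv_commute[of g "?D h a b"] D 1 c by (simp add: algebra_simps)
 qed
 also have "\<dots> = conv (L g) h u + conv g (L h) u" unfolding pair_sum_add pair_sum_conv_left pair_sum_conv_right L_def ..
 finally show ?thesis .
qed

definition scaled :: "real => ('a multiset => real) => 'a multiset => real" where
 "scaled N h u = h u / N ^ size u"

lemma tame_scaled:
 assumes "1 <= N" "tame h"
 shows "tame (scaled N h)"
proof -
 obtain w where w: "!!u. pts u ==> \<bar>h u\<bar> <= w (total u)" by (rule tame_bound[OF assms(2)]) blast
 show ?thesis
 proof (rule tameI)
  have "(%u. N ^ size u) : BM PM" by (rule mcomp[OF size_measurable]) simp
  then show "scaled N h : BM PM" unfolding scaled_def[abs_def] using tame_measurable[OF assms(2)] by simp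
  fix u assume u: "pts u"
  have "1 <= N ^ size u" using assms(1) by (rule one_le_power)
  then have "\<bar>scaled N h u\<bar> <= \<bar>h u\<bar>" unfolding scaled_def by (simp add: divide_le_eq mult_le_cancel_left1)
  then show "\<bar>scaled N h u\<bar> <= w (total u)" using w[OF u] by linarith
 qed
qed

text \<open>Sub-configurations that avoid the pair and its merger cancel. Those containing the
  merged particle give the gain, those containing exactly one of \<open>a\<close>, \<open>b\<close>
  give the losses, and those containing both give a loss of one particle more, hence with an
  additional factor 1/N. The rate K/N supplies the power of N that makes the first three match the
  size of the configuration.\<close>

lemma generator_conv:
 assumes N: "1 <= N" and h: "tame h" and u: "pts u"
 shows "pair_sum (%a b v. K a b / N * (jint (conv (scaled N h) (%_. 1)) a b v - conv (scaled N h) (%_. 1) (add_mset a (add_mset b v)))) u =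
  conv (scaled N (%\<eta>. L h \<eta> - V \<eta> * h \<eta> / N)) (%_. 1) u"
proof -
 let ?h = "scaled N h"
 let ?D = "%a b v. K a b / N * (jint ?h a b v - ?h (add_mset a v) - ?h (add_mset b v) - ?h (add_mset a (add_mset b v)))"
 have th: "tame ?h" by (rule tame_scaled[OF N h])
 have "pair_sum (%a b v. K a b / N * (jint (conv ?h (%_. 1)) a b v - conv ?h (%_. 1) (add_mset a (add_mset b v)))) u =
   pair_sum (%a b. conv (?D a b) (%_. 1)) u"
 proof (rule pair_sum_cong)
  fix a b v assume eq: "add_mset a (add_mset b v) = u"
  then have ab: "a : A" "b : A" "pts v" using u by auto
  interpret prob_space "J a b" by (rule J_prob[OF ab(1,2)])
  have sub: "pts v'" if "v' \<subseteq># v" for v' using set_mset_mono[OF that] ab by auto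
  have ig: "integrable (J a b) (%z. ?h (add_mset z v'))" if "v' \<subseteq># v" for v' using J_integrable[OF th ab(1,2) sub[OF that]] .
  have "jint (conv ?h (%_. 1)) a b v = conv (jint ?h a b) (%_. 1) v + conv ?h (%_. 1) v" unfolding jint_def[of "conv _ _"] conv_add_mset
   using conv_integral[of v "J a b" "%z v. ?h (add_mset z v)" "%_. 1"] ig by (simp add: jint_def[abs_def] prob_space)
  moreover have "conv ?h (%_. 1) (add_mset a (add_mset b v)) = conv (%v. ?h (add_mset a (add_mset b v))) (%_. 1) v +
    conv (%v. ?h (add_mset a v)) (%_. 1) v + conv (%v. ?h (add_mset b v)) (%_. 1) v + conv ?h (%_. 1) v" by (simp add: conv_add_mset add_mset_commute)
  ultimately show "K a b / N * (jint (conv ?h (%_. 1)) a b v - conv ?h (%_. 1) (add_mset a (add_mset b v))) = conv (?D a b) (%_. 1) v" unfolding conv_cmult_left conv_diff_left by simp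
 qed
 also have "\<dots> = conv (pair_sum ?D) (%_. 1) u" by (rule pair_sum_conv_left)
 also have "\<dots> = conv (scaled N (%\<eta>. L h \<eta> - V \<eta> * h \<eta> / N)) (%_. 1) u"
 proof (rule conv_cong)
  fix \<eta> assume "\<eta> \<subseteq># u"
  have "pair_sum ?D \<eta> = pair_sum (%a b v. 1 / N ^ size \<eta> * (K a b * (jint h a b v - h (add_mset a v) - h (add_mset b v)) - h \<eta> / N * K a b)) \<eta>"
  proof (rule pair_sum_cong)
   fix a b v assume eq: "add_mset a (add_mset b v) = \<eta>"
   have s: "size \<eta> = Suc (Suc (size v))" using eq by auto
   have "jint ?h a b v = jint h a b v / N ^ Suc (size v)" by (simp add: jint_def scaled_def)
   then show "?D a b v = 1 / N ^ size \<eta> * (K a b * (jint h a b v - h (add_mset a v) - h (add_mset b v)) - h \<eta> / N * K a b)" using N unfolding s eq by (simp add: scaled_def s field_simps)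
  qed
  also have "\<dots> = scaled N (%\<eta>. L h \<eta> - V \<eta> * h \<eta> / N) \<eta>" unfolding pair_sum_cmult pair_sum_diff scaled_def L_def V_def by (simp add: field_simps)
  finally show "pair_sum ?D \<eta> = scaled N (%\<eta>. L h \<eta> - V \<eta> * h \<eta> / N) \<eta>" .
 qed simp
 finally show ?thesis .
qed

end

section \<open>Poisson point processes and Mecke's formula\<close>

lemma poisson_point_process_image:
 assumes Om: "prob_space Om" and p: "poisson_point_process \<nu> Om k" and f: "f : \<nu> ->M M"
 shows "poisson_point_process (distr \<nu> M f) Om (%w. image_mset f (k w))"
proof -
 have sp: "set_mset (k w) \<subseteq> space \<nu>" if "w : space Om" for w using p that unfolding poisson_point_process_def by blast
 have cnt: "size (filter_mset (%x. x : B) (image_mset f (k w))) = size (filter_mset (%x. x : f -` B \<inter> space \<nu>) (k w))"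
  if "w : space Om" for w B
 proof -
  have "size (filter_mset (%x. x : B) (image_mset f u)) = size (filter_mset (%x. x : f -` B \<inter> space \<nu>) u)"
   if "set_mset u \<subseteq> space \<nu>" for u using that by (induction u) auto
  then show ?thesis using sp[OF that] by blast
 qed
 show ?thesis unfolding poisson_point_process_def
 proof (intro conjI ballI allI impI)
  show "set_mset (image_mset f (k w)) \<subseteq> space (distr \<nu> M f)" if "w : space Om" for w using sp[OF that] measurable_space[OF f] by auto
  show "measure Om {w : space Om. size (filter_mset (%x. x : B) (image_mset f (k w))) = n} =
    measure (distr \<nu> M f) B ^ n / fact n * exp (- measure (distr \<nu> M f) B)" if B: "B : sets (distr \<nu> M f)" for B n
  proof -
   have Bs: "f -` B \<inter> space \<nu> : sets \<nu>" using B f by (auto intro: measurable_sets)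
   have "{w : space Om. size (filter_mset (%x. x : B) (image_mset f (k w))) = n} =
     {w : space Om. size (filter_mset (%x. x : f -` B \<inter> space \<nu>) (k w)) = n}" using cnt by auto
   moreover have "measure Om {w : space Om. size (filter_mset (%x. x : f -` B \<inter> space \<nu>) (k w)) = n} =
     measure \<nu> (f -` B \<inter> space \<nu>) ^ n / fact n * exp (- measure \<nu> (f -` B \<inter> space \<nu>))" using p Bs unfolding poisson_point_process_def by blast
   moreover have "measure (distr \<nu> M f) B = measure \<nu> (f -` B \<inter> space \<nu>)" using B f by (intro measure_distr) simp_all
   ultimately show ?thesis by (simp only:)
  qed
  fix n and B :: "nat => _" assume B: "B ` {..<n} \<subseteq> sets (distr \<nu> M f)" "disjoint_family_on B {..<n}"
  let ?B = "%i. f -` B i \<inter> space \<nu>"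
  have "?B ` {..<n} \<subseteq> sets \<nu>" using B(1) f by (auto intro: measurable_sets)
  moreover have "disjoint_family_on ?B {..<n}" using B(2) by (auto simp: disjoint_family_on_def)
  ultimately have ind: "prob_space.indep_vars Om (%_. CSU) (%i w. size (filter_mset (%x. x : ?B i) (k w))) {..<n}" using p unfolding poisson_point_process_def by blast
  show "prob_space.indep_vars Om (%_. CSU) (%i w. size (filter_mset (%x. x : B i) (image_mset f (k w)))) {..<n}"
  proof -
   have "(%w. size (filter_mset (%x. x : B i) (image_mset f (k w)))) -` S \<inter> space Om =
     (%w. size (filter_mset (%x. x : ?B i) (k w))) -` S \<inter> space Om" for i S using cnt by auto
   moreover have "(%w. size (filter_mset (%x. x : B i) (image_mset f (k w)))) : Om ->M CSU <->
     (%w. size (filter_mset (%x. x : ?B i) (k w))) : Om ->M CSU" for i by (intro measurable_cong cnt)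
   ultimately show ?thesis using ind unfolding prob_space.indep_vars_def2[OF Om] by simp
  qed
 qed
qed

text \<open>Countable additivity on sets is monotone continuity applied to partial sums of
  indicators; then \<open>nn_functional_eqI\<close> identifies the functional with the
  integral.\<close>

lemma nn_functional_measure:
 assumes \<Phi>: "nn_functional E \<Phi>"
 obtains M where "sets M = sets E" "!!F. F : BM E ==> (NN x|M. F x) = \<Phi> F"
proof
 define M where "M = measure_of (space E) (sets E) (%B. \<Phi> (ind B))"
 show s: "sets M = sets E" by (simp add: M_def)
 have sp: "space M = space E" using s by (rule sets_eq_imp_space_eq)
 have zero: "\<Phi> (%_. 0) = 0" using nn_functionalD(2)[OF \<Phi>, of "%_. 0" 0] by simp
 have ind: "ind {} = (%_. 0 :: ennreal)" by (simp add: fun_eq_iff)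
 have em: "emeasure M B = \<Phi> (ind B)" if B: "B : sets E" for B
 proof (rule emeasure_measure_of[OF M_def])
  show "positive (sets M) (%B. \<Phi> (ind B))" by (simp add: positive_def ind zero)
  show "countably_additive (sets M) (%B. \<Phi> (ind B))"
  proof (rule countably_additiveI)
   fix B :: "nat => 'a set" assume B: "range B \<subseteq> sets M" "disjoint_family B"
   have m: "(%y. \<Sum>i<n. ind (B i) y :: ennreal) : BM E" for n using B(1) s by (intro borel_measurable_sum) auto
   have sum: "\<Phi> (%y. \<Sum>i<n. ind (B i) y) = (\<Sum>i<n. \<Phi> (ind (B i)))" for n
   proof (induction n)
    case (Suc n)
    then show ?case using nn_functionalD(3)[OF \<Phi> m, of "ind (B n)" n] B(1) s by (auto simp: add.commute)
   qed (use zero in simp)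
   have "\<Phi> (ind (\<Union>i. B i)) = \<Phi> (%y. SUP n. \<Sum>i<n. ind (B i) y)" using suminf_indicator[OF B(2)] by (simp add: suminf_eq_SUP[symmetric])
   also have "\<dots> = (SUP n. \<Phi> (%y. \<Sum>i<n. ind (B i) y))" by (rule nn_functionalD(4)[OF \<Phi> m]) (auto intro!: incseq_SucI simp: le_fun_def)
   finally show "(\<Sum>i. \<Phi> (ind (B i))) = \<Phi> (ind (\<Union>(range B)))" unfolding sum by (simp add: suminf_eq_SUP)
  qed
 qed (use B s sets.space_closed in auto)
 have "nn_functional E (%F. NN x|M. F x)" by (rule nn_functional_integral) (use s sp in \<open>auto intro: nn_functional_eval simp: measurable_cong_sets[OF s refl]\<close>)
 then show "(NN x|M. F x) = \<Phi> F" if "F : BM E" for F using nn_functional_eqI[of E "integral\<^sup>N M" \<Phi> F] \<Phi> that by (simp add: em s)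
qed

context bump_space
begin

text \<open>The information of level \<open>r\<close> on a marked particle and the remaining
  configuration. It takes countably many values, a finer key determines a coarser one, and the
  resulting sets generate the product \<sigma>-algebra, so that two finite measures can be compared
  key by key.\<close>

definition key :: "nat => 'a \<times> 'a multiset => nat \<times> nat multiset" where
 "key r p = (code r (fst p), image_mset (code r) (snd p))"

definition key_sets :: "('a \<times> 'a multiset) set set" where
 "key_sets = range (%(r, T). {p : A \<times> {u. pts u}. key r p : T})"

lemma key_setsI: "{p : A \<times> {u. pts u}. key r p : T} : key_sets" unfolding key_sets_def by (rule range_eqI[of _ _ "(r, T)"]) simp

lemma key_measurable: "key r : PA <*> PM ->M CSU"
proof -
 have "(%p. (code r (fst p), image_mset (code r) (snd p))) : PA <*> PM ->M CSU <*> CSU" by measurable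
 then show ?thesis by (simp add: key_def[abs_def] pair_measure_countable countable_multisets)
qed

lemma Int_stable_key_sets: "Int_stable key_sets"
proof (rule Int_stableI)
 have le: "{p : S. key r p : T} \<inter> {p : S. key s p : U} : key_sets"
  if "r <= s" and S: "S = A \<times> {u. pts u}" for r s T U S
 proof -
  have "key r p = map_prod (%c. c div 2 ^ (s - r)) (image_mset (%c. c div 2 ^ (s - r))) (key s p)" for p by (simp add: key_def multiset.map_comp o_def code_div[OF that(1)])
  then have "{p : S. key r p : T} \<inter> {p : S. key s p : U} =
    {p : S. key s p : {q : U. map_prod (%c. c div 2 ^ (s - r)) (image_mset (%c. c div 2 ^ (s - r))) q : T}}" by auto
  then show ?thesis unfolding S by (simp only: key_setsI)
 qed
 fix a b assume "a : key_sets" "b : key_sets"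
 then obtain r s T U where ab: "a = {p : A \<times> {u. pts u}. key r p : T}" "b = {p : A \<times> {u. pts u}. key s p : U}" by (auto simp: key_sets_def)
 then show "a \<inter> b : key_sets" using le[of r s] le[of s r] by (cases "r <= s") (simp_all add: Int_commute)
qed

lemma sets_key_sets: "sets (PA <*> PM) = sigma_sets (A \<times> {u. pts u}) key_sets"
proof
 let ?S = "A \<times> {u. pts u}"
 let ?M = "sigma ?S key_sets"
 have sub: "key_sets \<subseteq> Pow ?S" by (auto simp: key_sets_def)
 have sp: "space ?M = ?S" and se: "sets ?M = sigma_sets ?S key_sets" using sub by (simp_all add: space_measure_of sets_measure_of)
 have key: "(%p. f (key r p)) : ?M ->M CSU" for r and f :: "_ => 'c"
 proof (rule measurableI)
  fix T
  have "(%p. f (key r p)) -` T \<inter> space ?M = {p : ?S. key r p : f -` T}" unfolding sp by auto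
  then show "(%p. f (key r p)) -` T \<inter> space ?M : sets ?M" by (simp only: se sigma_sets.Basic[OF key_setsI])
 qed simp
 have "(%p. (fst p, snd p)) : ?M ->M PA <*> PM" using key[of fst] key[of snd] by (intro measurable_Pair measurable_PA measurable_PM) (auto simp: sp key_def)
 from measurable_sets[OF this] show "sets (PA <*> PM) \<subseteq> sigma_sets ?S key_sets" using sets.sets_into_space[of _ "PA <*> PM"] by (fastforce simp: sp se space_pair_measure Int_absorb2)
 have "{p : ?S. key r p : T} : sets (PA <*> PM)" for r T using measurable_sets[OF key_measurable, of T r] by (rule back_subst[where P = "%S. S : sets (PA <*> PM)"]) (auto simp: space_pair_measure)
 then show "sigma_sets ?S key_sets \<subseteq> sets (PA <*> PM)" using sets.sigma_sets_subset[of key_sets "PA <*> PM"] by (force simp: key_sets_def space_pair_measure)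
qed

text \<open>If the configuration has the codes \<kappa> together with one more \<open>c\<close>,
  then exactly \<open>count \<kappa> c + 1\<close> of its particles can be marked so that the mark
  has code \<open>c\<close>.\<close>

lemma sub_sum_level:
 assumes "pts u"
 shows "sub_sum (%y v. ind {(c, \<kappa>)} (key r (y, v)) :: ennreal) u =
  of_nat (Suc (count \<kappa> c)) * ind {add_mset c \<kappa>} (image_mset (code r) u)"
proof -
 let ?im = "image_mset (code r) u"
 have "ind {(c, \<kappa>)} (key r (y, u - {#y#})) = (of_bool (code r y = c) * ind {add_mset c \<kappa>} ?im :: ennreal)" if y: "y \<in># u" for y
 proof -
  have "?im = add_mset (code r y) (image_mset (code r) (u - {#y#}))" using y by (metis image_mset_add_mset insert_DiffM)
  then show ?thesis by (auto simp: indicator_def key_def)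
 qed
 then have "sub_sum (%y v. ind {(c, \<kappa>)} (key r (y, v)) :: ennreal) u = (\<Sum>y\<in>#u. of_bool (code r y = c)) * ind {add_mset c \<kappa>} ?im"
  unfolding sub_sum_def by (simp add: sum_mset_distrib_right cong: image_mset_cong)
 also have "(\<Sum>y\<in>#u. of_bool (code r y = c)) = (of_nat (count ?im c) :: ennreal)" by (induction u) auto
 finally show ?thesis by (auto simp: indicator_def)
qed

context
 fixes Om :: "'w measure" and \<nu> :: "'a measure" and X :: "'w => 'a multiset"
 assumes Om: "prob_space Om" and \<nu>: "sets \<nu> = sets PA" "finite_measure \<nu>"
  and X: "X : Om ->M PM" and ppp: "poisson_point_process \<nu> Om X"
begin

lemma codes_prob:
 assumes \<kappa>: "set_mset \<kappa> \<subseteq> {..<2 ^ r}"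
 shows "measure Om {w : space Om. image_mset (code r) (X w) = \<kappa>} =
  (\<Prod>c<2 ^ r. measure \<nu> {y : A. code r y = c} ^ count \<kappa> c / fact (count \<kappa> c) * exp (- measure \<nu> {y : A. code r y = c}))"
proof -
 interpret prob_space Om by (rule Om)
 let ?cell = "%c. {y : A. code r y = c}"
 let ?N = "%c w. size (filter_mset (%x. x : ?cell c) (X w))"
 have cell: "?cell c : sets \<nu>" for c using \<nu>(1) cell_in_sets by simp
 have "count (image_mset (code r) u) c = size (filter_mset (%x. x : ?cell c) u)" if "pts u" for u c using that by (induction u) auto
 then have cnt: "count (image_mset (code r) (X w)) c = ?N c w" if "w : space Om" for w c using measurable_space[OF X that] by simp
 have "(%c. ?cell c) ` {..<2 ^ r} \<subseteq> sets \<nu>" "disjoint_family_on (%c. ?cell c) {..<2 ^ r}" using cell by (auto simp: disjoint_family_on_def)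
 then have ind: "indep_vars (%_. CSU) ?N {..<2 ^ r}" using ppp unfolding poisson_point_process_def by blast
 have "(image_mset (code r) (X w) = \<kappa>) = (ALL c<2 ^ r. ?N c w = count \<kappa> c)" if "w : space Om" for w
 proof -
  have "count (image_mset (code r) (X w)) c = 0 & count \<kappa> c = 0" if "\<not> c < 2 ^ r" for c using that \<kappa> code_less[of r] by (auto simp: count_eq_zero_iff subset_iff)
  then show ?thesis unfolding multiset_eq_iff cnt[OF that] by (metis cnt that)
 qed
 then have "{w : space Om. image_mset (code r) (X w) = \<kappa>} = (\<Inter>c\<in>{..<2 ^ r}. ?N c -` {count \<kappa> c} \<inter> space Om)" by (auto simp: lessThan_empty_iff)
 then have "measure Om {w : space Om. image_mset (code r) (X w) = \<kappa>} = (\<Prod>c<2 ^ r. prob (?N c -` {count \<kappa> c} \<inter> space Om))"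
  using indep_varsD[OF ind, of "{..<2 ^ r}" "%c. {count \<kappa> c}"] by (simp add: lessThan_empty_iff)
 moreover have "?N c -` {n} \<inter> space Om = {w : space Om. ?N c w = n}" for c n by auto
 moreover have "prob {w : space Om. ?N c w = n} = measure \<nu> (?cell c) ^ n / fact n * exp (- measure \<nu> (?cell c))" for c n using ppp cell[of c] unfolding poisson_point_process_def by blast
 ultimately show ?thesis by simp
qed

text \<open>Mecke's formula at the level of codes. The counts in the cells are independent, so it
  reduces to (n+1) p(n+1) = a p(n) for the Poisson weights p of parameter a. Codes outside the range
  below 2^r make both sides 0.\<close>

lemma codes_prob_Suc:
 "real (Suc (count \<kappa> c)) * measure Om {w : space Om. image_mset (code r) (X w) = add_mset c \<kappa>} =
  measure \<nu> {y : A. code r y = c} * measure Om {w : space Om. image_mset (code r) (X w) = \<kappa>}"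
proof (cases "set_mset (add_mset c \<kappa>) \<subseteq> {..<2 ^ r}")
 case True
 let ?p = "%c k. measure \<nu> {y : A. code r y = c} ^ k / fact k * exp (- measure \<nu> {y : A. code r y = c})"
 have c: "c : {..<2 ^ r}" and \<kappa>: "set_mset \<kappa> \<subseteq> {..<2 ^ r}" using True by auto
 have "(\<Prod>d<2 ^ r. ?p d (count (add_mset c \<kappa>) d)) = ?p c (Suc (count \<kappa> c)) * (\<Prod>d\<in>{..<2 ^ r} - {c}. ?p d (count \<kappa> d))"
  unfolding prod.remove[OF finite_lessThan c] by (intro arg_cong2[where f = "(*)"] prod.cong) auto
 moreover have "(\<Prod>d<2 ^ r. ?p d (count \<kappa> d)) = ?p c (count \<kappa> c) * (\<Prod>d\<in>{..<2 ^ r} - {c}. ?p d (count \<kappa> d))" by (rule prod.remove[OF finite_lessThan c])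
 moreover have "real (Suc n) * ?p c (Suc n) = measure \<nu> {y : A. code r y = c} * ?p c n" for n by (simp add: divide_simps power_Suc del: of_nat_Suc)
 ultimately show ?thesis unfolding codes_prob[OF True] codes_prob[OF \<kappa>] by (simp only: mult.assoc[symmetric])
next
 case False
 have len: "image_mset (code r) u ~= \<kappa>'" if "\<not> set_mset \<kappa>' \<subseteq> {..<2 ^ r}" for u \<kappa>' using that code_less by auto
 have "{y : A. code r y = c} = {} | {w : space Om. image_mset (code r) (X w) = \<kappa>} = {}" using False code_less len[of \<kappa>] by (cases "c < 2 ^ r") auto
 moreover have "{w : space Om. image_mset (code r) (X w) = add_mset c \<kappa>} = {}" using len[OF False] by blast
 ultimately show ?thesis by (elim disjE) (simp_all only: measure_empty mult_zero_left mult_zero_right)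
qed

text \<open>Mecke's formula.\<close>

lemma mecke:
 assumes F: "F : BM (PA <*> PM)"
 shows "(NN w|Om. sub_sum (%y v. F (y, v)) (X w)) = (NN y|\<nu>. (NN w|Om. F (y, X w)))"
proof -
 interpret prob_space Om by (rule Om)
 interpret \<nu>: finite_measure \<nu> by (rule \<nu>)
 let ?P = "PA <*> PM"
 let ?D = "distr Om PM X"
 interpret D: prob_space ?D by (rule prob_space_distr[OF X])
 have XA: "pts (X w)" if "w : space Om" for w using measurable_space[OF X that] by simp
 have "nn_functional ?P (%F. NN w|Om. sub_sum (%y v. F (y, v)) (X w))"
 proof (rule nn_functional_integral)
  show "nn_functional ?P (%F. sub_sum (%y v. F (y, v)) (X w))" if "w : space Om" for w unfolding sub_sum_def using XA[OF that]
   by (intro nn_functional_sum_mset nn_functional_eval) (auto simp: space_pair_measure dest: in_diffD)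
  show "(%w. sub_sum (%y v. F (y, v)) (X w)) : BM Om" if "F : BM ?P" for F :: "_ => ennreal" using that by (intro mcomp[OF X sub_sum_measurable1]) simp
 qed
 then obtain M where s: "sets M = sets ?P"
  and M: "!!F. F : BM ?P ==> (NN p|M. F p) = (NN w|Om. sub_sum (%y v. F (y, v)) (X w))" by (rule nn_functional_measure) blast
 have sD: "sets (\<nu> <*> ?D) = sets ?P" by (intro sets_pair_measure_cong) (simp_all add: \<nu>)
 have sp: "space M = A \<times> {u. pts u}" "space (\<nu> <*> ?D) = A \<times> {u. pts u}" using sets_eq_imp_space_eq[OF s] sets_eq_imp_space_eq[OF sD] by (simp_all add: space_pair_measure)
 have km: "key r : M ->M CSU" "key r : \<nu> <*> ?D ->M CSU" for r using key_measurable by (simp_all add: measurable_cong_sets[OF s refl] measurable_cong_sets[OF sD refl])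
 \<comment> \<open>Both measures give the same mass to each value of the key, by
   \<open>sub_sum_level\<close> on the left and \<open>codes_prob_Suc\<close> in between.\<close>
 have "distr M (CSU) (key r) = distr (\<nu> <*> ?D) (CSU) (key r)" for r
 proof (rule measure_eqI_countable[where A = UNIV])
  have "countable (UNIV \<times> UNIV :: (nat \<times> nat multiset) set)" by (intro countable_SIGMA countable_multisets) simp
  then show "countable (UNIV :: (nat \<times> nat multiset) set)" by (simp only: UNIV_Times_UNIV)
  fix q :: "nat \<times> nat multiset"
  obtain c \<kappa> where q: "q = (c, \<kappa>)" by (cases q)
  let ?C = "{y : A. code r y = c}"
  let ?E = "%\<kappa>. {w : space Om. image_mset (code r) (X w) = \<kappa>}"
  have ms: "?E \<kappa> : sets Om" for \<kappa> using measurable_sets[OF mcomp[OF X codes_measurable], of "{\<kappa>}" r] by (simp add: vimage_def Int_def conj_commute)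
  have "emeasure (distr M (CSU) (key r)) {q} = (NN p|M. ind {q} (key r p))" using nn_integral_distr[OF km(1), of "ind {q}"] by simp
  also have "\<dots> = (NN w|Om. sub_sum (%y v. ind {q} (key r (y, v))) (X w))" by (rule M) (rule mcomp[OF key_measurable], simp)
  also have "\<dots> = (NN w|Om. of_nat (Suc (count \<kappa> c)) * ind (?E (add_mset c \<kappa>)) w)" unfolding q using sub_sum_level[OF XA] by (intro NN_cong) (simp add: indicator_def)
  also have "\<dots> = ennreal (real (Suc (count \<kappa> c)) * measure Om (?E (add_mset c \<kappa>)))"
   using ms by (subst nn_integral_cmult) (auto simp: emeasure_eq_measure ennreal_of_nat_eq_real_of_nat ennreal_mult' simp del: of_nat_Suc)
  also have "\<dots> = emeasure \<nu> ?C * emeasure Om (?E \<kappa>)" unfolding codes_prob_Suc by (simp add: emeasure_eq_measure \<nu>.emeasure_eq_measure ennreal_mult')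
  also have "emeasure Om (?E \<kappa>) = emeasure ?D (image_mset (code r) -` {\<kappa>} \<inter> space PM)" using XA measurable_sets[OF codes_measurable, of "{\<kappa>}" r]
   by (subst emeasure_distr[OF X]) (auto intro!: arg_cong[where f = "emeasure Om"])
  also have "emeasure \<nu> ?C * \<dots> = emeasure (\<nu> <*> ?D) (?C \<times> (image_mset (code r) -` {\<kappa>} \<inter> space PM))"
   using cell_in_sets \<nu>(1) measurable_sets[OF codes_measurable, of "{\<kappa>}" r] by (intro D.emeasure_pair_measure_Times[symmetric]) simp_all
  also have "?C \<times> (image_mset (code r) -` {\<kappa>} \<inter> space PM) = key r -` {q} \<inter> space (\<nu> <*> ?D)" unfolding sp q key_def by auto
  finally show "emeasure (distr M (CSU) (key r)) {q} = emeasure (distr (\<nu> <*> ?D) (CSU) (key r)) {q}" using emeasure_distr[OF km(2), of "{q}"] by simp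
 qed simp_all
 then have eq: "emeasure M {p : space M. key r p : T} = emeasure (\<nu> <*> ?D) {p : space M. key r p : T}" for r T
  using emeasure_distr[OF km(1), of T] emeasure_distr[OF km(2), of T] unfolding sp by (simp add: vimage_def Int_def conj_commute)
 have "M = \<nu> <*> ?D"
 proof (rule measure_eqI_generator_eq[where E = key_sets and \<Omega> = "space M" and A = "%_. space M"])
  have "emeasure M (space M) = emeasure (\<nu> <*> ?D) (space \<nu> \<times> space ?D)" using eq[of 0 UNIV] by (simp add: sp space_pair_measure[symmetric] del: space_distr)
  also have "\<dots> = emeasure \<nu> (space \<nu>) * emeasure ?D (space ?D)" by (rule D.emeasure_pair_measure_Times) (rule sets.top)+
  also have "\<dots> < top" by (simp add: \<nu>.emeasure_eq_measure D.emeasure_space_1 del: space_distr)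
  finally show "emeasure M (space M) ~= \<infinity>" by auto
  show "range (%_::nat. space M) \<subseteq> key_sets" using key_setsI[of 0 UNIV] by (auto simp: sp)
 qed (use eq s sD sets_key_sets Int_stable_key_sets in \<open>auto simp: sp key_sets_def\<close>)
 then have "(NN w|Om. sub_sum (%y v. F (y, v)) (X w)) = (NN p|(\<nu> <*> ?D). F p)" using M[OF F] by simp
 also have "\<dots> = (NN y|\<nu>. (NN u|?D. F (y, u)))" using F by (intro D.nn_integral_fst[symmetric]) (simp add: measurable_cong_sets[OF sD refl])
 also have "\<dots> = (NN y|\<nu>. (NN w|Om. F (y, X w)))"
 proof (intro NN_cong nn_integral_distr[OF X])
  fix y assume "y : space \<nu>"
  then have "y : A" using sets_eq_imp_space_eq[OF \<nu>(1)] by simp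
  then show "(%u. F (y, u)) : BM (distr Om PM X)" using mcomp[OF measurable_Pair1'[of y PA PM] F] by simp
 qed
 finally show ?thesis .
qed

end
end

section \<open>Derivations and the factorial moments of the initial state\<close>

lemma pascal_sum:
 fixes x :: "nat => nat => real"
 shows "(\<Sum>j\<le>n. real (n choose j) * (x (Suc j) (n - j) + x j (Suc (n - j)))) = (\<Sum>j\<le>Suc n. real (Suc n choose j) * x j (Suc n - j))"
proof -
 have "(\<Sum>j\<le>n. real (n choose j) * x j (Suc (n - j))) = (\<Sum>j\<le>Suc n. real (n choose j) * x j (Suc n - j))" by (simp add: Suc_diff_le)
 also have "\<dots> = x 0 (Suc n) + (\<Sum>j\<le>n. real (n choose Suc j) * x (Suc j) (n - j))" by (simp add: sum.atMost_Suc_shift del: sum.atMost_Suc)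
 finally show ?thesis by (simp add: sum.atMost_Suc_shift distrib_left distrib_right sum.distrib del: sum.atMost_Suc)
qed

lemma sub_sum_ennreal:
 assumes g: "!!y v. 0 <= g y v"
 shows "sub_sum (%y v. ennreal (g y v)) u = ennreal (sub_sum g u)"
proof -
 have "(\<Sum>y\<in>#\<eta>. ennreal (f y)) = ennreal (\<Sum>y\<in>#\<eta>. f y) & 0 <= (\<Sum>y\<in>#\<eta>. f y)" if "!!y. 0 <= f y" for f :: "'a => real" and \<eta>
  by (induction \<eta>) (auto simp: that ennreal_plus)
 from this[of "%y. g y (u - {#y#})" u] show ?thesis by (simp add: sub_sum_def g)
qed

text \<open>A sub-configuration on which \<open>f\<close> does not vanish has \<open>k\<close>
  particles, each of which can be the marked one.\<close>

lemma sub_sum_conv_size: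
 assumes "!!\<eta>. size \<eta> ~= k ==> f \<eta> = 0"
 shows "sub_sum (%y. conv (%\<eta>. f (add_mset y \<eta>)) h) u = real k * conv f h u"
proof -
 have "sub_sum (%y \<eta>. f (add_mset y \<eta>)) \<eta> = real k * f \<eta>" for \<eta>
 proof -
  have "image_mset (%y. f (add_mset y (\<eta> - {#y#}))) \<eta> = image_mset (%y. f \<eta>) \<eta>" by (intro image_mset_cong) simp
  then have "sub_sum (%y \<eta>. f (add_mset y \<eta>)) \<eta> = real (size \<eta>) * f \<eta>" by (simp add: sub_sum_def)
  then show ?thesis using assms[of \<eta>] by (cases "size \<eta> = k") auto
 qed
 then show ?thesis unfolding sub_sum_conv_left conv_cmult_left[symmetric] by (intro conv_cong) auto
qed

context coag_kernel
begin

lemma tame_cong: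
 assumes "tame f" "!!u. pts u ==> f u = g u"
 shows "tame g"
proof -
 obtain w where w: "!!u. pts u ==> \<bar>f u\<bar> <= w (total u)" by (rule tame_bound[OF assms(1)]) blast
 show ?thesis
 proof (rule tameI)
  show "g : BM PM" by (rule measurable_cong[THEN iffD1, OF _ tame_measurable[OF assms(1)]]) (use assms(2) in simp)
  show "\<bar>g u\<bar> <= w (total u)" if "pts u" for u using w[OF that] assms(2)[OF that] by simp
 qed
qed

lemma tame_pos: "tame h ==> tame (%u. max 0 (h u))" and tame_neg: "tame h ==> tame (%u. max 0 (- h u))"
proof -
 assume h: "tame h"
 obtain w where w: "!!u. pts u ==> \<bar>h u\<bar> <= w (total u)" by (rule tame_bound[OF h]) blast
 show "tame (%u. max 0 (h u))"
 proof (rule tameI[where w = w])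
  show "\<bar>max 0 (h u)\<bar> <= w (total u)" if "pts u" for u using w[OF that] by linarith
 qed (use tame_measurable[OF h] in simp)
 show "tame (%u. max 0 (- h u))"
 proof (rule tameI[where w = w])
  show "\<bar>max 0 (- h u)\<bar> <= w (total u)" if "pts u" for u using w[OF that] by linarith
 qed (use tame_measurable[OF h] in simp)
qed

lemma tame_add_point:
 assumes "tame h" "y : A"
 shows "tame (%u. h (add_mset y u))"
proof -
 obtain w where w: "!!u. pts u ==> \<bar>h u\<bar> <= w (total u)" by (rule tame_bound[OF assms(1)]) blast
 show ?thesis
 proof (rule tameI)
  have "(%u. add_mset y u) : PM ->M PM" using mcomp[OF measurable_Pair1'[of y PA PM] add_mset_measurable] assms(2) by simp
  from mcomp[OF this tame_measurable[OF assms(1)]]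
  show "(%u. h (add_mset y u)) : BM PM" .
  show "\<bar>h (add_mset y u)\<bar> <= (%n. w (mass y + n)) (total u)" if "pts u" for u using w[of "add_mset y u"] that assms(2) by simp
 qed
qed

lemma tame_conv_one: "tame h ==> tame (conv h (%_. 1))" by (rule tame_conv[OF _ tame_const])

lemma L_cong:
 assumes "!!u. pts u ==> f u = g u" "pts u"
 shows "L f u = L g u" unfolding L_def
proof (rule pair_sum_cong)
 fix a b v assume "add_mset a (add_mset b v) = u"
 then have ab: "a : A" "b : A" "pts v" using assms(2) by auto
 then have "jint f a b v = jint g a b v" unfolding jint_def using J_space[OF ab(1,2)] by (intro LINT_cong refl assms(1)) auto
 then show "K a b * (jint f a b v - f (add_mset a v) - f (add_mset b v)) = K a b * (jint g a b v - g (add_mset a v) - g (add_mset b v))" using assms(1) ab by simp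
qed

lemma L_add:
 assumes "tame f" "tame g" "pts u"
 shows "L (%u. f u + g u) u = L f u + L g u" unfolding L_def pair_sum_add[symmetric]
proof (rule pair_sum_cong)
 fix a b v assume "add_mset a (add_mset b v) = u"
 then have ab: "a : A" "b : A" "pts v" using assms(3) by auto
 then have "jint (%u. f u + g u) a b v = jint f a b v + jint g a b v" unfolding jint_def by (intro Bochner_Integration.integral_add J_integrable assms ab)
 then show "K a b * (jint (%u. f u + g u) a b v - (f (add_mset a v) + g (add_mset a v)) - (f (add_mset b v) + g (add_mset b v))) =
   K a b * (jint f a b v - f (add_mset a v) - f (add_mset b v)) + K a b * (jint g a b v - g (add_mset a v) - g (add_mset b v))" by (simp add: algebra_simps)
qed

text \<open>Iterates of derivations of \<open>conv\<close>; used for \<open>L\<close> and for integration of one point against \<open>\<nu>\<close>.\<close>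

definition derivation :: "(('a multiset => real) => 'a multiset => real) => bool" where
 "derivation D <-> (ALL f. tame f --> tame (D f)) \<and>
   (ALL f g. (ALL u. pts u --> f u = g u) --> (ALL u. pts u --> D f u = D g u)) \<and>
   (ALL f g u. tame f --> tame g --> pts u --> D (%u. f u + g u) u = D f u + D g u) \<and>
   (ALL f g u. tame f --> tame g --> pts u --> D (conv f g) u = conv (D f) g u + conv f (D g) u)"

lemma derivation_L: "derivation L" unfolding derivation_def using tame_L L_cong L_add L_conv by blast

context
 fixes D assumes D: "derivation D"
begin

lemma derivation_tame: "tame f ==> tame ((D ^^ n) f)" using D by (induction n) (auto simp: derivation_def)

lemma derivation_cong:
 "(!!u. pts u ==> f u = g u) ==> pts u ==> (D ^^ n) f u = (D ^^ n) g u"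
proof (induction n arbitrary: u)
 case (Suc n)
 have "ALL u. pts u --> D ((D ^^ n) f) u = D ((D ^^ n) g) u" using D Suc.IH Suc.prems(1) unfolding derivation_def by presburger
 then show ?case using Suc.prems(2) by simp
qed simp

lemma derivation_add:
 "tame f ==> tame g ==> pts u ==> (D ^^ n) (%u. f u + g u) u = (D ^^ n) f u + (D ^^ n) g u"
proof (induction n arbitrary: u f g)
 case (Suc n)
 have "(D ^^ Suc n) (%u. f u + g u) u = (D ^^ n) (D (%u. f u + g u)) u" by (simp only: funpow_Suc_right comp_apply)
 also have "\<dots> = (D ^^ n) (%u. D f u + D g u) u" using D Suc.prems by (intro derivation_cong) (auto simp: derivation_def)
 also have "\<dots> = (D ^^ n) (D f) u + (D ^^ n) (D g) u" using D Suc.prems by (intro Suc.IH) (auto simp: derivation_def)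
 finally show ?case by (simp only: funpow_Suc_right comp_apply)
qed simp

lemma leibniz:
 "tame g ==> tame h ==> pts u ==>
  (D ^^ n) (conv g h) u = (\<Sum>j\<le>n. real (n choose j) * conv ((D ^^ j) g) ((D ^^ (n - j)) h) u)"
proof (induction n arbitrary: g h)
 case (Suc n)
 have t: "tame (D g)" "tame (D h)" using D Suc.prems by (auto simp: derivation_def)
 have "(D ^^ Suc n) (conv g h) u = (D ^^ n) (D (conv g h)) u" by (simp only: funpow_Suc_right comp_apply)
 also have "\<dots> = (D ^^ n) (%u. conv (D g) h u + conv g (D h) u) u" using D Suc.prems by (intro derivation_cong) (auto simp: derivation_def)
 also have "\<dots> = (D ^^ n) (conv (D g) h) u + (D ^^ n) (conv g (D h)) u" using t Suc.prems by (intro derivation_add tame_conv)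
 also have "\<dots> = (\<Sum>j\<le>n. real (n choose j) * (conv ((D ^^ Suc j) g) ((D ^^ (n - j)) h) u + conv ((D ^^ j) g) ((D ^^ Suc (n - j)) h) u))"
  unfolding Suc.IH[OF t(1) Suc.prems(2,3)] Suc.IH[OF Suc.prems(1) t(2) Suc.prems(3)] distrib_left sum.distrib by (simp only: funpow_Suc_right comp_apply)
 also have "\<dots> = (\<Sum>j\<le>Suc n. real (Suc n choose j) * conv ((D ^^ j) g) ((D ^^ (Suc n - j)) h) u)" by (rule pascal_sum[where x = "%i j. conv ((D ^^ i) g) ((D ^^ j) h) u"])
 finally show ?case .
qed simp

end

lemma scaled_size: "(!!u. size u ~= k ==> h u = 0) ==> size u ~= k ==> scaled N h u = 0" by (simp add: scaled_def)

end

locale coag_initial = coag_kernel A \<B> K J mass H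
 for A :: "'a::second_countable_topology set" and \<B> K J mass H +
 fixes \<nu> :: "'a measure"
 assumes \<nu>_prob: "prob_space \<nu>" and \<nu>_sets: "sets \<nu> = sets PA" and \<nu>_mass: "AE y in \<nu>. mass y = 1"
begin

lemma \<nu>_space: "space \<nu> = A" using sets_eq_imp_space_eq[OF \<nu>_sets] by simp

lemma tame_point_measurable:
 assumes "tame h" "pts u"
 shows "(%y. h (add_mset y u)) : BM \<nu>" using mcomp[OF add_measurable[OF assms(2)] tame_measurable[OF assms(1)]] by (simp add: measurable_cong_sets[OF \<nu>_sets refl])

lemma AE_mass_one: "AE y in \<nu>. y : A & mass y = 1" using \<nu>_mass AE_space by eventually_elim (simp add: \<nu>_space)

lemma \<nu>_integrable:
 assumes "tame h" "pts u"
 shows "integrable \<nu> (%y. h (add_mset y u))"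
proof -
 interpret prob_space \<nu> by (rule \<nu>_prob)
 obtain w where w: "!!u. pts u ==> \<bar>h u\<bar> <= w (total u)" by (rule tame_bound[OF assms(1)]) blast
 show ?thesis
 proof (rule integrable_const_bound[OF _ tame_point_measurable[OF assms]])
  show "AE y in \<nu>. norm (h (add_mset y u)) <= w (1 + total u)" using AE_mass_one
  proof eventually_elim
   case (elim y)
   then show ?case using w[of "add_mset y u"] assms(2) by simp
  qed
 qed
qed

definition U :: "('a multiset => real) => 'a multiset => real" where
 "U h u = (LINT y|\<nu>. h (add_mset y u))"

lemma U_bound:
 assumes "tame h" "pts u" "!!y. y : A ==> mass y = 1 ==> \<bar>h (add_mset y u)\<bar> <= c"
 shows "\<bar>U h u\<bar> <= c"
proof -
 interpret prob_space \<nu> by (rule \<nu>_prob)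
 have "\<bar>U h u\<bar> <= (LINT y|\<nu>. \<bar>h (add_mset y u)\<bar>)" unfolding U_def by (rule integral_abs_bound)
 also have "\<dots> <= (LINT y|\<nu>. c)"
 proof (rule integral_mono_AE)
  show "AE y in \<nu>. \<bar>h (add_mset y u)\<bar> <= c" using AE_mass_one by eventually_elim (use assms(3) in auto)
 qed (use \<nu>_integrable[OF assms(1,2)] in auto)
 finally show ?thesis by (simp add: prob_space)
qed

text \<open>The particle that is integrated out belongs to exactly one of the two factors of
  \<open>conv\<close>; compare \<open>L_conv\<close>.\<close>

lemma derivation_U: "derivation U"
proof -
 interpret prob_space \<nu> by (rule \<nu>_prob)
 have "tame (U h)" if h: "tame h" for h
 proof -
  obtain w where w: "!!u. pts u ==> \<bar>h u\<bar> <= w (total u)" by (rule tame_bound[OF h]) blast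
  show ?thesis
  proof (rule tameI)
   have "(%p. (snd p, fst p)) : PM <*> \<nu> ->M PA <*> PM" by (intro measurable_Pair measurable_fst mcomp[OF measurable_snd]) (simp add: measurable_cong_sets[OF \<nu>_sets refl])
   from mcomp[OF mcomp[OF this add_mset_measurable] tame_measurable[OF h]]
   have "(%(u, y). h (add_mset y u)) : BM (PM <*> \<nu>)" by (simp add: case_prod_beta')
   then show "U h : BM PM" unfolding U_def[abs_def] by (rule borel_measurable_lebesgue_integral)
   show "\<bar>U h u\<bar> <= (%n. w (1 + n)) (total u)" if "pts u" for u using w[of "add_mset y u" for y] that by (intro U_bound[OF h that]) (metis add_mset_space total_simps(2))
  qed
 qed
 moreover have "U f u = U g u" if "ALL u. pts u --> f u = g u" "pts u" for f g u unfolding U_def using that \<nu>_space by (intro LINT_cong) auto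
 moreover have "U (%u. f u + g u) u = U f u + U g u" if "tame f" "tame g" "pts u" for f g u unfolding U_def using that by (intro Bochner_Integration.integral_add \<nu>_integrable)
 moreover have "U (conv f g) u = conv (U f) g u + conv f (U g) u" if fg: "tame f" "tame g" and u: "pts u" for f g u
 proof -
  have sub: "pts v" if "v \<subseteq># u" for v using set_mset_mono[OF that] u by auto
  have "U (conv f g) u = (LINT y|\<nu>. conv (%v. f (add_mset y v)) g u + conv (%v. g (add_mset y v)) f u)" unfolding U_def conv_add_mset by (simp only: conv_commute[of f])
  also have "\<dots> = conv (U f) g u + conv (U g) f u" using conv_integral[of u \<nu> "%y v. f (add_mset y v)" g] conv_integral[of u \<nu> "%y v. g (add_mset y v)" f] \<nu>_integrable fg sub
   by (simp add: U_def[abs_def])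
  finally show ?thesis by (simp only: conv_commute[of f])
 qed
 ultimately show ?thesis unfolding derivation_def by blast
qed

lemma U_point: "((U ^^ k) (%\<eta>. h (add_mset y \<eta>))) u = (U ^^ k) h (add_mset y u)" by (induction k arbitrary: u) (simp_all add: U_def add_mset_commute)

lemma U_nonneg: "(!!u. 0 <= h u) ==> 0 <= (U ^^ k) h u" by (induction k arbitrary: u) (auto simp: U_def intro!: integral_nonneg_AE)

text \<open>The factorial moment measure of order \<open>k\<close> of the rescaled initial configuration is \<open>\<nu>\<^sup>k\<close>.\<close>

definition moment :: "nat => ('a multiset => real) => real" where
 "moment k h = (U ^^ k) h {#} / fact k"

lemma moment_add: "tame f ==> tame g ==> moment k (%u. f u + g u) = moment k f + moment k g" unfolding moment_def by (simp add: derivation_add[OF derivation_U] add_divide_distrib)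

lemma moment_cong: "(!!u. pts u ==> f u = g u) ==> moment k f = moment k g" unfolding moment_def by (simp add: derivation_cong[OF derivation_U, of f g])

lemma U_power_size:
 "(!!u. size u ~= k ==> h u = 0) ==> size u + j ~= k ==> (U ^^ j) h u = 0" by (induction j arbitrary: u) (auto simp: U_def)

text \<open>In the Leibniz expansion at the empty configuration only the term with \<open>k\<close>
  integrations in the first factor survives, because \<open>g\<close> and \<open>h\<close> live on a
  fixed number of particles. The binomial coefficient is absorbed by the factorials.\<close>

lemma moment_conv:
 assumes g: "tame g" "!!u. size u ~= k ==> g u = 0" and h: "tame h" "!!u. size u ~= l ==> h u = 0"
 shows "moment (k + l) (conv g h) = moment k g * moment l h"
proof -
 have "(U ^^ (k + l)) (conv g h) {#} = (\<Sum>j\<le>k + l. real (k + l choose j) * ((U ^^ j) g {#} * (U ^^ (k + l - j)) h {#}))" using leibniz[OF derivation_U g(1) h(1), of "{#}" "k + l"] by simp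
 also have "\<dots> = (\<Sum>j\<in>{k}. real (k + l choose j) * ((U ^^ j) g {#} * (U ^^ (k + l - j)) h {#}))" by (rule sum.mono_neutral_right) (auto simp: U_power_size[OF g(2)])
 finally show ?thesis by (simp add: moment_def binomial_fact field_simps)
qed

text \<open>Initial particles have mass one, so on them \<open>W k i\<close> equals (k-1)! k^i, and
  the division by k! leaves k^i / k. In the induction, \<open>total u + j\<close> is the mass after
  the \<open>j\<close> particles still to be integrated have been added.\<close>

lemma moment_bound:
 assumes h: "tame h" and k: "1 <= k" and c: "0 <= c" and le: "!!u. pts u ==> \<bar>h u\<bar> <= c * W k i u"
 shows "\<bar>moment k h\<bar> <= c * (real k ^ i / real k)"
proof -
 have "\<bar>(U ^^ j) h u\<bar> <= c * (fact (k - 1) * mprod u * real (total u + j) ^ i)" if "pts u" "size u + j = k" for j u using that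
 proof (induction j arbitrary: u)
  case 0
  then show ?case using le[of u] by (simp add: W_def)
 next
  case (Suc j)
  have "\<bar>U ((U ^^ j) h) u\<bar> <= c * (fact (k - 1) * mprod u * real (total u + Suc j) ^ i)"
  proof (rule U_bound[OF derivation_tame[OF derivation_U h] Suc.prems(1)])
   fix y assume "y : A" "mass y = 1"
   then show "\<bar>(U ^^ j) h (add_mset y u)\<bar> <= c * (fact (k - 1) * mprod u * real (total u + Suc j) ^ i)" using Suc.IH[of "add_mset y u"] Suc.prems by simp
  qed
  then show ?case by simp
 qed
 from this[of "{#}" k] have "\<bar>(U ^^ k) h {#}\<bar> <= c * (fact (k - 1) * real k ^ i)" by simp
 then have "\<bar>moment k h\<bar> <= c * (fact (k - 1) * real k ^ i) / fact k" unfolding moment_def by (simp add: divide_right_mono)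
 also have "\<dots> = c * (real k ^ i / real k)" using k by (simp add: fact_reduce[of k])
 finally show ?thesis .
qed

text \<open>Moments of the initial configuration, by Mecke's formula.\<close>

context
 fixes Om :: "'w measure" and N :: nat and X :: "'w => 'a multiset"
 assumes Om: "prob_space Om" and N: "0 < N" and X: "X : Om ->M PM"
  and ppp: "poisson_point_process (scale_measure (of_nat N) \<nu>) Om X"
begin

text \<open>Induction on \<open>k\<close>. Marking a particle of the sub-configuration costs the
  factor \<open>Suc k\<close> by \<open>sub_sum_conv_size\<close>; Mecke's formula then integrates
  it against N \<nu>, and the factor N cancels one power in \<open>scaled\<close>.\<close>

lemma nn_integral_initial:
 assumes "tame h" "!!u. 0 <= h u" "!!u. size u ~= k ==> h u = 0"
 shows "(NN w|Om. ennreal (conv (scaled N h) (%_. 1) (X w))) = ennreal (moment k h)" using assms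
proof (induction k arbitrary: h)
 case 0
 have "scaled N h = (%v. h {#} * (if v = {#} then 1 else 0))" using 0(3) by (auto simp: scaled_def)
 moreover have "conv (%v. if v = {#} then 1 else 0) (%_. 1) u = 1" for u :: "'a multiset" by (induction u) (simp_all add: conv_add_mset)
 ultimately have "conv (scaled N h) (%_. 1) u = h {#}" for u by (simp add: conv_cmult_left)
 then show ?case using prob_space.emeasure_space_1[OF Om] by (simp add: moment_def)
next
 case (Suc k)
 interpret \<nu>: prob_space \<nu> by (rule \<nu>_prob)
 let ?g = "%y. conv (%\<eta>. scaled N h (add_mset y \<eta>)) (%_. 1)"
 have N1: "1 <= real N" using N by simp
 have sc: "0 <= scaled N h u" for u using Suc.prems(2) by (simp add: scaled_def)
 have tc: "tame (conv (scaled N h) (%_. 1))" by (rule tame_conv_one[OF tame_scaled[OF N1 Suc.prems(1)]])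
 have gm: "(%p. ennreal (?g (fst p) (snd p))) : BM (PA <*> PM)"
 proof -
  have "?g y v = conv (scaled N h) (%_. 1) (add_mset y v) - conv (scaled N h) (%_. 1) v" for y v by (simp add: conv_add_mset)
  moreover have "(%p. conv (scaled N h) (%_. 1) (add_mset (fst p) (snd p))) : BM (PA <*> PM)" using mcomp[OF add_mset_measurable tame_measurable[OF tc]] by (simp add: case_prod_beta')
  moreover have "(%p. conv (scaled N h) (%_. 1) (snd p)) : BM (PA <*> PM)" by (rule mcomp[OF measurable_snd tame_measurable[OF tc]])
  ultimately show ?thesis by simp
 qed
 have Nsets: "sets (scale_measure (of_nat N) \<nu>) = sets PA" by (simp add: \<nu>_sets)
 have fin: "finite_measure (scale_measure (of_nat N) \<nu>)" by (rule finite_measureI) (simp add: \<nu>.emeasure_space_1 ennreal_mult_eq_top_iff)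
 have int: "integrable \<nu> (%y. (U ^^ k) h {#y#})" by (rule \<nu>_integrable[OF derivation_tame[OF derivation_U Suc.prems(1)], of "{#}"]) simp
 have pt: "(NN w|Om. ennreal (?g y (X w))) = ennreal ((U ^^ k) h {#y#} / fact k / N)" if y: "y : A" for y
 proof -
  have "?g y u = 1 / N * conv (scaled N (%\<eta>. h (add_mset y \<eta>))) (%_. 1) u" for u unfolding conv_cmult_left[symmetric] by (intro conv_cong) (simp_all add: scaled_def)
  moreover have "conv (scaled N (%\<eta>. h (add_mset y \<eta>))) (%_. 1) u >= 0" for u using Suc.prems(2) by (intro conv_nonneg) (auto simp: scaled_def)
  ultimately have "ennreal (?g y u) = ennreal (1 / N) * ennreal (conv (scaled N (%\<eta>. h (add_mset y \<eta>))) (%_. 1) u)" for u by (simp only: ennreal_mult' zero_le_divide_1_iff of_nat_0_le_iff)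
  moreover have "(%w. ennreal (conv (scaled N (%\<eta>. h (add_mset y \<eta>))) (%_. 1) (X w))) : BM Om"
   by (intro mcomp[OF X] mcomp[OF tame_measurable measurable_ennreal] tame_conv_one tame_scaled N1 tame_add_point Suc.prems y)
  ultimately have "(NN w|Om. ennreal (?g y (X w))) = ennreal (1 / N) * (NN w|Om. ennreal (conv (scaled N (%\<eta>. h (add_mset y \<eta>))) (%_. 1) (X w)))" by (simp only: nn_integral_cmult)
  also have "(NN w|Om. ennreal (conv (scaled N (%\<eta>. h (add_mset y \<eta>))) (%_. 1) (X w))) = ennreal (moment k (%\<eta>. h (add_mset y \<eta>)))"
   by (rule Suc.IH) (use Suc.prems y tame_add_point in auto)
  finally show ?thesis using N by (simp add: moment_def U_point ennreal_mult'[symmetric] mult.commute)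
 qed
 have "of_nat (Suc k) * (NN w|Om. ennreal (conv (scaled N h) (%_. 1) (X w))) =
   (NN w|Om. ennreal (real (Suc k) * conv (scaled N h) (%_. 1) (X w)))" using mcomp[OF X mcomp[OF tame_measurable[OF tc] measurable_ennreal]]
  by (simp only: ennreal_mult' of_nat_0_le_iff ennreal_of_nat_eq_real_of_nat[symmetric] nn_integral_cmult)
 also have "\<dots> = (NN w|Om. sub_sum (%y v. ennreal (?g y v)) (X w))" using sub_sum_conv_size[of "Suc k" "scaled N h" "%_. 1"] scaled_size[OF Suc.prems(3)] sc
  by (subst sub_sum_ennreal) (auto intro: conv_nonneg)
 also have "\<dots> = (NN y|(scale_measure (of_nat N) \<nu>). (NN w|Om. ennreal (?g y (X w))))" using mecke[OF Om Nsets fin X ppp gm] by simp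
 also have "\<dots> = (NN y|(scale_measure (of_nat N) \<nu>). ennreal ((U ^^ k) h {#y#} / fact k / N))" using pt by (intro NN_cong) (simp add: space_scale_measure \<nu>_space)
 also have "\<dots> = of_nat N * ennreal (LINT y|\<nu>. (U ^^ k) h {#y#} / fact k / N)" using int U_nonneg[OF Suc.prems(2)] by (simp add: nn_integral_scale_measure nn_integral_eq_integral)
 also have "(LINT y|\<nu>. (U ^^ k) h {#y#} / fact k / N) = real (Suc k) * moment (Suc k) h / N" by (simp add: moment_def U_def)
 also have "of_nat N * ennreal \<dots> = of_nat (Suc k) * ennreal (moment (Suc k) h)" using N by (simp add: ennreal_of_nat_eq_real_of_nat ennreal_mult'[symmetric] del: of_nat_Suc)
 finally show ?case by (simp add: ennreal_mult_cancel_left del: of_nat_Suc)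
qed

lemma integral_initial:
 assumes h: "tame h" and k: "!!u. size u ~= k ==> h u = 0"
 shows "integrable Om (%w. conv (scaled N h) (%_. 1) (X w))"
  "(LINT w|Om. conv (scaled N h) (%_. 1) (X w)) = moment k h"
proof -
 have N1: "1 <= real N" using N by simp
 have *: "has_bochner_integral Om (%w. conv (scaled N h) (%_. 1) (X w)) (moment k h)"
  if "tame h" "!!u. 0 <= h u" "!!u. size u ~= k ==> h u = 0" for h
 proof (rule has_bochner_integral_nn_integral)
  show "(%w. conv (scaled N h) (%_. 1) (X w)) : BM Om" by (intro mcomp[OF X tame_measurable] tame_conv_one tame_scaled N1 that)
  show "AE w in Om. 0 <= conv (scaled N h) (%_. 1) (X w)" using that(2) by (intro AE_I2 conv_nonneg) (auto simp: scaled_def)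
  show "0 <= moment k h" using U_nonneg[of h k] that(2) by (simp add: moment_def)
 qed (rule nn_integral_initial[OF that])
 let ?p = "%u. max 0 (h u)" and ?n = "%u. max 0 (- h u)"
 have "has_bochner_integral Om (%w. conv (scaled N ?p) (%_. 1) (X w) - conv (scaled N ?n) (%_. 1) (X w)) (moment k ?p - moment k ?n)"
  by (intro has_bochner_integral_diff * tame_pos[OF h] tame_neg[OF h]) (simp_all add: k)
 moreover have "conv (scaled N ?p) (%_. 1) u - conv (scaled N ?n) (%_. 1) u = conv (scaled N h) (%_. 1) u" for u
  unfolding conv_diff_left[symmetric] by (intro conv_cong) (auto simp: scaled_def max_def)
 moreover have "moment k ?p - moment k ?n = moment k h"
 proof -
  have "(%u. h u + max 0 (- h u)) = ?p" by (rule ext) (simp add: max_def)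
  then show ?thesis using moment_add[OF h tame_neg[OF h], of k] by simp
 qed
 ultimately have "has_bochner_integral Om (%w. conv (scaled N h) (%_. 1) (X w)) (moment k h)" by simp
 then show "integrable Om (%w. conv (scaled N h) (%_. 1) (X w))"
  "(LINT w|Om. conv (scaled N h) (%_. 1) (X w)) = moment k h" by (auto simp: has_bochner_integral_iff)
qed

end
end

section \<open>Dynkin's formula and the moment hierarchy\<close>

definition nn_pair_sum :: "('a => 'a => 'a multiset => ennreal) => 'a multiset => ennreal" where
 "nn_pair_sum G u = ennreal (1 / 2) * (\<Sum>a\<in>#u. \<Sum>b\<in>#u - {#a#}. G a b (u - {#a#} - {#b#}))"

lemma nn_pair_sum_cong:
 assumes "!!a b v. add_mset a (add_mset b v) = u ==> G a b v = G' a b v"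
 shows "nn_pair_sum G u = nn_pair_sum G' u" unfolding nn_pair_sum_def by (intro arg_cong[where f = "(*) (ennreal (1 / 2))"] arg_cong[where f = sum_mset] image_mset_cong assms remove_pair)

lemma nn_pair_sum_ennreal:
 assumes "!!a b v. add_mset a (add_mset b v) = u ==> 0 <= D a b v"
 shows "nn_pair_sum (%a b v. ennreal (D a b v)) u = ennreal (pair_sum D u)"
proof -
 have *: "(\<Sum>y\<in>#\<eta>. ennreal (f y)) = ennreal (\<Sum>y\<in>#\<eta>. f y) & 0 <= (\<Sum>y\<in>#\<eta>. f y)" if "!!y. y \<in># \<eta> ==> 0 <= f y" for f :: "'a => real" and \<eta>
  using that by (induction \<eta>) (auto simp: ennreal_plus)
 have 1: "0 <= D a b (u - {#a#} - {#b#})" if "a \<in># u" "b \<in># u - {#a#}" for a b using assms remove_pair[OF that] by blast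
 have "(\<Sum>a\<in>#u. \<Sum>b\<in>#u - {#a#}. ennreal (D a b (u - {#a#} - {#b#}))) = (\<Sum>a\<in>#u. ennreal (\<Sum>b\<in>#u - {#a#}. D a b (u - {#a#} - {#b#})))"
  by (intro arg_cong[where f = sum_mset] image_mset_cong *[THEN conjunct1] 1)
 also have "\<dots> = ennreal (\<Sum>a\<in>#u. \<Sum>b\<in>#u - {#a#}. D a b (u - {#a#} - {#b#}))" by (rule *[THEN conjunct1]) (rule *[THEN conjunct2], rule 1)
 finally have e: "(\<Sum>a\<in>#u. \<Sum>b\<in>#u - {#a#}. ennreal (D a b (u - {#a#} - {#b#}))) = \<dots>" .
 show ?thesis unfolding nn_pair_sum_def pair_sum_def sub_sum_def e by (rule ennreal_mult'[symmetric]) simp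
qed

lemma nn_pair_sum_cmult: "nn_pair_sum (%a b v. c * G a b v) u = c * nn_pair_sum G u" unfolding nn_pair_sum_def by (simp add: sum_mset_distrib_left[symmetric] mult.left_commute)

context coag_kernel
begin

lemma nn_pair_sum_measurable:
 assumes "(%(a, b, v). G a b v) : BM (PA <*> (PA <*> PM))"
 shows "nn_pair_sum G : BM PM"
proof -
 have "nn_pair_sum G = (%u. ennreal (1 / 2) * sub_sum (%a. sub_sum (G a)) u)" by (simp add: fun_eq_iff nn_pair_sum_def sub_sum_def)
 then show ?thesis by (simp only:) (intro borel_measurable_times_ennreal sub_sum_measurable1 sub_sum_measurable assms, simp)
qed

definition rate :: "real => 'a multiset => 'a multiset set => real" where
 "rate N u B = pair_sum (%a b v. K a b / N * measure (J a b) {z : A. add_mset z v : B}) u"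

definition jump :: "real => ('a multiset => ennreal) => 'a multiset => ennreal" where
 "jump N F = nn_pair_sum (%a b v. ennreal (K a b / N) * (NN z|(J a b). F (add_mset z v)))"

lemma pairD: "add_mset a (add_mset b v) = u ==> u : space PM ==> a : A & b : A & pts v" by auto

lemma add_J_measurable:
 assumes "a : A" "b : A" "pts v" "F : M ->M M'" "sets M = sets PM"
 shows "(%z. F (add_mset z v)) : J a b ->M M'" using mcomp[OF add_measurable[OF assms(3)], of F M'] assms(4,5) J_sets[OF assms(1,2)] by (simp cong: measurable_cong_sets)

lemma jump_functional: "u : space PM ==> nn_functional PM (%F. jump N F u)" unfolding jump_def nn_pair_sum_def
proof (intro nn_functional_cmult nn_functional_sum_mset nn_functional_integral nn_functional_eval)
 fix a b z assume u: "u : space PM" and ab: "a \<in># u" "b \<in># u - {#a#}"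
 then have A: "a : A" "b : A" "pts (u - {#a#} - {#b#})" using pairD[OF remove_pair[OF ab] u] by auto
 then show "z : space (J a b) ==> add_mset z (u - {#a#} - {#b#}) : space PM" using J_space by simp
 show "F : BM PM ==> (%z. F (add_mset z (u - {#a#} - {#b#}))) : BM (J a b)" for F :: "'a multiset => ennreal" using add_J_measurable[OF A _ refl] .
qed

lemma jump_measurable:
 assumes F: "F : BM PM"
 shows "jump N F : BM PM" unfolding jump_def
proof (rule nn_pair_sum_measurable)
 let ?M = "PA <*> (PA <*> PM)"
 have "(%p. (snd p, snd (snd (fst p)))) : ?M <*> PA ->M PA <*> PM" by measurable
 from mcomp[OF mcomp[OF this add_mset_measurable] F]
 have 1: "(%(p, z). F (add_mset z (snd (snd p)))) : BM (?M <*> PA)" by (simp add: case_prod_beta')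
 have "(%p. (fst p, fst (snd p))) : ?M ->M PA <*> PA" by measurable
 from measurable_prob_algebraD[OF mcomp[OF this J_measurable]]
 have 2: "(%p. J (fst p) (fst (snd p))) : ?M ->M subprob_algebra PA" by simp
 show "(%(a, b, v). ennreal (K a b / N) * (NN z|(J a b). F (add_mset z v))) : BM ?M" using nn_integral_measurable_subprob_algebra2[OF 1 2] K_measurable3 by (simp add: case_prod_beta')
qed

lemma jump_indicator:
 assumes "0 <= N" "u : space PM" "B : sets PM"
 shows "jump N (ind B) u = ennreal (rate N u B)" unfolding jump_def rate_def
proof (subst nn_pair_sum_ennreal[symmetric])
 fix a b v assume "add_mset a (add_mset b v) = u"
 then have ab: "a : A" "b : A" "pts v" using pairD assms by blast+
 show "0 <= K a b / N * measure (J a b) {z : A. add_mset z v : B}" using K_nonneg ab assms by simp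
next
 show "nn_pair_sum (%a b v. ennreal (K a b / N) * (NN z|(J a b). ind B (add_mset z v))) u =
   nn_pair_sum (%a b v. ennreal (K a b / N * measure (J a b) {z : A. add_mset z v : B})) u"
 proof (rule nn_pair_sum_cong)
  fix a b v assume "add_mset a (add_mset b v) = u"
  then have ab: "a : A" "b : A" "pts v" using pairD assms by blast+
  interpret prob_space "J a b" by (rule J_prob[OF ab(1,2)])
  have S: "{z : A. add_mset z v : B} : sets (J a b)" using measurable_sets[OF add_measurable[OF ab(3)] assms(3)] J_sets[OF ab(1,2)] by (simp add: vimage_def Int_def conj_commute)
  have "(NN z|(J a b). ind B (add_mset z v)) = (NN z|(J a b). ind {z : A. add_mset z v : B} z)" by (intro NN_cong) (auto simp: J_space[OF ab(1,2)] indicator_def)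
  also have "\<dots> = ennreal (measure (J a b) {z : A. add_mset z v : B})" using S by (simp add: emeasure_eq_measure)
  finally have i: "(NN z|(J a b). ind B (add_mset z v)) = \<dots>" .
  show "ennreal (K a b / N) * (NN z|(J a b). ind B (add_mset z v)) = ennreal (K a b / N * measure (J a b) {z : A. add_mset z v : B})" unfolding i by (rule ennreal_mult''[symmetric]) simp
 qed
qed

lemma rate_space: "u : space PM ==> rate N u (space PM) = V u / N"
proof -
 assume x: "u : space PM"
 have "rate N u (space PM) = pair_sum (%a b v. 1 / N * K a b) u" unfolding rate_def
 proof (rule pair_sum_cong)
  fix a b v assume "add_mset a (add_mset b v) = u"
  then have ab: "a : A" "b : A" "pts v" using pairD x by blast+
  interpret prob_space "J a b" by (rule J_prob[OF ab(1,2)])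
  have "{z : A. add_mset z v : space PM} = space (J a b)" using ab J_space by auto
  then show "K a b / N * measure (J a b) {z : A. add_mset z v : space PM} = 1 / N * K a b" by (simp add: prob_space)
 qed
 then show ?thesis unfolding V_def pair_sum_cmult by simp
qed

lemma tame_Lplus:
 assumes "tame h"
 shows "tame (Lplus h)"
proof -
 obtain w where w: "mono w" "!!u. pts u ==> \<bar>h u\<bar> <= w (total u)" "!!n. 0 <= w n" by (rule tame_bound[OF assms]) blast
 show ?thesis
 proof (rule tameI[OF Lplus_measurable[OF tame_measurable[OF assms]]])
  fix u assume u: "pts u"
  have "\<bar>Lplus h u\<bar> <= pair_sum (%a b v. w (total u) * K a b) u" unfolding Lplus_def
  proof (rule pair_sum_abs_le)
   fix a b v assume eq: "add_mset a (add_mset b v) = u"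
   then have ab: "a : A" "b : A" "pts v" using u by auto
   have "\<bar>jint h a b v\<bar> <= w (total u)"
   proof (rule jint_bound[OF ab assms])
    fix z assume "z : A" "mass z = mass a + mass b"
    then show "\<bar>h (add_mset z v)\<bar> <= w (total u)" using w(2)[of "add_mset z v"] ab eq by (auto simp: add.assoc)
   qed
   then show "\<bar>K a b * jint h a b v\<bar> <= w (total u) * K a b" using K_nonneg[OF ab(1,2)] by (simp add: abs_mult mult.commute mult_left_mono)
  qed
  also have "\<dots> = w (total u) * V u" unfolding pair_sum_cmult V_def ..
  also have "\<dots> <= w (total u) * (H / 2 * (real (total u))\<^sup>2)" by (intro mult_left_mono V_bounds[OF u] w)
  finally show "\<bar>Lplus h u\<bar> <= (%n. w n * (H / 2 * (real n)\<^sup>2)) (total u)" .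
 qed
qed

text \<open>A merger leaves the total mass unchanged, so the restriction to total mass at most
  \<open>n\<close> can be tested before the jump instead of after it.\<close>

lemma jump_localized:
 assumes G: "tame G" "!!u. pts u ==> total u <= n ==> 0 <= G u" and N: "0 < N" and u: "u : space PM"
 shows "jump N (%u. if total u <= n then ennreal (G u) else 0) u = (if total u <= n then ennreal (Lplus G u / N) else 0)"
proof -
 have int: "(NN z|(J a b). (if total (add_mset z v) <= n then ennreal (G (add_mset z v)) else 0)) =
   (if total u <= n then ennreal (jint G a b v) else 0)" (is "?l = ?r")
  and pos: "total u <= n ==> 0 <= jint G a b v" if eq: "add_mset a (add_mset b v) = u" for a b v
 proof -
  have ab: "a : A" "b : A" "pts v" using pairD eq u by blast+
  have tot: "AE z in J a b. z : A & total (add_mset z v) = total u" using J_mass[OF ab(1,2)] AE_space by eventually_elim (use eq J_space[OF ab(1,2)] in auto)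
  have AEpos: "AE z in J a b. 0 <= G (add_mset z v)" if "total u <= n" using tot by eventually_elim (use G(2) that ab in auto)
  have "?l = (NN z|(J a b). (if total u <= n then ennreal (G (add_mset z v)) else 0))" by (rule nn_integral_cong_AE) (use tot in \<open>eventually_elim, simp\<close>)
  also have "\<dots> = ?r" using nn_integral_eq_integral[OF J_integrable[OF G(1) ab] AEpos] by (auto simp: jint_def)
  finally show "?l = ?r" .
  show "total u <= n ==> 0 <= jint G a b v" unfolding jint_def using AEpos by (intro integral_nonneg_AE)
 qed
 show ?thesis
 proof (cases "total u <= n")
  case True
  have "jump N (%u. if total u <= n then ennreal (G u) else 0) u = nn_pair_sum (%a b v. ennreal (1 / N * (K a b * jint G a b v))) u" unfolding jump_def
  proof (rule nn_pair_sum_cong)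
   fix a b v assume eq: "add_mset a (add_mset b v) = u"
   show "ennreal (K a b / N) * (NN z|(J a b). (if total (add_mset z v) <= n then ennreal (G (add_mset z v)) else 0)) = ennreal (1 / N * (K a b * jint G a b v))"
    unfolding int[OF eq] using True pos[OF eq] by (simp add: ennreal_mult''[symmetric])
  qed
  also have "\<dots> = ennreal (pair_sum (%a b v. 1 / N * (K a b * jint G a b v)) u)" using K_nonneg pos[OF _ True] pairD[OF _ u] N by (intro nn_pair_sum_ennreal) auto
  finally show ?thesis using True unfolding pair_sum_cmult Lplus_def by simp
 next
  case False
  have "jump N (%u. if total u <= n then ennreal (G u) else 0) u = nn_pair_sum (%a b v. 0 * 0) u" unfolding jump_def using False int by (intro nn_pair_sum_cong) simp
  then show ?thesis using False unfolding nn_pair_sum_cmult by simp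
 qed
qed

end

locale coag_process = coag_initial A \<B> K J mass H \<nu>
 for A :: "'a::second_countable_topology set" and \<B> K J mass H \<nu> +
 fixes Om :: "'w measure" and N :: nat and Y :: "nat => 'w => 'a multiset" and \<sigma> :: "nat => 'w => ennreal"
  and X :: "real => 'w => 'a multiset"
 assumes N_pos: "0 < N" and jp: "jump_process Om PM (rate (real N)) Y \<sigma> X"
  and ppp: "poisson_point_process (scale_measure (of_nat N) \<nu>) Om (X 0)"
begin

sublocale jump_process Om PM "rate (real N)" Y \<sigma> X by (rule jp)

lemma N_ge_1: "1 <= real N" using N_pos by simp

lemma X_space: "0 <= t ==> w : space Om ==> pts (X t w)" using measurable_space[OF X_measurable[of t]] by auto

lemma forward_jump:
 assumes "F : BM PM" "0 <= t"
 shows "(NN w|Om. F (X t w)) + (NN s|lborel. ind {0..t} s * (NN w|Om. ennreal (rate N (X s w) (space PM)) * F (X s w))) =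
  (NN w|Om. F (X 0 w)) + (NN s|lborel. ind {0..t} s * (NN w|Om. jump N F (X s w)))" by (rule forward[OF jump_functional jump_indicator[OF of_nat_0_le_iff] jump_measurable assms])

text \<open>Expectation localized to configurations of total mass at most \<open>n\<close>.\<close>

definition loc :: "nat => ('a multiset => real) => 'a multiset => real" where
 "loc n g u = (if total u <= n then g u else 0)"

definition \<E> :: "nat => ('a multiset => real) => real => real" where
 "\<E> n g t = (LINT w|Om. loc n g (X t w))"

lemma loc_measurable: "tame g ==> loc n g : BM PM"
proof -
 assume g: "tame g"
 have "(%u. if real (total u) <= real n then g u else 0) : BM PM" using total_measurable tame_measurable[OF g] by measurable
 then show ?thesis by (simp add: loc_def[abs_def])
qed

lemma loc_bounded:
 assumes "tame g"
 obtains c where "0 <= c" "!!u. pts u ==> \<bar>loc n g u\<bar> <= c"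
proof -
 obtain w where w: "mono w" "!!u. pts u ==> \<bar>g u\<bar> <= w (total u)" "!!n. 0 <= w n" by (rule tame_bound[OF assms]) blast
 have "\<bar>loc n g u\<bar> <= w n" if "pts u" for u using w(2)[OF that] monoD[OF w(1), of "total u" n] w(3)[of n] by (auto simp: loc_def)
 then show ?thesis using w(3) that by blast
qed

lemma loc_integrable: "tame g ==> 0 <= t ==> integrable Om (%w. loc n g (X t w))"
proof -
 assume g: "tame g" and t: "0 <= t"
 obtain c where c: "!!u. pts u ==> \<bar>loc n g u\<bar> <= c" by (rule loc_bounded[OF g]) blast
 show ?thesis by (rule integrable_const_bound[of _ c]) (use c X_space[OF t] mcomp[OF X_measurable[OF t] loc_measurable[OF g]] in auto)
qed

lemma \<E>_bounded:
 assumes "tame g"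
 obtains c where "0 <= c" "!!s. 0 <= s ==> \<bar>\<E> n g s\<bar> <= c"
proof -
 obtain c where c: "0 <= c" "!!u. pts u ==> \<bar>loc n g u\<bar> <= c" by (rule loc_bounded[OF assms]) blast
 have "\<bar>\<E> n g s\<bar> <= c" if s: "0 <= s" for s
 proof -
  have "\<bar>\<E> n g s\<bar> <= (LINT w|Om. \<bar>loc n g (X s w)\<bar>)" unfolding \<E>_def by (rule integral_abs_bound)
  also have "\<dots> <= (LINT w|Om. c)" using c X_space[OF s] loc_integrable[OF assms s] by (intro integral_mono) auto
  finally show ?thesis by (simp add: prob_space)
 qed
 then show ?thesis using c(1) that by blast
qed

lemma \<E>_mono:
 assumes "tame f" "tame g" "0 <= t" "!!u. pts u ==> f u <= g u"
 shows "\<E> n f t <= \<E> n g t" unfolding \<E>_def using assms X_space[OF assms(3)] by (intro integral_mono loc_integrable) (auto simp: loc_def)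

lemma \<E>_add: "tame f ==> tame g ==> 0 <= t ==> \<E> n (%u. f u + g u) t = \<E> n f t + \<E> n g t"
proof -
 assume a: "tame f" "tame g" "0 <= t"
 have "\<E> n (%u. f u + g u) t = (LINT w|Om. loc n f (X t w) + loc n g (X t w))" unfolding \<E>_def by (intro LINT_cong) (auto simp: loc_def)
 then show ?thesis unfolding \<E>_def using loc_integrable a by simp
qed

lemma \<E>_cmult: "\<E> n (%u. c * g u) t = c * \<E> n g t"
proof -
 have "\<E> n (%u. c * g u) t = (LINT w|Om. c * loc n g (X t w))" unfolding \<E>_def by (intro LINT_cong) (auto simp: loc_def)
 then show ?thesis unfolding \<E>_def by simp
qed

lemma \<E>_diff: "tame f ==> tame g ==> 0 <= t ==> \<E> n (%u. f u - g u) t = \<E> n f t - \<E> n g t" using \<E>_add[of f "%u. -1 * g u" t n] tame_cmult[of g "-1"] \<E>_cmult[of n "-1" g t] by simp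

lemma \<E>_cong: "0 <= t ==> (!!u. pts u ==> f u = g u) ==> \<E> n f t = \<E> n g t" unfolding \<E>_def using X_space by (intro LINT_cong) (auto simp: loc_def)

lemma \<E>_abs_le:
 assumes "tame f" "tame g" "0 <= t" "!!u. pts u ==> \<bar>f u\<bar> <= g u"
 shows "\<bar>\<E> n f t\<bar> <= \<E> n g t"
proof -
 have "f u <= g u" "-1 * f u <= g u" if "pts u" for u using assms(4)[OF that] by auto
 then have "\<E> n f t <= \<E> n g t" "\<E> n (%u. - 1 * f u) t <= \<E> n g t" using \<E>_mono[OF assms(1-3)] \<E>_mono[OF tame_cmult[OF assms(1)] assms(2,3)] by blast+
 then show ?thesis unfolding \<E>_cmult by simp
qed

lemma \<E>_measurable:
 assumes "tame g"
 shows "(%s. ind {0..t} s * \<E> n g s) : BM borel"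
proof -
 have pos: "(%s. ind {0..t} s * \<E> n g s) : BM borel" if g: "tame g" and nn: "!!u. 0 <= g u" for g
 proof -
  have "(%s. enn2real (NN w|Om. ind {0..t} s * ennreal (loc n g (X s w)))) : BM borel"
   using borel_measurable_nn_integral_fst[OF X_measurable_pair[OF mcomp[OF loc_measurable[OF g] measurable_ennreal]]] by simp
  moreover have "enn2real (NN w|Om. ind {0..t} s * ennreal (loc n g (X s w))) = ind {0..t} s * \<E> n g s" for s
  proof (cases "s : {0..t}")
   case True
   have "0 <= loc n g u" for u using nn by (simp add: loc_def)
   moreover from this have "0 <= \<E> n g s" unfolding \<E>_def by simp
   ultimately show ?thesis using True loc_integrable[OF g, of s n] by (simp add: nn_integral_eq_integral \<E>_def)
  qed simp
  ultimately show ?thesis by simp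
 qed
 have "(%s. ind {0..t} s * (ind {0..t} s * \<E> n (%u. max 0 (g u)) s - ind {0..t} s * \<E> n (%u. max 0 (- g u)) s)) : BM borel" using pos[OF tame_pos[OF assms]] pos[OF tame_neg[OF assms]] by simp
 moreover have "ind {0..t} s * (ind {0..t} s * \<E> n (%u. max 0 (g u)) s - ind {0..t} s * \<E> n (%u. max 0 (- g u)) s) = ind {0..t} s * \<E> n g s" for s
 proof (cases "s : {0..t}")
  case True
  then have "\<E> n g s = \<E> n (%u. max 0 (g u) - max 0 (- g u)) s" by (intro \<E>_cong) auto
  then show ?thesis using True \<E>_diff[OF tame_pos[OF assms] tame_neg[OF assms], of s n] by simp
 qed simp
 ultimately show ?thesis by simp
qed

lemma \<E>_set_integrable: "tame g ==> set_integrable lborel {0..t} (\<E> n g)"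
proof -
 assume g: "tame g"
 obtain c where c: "0 <= c" "!!s. 0 <= s ==> \<bar>\<E> n g s\<bar> <= c" by (rule \<E>_bounded[OF g]) blast
 show ?thesis unfolding set_integrable_def
 proof (rule Bochner_Integration.integrable_bound)
  show "integrable lborel (%s. ind {0..t} s * c)" by (intro integrable_mult_left integrable_real_indicator) (auto simp: emeasure_lborel_Icc_eq)
  show "AE s in lborel. norm (ind {0..t} s *\<^sub>R \<E> n g s) <= norm (ind {0..t} s * c)" using c by (intro AE_I2) (auto simp: indicator_def)
 qed (use \<E>_measurable[OF g] in simp)
qed

lemma nn_\<E>:
 assumes "tame g" "!!u. pts u ==> total u <= n ==> 0 <= g u" "0 <= s"
 shows "(NN w|Om. ennreal (loc n g (X s w))) = ennreal (\<E> n g s)" "0 <= \<E> n g s"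
proof -
 have "AE w in Om. 0 <= loc n g (X s w)" using assms X_space by (intro AE_I2) (auto simp: loc_def)
 then show "(NN w|Om. ennreal (loc n g (X s w))) = ennreal (\<E> n g s)" "0 <= \<E> n g s" unfolding \<E>_def by (auto intro!: nn_integral_eq_integral integral_nonneg_AE loc_integrable assms)
qed

lemma nn_\<E>_integral:
 assumes "tame g" "!!u. pts u ==> total u <= n ==> 0 <= g u"
 shows "(NN s|lborel. ind {0..t} s * (NN w|Om. ennreal (loc n g (X s w)))) = ennreal (LBINT s:{0..t}. \<E> n g s)"
  "0 <= (LBINT s:{0..t}. \<E> n g s)"
proof -
 have nn: "0 <= ind {0..t} s *\<^sub>R \<E> n g s" for s using nn_\<E>(2)[OF assms] by (auto simp: indicator_def)
 have "(NN s|lborel. ind {0..t} s * (NN w|Om. ennreal (loc n g (X s w)))) = (NN s|lborel. ennreal (ind {0..t} s *\<^sub>R \<E> n g s))"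
  using nn_\<E>(1)[OF assms] by (intro NN_cong) (auto simp: indicator_def)
 also have "\<dots> = ennreal (LBINT s:{0..t}. \<E> n g s)" unfolding set_lebesgue_integral_def
  using \<E>_set_integrable[OF assms(1), of t n] nn by (intro nn_integral_eq_integral) (auto simp: set_integrable_def)
 finally show "(NN s|lborel. ind {0..t} s * (NN w|Om. ennreal (loc n g (X s w)))) = ennreal (LBINT s:{0..t}. \<E> n g s)" .
 show "0 <= (LBINT s:{0..t}. \<E> n g s)" unfolding set_lebesgue_integral_def using nn by (intro integral_nonneg_AE AE_I2)
qed

text \<open>The forward equation holds between extended nonnegative numbers. After localization all
  four terms are finite, so that the loss can be moved to the other side.\<close>

lemma dynkin_nonneg:
 assumes G: "tame G" and pos: "!!u. pts u ==> total u <= n ==> 0 <= G u" and t: "0 <= t"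
 shows "\<E> n G t = \<E> n G 0 + (LBINT s:{0..t}. \<E> n (%u. 1 / N * Lplus G u - 1 / N * (V u * G u)) s)"
proof -
 let ?P = "%u. 1 / N * Lplus G u" and ?V = "%u. 1 / N * (V u * G u)"
 have tP: "tame ?P" and tV: "tame ?V" by (intro tame_cmult tame_Lplus tame_mult tame_V G)+
 have pV: "0 <= ?V u" if "pts u" "total u <= n" for u using pos[OF that] V_bounds(1)[OF that(1)] by simp
 have pP: "0 <= ?P u" if "pts u" "total u <= n" for u
 proof -
  have "0 <= Lplus G u" unfolding Lplus_def
  proof (rule pair_sum_nonneg)
   fix a b v assume eq: "add_mset a (add_mset b v) = u"
   then have ab: "a : A" "b : A" "pts v" using that by auto
   have "AE z in J a b. 0 <= G (add_mset z v)" using J_mass[OF ab(1,2)] AE_space by eventually_elim (use eq that ab J_space in \<open>intro pos; auto\<close>)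
   then show "0 <= K a b * jint G a b v" unfolding jint_def using K_nonneg ab by (intro mult_nonneg_nonneg integral_nonneg_AE)
  qed
  then show ?thesis by simp
 qed
 let ?F = "%u. if total u <= n then ennreal (G u) else 0"
 have F: "?F u = ennreal (loc n G u)" for u by (simp add: loc_def)
 have mF: "?F : BM PM" using mcomp[OF loc_measurable[OF G] measurable_ennreal] by (simp only: F)
 have Vp: "ennreal (rate N u (space PM)) * ?F u = ennreal (loc n ?V u)" if x: "pts u" for u
 proof -
  have "u : space PM" using x by simp
  from rate_space[OF this] show ?thesis using pos[OF x] V_bounds(1)[OF x] by (simp add: loc_def ennreal_mult'[symmetric] del: space_PM)
 qed
 have Vi: "(NN s|lborel. ind {0..t} s * (NN w|Om. ennreal (rate N (X s w) (space PM)) * ?F (X s w))) = ennreal (LBINT s:{0..t}. \<E> n ?V s)"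
 proof (rule trans[OF NN_cong nn_\<E>_integral(1)[OF tV pV]])
  fix s
  show "ind {0..t} s * (NN w|Om. ennreal (rate N (X s w) (space PM)) * ?F (X s w)) = ind {0..t} s * (NN w|Om. ennreal (loc n ?V (X s w)))"
  proof (cases "s : {0..t}")
   case True
   then have "(NN w|Om. ennreal (rate N (X s w) (space PM)) * ?F (X s w)) = (NN w|Om. ennreal (loc n ?V (X s w)))" using X_space[of s] by (intro NN_cong Vp) auto
   then show ?thesis by simp
  qed simp
 qed
 have Pi: "(NN s|lborel. ind {0..t} s * (NN w|Om. jump N ?F (X s w))) = ennreal (LBINT s:{0..t}. \<E> n ?P s)"
 proof (rule trans[OF NN_cong nn_\<E>_integral(1)[OF tP pP]])
  fix s
  show "ind {0..t} s * (NN w|Om. jump N ?F (X s w)) = ind {0..t} s * (NN w|Om. ennreal (loc n ?P (X s w)))"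
  proof (cases "s : {0..t}")
   case True
   then have "(NN w|Om. jump N ?F (X s w)) = (NN w|Om. ennreal (loc n ?P (X s w)))" using X_space[of s] N_pos by (intro NN_cong, subst jump_localized[OF G pos]) (auto simp: loc_def)
   then show ?thesis by simp
  qed simp
 qed
 have i: "0 <= (LBINT s:{0..t}. \<E> n ?V s)" "0 <= (LBINT s:{0..t}. \<E> n ?P s)" using nn_\<E>_integral(2)[OF tV pV] nn_\<E>_integral(2)[OF tP pP] by auto
 have Fi: "(NN w|Om. ?F (X s w)) = ennreal (\<E> n G s)" if "0 <= s" for s using nn_\<E>(1)[of G n, OF G pos that] by (simp only: F)
 have "ennreal (\<E> n G t) + ennreal (LBINT s:{0..t}. \<E> n ?V s) = ennreal (\<E> n G 0) + ennreal (LBINT s:{0..t}. \<E> n ?P s)"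
  using forward_jump[OF mF t] unfolding Vi Pi Fi[OF t] Fi[OF order_refl] .
 then have "\<E> n G t + (LBINT s:{0..t}. \<E> n ?V s) = \<E> n G 0 + (LBINT s:{0..t}. \<E> n ?P s)"
  using i nn_\<E>(2)[of G n, OF G pos t] nn_\<E>(2)[of G n, OF G pos order_refl] by (simp add: ennreal_plus[symmetric] del: ennreal_plus)
 moreover have "(LBINT s:{0..t}. \<E> n (%u. ?P u - ?V u) s) = (LBINT s:{0..t}. \<E> n ?P s - \<E> n ?V s)" using tP tV by (intro set_lebesgue_integral_cong) (auto intro: \<E>_diff)
 moreover have "\<dots> = (LBINT s:{0..t}. \<E> n ?P s) - (LBINT s:{0..t}. \<E> n ?V s)" using tP tV by (intro set_integral_diff \<E>_set_integrable)
 ultimately show ?thesis by simp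
qed

text \<open>A constant that makes the localized function nonnegative changes the gain and the loss
  by the same multiple of \<open>V\<close>, and its own localized expectation does not depend on
  time.\<close>

lemma dynkin:
 assumes G: "tame G" and t: "0 <= t"
 shows "\<E> n G t = \<E> n G 0 + (LBINT s:{0..t}. \<E> n (%u. 1 / N * Lplus G u - 1 / N * (V u * G u)) s)"
proof -
 obtain c where c: "0 <= c" "!!u. pts u ==> \<bar>loc n G u\<bar> <= c" by (rule loc_bounded[OF G]) blast
 let ?D = "%G u. 1 / N * Lplus G u - 1 / N * (V u * G u)"
 have shift: "Lplus (%u. G u + c) u = Lplus G u + c * V u" if G: "tame G" and u: "pts u" for G u unfolding Lplus_def V_def pair_sum_cmult[symmetric] pair_sum_add[symmetric]
 proof (rule pair_sum_cong)
  fix a b v assume "add_mset a (add_mset b v) = u"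
  then have ab: "a : A" "b : A" "pts v" using u by auto
  interpret J: prob_space "J a b" by (rule J_prob[OF ab(1,2)])
  have "jint (%u. G u + c) a b v = jint G a b v + c" unfolding jint_def using J_integrable[OF G ab] by (simp add: J.prob_space)
  then show "K a b * jint (%u. G u + c) a b v = K a b * jint G a b v + c * K a b" by (simp add: algebra_simps)
 qed
 have t0: "tame (%_. 0)" and tc: "tame (%_. c)" by (rule tame_const)+
 have L0: "Lplus (%_. 0) u = 0" for u by (simp add: Lplus_def jint_def pair_sum_zero)
 have const: "\<E> n (%_. c) t = \<E> n (%_. c) 0"
 proof -
  have "(LBINT s:{0..t}. \<E> n (?D (%_. c)) s) = (LBINT s:{0..t}. \<E> n (%_. 0) s)" using shift[OF t0] by (intro set_lebesgue_integral_cong) (auto intro!: \<E>_cong simp: L0)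
  also have "\<dots> = 0" by (simp add: \<E>_def loc_def)
  finally show ?thesis using dynkin_nonneg[OF tc c(1) t] by simp
 qed
 have "\<E> n (%u. G u + c) t = \<E> n (%u. G u + c) 0 + (LBINT s:{0..t}. \<E> n (?D (%u. G u + c)) s)"
 proof (rule dynkin_nonneg[OF tame_add[OF G tc] _ t])
  show "0 <= G u + c" if "pts u" "total u <= n" for u using c(2)[OF that(1)] that(2) by (simp add: loc_def)
 qed
 also have "(LBINT s:{0..t}. \<E> n (?D (%u. G u + c)) s) = (LBINT s:{0..t}. \<E> n (?D G) s)"
  using shift[OF G] by (intro set_lebesgue_integral_cong) (auto intro!: \<E>_cong simp: algebra_simps add_divide_distrib)
 finally show ?thesis using const \<E>_add[OF G tc t] \<E>_add[OF G tc order_refl] by simp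
qed

text \<open>The hierarchy of rescaled factorial moment measures.\<close>

definition \<C> :: "nat => ('a multiset => real) => real => real" where
 "\<C> n h = \<E> n (conv (scaled N h) (%_. 1))"

lemma tame_\<C>: "tame h ==> tame (conv (scaled N h) (%_. 1))" by (rule tame_conv_one[OF tame_scaled[OF N_ge_1]])

lemma hierarchy:
 assumes h: "tame h" and t: "0 <= t"
 shows "\<C> n h t = \<C> n h 0 + (LBINT s:{0..t}. \<C> n (%u. L h u - V u * h u / N) s)" unfolding \<C>_def
proof (subst dynkin[OF tame_\<C>[OF h] t], intro arg_cong2[where f = "(+)"] refl set_lebesgue_integral_cong allI impI \<E>_cong)
 fix s u assume u: "pts u"
 let ?G = "conv (scaled N h) (%_. 1)"
 have "1 / N * Lplus ?G u - 1 / N * (V u * ?G u) = pair_sum (%a b v. 1 / N * (K a b * jint ?G a b v) - 1 / N * (?G u * K a b)) u" unfolding pair_sum_diff pair_sum_cmult Lplus_def V_def by simp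
 also have "\<dots> = pair_sum (%a b v. K a b / N * (jint ?G a b v - ?G (add_mset a (add_mset b v)))) u" by (intro pair_sum_cong) (simp add: algebra_simps diff_divide_distrib)
 also have "\<dots> = conv (scaled N (%\<eta>. L h \<eta> - V \<eta> * h \<eta> / N)) (%_. 1) u" by (rule generator_conv[OF N_ge_1 h u])
 finally show "1 / N * Lplus ?G u - 1 / N * (V u * ?G u) = \<dots>" .
qed auto

end

section \<open>Expansion of the moments over a short time\<close>

lemma power_le_fact_exp: "0 <= x ==> x ^ n <= fact n * exp (x :: real)"
proof -
 assume x: "0 <= x"
 have s: "(%n. x ^ n /\<^sub>R fact n) sums exp x" by (rule exp_converges)
 have "(\<Sum>i\<in>{n}. x ^ i /\<^sub>R fact i) <= (\<Sum>i. x ^ i /\<^sub>R fact i)" using x by (intro sum_le_suminf sums_summable[OF s]) auto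
 then have "(\<Sum>i\<in>{n}. x ^ i /\<^sub>R fact i) <= exp x" by (simp only: sums_unique[OF s])
 then show ?thesis by (simp add: field_simps)
qed

lemma integral_power_Icc:
 fixes t :: real
 assumes "0 <= t"
 shows "set_integrable lborel {0..t} (%s. s ^ n)" "(LBINT s:{0..t}. s ^ n) = t ^ Suc n / real (Suc n)"
proof -
 have "has_bochner_integral lborel (%x. x ^ n * ind {0..t} x) (t ^ Suc n / real (Suc n) - 0 ^ Suc n / real (Suc n))"
  by (rule has_bochner_integral_FTC_Icc_real[where F = "%x. x ^ Suc n / real (Suc n)" and f = "%x. x ^ n", OF assms])
   (auto intro!: derivative_eq_intros continuous_intros simp del: power_Suc of_nat_Suc)
 then show "set_integrable lborel {0..t} (%s. s ^ n)" "(LBINT s:{0..t}. s ^ n) = t ^ Suc n / real (Suc n)"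
  by (auto simp: set_integrable_def set_lebesgue_integral_def has_bochner_integral_iff mult.commute)
qed

lemma integral_poly_Icc:
 fixes t :: real
 assumes "0 <= t"
 shows "set_integrable lborel {0..t} (%s. \<Sum>j<m. c j * s ^ j)"
  "(LBINT s:{0..t}. (\<Sum>j<m. c j * s ^ j)) = (\<Sum>j<m. c j * (t ^ Suc j / real (Suc j)))"
proof (induction m)
 case (Suc m)
 {
  case 1
  show ?case unfolding sum.lessThan_Suc by (intro set_integral_add Suc set_integrable_mult_right integral_power_Icc assms)
 next
  case 2
  have "(LBINT s:{0..t}. (\<Sum>j<m. c j * s ^ j) + c m * s ^ m) = (LBINT s:{0..t}. (\<Sum>j<m. c j * s ^ j)) + (LBINT s:{0..t}. c m * s ^ m)"
   by (intro set_integral_add Suc set_integrable_mult_right integral_power_Icc assms)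
  then show ?case unfolding sum.lessThan_Suc Suc(2) by (simp add: integral_power_Icc(2)[OF assms] del: power_Suc of_nat_Suc)
 }
qed (simp_all add: set_integrable_def set_lebesgue_integral_def)

lemma set_integral_abs_le:
 fixes f g :: "real => real"
 assumes "set_integrable lborel {0..t} f" "set_integrable lborel {0..t} g" "!!s. 0 <= s ==> s <= t ==> \<bar>f s\<bar> <= g s"
 shows "\<bar>LBINT s:{0..t}. f s\<bar> <= (LBINT s:{0..t}. g s)"
proof -
 have "\<bar>LBINT s:{0..t}. f s\<bar> <= (LBINT s:{0..t}. \<bar>f s\<bar>)"
  unfolding set_lebesgue_integral_def using integral_abs_bound[of lborel "%s. ind {0..t} s *\<^sub>R f s"] by (simp add: abs_mult)
 also have "\<dots> <= (LBINT s:{0..t}. g s)" using assms by (intro set_integral_mono set_integrable_abs) auto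
 finally show ?thesis .
qed

locale coag_short = coag_initial A \<B> K J mass H \<nu>
 for A :: "'a::second_countable_topology set" and \<B> K J mass H \<nu> +
 fixes T :: real
 assumes T_nonneg: "0 <= T" and small: "3 * exp 1 * (H * T) < 1"
begin

abbreviation \<theta> :: real where "\<theta> \<equiv> 3 * exp 1 * (H * T)"

lemma HT_nonneg: "0 <= H * T" and \<theta>_nonneg: "0 <= \<theta>" using H_nonneg T_nonneg by auto

text \<open>The \<open>j\<close>-th term of the iterated upper bound for the moment of
  \<open>W k i\<close>: \<open>j\<close> gains produce H^j times \<open>W (k+j) (i+j)\<close>, whose
  initial moment is at most (k+j)^(i+j) / (k+j), and the nested time integrals produce T^j /
  j!.\<close>

definition coeff :: "nat => nat => nat => real" where
 "coeff k i j = (H * T) ^ j / fact j * (real (k + j) ^ (i + j) / real (k + j))"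

definition S :: "nat => nat => real" where
 "S k i = (\<Sum>j. coeff k i j)"

lemma coeff_nonneg: "0 <= coeff k i j" using HT_nonneg by (simp add: coeff_def)

text \<open>With n = k + j, the estimates n^i <= i! e^n and n^j <= j! e^n give a geometric majorant
  of ratio e^2 H T, which is at most \<theta> because e <= 3.\<close>

lemma coeff_summable:
 assumes "1 <= k"
 shows "summable (coeff k i)"
proof -
 have "exp (2 :: real) = exp 1 * exp 1" by (simp add: exp_add[symmetric])
 also have "\<dots> <= 3 * exp 1" using exp_le by (intro mult_right_mono) auto
 finally have "exp 2 * (H * T) <= \<theta>" using HT_nonneg by (intro mult_right_mono) auto
 then have g: "summable (%j. (fact i * exp (real k) * exp (real k)) * (exp 2 * (H * T)) ^ j)" using small HT_nonneg by (intro summable_mult summable_geometric) simp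
 show ?thesis
 proof (rule summable_comparison_test'[OF g])
  fix j
  let ?n = "real (k + j)"
  have "?n ^ (i + j) <= (fact i * exp ?n) * (fact j * exp ?n)" unfolding power_add using power_le_fact_exp[of ?n] by (intro mult_mono) auto
  moreover have "?n ^ (i + j) / ?n <= ?n ^ (i + j)" using assms by (simp add: divide_le_eq mult_le_cancel_left1)
  ultimately have "?n ^ (i + j) / ?n <= (fact i * exp ?n) * (fact j * exp ?n)" by linarith
  then have "coeff k i j <= (H * T) ^ j / fact j * ((fact i * exp ?n) * (fact j * exp ?n))" unfolding coeff_def using HT_nonneg by (intro mult_left_mono) auto
  also have "\<dots> = (fact i * exp (real k) * exp (real k)) * (exp 2 * (H * T)) ^ j"
  proof -
   have "exp ?n = exp (real k) * exp 1 ^ j" by (simp add: exp_add exp_of_nat_mult[symmetric])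
   moreover have "exp (2 :: real) ^ j = exp 1 ^ j * exp 1 ^ j" by (simp add: power_mult_distrib[symmetric] exp_add[symmetric])
   ultimately show ?thesis by (simp add: power_mult_distrib)
  qed
  finally show "norm (coeff k i j) <= (fact i * exp (real k) * exp (real k)) * (exp 2 * (H * T)) ^ j" using coeff_nonneg by simp
 qed
qed

lemma sum_coeff_le: "1 <= k ==> (\<Sum>j<M. coeff k i j) <= S k i" unfolding S_def by (intro sum_le_suminf coeff_summable) (auto simp: coeff_nonneg)

lemma S_nonneg: "1 <= k ==> 0 <= S k i" unfolding S_def by (intro suminf_nonneg coeff_summable) (auto simp: coeff_nonneg)

lemma power_fact_le: "real (k + n) ^ n / fact n <= exp (real k) * exp 1 ^ n"
proof -
 have "real (k + n) ^ n / fact n <= exp (real (k + n))" using power_le_fact_exp[of "real (k + n)" n] by (simp add: divide_le_eq mult.commute)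
 then show ?thesis by (simp add: exp_add exp_of_nat_mult[symmetric])
qed

text \<open>The remainder after \<open>m\<close> signed steps costs 2^m and the following
  \<open>j\<close> upper-bound steps only 1, with the binomial coefficient of m+j over m from the
  factorials. One term of the binomial expansion of (2 + 1)^(m+j) is at most 3^(m+j); this is the
  origin of the 3 in \<theta>.\<close>

lemma S_tail:
 assumes "1 <= k"
 shows "(2 * H * T) ^ m / fact m * S (k + m) (1 + m) <= exp (real k) * \<theta> ^ m / (1 - \<theta>)"
proof -
 have le: "(2 * H * T) ^ m / fact m * coeff (k + m) (1 + m) j <= exp (real k) * \<theta> ^ m * \<theta> ^ j" for j
 proof -
  let ?n = "m + j"
  have "real (?n choose m) * 2 ^ m * 1 ^ (?n - m) <= (\<Sum>l\<le>?n. real (?n choose l) * 2 ^ l * 1 ^ (?n - l))" by (rule member_le_sum) auto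
  also have "\<dots> = 3 ^ ?n" using binomial_ring[of "2 :: real" 1 ?n] by simp
  finally have b: "real (?n choose m) * 2 ^ m <= 3 ^ ?n" by simp
  have "(2 * H * T) ^ m / fact m * coeff (k + m) (1 + m) j = (real (?n choose m) * 2 ^ m) * (H * T) ^ ?n * (real (k + ?n) ^ ?n / fact ?n)"
   using assms by (simp add: coeff_def binomial_fact power_mult_distrib power_add add.assoc mult.assoc mult.left_commute)
  also have "\<dots> <= 3 ^ ?n * (H * T) ^ ?n * (exp (real k) * exp 1 ^ ?n)" using b HT_nonneg power_fact_le[of k ?n] by (intro mult_mono mult_nonneg_nonneg) auto
  also have "\<dots> = exp (real k) * \<theta> ^ m * \<theta> ^ j" by (simp add: power_mult_distrib power_add)
  finally show ?thesis .
 qed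
 have "(2 * H * T) ^ m / fact m * S (k + m) (1 + m) = (\<Sum>j. (2 * H * T) ^ m / fact m * coeff (k + m) (1 + m) j)"
  unfolding S_def using coeff_summable[of "k + m" "1 + m"] assms by (intro suminf_mult[symmetric]) auto
 also have "\<dots> <= (\<Sum>j. exp (real k) * \<theta> ^ m * \<theta> ^ j)"
  using coeff_summable[of "k + m" "1 + m"] assms le small \<theta>_nonneg by (intro suminf_le summable_mult summable_geometric) auto
 also have "\<dots> = exp (real k) * \<theta> ^ m / (1 - \<theta>)" using small \<theta>_nonneg by (subst suminf_mult) (auto simp: suminf_geometric intro: summable_geometric)
 finally show ?thesis .
qed

lemma L_power_bound:
 assumes h: "tame h" and k: "1 <= k" and c: "0 <= c" and le: "!!u. pts u ==> \<bar>h u\<bar> <= c * W k i u"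
 shows "pts u ==> \<bar>(L ^^ n) h u\<bar> <= ((2 * H) ^ n * c) * W (k + n) (i + n) u"
proof (induction n arbitrary: u)
 case (Suc n)
 have "\<bar>L ((L ^^ n) h) u\<bar> <= 2 * H * ((2 * H) ^ n * c) * W (Suc (k + n)) (Suc (i + n)) u"
  by (rule L_bound[OF Suc.prems _ derivation_tame[OF derivation_L h] _ Suc.IH]) (use k c H_nonneg in auto)
 then show ?case by (simp add: mult.assoc)
qed (use le in simp)

text \<open>The power series of exp(t L) applied to \<open>h\<close>, tested against the initial
  moments: the expected limit of the factorial moments of order \<open>k\<close> at time
  \<open>t\<close>.\<close>

definition R :: "nat => ('a multiset => real) => real => real" where
 "R k h t = (\<Sum>n. t ^ n / fact n * moment (k + n) ((L ^^ n) h))"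

text \<open>For the exponent 1 the initial moment of the \<open>n\<close>-th iterate is bounded by a
  multiple of (k+n)^n, which n! compensates up to e^(k+n).\<close>

lemma moment_L_bound:
 assumes h: "tame h" and k: "1 <= k" and c: "0 <= c" and le: "!!u. pts u ==> \<bar>h u\<bar> <= c * W k 1 u"
 shows "T ^ n / fact n * \<bar>moment (k + n) ((L ^^ n) h)\<bar> <= c * exp (real k) * \<theta> ^ n"
proof -
 have "\<bar>moment (k + n) ((L ^^ n) h)\<bar> <= ((2 * H) ^ n * c) * (real (k + n) ^ (1 + n) / real (k + n))"
  by (rule moment_bound[OF derivation_tame[OF derivation_L h] _ _ L_power_bound[OF h k c le]]) (use k c H_nonneg in auto)
 then have "T ^ n / fact n * \<bar>moment (k + n) ((L ^^ n) h)\<bar> <= T ^ n / fact n * (((2 * H) ^ n * c) * real (k + n) ^ n)" using T_nonneg k by (intro mult_left_mono) auto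
 also have "\<dots> = c * (2 * (H * T)) ^ n * (real (k + n) ^ n / fact n)" by (simp add: power_mult_distrib)
 also have "\<dots> <= c * (3 * (H * T)) ^ n * (exp (real k) * exp 1 ^ n)" using c H_nonneg T_nonneg power_fact_le[of k n] by (intro mult_mono mult_left_mono power_mono mult_nonneg_nonneg) auto
 also have "\<dots> = c * exp (real k) * \<theta> ^ n" by (simp add: power_mult_distrib)
 finally show ?thesis .
qed

context
 fixes h k c
 assumes h: "tame h" and k: "1 <= k" and c: "0 <= c" and le: "!!u. pts u ==> \<bar>h u\<bar> <= c * W k 1 u"
begin

lemma R_term_bound:
 assumes "0 <= t" "t <= T"
 shows "\<bar>t ^ n / fact n * moment (k + n) ((L ^^ n) h)\<bar> <= c * exp (real k) * \<theta> ^ n"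
proof -
 have "\<bar>t ^ n / fact n * moment (k + n) ((L ^^ n) h)\<bar> <= T ^ n / fact n * \<bar>moment (k + n) ((L ^^ n) h)\<bar>"
  using assms by (auto simp: abs_mult intro!: mult_right_mono divide_right_mono power_mono)
 then show ?thesis using moment_L_bound[OF h k c le, of n] by linarith
qed

lemma R_summable:
 assumes "0 <= t" "t <= T"
 shows "summable (%n. \<bar>t ^ n / fact n * moment (k + n) ((L ^^ n) h)\<bar>)"
proof (rule summable_comparison_test')
 show "summable (%n. c * exp (real k) * \<theta> ^ n)" using small \<theta>_nonneg by (intro summable_mult summable_geometric) simp
qed (use R_term_bound[OF assms] in simp)

lemma R_tail:
 assumes "0 <= t" "t <= T"
 shows "\<bar>(\<Sum>n<m. t ^ n / fact n * moment (k + n) ((L ^^ n) h)) - R k h t\<bar> <= c * (exp (real k) * \<theta> ^ m / (1 - \<theta>))"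
proof -
 let ?r = "%n. t ^ n / fact n * moment (k + n) ((L ^^ n) h)"
 have s: "summable (%n. \<bar>?r n\<bar>)" by (rule R_summable[OF assms])
 have sm: "summable (%n. \<bar>?r (n + m)\<bar>)" using summable_ignore_initial_segment[OF s, of m] by simp
 have "R k h t - (\<Sum>n<m. ?r n) = (\<Sum>n. ?r (n + m))" unfolding R_def using suminf_split_initial_segment[OF summable_rabs_cancel[OF s], of m] by simp
 moreover have "\<bar>\<Sum>n. ?r (n + m)\<bar> <= (\<Sum>n. \<bar>?r (n + m)\<bar>)" by (rule summable_rabs[OF sm])
 moreover have "\<dots> <= (\<Sum>n. (c * exp (real k) * \<theta> ^ m) * \<theta> ^ n)"
 proof (rule suminf_le[OF _ sm])
  show "summable (%n. (c * exp (real k) * \<theta> ^ m) * \<theta> ^ n)" using small \<theta>_nonneg by (intro summable_mult summable_geometric) simp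
  show "\<bar>?r (n + m)\<bar> <= (c * exp (real k) * \<theta> ^ m) * \<theta> ^ n" for n using R_term_bound[OF assms, of "n + m"] by (simp add: power_add mult.commute mult.left_commute)
 qed
 moreover have "\<dots> = c * (exp (real k) * \<theta> ^ m / (1 - \<theta>))" using small \<theta>_nonneg by (subst suminf_mult) (auto simp: suminf_geometric intro: summable_geometric)
 ultimately show ?thesis by linarith
qed

end

text \<open>The accumulated corrections of order 1/N. At each of the \<open>m\<close> expansion
  steps the term \<open>V h\<close> is bounded through the weight \<open>W k (i+2)\<close>, and the
  error of the next step comes with the factor 2 H and both indices raised.\<close>

fun D :: "nat => nat => nat => real" where
 "D 0 k i = 0"
| "D (Suc m) k i = T * (H / 2 * S k (i + 2) + 2 * H * D m (Suc k) (Suc i))"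

lemma D_nonneg: "1 <= k ==> 0 <= D m k i" by (induction m arbitrary: k i) (auto simp: T_nonneg H_nonneg S_nonneg)

end

locale coag_short_process = coag_short A \<B> K J mass H \<nu> T + coag_process A \<B> K J mass H \<nu> Om N Y \<sigma> X
 for A :: "'a::second_countable_topology set" and \<B> K J mass H \<nu> T
  and Om :: "'w measure" and N :: nat and Y :: "nat => 'w => 'a multiset" and \<sigma> :: "nat => 'w => ennreal"
  and X :: "real => 'w => 'a multiset"
begin

lemma \<C>_set_integrable: "tame h ==> set_integrable lborel {0..t} (\<C> n h)" unfolding \<C>_def by (rule \<E>_set_integrable[OF tame_\<C>])

lemma scaled_mono: "f v <= g v ==> scaled N f v <= scaled N g v" by (simp add: scaled_def divide_right_mono)

lemma conv_scaled_mono: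
 assumes "!!u. pts u ==> f u <= g u" "pts u"
 shows "conv (scaled N f) (%_. 1) u <= conv (scaled N g) (%_. 1) u"
proof (rule conv_mono_left)
 fix v assume "v \<subseteq># u"
 then have "pts v" using set_mset_mono assms(2) by blast
 then show "scaled N f v <= scaled N g v" by (intro scaled_mono assms(1))
qed simp

lemma conv_scaled_abs_le:
 assumes "!!u. pts u ==> \<bar>f u\<bar> <= g u" "pts u"
 shows "\<bar>conv (scaled N f) (%_. 1) u\<bar> <= conv (scaled N g) (%_. 1) u"
proof (rule conv_abs_le)
 fix v assume "v \<subseteq># u"
 then have "pts v" using set_mset_mono assms(2) by blast
 then show "\<bar>scaled N f v\<bar> <= scaled N g v" using assms(1)[of v] by (simp add: scaled_def divide_right_mono)
qed simp

lemma conv_scaled_cmult: "conv (scaled N (%u. c * h u)) (%_. 1) u = c * conv (scaled N h) (%_. 1) u" unfolding conv_cmult_left[symmetric] by (intro conv_cong) (simp_all add: scaled_def)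

lemma conv_scaled_diff: "conv (scaled N (%u. f u - g u)) (%_. 1) u = conv (scaled N f) (%_. 1) u - conv (scaled N g) (%_. 1) u"
 unfolding conv_diff_left[symmetric] by (intro conv_cong) (simp_all add: scaled_def diff_divide_distrib)

lemma conv_scaled_add: "conv (scaled N (%u. f u + g u)) (%_. 1) u = conv (scaled N f) (%_. 1) u + conv (scaled N g) (%_. 1) u"
 unfolding conv_add_left[symmetric] by (intro conv_cong) (simp_all add: scaled_def add_divide_distrib)

lemma conv_scaled_nonneg: "(!!u. 0 <= h u) ==> 0 <= conv (scaled N h) (%_. 1) u" by (intro conv_nonneg) (auto simp: scaled_def)

lemma \<C>_mono: "tame f ==> tame g ==> 0 <= t ==> (!!u. pts u ==> f u <= g u) ==> \<C> n f t <= \<C> n g t" unfolding \<C>_def by (intro \<E>_mono tame_\<C> conv_scaled_mono)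

lemma \<C>_abs_le: "tame f ==> tame g ==> 0 <= t ==> (!!u. pts u ==> \<bar>f u\<bar> <= g u) ==> \<bar>\<C> n f t\<bar> <= \<C> n g t"
 unfolding \<C>_def by (intro \<E>_abs_le tame_\<C> conv_scaled_abs_le)

lemma \<C>_cmult: "\<C> n (%u. c * h u) t = c * \<C> n h t" unfolding \<C>_def conv_scaled_cmult[abs_def] by (simp add: \<E>_cmult[symmetric] conv_scaled_cmult)

lemma \<C>_diff: "tame f ==> tame g ==> 0 <= t ==> \<C> n (%u. f u - g u) t = \<C> n f t - \<C> n g t"
 unfolding \<C>_def using \<E>_diff[OF tame_\<C> tame_\<C>, of f g t n] by (simp add: conv_scaled_diff[abs_def])

lemma W_initial_le:
 assumes "1 <= k"
 shows "\<C> n (W k i) 0 <= real k ^ i / real k"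
proof -
 have W0: "W k i u = 0" if "size u ~= k" for u using that by (simp add: W_def)
 note int = integral_initial[OF prob_space_axioms N_pos X_measurable[OF order_refl] ppp tame_W W0]
 have "\<C> n (W k i) 0 <= (LINT w|Om. conv (scaled N (W k i)) (%_. 1) (X 0 w))" unfolding \<C>_def \<E>_def
  by (intro integral_mono loc_integrable tame_\<C> tame_W int) (auto simp: loc_def intro: conv_scaled_nonneg W_nonneg)
 also have "\<dots> = moment k (W k i)" by (rule int)
 also have "\<dots> <= 1 * (real k ^ i / real k)" using moment_bound[OF tame_W assms, of 1 k i i] by (simp add: W_nonneg)
 finally show ?thesis by simp
qed

text \<open>Iterates the hierarchy with the gain as an upper bound for the right-hand side. The
  iteration is finite: a configuration of total mass at most \<open>n\<close> has at most
  \<open>n\<close> particles, hence no sub-configuration of k+M > n particles, so the localized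
  moment at the end is 0.\<close>

lemma W_bound_aux:
 "1 <= k ==> n < k + M ==> 0 <= t ==>
  \<C> n (W k i) t <= (\<Sum>j<M. (H * t) ^ j / fact j * (real (k + j) ^ (i + j) / real (k + j)))"
proof (induction M arbitrary: k i t)
 case 0
 have "loc n (conv (scaled N (W k i)) (%_. 1)) u = 0" if x: "pts u" for u
 proof (cases "total u <= n")
  case True
  have "conv (scaled N (W k i)) (%_. 1) u = conv (%_. 0) (%_. 1) u"
  proof (rule conv_cong)
   fix v assume "v \<subseteq># u"
   then have "size v <= n" using size_mset_mono[of v u] size_le_total[OF x] True by simp
   then show "scaled N (W k i) v = 0" using 0 by (simp add: scaled_def W_def)
  qed simp
  then show ?thesis by (simp add: loc_def)
 qed (simp add: loc_def)
 then have "\<C> n (W k i) t = (LINT w|Om. 0)" unfolding \<C>_def \<E>_def using X_space[OF \<open>0 <= t\<close>] by (intro LINT_cong) auto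
 then show ?case by simp
next
 case (Suc M)
 let ?h = "%u. L (W k i) u - V u * W k i u / N"
 let ?c = "%j. H ^ Suc j / fact j * (real (k + Suc j) ^ (i + Suc j) / real (k + Suc j))"
 have th: "tame ?h" using tame_diff[OF tame_L[OF tame_W[of k i]] tame_cmult[OF tame_mult[OF tame_V tame_W[of k i]], of "1 / N"]] by simp
 have "\<C> n (W k i) t = \<C> n (W k i) 0 + (LBINT s:{0..t}. \<C> n ?h s)" by (rule hierarchy[OF tame_W Suc.prems(3)])
 also have "\<dots> <= real k ^ i / real k + (LBINT s:{0..t}. (\<Sum>j<M. ?c j * s ^ j))"
 proof (intro add_mono W_initial_le Suc.prems set_integral_mono \<C>_set_integrable th)
  show "set_integrable lborel {0..t} (%s. \<Sum>j<M. ?c j * s ^ j)" by (rule integral_poly_Icc[OF Suc.prems(3)])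
  fix s assume s: "s : {0..t}"
  have "\<C> n ?h s <= \<C> n (%u. H * W (Suc k) (Suc i) u) s"
  proof (rule \<C>_mono[OF th tame_cmult[OF tame_W]])
   fix u assume u: "pts u"
   have "L (W k i) u <= Lplus (W k i) u" unfolding L_def Lplus_def by (intro pair_sum_mono mult_left_mono) (use u K_nonneg W_nonneg in \<open>auto simp: algebra_simps add_nonneg_nonneg\<close>)
   then show "?h u <= H * W (Suc k) (Suc i) u"
    using Lplus_W[OF u Suc.prems(1), of i] V_bounds(1)[OF u] W_nonneg[of k i u] divide_nonneg_nonneg[of "V u * W k i u" "real N"] mult_nonneg_nonneg[of "V u" "W k i u"] by linarith
  qed (use s in simp)
  also have "\<dots> = H * \<C> n (W (Suc k) (Suc i)) s" by (rule \<C>_cmult)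
  also have "\<dots> <= H * (\<Sum>j<M. (H * s) ^ j / fact j * (real (Suc k + j) ^ (Suc i + j) / real (Suc k + j)))" using Suc.prems s H_nonneg by (intro mult_left_mono Suc.IH) auto
  also have "\<dots> = (\<Sum>j<M. ?c j * s ^ j)" unfolding sum_distrib_left by (intro sum.cong refl) (simp add: power_mult_distrib)
  finally show "\<C> n ?h s <= (\<Sum>j<M. ?c j * s ^ j)" .
 qed
 also have "(LBINT s:{0..t}. (\<Sum>j<M. ?c j * s ^ j)) = (\<Sum>j<M. ?c j * (t ^ Suc j / real (Suc j)))" by (rule integral_poly_Icc[OF Suc.prems(3)])
 also have "real k ^ i / real k + \<dots> = (\<Sum>j<Suc M. (H * t) ^ j / fact j * (real (k + j) ^ (i + j) / real (k + j)))"
  unfolding sum.lessThan_Suc_shift by (simp add: power_mult_distrib mult.assoc mult.left_commute mult.commute)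
 finally show ?case .
qed

lemma W_bound:
 assumes k: "1 <= k" and t: "0 <= t" "t <= T"
 shows "\<C> n (W k i) t <= S k i"
proof -
 have "\<C> n (W k i) t <= (\<Sum>j<Suc n. (H * t) ^ j / fact j * (real (k + j) ^ (i + j) / real (k + j)))" by (rule W_bound_aux) (use k t in auto)
 also have "\<dots> <= (\<Sum>j<Suc n. coeff k i j)" unfolding coeff_def using t H_nonneg by (intro sum_mono mult_right_mono divide_right_mono power_mono mult_left_mono) auto
 also have "\<dots> <= S k i" by (rule sum_coeff_le[OF k])
 finally show ?thesis .
qed

text \<open>Taylor's formula for the hierarchy. Each step replaces \<open>h\<close> by
  \<open>L h\<close>, with the constant 2 H c and both indices raised, and leaves behind the
  correction \<open>V h / N\<close>. The remainder is bounded by \<open>W_bound\<close> at the end,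
  so no bound on the signed iterates beyond \<open>L_bound\<close> is needed.\<close>

lemma expansion_bound:
 "tame h ==> 1 <= k ==> 0 <= c ==> (!!u. pts u ==> \<bar>h u\<bar> <= c * W k i u) ==> 0 <= t ==> t <= T ==>
  \<bar>\<C> n h t - (\<Sum>j<m. t ^ j / fact j * \<C> n ((L ^^ j) h) 0)\<bar> <= c * ((2 * H * t) ^ m / fact m * S (k + m) (i + m) + D m k i / N)"
proof (induction m arbitrary: h k i c t)
 case 0
 have "\<bar>\<C> n h t\<bar> <= \<C> n (%u. c * W k i u) t" using 0 by (intro \<C>_abs_le tame_cmult tame_W) auto
 also have "\<dots> <= c * S k i" unfolding \<C>_cmult using 0 by (intro mult_left_mono W_bound) auto
 finally show ?case by simp
next
 case (Suc m)
 note h = Suc.prems(1) and k = Suc.prems(2) and c = Suc.prems(3) and le = Suc.prems(4) and t = Suc.prems(5,6)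
 let ?v = "%u. V u * h u / N"
 let ?p = "%s. \<Sum>j<m. s ^ j / fact j * \<C> n ((L ^^ j) (L h)) 0"
 have tv: "tame ?v" using tame_cmult[OF tame_mult[OF tame_V h], of "1 / N"] by simp
 have tL: "tame (L h)" by (rule tame_L[OF h])
 have p: "?p s = (\<Sum>j<m. \<C> n ((L ^^ j) (L h)) 0 / fact j * s ^ j)" for s by (intro sum.cong) auto
 have pint: "set_integrable lborel {0..t} ?p" unfolding p by (rule integral_poly_Icc[OF t(1)])
 have P: "(\<Sum>j<Suc m. t ^ j / fact j * \<C> n ((L ^^ j) h) 0) = \<C> n h 0 + (LBINT s:{0..t}. ?p s)"
 proof -
  have "(LBINT s:{0..t}. ?p s) = (\<Sum>j<m. \<C> n ((L ^^ j) (L h)) 0 / fact j * (t ^ Suc j / real (Suc j)))" unfolding p by (rule integral_poly_Icc[OF t(1)])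
  also have "\<dots> = (\<Sum>j<m. t ^ Suc j / fact (Suc j) * \<C> n ((L ^^ Suc j) h) 0)" by (intro sum.cong refl) (simp add: funpow_Suc_right mult.commute del: funpow.simps)
  finally show ?thesis unfolding sum.lessThan_Suc_shift by simp
 qed
 \<comment> \<open>The first summand is the induction hypothesis for \<open>L h\<close>, the second
   bounds the moment of \<open>V h / N\<close>, where \<open>V\<close> adds H/2 and two powers of
   the total mass to the weight.\<close>
 let ?B = "%s. (2 * H * c) * ((2 * H * s) ^ m / fact m * S (Suc k + m) (Suc i + m) + D m (Suc k) (Suc i) / N) + c * (H / 2 * S k (i + 2)) / N"
 have eq: "\<C> n h t - (\<Sum>j<Suc m. t ^ j / fact j * \<C> n ((L ^^ j) h) 0) = (LBINT s:{0..t}. \<C> n (%u. L h u - ?v u) s - ?p s)"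
  unfolding P hierarchy[OF h t(1)] using \<C>_set_integrable[OF tame_diff[OF tL tv]] pint by (subst set_integral_diff) auto
 have "\<bar>\<dots>\<bar> <= (LBINT s:{0..t}. ?B s)"
 proof (rule set_integral_abs_le)
  show "set_integrable lborel {0..t} (%s. \<C> n (%u. L h u - ?v u) s - ?p s)" using \<C>_set_integrable[OF tame_diff[OF tL tv]] pint by (intro set_integral_diff) auto
  show "set_integrable lborel {0..t} ?B" using t integral_power_Icc[of t m] borel_integrable_atLeastAtMost' unfolding set_integrable_def[symmetric]
   by (intro borel_integrable_atLeastAtMost' continuous_intros) auto
  fix s assume s: "0 <= s" "s <= t"
  have "\<bar>\<C> n (L h) s - ?p s\<bar> <= (2 * H * c) * ((2 * H * s) ^ m / fact m * S (Suc k + m) (Suc i + m) + D m (Suc k) (Suc i) / N)"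
   by (rule Suc.IH[OF tL _ _ L_bound[OF _ k h c le]]) (use s t c H_nonneg in auto)
  moreover have "\<bar>\<C> n ?v s\<bar> <= c * (H / 2 * S k (i + 2)) / N"
  proof -
   have "\<bar>\<C> n ?v s\<bar> <= \<C> n (%u. (c * (H / 2) / N) * W k (i + 2) u) s"
   proof (intro \<C>_abs_le tv tame_cmult tame_W s)
    fix u assume u: "pts u"
    have "\<bar>V u * h u\<bar> <= (H / 2 * (real (total u))\<^sup>2) * (c * W k i u)" unfolding abs_mult using V_bounds[OF u] le[OF u] by (intro mult_mono) auto
    also have "\<dots> = c * (H / 2) * W k (i + 2) u" by (simp add: W_def power_add power2_eq_square)
    finally have "\<bar>V u * h u\<bar> <= c * (H / 2) * W k (i + 2) u" .
    from divide_right_mono[OF this, of "real N"] show "\<bar>?v u\<bar> <= (c * (H / 2) / N) * W k (i + 2) u" by simp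
   qed
   also have "\<dots> <= (c * (H / 2) / N) * S k (i + 2)" unfolding \<C>_cmult using k c H_nonneg s t by (intro mult_left_mono W_bound) auto
   finally show ?thesis by simp
  qed
  moreover have "\<C> n (%u. L h u - ?v u) s = \<C> n (L h) s - \<C> n ?v s" by (rule \<C>_diff[OF tL tv s(1)])
  ultimately show "\<bar>\<C> n (%u. L h u - ?v u) s - ?p s\<bar> <= ?B s" by linarith
 qed
 also have "(LBINT s:{0..t}. ?B s) = c * ((2 * H * t) ^ Suc m / fact (Suc m) * S (Suc k + m) (Suc i + m) + t * (2 * H * D m (Suc k) (Suc i) + H / 2 * S k (i + 2)) / N)"
 proof -
  let ?a = "2 * H * c * ((2 * H) ^ m / fact m * S (Suc k + m) (Suc i + m))" and ?b = "2 * H * c * D m (Suc k) (Suc i) / N + c * (H / 2 * S k (i + 2)) / N"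
  have "(LBINT s:{0..t}. ?B s) = (LBINT s:{0..t}. ?a * s ^ m + ?b * s ^ 0)" by (intro set_lebesgue_integral_cong) (auto simp: power_mult_distrib algebra_simps)
  also have "\<dots> = ?a * (t ^ Suc m / real (Suc m)) + ?b * (t ^ Suc 0 / real (Suc 0))"
   using t by (subst set_integral_add) (auto intro!: set_integrable_mult_right integral_power_Icc simp: integral_power_Icc simp del: power_Suc power_0 of_nat_Suc)
  also have "\<dots> = c * ((2 * H * t) ^ Suc m / fact (Suc m) * S (Suc k + m) (Suc i + m) + t * (2 * H * D m (Suc k) (Suc i) + H / 2 * S k (i + 2)) / N)"
   using N_pos by (simp add: power_mult_distrib field_simps)
  finally show ?thesis .
 qed
 also have "\<dots> <= c * ((2 * H * t) ^ Suc m / fact (Suc m) * S (k + Suc m) (i + Suc m) + D (Suc m) k i / N)"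
 proof -
  have "t * (2 * H * D m (Suc k) (Suc i) + H / 2 * S k (i + 2)) <= D (Suc m) k i" using t D_nonneg[of "Suc k" m "Suc i"] S_nonneg[OF k] H_nonneg by (simp add: add.commute mult_right_mono)
  then have "t * (2 * H * D m (Suc k) (Suc i) + H / 2 * S k (i + 2)) / N <= D (Suc m) k i / N" by (rule divide_right_mono) simp
  then show ?thesis using c by (intro mult_left_mono) (simp_all del: D.simps power_Suc fact_Suc)
 qed
 finally show ?case unfolding eq .
qed

definition \<F> :: "('a multiset => real) => real => real" where
 "\<F> h t = (LINT w|Om. conv (scaled N h) (%_. 1) (X t w))"

lemma loc_tendsto: "(%n. loc n g u) \<longlonglongrightarrow> g u" by (rule tendsto_eventually, rule eventually_sequentiallyI[of "total u"]) (simp add: loc_def)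

lemma scaled_X_measurable: "tame h ==> 0 <= t ==> (%w. conv (scaled N h) (%_. 1) (X t w)) : BM Om" by (rule mcomp[OF X_measurable tame_measurable[OF tame_\<C>]])

text \<open>The localized moments increase with \<open>n\<close> and are bounded by
  \<open>S k i\<close> uniformly in \<open>n\<close>; monotone convergence removes the
  localization.\<close>

lemma W_full:
 assumes k: "1 <= k" and t: "0 <= t" "t <= T"
 shows "integrable Om (%w. conv (scaled N (W k i)) (%_. 1) (X t w))" "\<F> (W k i) t <= S k i"
proof -
 let ?G = "conv (scaled N (W k i)) (%_. 1)"
 have G: "tame ?G" by (rule tame_\<C>[OF tame_W])
 have nn: "0 <= ?G u" for u by (intro conv_scaled_nonneg W_nonneg)
 have inc: "incseq (%n. loc n ?G u)" for u using nn by (auto simp: incseq_def loc_def)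
 have "incseq (%n. \<C> n (W k i) t)" unfolding incseq_def \<C>_def \<E>_def using inc by (auto intro!: integral_mono loc_integrable G t simp: incseq_def)
 then obtain l where l: "(%n. \<C> n (W k i) t) \<longlonglongrightarrow> l" using W_bound[OF k t] incseq_convergent[of "%n. \<C> n (W k i) t" "S k i"] by metis
 have a: "AE w in Om. mono (%n. loc n ?G (X t w))" and b: "AE w in Om. (%n. loc n ?G (X t w)) \<longlonglongrightarrow> ?G (X t w)" using inc loc_tendsto by auto
 note mc = loc_integrable[OF G t(1)] a b l[unfolded \<C>_def \<E>_def] scaled_X_measurable[OF tame_W t(1)]
 show "integrable Om (%w. ?G (X t w))" by (rule integrable_monotone_convergence[OF mc])
 have "\<F> (W k i) t = l" unfolding \<F>_def by (rule integral_monotone_convergence[OF mc])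
 then show "\<F> (W k i) t <= S k i" using LIMSEQ_le_const2[OF l] W_bound[OF k t] by blast
qed

context
 fixes h k c i t
 assumes h: "tame h" and k: "1 <= k" and c: "0 <= c" and le: "!!u. pts u ==> \<bar>h u\<bar> <= c * W k i u"
  and t: "0 <= t" "t <= T"
begin

lemma scaled_le_W: "pts u ==> \<bar>conv (scaled N h) (%_. 1) u\<bar> <= c * conv (scaled N (W k i)) (%_. 1) u" unfolding conv_scaled_cmult[symmetric] by (intro conv_scaled_abs_le le)

lemma \<F>_integrable: "integrable Om (%w. conv (scaled N h) (%_. 1) (X t w))"
proof (rule Bochner_Integration.integrable_bound[OF _ scaled_X_measurable[OF h t(1)]])
 show "integrable Om (%w. c * conv (scaled N (W k i)) (%_. 1) (X t w))" using W_full(1)[OF k t] by simp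
 show "AE w in Om. norm (conv (scaled N h) (%_. 1) (X t w)) <= norm (c * conv (scaled N (W k i)) (%_. 1) (X t w))"
 proof (rule AE_I2)
  fix w assume "w : space Om"
  from scaled_le_W[OF X_space[OF t(1) this]]
  show "norm (conv (scaled N h) (%_. 1) (X t w)) <= norm (c * conv (scaled N (W k i)) (%_. 1) (X t w))" by simp
 qed
qed

lemma \<F>_abs_le: "\<bar>\<F> h t\<bar> <= c * S k i"
proof -
 have "\<bar>\<F> h t\<bar> <= (LINT w|Om. \<bar>conv (scaled N h) (%_. 1) (X t w)\<bar>)" unfolding \<F>_def by (rule integral_abs_bound)
 also have "\<dots> <= (LINT w|Om. c * conv (scaled N (W k i)) (%_. 1) (X t w))" using scaled_le_W X_space[OF t(1)] \<F>_integrable W_full(1)[OF k t, of i] by (intro integral_mono) auto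
 also have "\<dots> <= c * S k i" using W_full(2)[OF k t, of i] c by (simp add: \<F>_def mult_left_mono)
 finally show ?thesis .
qed

lemma \<C>_tendsto: "(%n. \<C> n h t) \<longlonglongrightarrow> \<F> h t" unfolding \<C>_def \<E>_def \<F>_def
proof (rule integral_dominated_convergence)
 let ?G = "conv (scaled N h) (%_. 1)" and ?W = "conv (scaled N (W k i)) (%_. 1)"
 show "integrable Om (%w. c * ?W (X t w))" using W_full(1)[OF k t] by simp
 show "AE w in Om. (%n. loc n ?G (X t w)) \<longlonglongrightarrow> ?G (X t w)" using loc_tendsto by auto
 show "AE w in Om. norm (loc n ?G (X t w)) <= c * ?W (X t w)" for n using scaled_le_W X_space[OF t(1)] c conv_scaled_nonneg[OF W_nonneg[of k i]] by (intro AE_I2) (auto simp: loc_def)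
qed (use scaled_X_measurable[OF h t(1)] loc_integrable[OF tame_\<C>[OF h] t(1)] in auto)

end

lemma \<F>_initial:
 assumes h: "tame h" and k: "1 <= k" and c: "0 <= c" and le: "!!u. pts u ==> \<bar>h u\<bar> <= c * W k i u"
 shows "\<F> h 0 = moment k h"
proof -
 \<comment> \<open>The weight bound makes \<open>h\<close> vanish on configurations of other sizes
   only within the space of particles; the initial moments ask for vanishing everywhere.\<close>
 let ?h = "%u. if size u = k then h u else 0"
 have eq: "h u = ?h u" if "pts u" for u using le[OF that] by (auto simp: W_def)
 have th: "tame ?h" by (rule tame_cong[OF h eq])
 have "\<F> h 0 = \<F> ?h 0" unfolding \<F>_def
 proof (intro LINT_cong refl conv_cong)
  fix w v assume "w : space Om" "v \<subseteq># X 0 w"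
  then have "pts v" using X_space[OF order_refl] set_mset_mono by blast
  then show "scaled N h v = scaled N ?h v" using eq by (simp add: scaled_def)
 qed
 also have "\<dots> = moment k ?h" unfolding \<F>_def by (rule integral_initial(2)[OF prob_space_axioms N_pos X_measurable[OF order_refl] ppp th]) simp
 also have "\<dots> = moment k h" using eq by (intro moment_cong) simp
 finally show ?thesis .
qed

text \<open>The localization in \<open>expansion_bound\<close> is removed by dominated convergence,
  and the initial factorial moments are exact. Of the two equal geometric errors one is the
  remainder of the expansion and the other the tail of the series \<open>R\<close>. The bound
  depends on \<open>h\<close> only through \<open>c\<close> and \<open>k\<close>.\<close>

theorem \<F>_expansion:
 assumes h: "tame h" and k: "1 <= k" and c: "0 <= c" and le: "!!u. pts u ==> \<bar>h u\<bar> <= c * W k 1 u"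
  and t: "0 <= t" "t <= T"
 shows "\<bar>\<F> h t - R k h t\<bar> <= c * (2 * (exp (real k) * \<theta> ^ m / (1 - \<theta>)) + D m k 1 / N)"
proof -
 let ?s = "\<Sum>j<m. t ^ j / fact j * moment (k + j) ((L ^^ j) h)"
 have "(%n. \<bar>\<C> n h t - (\<Sum>j<m. t ^ j / fact j * \<C> n ((L ^^ j) h) 0)\<bar>) \<longlonglongrightarrow> \<bar>\<F> h t - (\<Sum>j<m. t ^ j / fact j * \<F> ((L ^^ j) h) 0)\<bar>"
  using k c H_nonneg T_nonneg L_power_bound[OF h k c le] by (intro tendsto_rabs tendsto_diff tendsto_sum tendsto_mult tendsto_const \<C>_tendsto[OF h k c le t]
   \<C>_tendsto[OF derivation_tame[OF derivation_L h], where k = "k + j" and i = "1 + j" and c = "(2 * H) ^ j * c" for j]) auto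
 moreover have "\<F> ((L ^^ j) h) 0 = moment (k + j) ((L ^^ j) h)" for j using k c H_nonneg by (intro \<F>_initial[OF derivation_tame[OF derivation_L h] _ _ L_power_bound[OF h k c le]]) auto
 ultimately have "(%n. \<bar>\<C> n h t - (\<Sum>j<m. t ^ j / fact j * \<C> n ((L ^^ j) h) 0)\<bar>) \<longlonglongrightarrow> \<bar>\<F> h t - ?s\<bar>" by simp
 then have "\<bar>\<F> h t - ?s\<bar> <= c * ((2 * H * t) ^ m / fact m * S (k + m) (1 + m) + D m k 1 / N)" using expansion_bound[OF h k c le t] by (intro LIMSEQ_le_const2) blast+
 also have "\<dots> <= c * ((2 * H * T) ^ m / fact m * S (k + m) (1 + m) + D m k 1 / N)"
  using t H_nonneg S_nonneg[of "k + m" "1 + m"] k c by (intro mult_left_mono add_mono mult_right_mono divide_right_mono power_mono) auto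
 also have "\<dots> <= c * (exp (real k) * \<theta> ^ m / (1 - \<theta>) + D m k 1 / N)" using c by (intro mult_left_mono add_mono S_tail k) auto
 finally have "\<bar>\<F> h t - ?s\<bar> <= c * (exp (real k) * \<theta> ^ m / (1 - \<theta>) + D m k 1 / N)" .
 then have "\<bar>\<F> h t - R k h t\<bar> <= c * (exp (real k) * \<theta> ^ m / (1 - \<theta>) + D m k 1 / N) + c * (exp (real k) * \<theta> ^ m / (1 - \<theta>))"
  using R_tail[OF h k c le t, of m] by linarith
 then show ?thesis by (simp add: algebra_simps)
qed

end

section \<open>The limiting functionals: product rule, derivative and representing measures\<close>

text \<open>Continuity along sets decreasing to the empty set makes the values on indicators a
  finite measure. Only such continuity is asked for, not monotone continuity for functions;
  functions are reached by uniform approximation with simple ones and positivity.\<close>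

lemma bounded_functional_measure:
 fixes M :: "'b measure" and \<Phi> :: "('b => real) => real"
 defines "bm \<equiv> {f : BM M. EX c. ALL x:space M. \<bar>f x\<bar> <= c}"
 assumes add: "!!f g. f : bm ==> g : bm ==> \<Phi> (%x. f x + g x) = \<Phi> f + \<Phi> g"
  and cmult: "!!c f. f : bm ==> \<Phi> (%x. c * f x) = c * \<Phi> f"
  and pos: "!!f. f : bm ==> (!!x. x : space M ==> 0 <= f x) ==> 0 <= \<Phi> f"
  and cont: "!!B :: nat => 'b set. range B \<subseteq> sets M ==> decseq B ==> (\<Inter>i. B i) = {} ==> (%i. \<Phi> (ind (B i))) \<longlonglongrightarrow> 0"
 shows "\<exists>\<rho>. finite_measure \<rho> & sets \<rho> = sets M & (ALL f:bm. \<Phi> f = (LINT x|\<rho>. f x))"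
proof -
 have ind: "ind B : bm" if "B : sets M" for B unfolding bm_def using that by (auto intro!: exI[of _ 1] simp: indicator_def)
 have bm_add: "(%x. f x + g x) : bm" if fg: "f : bm" "g : bm" for f g
 proof -
  obtain c d where "ALL x:space M. \<bar>f x\<bar> <= c" "ALL x:space M. \<bar>g x\<bar> <= d" using fg by (auto simp: bm_def)
  then have "ALL x:space M. \<bar>f x + g x\<bar> <= c + d" by (auto intro: order_trans[OF abs_triangle_ineq add_mono])
  then show ?thesis using fg unfolding bm_def by auto
 qed
 have bm_cmult: "(%x. c * f x) : bm" if f: "f : bm" for c f
 proof -
  obtain d where "ALL x:space M. \<bar>f x\<bar> <= d" using f by (auto simp: bm_def)
  then have "ALL x:space M. \<bar>c * f x\<bar> <= \<bar>c\<bar> * d" by (auto simp: abs_mult intro: mult_left_mono)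
  then show ?thesis using f unfolding bm_def by auto
 qed
 have mono: "\<Phi> f <= \<Phi> g" if fg: "f : bm" "g : bm" and le: "!!x. x : space M ==> f x <= g x" for f g
 proof -
  have "0 <= \<Phi> (%x. g x + -1 * f x)" using le by (intro pos bm_add bm_cmult fg) auto
  also have "\<dots> = \<Phi> g + -1 * \<Phi> f" using add[OF fg(2) bm_cmult[OF fg(1), of "-1"]] cmult[OF fg(1), of "-1"] by simp
  finally show ?thesis by simp
 qed
 have cong: "\<Phi> f = \<Phi> g" if "f : bm" "g : bm" "!!x. x : space M ==> f x = g x" for f g using mono[OF that(1,2)] mono[OF that(2,1)] that(3) by force
 define \<rho> where "\<rho> = measure_of (space M) (sets M) (%B. ennreal (\<Phi> (ind B)))"
 have "positive (sets M) (%B. ennreal (\<Phi> (ind B)))"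
 proof -
  have "ind {} = (%x. 0 * ind {} x :: real)" by (auto simp: indicator_def)
  then have "\<Phi> (ind {}) = \<Phi> (%x. 0 * ind {} x)" by (rule arg_cong[where f = \<Phi>])
  also have "\<dots> = 0 * \<Phi> (ind {})" by (rule cmult[OF ind]) simp
  finally show ?thesis by (simp add: positive_def)
 qed
 moreover have "Measure_Space.additive (sets M) (%B. ennreal (\<Phi> (ind B)))" unfolding Measure_Space.additive_def
 proof (intro ballI impI)
  fix B C assume BC: "B : sets M" "C : sets M" "B \<inter> C = {}"
  have "\<Phi> (ind (B \<union> C)) = \<Phi> (%x. ind B x + ind C x)" using BC by (auto simp: indicator_add)
  also have "\<dots> = \<Phi> (ind B) + \<Phi> (ind C)" using BC by (intro add ind)
  finally show "ennreal (\<Phi> (ind (B \<union> C))) = ennreal (\<Phi> (ind B)) + ennreal (\<Phi> (ind C))" using pos[OF ind] BC by (simp add: ennreal_plus)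
 qed
 moreover have "(%i. ennreal (\<Phi> (ind (B i)))) \<longlonglongrightarrow> 0"
  if "range B \<subseteq> sets M" "decseq B" "(\<Inter>i. B i) = {}" for B :: "nat => 'b set" using tendsto_ennrealI[OF cont[OF that]] by simp
 ultimately have em: "emeasure \<rho> B = ennreal (\<Phi> (ind B))" if "B : sets M" for B unfolding \<rho>_def using that
  by (intro emeasure_measure_of_sigma[OF sets.sigma_algebra_axioms] sets.empty_continuous_imp_countably_additive) auto
 have sets: "sets \<rho> = sets M" and sp: "space \<rho> = space M" unfolding \<rho>_def by (simp_all add: sets.sigma_sets_eq sets.space_closed)
 have fin: "finite_measure \<rho>" by (rule finite_measureI) (simp add: sp em)
 interpret finite_measure \<rho> by (rule fin)
 have me: "measure \<rho> B = \<Phi> (ind B)" if "B : sets M" for B using em[OF that] pos[OF ind[OF that]] by (simp add: measure_def)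
 have one: "(%_. 1) : bm" by (auto simp: bm_def)
 have const: "(%_. c) : bm" "\<Phi> (%_. c) = c * \<Phi> (%_. 1)" for c using cmult[OF one, of c] by (auto simp: bm_def)
 have int: "integrable \<rho> f" if f: "f : bm" for f
 proof -
  obtain c where "!!x. x : space M ==> \<bar>f x\<bar> <= c" using f by (auto simp: bm_def)
  then show ?thesis by (intro integrable_const_bound[of _ c]) (use f in \<open>auto simp: bm_def sp measurable_cong_sets[OF sets refl]\<close>)
 qed
 have unit: "\<Phi> f = (LINT x|\<rho>. f x)" if f: "f : bm" and 01: "!!x. x : space M ==> 0 <= f x & f x <= 1" for f
 proof -
  \<comment> \<open>Greedy binary expansion of \<open>f\<close>: the digit 2^-(n+1) is added
    wherever it still fits, so that \<open>F n\<close> is simple and within 2^-n below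
    \<open>f\<close>.\<close>
  define F :: "nat => 'b => real" where
   "F = rec_nat (%_. 0) (%n g x. g x + (1 / 2) ^ Suc n * ind {x : space M. g x + (1 / 2) ^ Suc n <= f x} x)"
  have F: "F n : bm & (ALL x:space M. F n x <= f x & f x <= F n x + (1 / 2) ^ n) & \<Phi> (F n) = (LINT x|\<rho>. F n x)" for n
  proof (induction n)
   case 0
   show ?case using 01 cmult[OF one, of 0] by (auto simp: F_def bm_def)
  next
   case (Suc n)
   define e :: real where "e = (1 / 2) ^ Suc n"
   let ?B = "{x : space M. F n x + e <= f x}"
   have B: "?B : sets M" using Suc f by (auto simp: bm_def)
   have Fn: "F (Suc n) = (%x. F n x + e * ind ?B x)" and e: "(1 / 2) ^ n = 2 * e" by (simp_all add: F_def e_def)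
   have "\<Phi> (F (Suc n)) = (LINT x|\<rho>. F (Suc n) x)" using add[OF _ bm_cmult[OF ind[OF B]], of "F n" e] cmult[OF ind[OF B], of e] Suc int B me[OF B] by (simp add: Fn sets ind sp Int_absorb2)
   then show ?case using Suc bm_add[OF _ bm_cmult[OF ind[OF B]], of "F n" e] by (auto simp: Fn e e_def[symmetric] indicator_def simp del: power_Suc)
  qed
  have "\<bar>\<Phi> f - (LINT x|\<rho>. f x)\<bar> <= 0"
  proof (rule LIMSEQ_le_const)
   show "(%n. (1 / 2) ^ n * \<Phi> (%_. 1)) \<longlonglongrightarrow> 0" by real_asymp
   have "\<bar>\<Phi> f - (LINT x|\<rho>. f x)\<bar> <= (1 / 2) ^ n * \<Phi> (%_. 1)" for n
   proof -
    have Fn: "F n : bm" "!!x. x : space M ==> F n x <= f x & f x <= F n x + (1 / 2) ^ n" "\<Phi> (F n) = (LINT x|\<rho>. F n x)" using F[of n] by auto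
    have "\<Phi> (F n) <= \<Phi> f" "\<Phi> f <= \<Phi> (%x. F n x + (1 / 2) ^ n)" using Fn(2) by (auto intro!: mono bm_add const Fn(1) f)
    moreover have "(LINT x|\<rho>. F n x) <= (LINT x|\<rho>. f x)" "(LINT x|\<rho>. f x) <= (LINT x|\<rho>. F n x + (1 / 2) ^ n)"
     using Fn(2) by (auto intro!: integral_mono int bm_add const Fn(1) f simp: sp)
    moreover have "(LINT x|\<rho>. F n x + (1 / 2) ^ n) = \<Phi> (F n) + (1 / 2) ^ n * \<Phi> (%_. 1)" using Fn int cong[OF one ind[OF sets.top]] me[OF sets.top] by (simp add: sp)
    ultimately show ?thesis using Fn(3) add[OF Fn(1) const(1)] const(2)[of "(1 / 2) ^ n"] by simp
   qed
   then show "EX N. ALL n>=N. \<bar>\<Phi> f - (LINT x|\<rho>. f x)\<bar> <= (1 / 2) ^ n * \<Phi> (%_. 1)" by blast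
  qed
  then show ?thesis by simp
 qed
 have "\<Phi> f = (LINT x|\<rho>. f x)" if f: "f : bm" for f
 proof -
  obtain d where "!!x. x : space M ==> \<bar>f x\<bar> <= d" using f by (auto simp: bm_def)
  moreover define c where "c = max 1 d"
  ultimately have c: "0 < c" "!!x. x : space M ==> \<bar>f x\<bar> <= c" by (auto simp: le_max_iff_disj)
  \<comment> \<open>Maps the range [-c, c] of \<open>f\<close> into the unit interval.\<close>
  let ?g = "%x. 1 / (2 * c) * f x + 1 / 2"
  have g: "?g : bm" by (intro bm_add bm_cmult f const)
  have "0 <= c + f x & f x <= c" if "x : space M" for x using c(2)[OF that] by auto
  then have "\<Phi> ?g = (LINT x|\<rho>. ?g x)" using c(1) by (intro unit g) (auto simp: field_simps)
  moreover have "\<Phi> ?g = 1 / (2 * c) * \<Phi> f + 1 / 2 * \<Phi> (%_. 1)" using add[OF bm_cmult[OF f] const(1), of "1 / (2 * c)" "1 / 2"] cmult[OF f, of "1 / (2 * c)"] const(2)[of "1 / 2"] by simp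
  moreover have "(LINT x|\<rho>. ?g x) = 1 / (2 * c) * (LINT x|\<rho>. f x) + 1 / 2 * \<Phi> (%_. 1)" using int[OF f] unit[OF one] by simp
  ultimately show ?thesis using c(1) by simp
 qed
 then show ?thesis using fin sets by blast
qed

lemma (in coag_kernel) L_size:
 assumes "!!u. size u ~= k ==> g u = 0" "size u ~= k + n"
 shows "(L ^^ n) g u = 0" using assms(2)
proof (induction n arbitrary: u)
 case (Suc n)
 have "L ((L ^^ n) g) u = pair_sum (%a b v. 0) u" unfolding L_def[of "(L ^^ n) g"]
 proof (rule pair_sum_cong)
  fix a b v assume "add_mset a (add_mset b v) = u"
  then have "size v + 2 ~= k + Suc n" using Suc.prems by auto
  then have "(L ^^ n) g (add_mset z v) = 0" for z by (intro Suc.IH) simp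
  then show "K a b * (jint ((L ^^ n) g) a b v - (L ^^ n) g (add_mset a v) - (L ^^ n) g (add_mset b v)) = 0" by (simp add: jint_def)
 qed
 then show ?case by (simp add: pair_sum_zero)
qed (use assms(1) in simp)

context coag_short
begin

lemma moment_sum:
 assumes "finite I" "!!i. i : I ==> tame (f i)"
 shows "tame (%u. \<Sum>i\<in>I. c i * f i u) & moment k (%u. \<Sum>i\<in>I. c i * f i u) = (\<Sum>i\<in>I. c i * moment k (f i))" using assms
proof (induction I)
 case empty
 have "(U ^^ k) (%_. 0) u = 0" for u by (induction k arbitrary: u) (simp_all add: U_def)
 then show ?case by (simp add: tame_const moment_def)
next
 case (insert i I)
 have "(U ^^ k) (%u. c i * f i u) u = c i * (U ^^ k) (f i) u" for u by (induction k arbitrary: u) (simp_all add: U_def)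
 then have "moment k (%u. c i * f i u) = c i * moment k (f i)" by (simp add: moment_def)
 then show ?case using insert moment_add[of "%u. c i * f i u" "%u. \<Sum>i\<in>I. c i * f i u" k] tame_add[of "%u. c i * f i u" "%u. \<Sum>i\<in>I. c i * f i u"] by (simp add: tame_cmult)
qed

text \<open>The Leibniz rule for the powers of \<open>L\<close> and \<open>moment_conv\<close> write
  each coefficient as a sum of products; the binomial coefficients distribute n! over the factors,
  and the result is the Cauchy product of two absolutely convergent series.\<close>

lemma R_conv:
 assumes g: "tame g" "1 <= k" "0 <= c" "!!u. pts u ==> \<bar>g u\<bar> <= c * W k 1 u" "!!u. size u ~= k ==> g u = 0"
  and h: "tame h" "1 <= l" "0 <= d" "!!u. pts u ==> \<bar>h u\<bar> <= d * W l 1 u" "!!u. size u ~= l ==> h u = 0"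
  and t: "0 <= t" "t <= T"
 shows "R (k + l) (conv g h) t = R k g t * R l h t"
proof -
 let ?a = "%n. t ^ n / fact n * moment (k + n) ((L ^^ n) g)" and ?b = "%n. t ^ n / fact n * moment (l + n) ((L ^^ n) h)"
 have tg: "tame ((L ^^ n) g)" and th: "tame ((L ^^ n) h)" for n by (rule derivation_tame[OF derivation_L], fact)+
 have "t ^ n / fact n * moment (k + l + n) ((L ^^ n) (conv g h)) = (\<Sum>j\<le>n. ?a j * ?b (n - j))" for n
 proof -
  have "moment (k + l + n) ((L ^^ n) (conv g h)) = moment (k + l + n) (%u. \<Sum>j\<le>n. real (n choose j) * conv ((L ^^ j) g) ((L ^^ (n - j)) h) u)"
   by (intro moment_cong leibniz[OF derivation_L g(1) h(1)])
  also have "\<dots> = (\<Sum>j\<le>n. real (n choose j) * moment (k + l + n) (conv ((L ^^ j) g) ((L ^^ (n - j)) h)))"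
   using moment_sum[of "{..n}" "%j. conv ((L ^^ j) g) ((L ^^ (n - j)) h)"] tame_conv[OF tg th] by simp
  also have "\<dots> = (\<Sum>j\<le>n. real (n choose j) * (moment (k + j) ((L ^^ j) g) * moment (l + (n - j)) ((L ^^ (n - j)) h)))"
  proof (intro sum.cong refl arg_cong2[where f = "(*)"])
   fix j assume "j : {..n}"
   then have e: "k + l + n = (k + j) + (l + (n - j))" by simp
   show "moment (k + l + n) (conv ((L ^^ j) g) ((L ^^ (n - j)) h)) = moment (k + j) ((L ^^ j) g) * moment (l + (n - j)) ((L ^^ (n - j)) h)"
    unfolding e by (rule moment_conv[OF tg L_size[OF g(5)] th L_size[OF h(5)]])
  qed
  finally have "t ^ n / fact n * moment (k + l + n) ((L ^^ n) (conv g h)) =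
    (\<Sum>j\<le>n. t ^ n / fact n * (real (n choose j) * (moment (k + j) ((L ^^ j) g) * moment (l + (n - j)) ((L ^^ (n - j)) h))))" by (simp only: sum_distrib_left)
  also have "\<dots> = (\<Sum>j\<le>n. ?a j * ?b (n - j))"
  proof (intro sum.cong refl)
   fix j assume "j : {..n}"
   then have "t ^ n = t ^ j * t ^ (n - j)" by (simp flip: power_add)
   then show "t ^ n / fact n * (real (n choose j) * (moment (k + j) ((L ^^ j) g) * moment (l + (n - j)) ((L ^^ (n - j)) h))) = ?a j * ?b (n - j)"
    using \<open>j : {..n}\<close> by (simp add: binomial_fact)
  qed
  finally show ?thesis .
 qed
 then have "R (k + l) (conv g h) t = (\<Sum>n. \<Sum>j\<le>n. ?a j * ?b (n - j))" unfolding R_def by simp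
 also have "\<dots> = R k g t * R l h t" unfolding R_def using R_summable[OF g(1-4) t] R_summable[OF h(1-4) t] by (intro Cauchy_product[symmetric]) auto
 finally show ?thesis .
qed

lemma R_derivative:
 assumes h: "tame h" and k: "1 <= k" and c: "0 <= c" and le: "!!u. pts u ==> \<bar>h u\<bar> <= c * W k 1 u"
  and t: "0 <= t" "t <= T" and T: "0 < T"
 shows "(R k h has_real_derivative R (Suc k) (L h) t) (at t within I)"
proof -
 let ?a = "%n. moment (k + n) ((L ^^ n) h) / fact n"
 \<comment> \<open>The derivative at the endpoint t = T needs a radius of convergence beyond
   \<open>T\<close>. As \<theta> < 1, this \<kappa> exceeds 1 while \<kappa> \<theta> stays below
   1.\<close>
 define \<kappa> where "\<kappa> = 2 / (1 + \<theta>)"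
 have \<kappa>: "1 < \<kappa>" "\<kappa> * \<theta> < 1" "0 <= \<kappa> * \<theta>" unfolding \<kappa>_def using small \<theta>_nonneg by (simp_all add: field_simps)
 have "summable (%n. ?a n * (T * \<kappa>) ^ n)"
 proof (rule summable_comparison_test')
  show "summable (%n. c * exp (real k) * (\<kappa> * \<theta>) ^ n)" using \<kappa> by (intro summable_mult summable_geometric) simp
  fix n
  have "norm (?a n * (T * \<kappa>) ^ n) = (T ^ n / fact n * \<bar>moment (k + n) ((L ^^ n) h)\<bar>) * \<kappa> ^ n" using T \<kappa> by (simp add: abs_mult power_mult_distrib)
  also have "\<dots> <= (c * exp (real k) * \<theta> ^ n) * \<kappa> ^ n" using \<kappa> by (intro mult_right_mono moment_L_bound[OF h k c le]) auto
  finally show "norm (?a n * (T * \<kappa>) ^ n) <= c * exp (real k) * (\<kappa> * \<theta>) ^ n" by (simp only: power_mult_distrib ac_simps)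
 qed
 moreover have "norm t < norm (T * \<kappa>)"
 proof -
  have "T * 1 < T * \<kappa>" by (rule mult_strict_left_mono[OF \<kappa>(1) T])
  moreover have "norm t = t" "norm (T * \<kappa>) = T * \<kappa>" using t T \<kappa> by (auto simp: abs_mult)
  ultimately show ?thesis using t by linarith
 qed
 ultimately have "DERIV (%x. \<Sum>n. ?a n * x ^ n) t :> (\<Sum>n. diffs ?a n * t ^ n)" by (rule termdiffs_strong)
 moreover have "R k h = (%x. \<Sum>n. ?a n * x ^ n)" unfolding R_def by (auto simp: mult.commute)
 moreover have "R (Suc k) (L h) t = (\<Sum>n. diffs ?a n * t ^ n)" unfolding R_def diffs_def by (simp add: funpow_Suc_right mult.commute del: funpow.simps of_nat_Suc)
 ultimately show ?thesis by (simp add: has_field_derivative_at_within)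
qed

end

locale coag_limit = coag_short A \<B> K J mass H \<nu> T
 for A :: "'a::second_countable_topology set" and \<B> K J mass H \<nu> T +
 fixes Om :: "nat => 'w measure" and Y :: "nat => nat => 'w => 'a multiset" and \<sigma> :: "nat => nat => 'w => ennreal"
  and X :: "nat => real => 'w => 'a multiset"
 assumes process: "!!N. 0 < N ==> coag_process A \<B> K J mass H \<nu> (Om N) N (Y N) (\<sigma> N) (X N)"
begin

lemma short_process: "0 < N ==> coag_short_process A \<B> K J mass H \<nu> T (Om N) N (Y N) (\<sigma> N) (X N)" using process coag_short_axioms by (intro coag_short_process.intro)

definition mn :: "nat => ('a multiset => real) => real => real" where
 "mn N h t = (LINT w|(Om N). conv (scaled N h) (%_. 1) (X N t w))"

lemma mn_bounds:
 assumes "0 < N" "tame h" "1 <= k" "0 <= c" "!!u. pts u ==> \<bar>h u\<bar> <= c * W k i u" "0 <= t" "t <= T"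
 shows "integrable (Om N) (%w. conv (scaled N h) (%_. 1) (X N t w))" "\<bar>mn N h t\<bar> <= c * S k i"
proof -
 interpret P: coag_short_process A \<B> K J mass H \<nu> T "Om N" N "Y N" "\<sigma> N" "X N" by (rule short_process[OF assms(1)])
 show "integrable (Om N) (%w. conv (scaled N h) (%_. 1) (X N t w))" "\<bar>mn N h t\<bar> <= c * S k i"
  using P.\<F>_integrable[OF assms(2-7)] P.\<F>_abs_le[OF assms(2-7)] by (auto simp: mn_def P.\<F>_def)
qed

text \<open>First \<open>m\<close> makes the geometric part of \<open>\<F>_expansion\<close> small,
  then \<open>N\<close> the correction \<open>D m k 1 / N\<close>. The threshold depends only on
  \<open>k\<close>, \<open>c\<close> and \<epsilon>, which \<open>functional_measure\<close>
  exploits.\<close>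

lemma mn_uniform:
 assumes "1 <= k" "0 <= c" "0 < \<epsilon>"
 obtains N\<^sub>0 where "0 < N\<^sub>0" "!!N h t. N\<^sub>0 <= N ==> tame h ==> (!!u. pts u ==> \<bar>h u\<bar> <= c * W k 1 u) ==> 0 <= t ==> t <= T ==>
  \<bar>mn N h t - R k h t\<bar> <= \<epsilon>"
proof -
 have "(%m. c * (2 * (exp (real k) * \<theta> ^ m / (1 - \<theta>)))) \<longlonglongrightarrow> c * (2 * (exp (real k) * 0 / (1 - \<theta>)))"
  using small \<theta>_nonneg by (intro tendsto_intros LIMSEQ_power_zero) auto
 then have "(%m. c * (2 * (exp (real k) * \<theta> ^ m / (1 - \<theta>)))) \<longlonglongrightarrow> 0" by simp
 from order_tendstoD(2)[OF this, of "\<epsilon> / 2"] assms(3)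
 obtain m where m: "c * (2 * (exp (real k) * \<theta> ^ m / (1 - \<theta>))) < \<epsilon> / 2" by (auto simp: eventually_sequentially)
 obtain N\<^sub>0 :: nat where N0: "c * D m k 1 * 2 / \<epsilon> < N\<^sub>0" using reals_Archimedean2 by blast
 show ?thesis
 proof (rule that[of "Suc N\<^sub>0"])
  fix N h t assume N: "Suc N\<^sub>0 <= N" and h: "tame h" "!!u. pts u ==> \<bar>h u\<bar> <= c * W k 1 u" and t: "0 <= t" "t <= T"
  interpret P: coag_short_process A \<B> K J mass H \<nu> T "Om N" N "Y N" "\<sigma> N" "X N" using N by (intro short_process) simp
  have "c * D m k 1 * 2 / \<epsilon> <= N" using N0 N by linarith
  then have "c * (D m k 1 / N) <= \<epsilon> / 2" using assms(3) N by (simp add: field_simps)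
  then show "\<bar>mn N h t - R k h t\<bar> <= \<epsilon>" using P.\<F>_expansion[OF h(1) assms(1,2) h(2) t, of m] m unfolding mn_def P.\<F>_def distrib_left by linarith
 qed simp
qed

lemma mn_tendsto:
 assumes "tame h" "1 <= k" "0 <= c" "!!u. pts u ==> \<bar>h u\<bar> <= c * W k 1 u" "0 <= t" "t <= T"
 shows "(%N. mn N h t) \<longlonglongrightarrow> R k h t"
proof (rule LIMSEQ_I)
 fix r :: real assume "0 < r"
 then obtain N0 where "!!N h t. N0 <= N ==> tame h ==> (!!u. pts u ==> \<bar>h u\<bar> <= c * W k 1 u) ==> 0 <= t ==> t <= T ==>
  \<bar>mn N h t - R k h t\<bar> <= r / 2" using mn_uniform[OF assms(2,3), of "r / 2"] by (metis half_gt_zero)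
 then have "\<bar>mn N h t - R k h t\<bar> <= r / 2" if "N0 <= N" for N using that assms by blast
 then show "EX no. ALL n>=no. norm (mn n h t - R k h t) < r" using \<open>0 < r\<close> by (intro exI[of _ N0]) force
qed

text \<open>Inherited from the moments before the limit. This gives a bound by any weight exponent
  \<open>i\<close>, whereas convergence is known through the exponent 1.\<close>

lemma R_le:
 assumes "tame h" "1 <= k" "0 <= c" "!!u. pts u ==> \<bar>h u\<bar> <= c * W k 1 u" "0 <= t" "t <= T"
  and d: "0 <= d" "!!u. pts u ==> \<bar>h u\<bar> <= d * W k i u"
 shows "\<bar>R k h t\<bar> <= d * S k i"
proof (rule LIMSEQ_le_const2[OF tendsto_rabs[OF mn_tendsto[OF assms(1-6)]]])
 show "EX N. ALL n>=N. \<bar>mn n h t\<bar> <= d * S k i" using mn_bounds(2)[OF _ assms(1,2) d assms(5,6)] by (intro exI[of _ 1]) auto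
qed

lemma mn_add:
 assumes "0 < N" "1 <= k" "0 <= t" "t <= T" "tame f" "0 <= c" "!!u. pts u ==> \<bar>f u\<bar> <= c * W k 1 u"
  and "tame g" "0 <= d" "!!u. pts u ==> \<bar>g u\<bar> <= d * W k 1 u"
 shows "mn N (%u. f u + g u) t = mn N f t + mn N g t"
proof -
 interpret P: coag_short_process A \<B> K J mass H \<nu> T "Om N" N "Y N" "\<sigma> N" "X N" by (rule short_process[OF assms(1)])
 show ?thesis unfolding mn_def P.conv_scaled_add by (intro Bochner_Integration.integral_add mn_bounds(1)[OF assms(1,5,2,6,7,3,4)] mn_bounds(1)[OF assms(1,8,2,9,10,3,4)])
qed

lemma R_add:
 assumes "1 <= k" "0 <= t" "t <= T" "tame f" "0 <= c" "!!u. pts u ==> \<bar>f u\<bar> <= c * W k 1 u"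
  and "tame g" "0 <= d" "!!u. pts u ==> \<bar>g u\<bar> <= d * W k 1 u"
 shows "R k (%u. f u + g u) t = R k f t + R k g t"
proof (rule LIMSEQ_unique)
 have "\<bar>f u + g u\<bar> <= (c + d) * W k 1 u" if "pts u" for u using assms(6)[OF that] assms(9)[OF that] by (simp add: distrib_right)
 then show "(%N. mn N (%u. f u + g u) t) \<longlonglongrightarrow> R k (%u. f u + g u) t" using assms by (intro mn_tendsto[where c = "c + d"] tame_add) auto
 have "(%N. mn N f t + mn N g t) \<longlonglongrightarrow> R k f t + R k g t" by (intro tendsto_add mn_tendsto[OF assms(4,1,5,6,2,3)] mn_tendsto[OF assms(7,1,8,9,2,3)])
 then show "(%N. mn N (%u. f u + g u) t) \<longlonglongrightarrow> R k f t + R k g t"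
  by (rule Lim_transform_eventually, intro eventually_sequentiallyI[of 1]) (use assms in \<open>simp add: mn_add[of _ k t f c g d]\<close>)
qed

lemma R_cmult:
 assumes "1 <= k" "0 <= t" "t <= T" "tame f" "0 <= c" "!!u. pts u ==> \<bar>f u\<bar> <= c * W k 1 u"
 shows "R k (%u. a * f u) t = a * R k f t"
proof (rule LIMSEQ_unique)
 have "\<bar>a * f u\<bar> <= (\<bar>a\<bar> * c) * W k 1 u" if "pts u" for u using assms(6)[OF that] by (simp add: abs_mult mult.assoc mult_left_mono)
 then show "(%N. mn N (%u. a * f u) t) \<longlonglongrightarrow> R k (%u. a * f u) t" using assms by (intro mn_tendsto[where c = "\<bar>a\<bar> * c"] tame_cmult) auto
 have "mn N (%u. a * f u) t = a * mn N f t" if "0 < N" for N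
 proof -
  interpret P: coag_short_process A \<B> K J mass H \<nu> T "Om N" N "Y N" "\<sigma> N" "X N" by (rule short_process[OF that])
  show ?thesis unfolding mn_def P.conv_scaled_cmult by simp
 qed
 moreover have "(%N. a * mn N f t) \<longlonglongrightarrow> a * R k f t" by (intro tendsto_mult tendsto_const mn_tendsto[OF assms(4,1,5,6,2,3)])
 ultimately show "(%N. mn N (%u. a * f u) t) \<longlonglongrightarrow> a * R k f t" by (elim Lim_transform_eventually, intro eventually_sequentiallyI[of 1]) simp
qed

text \<open>Linearity and positivity pass to the limit in \<open>N\<close>. For continuity at the
  empty set, fix one large \<open>N\<close>: there it is dominated convergence, and the distance to
  \<open>R\<close> is small uniformly over all indicators by \<open>mn_uniform\<close>.\<close>

lemma functional_measure:
 fixes \<Psi> :: "('b => real) => 'a multiset => real" and M :: "'b measure"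
 defines "bm \<equiv> {f : BM M. EX c. ALL x:space M. \<bar>f x\<bar> <= c}"
 assumes k: "1 <= k" and t: "0 <= t" "t <= T"
  and tame: "!!f. f : bm ==> tame (\<Psi> f)"
  and bound: "!!f c u. f : BM M ==> (!!x. x : space M ==> \<bar>f x\<bar> <= c) ==> 0 <= c ==> pts u ==> \<bar>\<Psi> f u\<bar> <= c * W k 1 u"
  and add: "!!f g. \<Psi> (%x. f x + g x) = (%u. \<Psi> f u + \<Psi> g u)"
  and cmult: "!!a f. \<Psi> (%x. a * f x) = (%u. a * \<Psi> f u)"
  and pos: "!!f u. (!!x. x : space M ==> 0 <= f x) ==> pts u ==> 0 <= \<Psi> f u"
  and cont: "!!(B :: nat => 'b set) u. decseq B ==> (\<Inter>i. B i) = {} ==> (%i. \<Psi> (ind (B i)) u) \<longlonglongrightarrow> 0"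
 shows "\<exists>\<rho>. finite_measure \<rho> & sets \<rho> = sets M & (ALL f:bm. R k (\<Psi> f) t = (LINT x|\<rho>. f x))" unfolding bm_def
proof (rule bounded_functional_measure)
 have bd: "EX c>=0. ALL u. pts u --> \<bar>\<Psi> f u\<bar> <= c * W k 1 u" if f: "f : bm" for f
 proof -
  obtain c where c: "ALL x:space M. \<bar>f x\<bar> <= c" using f by (auto simp: bm_def)
  then have "!!x. x : space M ==> \<bar>f x\<bar> <= \<bar>c\<bar>" by force
  then show ?thesis using bound[of f "\<bar>c\<bar>"] f by (intro exI[of _ "\<bar>c\<bar>"]) (auto simp: bm_def)
 qed
 fix f :: "'b => real" assume f: "f : {f : BM M. EX c. ALL x:space M. \<bar>f x\<bar> <= c}"
 then have f: "f : bm" by (simp add: bm_def)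
 obtain c where c: "0 <= c" "!!u. pts u ==> \<bar>\<Psi> f u\<bar> <= c * W k 1 u" using bd[OF f] by blast
 show "R k (\<Psi> (%x. a * f x)) t = a * R k (\<Psi> f) t" for a unfolding cmult by (rule R_cmult[OF k t tame[OF f] c])
 show "R k (\<Psi> (%x. f x + g x)) t = R k (\<Psi> f) t + R k (\<Psi> g) t" if "g : {f : BM M. EX c. ALL x:space M. \<bar>f x\<bar> <= c}" for g
 proof -
  have g: "g : bm" using that by (simp add: bm_def)
  obtain d where d: "0 <= d" "!!u. pts u ==> \<bar>\<Psi> g u\<bar> <= d * W k 1 u" using bd[OF g] by blast
  show ?thesis unfolding add by (rule R_add[OF k t tame[OF f] c tame[OF g] d])
 qed
 show "0 <= R k (\<Psi> f) t" if nn: "!!x. x : space M ==> 0 <= f x"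
 proof -
  have "0 <= mn N (\<Psi> f) t" if N: "1 <= N" for N
  proof -
  interpret P: coag_short_process A \<B> K J mass H \<nu> T "Om N" N "Y N" "\<sigma> N" "X N" using N by (intro short_process) simp
  have "0 <= conv (scaled N (\<Psi> f)) (%_. 1) (X N t w)" if w: "w : space (Om N)" for w using P.conv_scaled_mono[of "%_. 0" "\<Psi> f" "X N t w"] pos[of f] nn P.X_space[OF t(1) w]
   by (simp add: scaled_def[abs_def])
  then show "0 <= mn N (\<Psi> f) t" unfolding mn_def by (intro integral_nonneg_AE AE_I2)
  qed
  then show ?thesis using LIMSEQ_le_const[OF mn_tendsto[OF tame[OF f] k c t], of 0] by blast
 qed
next
 fix B :: "nat => 'b set" assume B: "range B \<subseteq> sets M" "decseq B" "(\<Inter>i. B i) = {}"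
 have ind: "ind (B i) : bm" "(ind (B i) :: 'b => real) : BM M" for i using B(1) unfolding bm_def by (auto intro!: exI[of _ 1] simp: indicator_def)
 have bd: "\<bar>\<Psi> (ind (B i)) u\<bar> <= 1 * W k 1 u" if "pts u" for i u by (rule bound[OF ind(2) _ _ that]) (auto simp: indicator_def)
 show "(%i. R k (\<Psi> (ind (B i))) t) \<longlonglongrightarrow> 0"
 proof (rule LIMSEQ_I)
  fix r :: real assume r: "0 < r"
  obtain N where N: "0 < N" "!!M h t. N <= M ==> tame h ==> (!!u. pts u ==> \<bar>h u\<bar> <= 1 * W k 1 u) ==> 0 <= t ==> t <= T ==>
   \<bar>mn M h t - R k h t\<bar> <= r / 2" by (rule mn_uniform[OF k, of 1 "r / 2"]) (use r in auto)
  interpret P: coag_short_process A \<B> K J mass H \<nu> T "Om N" N "Y N" "\<sigma> N" "X N" by (rule short_process[OF N(1)])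
  have "(%i. mn N (\<Psi> (ind (B i))) t) \<longlonglongrightarrow> (LINT w|(Om N). 0)" unfolding mn_def
  proof (rule integral_dominated_convergence)
   show "integrable (Om N) (%w. conv (scaled N (W k 1)) (%_. 1) (X N t w))" by (rule P.W_full(1)[OF k t])
   show "AE w in Om N. (%i. conv (scaled N (\<Psi> (ind (B i)))) (%_. 1) (X N t w)) \<longlonglongrightarrow> 0"
   proof (rule AE_I2)
    fix w
    have "(%i. conv (scaled N (\<Psi> (ind (B i)))) (%_. 1) (X N t w)) \<longlonglongrightarrow> conv (%_. 0) (%_. 1) (X N t w)"
    proof (rule conv_tendsto)
     fix v
     have "(%i. \<Psi> (ind (B i)) v / real N ^ size v) \<longlonglongrightarrow> 0 / real N ^ size v" using N(1) by (intro tendsto_intros cont B) auto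
     then show "(%i. scaled N (\<Psi> (ind (B i))) v) \<longlonglongrightarrow> 0" by (simp add: scaled_def)
    qed
    then show "(%i. conv (scaled N (\<Psi> (ind (B i)))) (%_. 1) (X N t w)) \<longlonglongrightarrow> 0" by simp
   qed
   show "AE w in Om N. norm (conv (scaled N (\<Psi> (ind (B i)))) (%_. 1) (X N t w)) <= conv (scaled N (W k 1)) (%_. 1) (X N t w)" for i
    using P.conv_scaled_abs_le[of "\<Psi> (ind (B i))" "W k 1"] bd P.X_space[OF t(1)] by (intro AE_I2) auto
  qed (use P.scaled_X_measurable[OF tame[OF ind(1)] t(1)] in auto)
  then obtain i0 where i0: "!!i. i0 <= i ==> \<bar>mn N (\<Psi> (ind (B i))) t\<bar> < r / 2" using LIMSEQ_D[of "%i. mn N (\<Psi> (ind (B i))) t" 0 "r / 2"] r by auto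
  have "\<bar>R k (\<Psi> (ind (B i))) t\<bar> < r" if "i0 <= i" for i using i0[OF that] N(2)[OF order_refl tame[OF ind(1)] bd t, of i] by linarith
  then show "EX no. ALL n>=no. norm (R k (\<Psi> (ind (B n))) t - 0) < r" by auto
 qed
qed

end

section \<open>Propagation of chaos and the limit equation\<close>

context coag_kernel
begin

definition sing :: "('a => real) => 'a multiset => real" where
 "sing f u = (if size u = 1 then \<Sum>x\<in>#u. f x else 0)"

text \<open>The factor 2 undoes the 1/2 of \<open>pair_sum\<close>, so both orders of the pair are
  counted. In the limit this becomes the integral of \<phi> against the product of \<rho>(t) with
  itself, without a factor.\<close>

definition dbl :: "('a \<times> 'a => real) => 'a multiset => real" where
 "dbl \<phi> u = (if size u = 2 then 2 * pair_sum (%x y _. \<phi> (x, y)) u else 0)"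

lemma size_one: "size u = 1 ==> EX x. u = {#x#}" by (simp add: size_1_singleton_mset)

lemma size_two: "size u = 2 ==> EX x y. u = {#x, y#}" by (metis One_nat_def Suc_1 size_1_singleton_mset size_eq_Suc_imp_eq_union diff_Suc_1 size_add_mset nat.inject)

lemma sing_single[simp]: "sing f {#x#} = f x" by (simp add: sing_def)

lemma dbl_pair[simp]: "dbl \<phi> {#x, y#} = \<phi> (x, y) + \<phi> (y, x)" by (simp add: dbl_def pair_sum_def sub_sum_add_mset)

lemma tame_le:
 assumes "h : BM PM" "tame g" "!!u. pts u ==> \<bar>h u\<bar> <= g u"
 shows "tame h"
proof -
 obtain w where "!!u. pts u ==> \<bar>g u\<bar> <= w (total u)" by (rule tame_bound[OF assms(2)]) blast
 then show ?thesis using assms(3) by (intro tameI[OF assms(1), of w]) (meson abs_ge_self order_trans)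
qed

lemma sing_bound:
 assumes "!!x. x : A ==> \<bar>f x\<bar> <= c * real (mass x)" "0 <= c" "pts u"
 shows "\<bar>sing f u\<bar> <= c * W 1 i u"
proof (cases "size u = 1")
 case True
 then obtain x where x: "u = {#x#}" using size_one by blast
 have m: "1 <= real (mass x)" using mass_pos[of x] assms(3) x by simp
 have "c * real (mass x) * 1 <= c * real (mass x) * real (mass x) ^ i" using assms(2) m by (intro mult_left_mono one_le_power) auto
 then show ?thesis using assms(1)[of x] assms(3) x by (simp add: W_def mult.assoc)
qed (simp add: sing_def W_def)

lemma dbl_bound:
 assumes "!!x y. x : A ==> y : A ==> \<bar>\<phi> (x, y)\<bar> <= c * (real (mass x) * real (mass y))" "0 <= c" "pts u"
 shows "\<bar>dbl \<phi> u\<bar> <= c * W 2 1 u"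
proof (cases "size u = 2")
 case True
 then obtain x y where x: "u = {#x, y#}" using size_two by blast
 have m: "1 <= real (mass x)" "1 <= real (mass y)" using mass_pos[of x] mass_pos[of y] assms(3) x by simp_all
 let ?m = "real (mass x) * real (mass y)"
 have "\<bar>dbl \<phi> u\<bar> <= c * (?m * 2)" using assms(1)[of x y] assms(1)[of y x] assms(3) x by (simp add: mult.commute)
 also have "\<dots> <= c * (?m * (real (mass x) + real (mass y)))" using m assms(2) by (intro mult_left_mono) auto
 finally show ?thesis by (simp add: W_def x mult.assoc)
qed (simp add: dbl_def W_def)

lemma sing_measurable:
 assumes "f : BM PA"
 shows "sing f : BM PM" using sum_measurable[OF assms] unfolding sing_def[abs_def] by measurable

lemma dbl_measurable: "\<phi> : BM (PA <*> PA) ==> dbl \<phi> : BM PM"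
proof -
 assume \<phi>: "\<phi> : BM (PA <*> PA)"
 have "(%p. (fst p, fst (snd p))) : PA <*> (PA <*> PM) ->M PA <*> PA" by measurable
 from mcomp[OF this \<phi>] have "pair_sum (%x y _. \<phi> (x, y)) : BM PM" by (intro pair_sum_measurable) (simp add: case_prod_beta')
 then show ?thesis unfolding dbl_def[abs_def] by measurable
qed

lemma tame_sing:
 assumes "f : BM PA" "!!x. x : A ==> \<bar>f x\<bar> <= c * real (mass x)" "0 <= c"
 shows "tame (sing f)" using sing_bound[OF assms(2,3), of _ 0] by (intro tame_le[OF sing_measurable[OF assms(1)] tame_cmult[OF tame_W[of 1 0], of c]]) auto

lemma tame_dbl:
 assumes "\<phi> : BM (PA <*> PA)" "!!x y. x : A ==> y : A ==> \<bar>\<phi> (x, y)\<bar> <= c * (real (mass x) * real (mass y))" "0 <= c"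
 shows "tame (dbl \<phi>)" using dbl_bound[OF assms(2,3)] by (intro tame_le[OF dbl_measurable[OF assms(1)] tame_cmult[OF tame_W[of 2 1], of c]]) auto

lemma bounded_by_mass:
 assumes "\<bar>f x\<bar> <= c" "0 <= c" "x : A"
 shows "\<bar>f x\<bar> <= c * real (mass x)" using assms mass_pos[of x] mult_left_mono[of 1 "real (mass x)" c] by simp

lemma bounded_by_mass2:
 assumes "\<bar>\<phi> (x, y)\<bar> <= c" "0 <= c" "x : A" "y : A"
 shows "\<bar>\<phi> (x, y)\<bar> <= c * (real (mass x) * real (mass y))"
 using assms mass_pos[of x] mass_pos[of y] mult_left_mono[of 1 "real (mass x) * real (mass y)" c] mult_mono[of 1 "real (mass x)" 1 "real (mass y)"] by simp

definition jump_effect :: "('a => real) => 'a \<times> 'a => real" where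
 "jump_effect f = (%(x, y). K x y * ((LINT z|(J x y). f z) - f x - f y))"

lemma L_sing: "L (sing f) u = 1 / 2 * dbl (jump_effect f) u"
proof (cases "size u = 2")
 case True
 have "L (sing f) u = pair_sum (%x y _. jump_effect f (x, y)) u" unfolding L_def
 proof (rule pair_sum_cong)
  fix a b v assume "add_mset a (add_mset b v) = u"
  then have "v = {#}" using True by auto
  then show "K a b * (jint (sing f) a b v - sing f (add_mset a v) - sing f (add_mset b v)) = jump_effect f (a, b)" by (simp add: jint_def jump_effect_def)
 qed
 then show ?thesis using True by (simp add: dbl_def)
next
 case False
 then have "(L ^^ 1) (sing f) u = 0" by (intro L_size[of 1]) (simp_all add: sing_def)
 then show ?thesis using False by (simp add: dbl_def)
qed

lemma jump_effect_measurable: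
 assumes f: "f : BM PA"
 shows "jump_effect f : BM (PA <*> PA)"
proof -
 have "(%p. LINT z|(case p of (x, y) => J x y). f z) : BM (PA <*> PA)" using mcomp[OF measurable_prob_algebraD[OF J_measurable] integral_measurable_subprob_algebra[OF f]] .
 moreover have "(%p. f (fst p)) : BM (PA <*> PA)" "(%p. f (snd p)) : BM (PA <*> PA)" by (rule mcomp[OF measurable_fst f] mcomp[OF measurable_snd f])+
 ultimately show ?thesis using K_measurable unfolding jump_effect_def by (simp add: case_prod_beta')
qed

lemma jump_effect_bound:
 assumes f: "f : BM PA" "!!x. x : A ==> \<bar>f x\<bar> <= c" and xy: "x : A" "y : A"
 shows "\<bar>jump_effect f (x, y)\<bar> <= (3 * c * H) * (real (mass x) * real (mass y))"
proof -
 interpret prob_space "J x y" by (rule J_prob[OF xy])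
 have "\<bar>LINT z|(J x y). f z\<bar> <= (LINT z|(J x y). \<bar>f z\<bar>)" by (rule integral_abs_bound)
 also have "\<dots> <= (LINT z|(J x y). c)"
 proof (rule integral_mono)
  have "f : BM (J x y)" using f(1) J_sets[OF xy] by (simp cong: measurable_cong_sets)
  then show "integrable (J x y) (%z. \<bar>f z\<bar>)" using f(2) J_space[OF xy] by (intro integrable_abs integrable_const_bound[of _ c]) auto
 qed (use f(2) J_space[OF xy] in auto)
 finally have "\<bar>(LINT z|(J x y). f z) - f x - f y\<bar> <= 3 * c" using f(2)[OF xy(1)] f(2)[OF xy(2)] by (simp add: prob_space)
 then have "\<bar>jump_effect f (x, y)\<bar> <= (H * (real (mass x) * real (mass y))) * (3 * c)"
  unfolding jump_effect_def using K_le[OF xy] K_nonneg[OF xy] by (simp add: abs_mult) (intro mult_mono, auto)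
 then show ?thesis by (simp add: mult.commute mult.left_commute)
qed

lemma indicator_decseq_tendsto: "decseq B ==> (\<Inter>i. B i) = {} ==> (%i. ind (B i) x :: real) \<longlonglongrightarrow> 0"
 for B :: "nat => 'b set" using LIMSEQ_indicator_decseq[of B x] by simp

end

lemma (in coag_short) R_cong: "(!!u. pts u ==> f u = g u) ==> R k f t = R k g t"
 unfolding R_def by (intro arg_cong[where f = suminf] ext arg_cong2[where f = "(*)"] refl moment_cong derivation_cong[OF derivation_L])

context coag_limit
begin

lemma ex_\<rho>:
 assumes t: "0 <= t" "t <= T"
 shows "\<exists>\<rho>. finite_measure \<rho> & sets \<rho> = sets PA & (ALL f:{f : BM PA. EX c. ALL x:space PA. \<bar>f x\<bar> <= c}. R 1 (sing f) t = (LINT x|\<rho>. f x))"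
proof (rule functional_measure[OF order_refl t])
 fix f :: "'a => real"
 show "tame (sing f)" if f: "f : {f : BM PA. EX c. ALL x:space PA. \<bar>f x\<bar> <= c}"
 proof -
  obtain c where c: "ALL x:A. \<bar>f x\<bar> <= c" using f by auto
  then have "\<bar>f x\<bar> <= \<bar>c\<bar>" if "x : A" for x using that by force
  then show ?thesis using f by (intro tame_sing[where c = "\<bar>c\<bar>"] bounded_by_mass) auto
 qed
 show "\<bar>sing f u\<bar> <= c * W 1 1 u" if "!!x. x : space PA ==> \<bar>f x\<bar> <= c" "0 <= c" "pts u" for c u using that by (intro sing_bound bounded_by_mass) auto
 show "sing (%x. a * f x) = (%u. a * sing f u)" for a by (auto simp: sing_def sum_mset_distrib_left)
 show "sing (%x. f x + g x) = (%u. sing f u + sing g u)" for g by (auto simp: sing_def sum_mset.distrib)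
 show "0 <= sing f u" if "!!x. x : space PA ==> 0 <= f x" "pts u" for u using that size_one[of u] by (cases "size u = 1") (auto simp: sing_def)
next
 fix B :: "nat => 'a set" and u assume B: "decseq B" "(\<Inter>i. B i) = {}"
 show "(%i. sing (ind (B i)) u) \<longlonglongrightarrow> 0" using size_one[of u] indicator_decseq_tendsto[OF B] by (cases "size u = 1") (auto simp: sing_def)
qed

lemma ex_\<rho>2:
 assumes t: "0 <= t" "t <= T"
 shows "\<exists>\<rho>. finite_measure \<rho> & sets \<rho> = sets (PA <*> PA) & (\<forall>\<phi>\<in>{f : BM (PA <*> PA). EX c. ALL x:space (PA <*> PA). \<bar>f x\<bar> <= c}. R 2 (dbl \<phi>) t = (LINT x|\<rho>. \<phi> x))"
proof (rule functional_measure[OF _ t])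
 fix f :: "'a \<times> 'a => real"
 show "tame (dbl f)" if f: "f : {f : BM (PA <*> PA). EX c. ALL x:space (PA <*> PA). \<bar>f x\<bar> <= c}"
 proof -
  obtain c where c: "ALL x:A \<times> A. \<bar>f x\<bar> <= c" using f by (auto simp: space_pair_measure)
  then have "\<bar>f (x, y)\<bar> <= \<bar>c\<bar>" if "x : A" "y : A" for x y using that by force
  then show ?thesis using f by (intro tame_dbl[where c = "\<bar>c\<bar>"] bounded_by_mass2) auto
 qed
 show "\<bar>dbl f u\<bar> <= c * W 2 1 u" if "!!x. x : space (PA <*> PA) ==> \<bar>f x\<bar> <= c" "0 <= c" "pts u" for c u
  using that by (intro dbl_bound bounded_by_mass2) (auto simp: space_pair_measure)
 show "dbl (%x. a * f x) = (%u. a * dbl f u)" for a unfolding dbl_def[abs_def] pair_sum_cmult by auto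
 show "dbl (%x. f x + g x) = (%u. dbl f u + dbl g u)" for g unfolding dbl_def[abs_def] pair_sum_add by auto
 show "0 <= dbl f u" if "!!x. x : space (PA <*> PA) ==> 0 <= f x" "pts u" for u
 proof (cases "size u = 2")
  case True
  then obtain x y where x: "u = {#x, y#}" using size_two by blast
  then have "0 <= f (x, y)" "0 <= f (y, x)" using that by (auto simp: space_pair_measure)
  then show ?thesis unfolding x dbl_pair by simp
 qed (simp add: dbl_def)
next
 fix B :: "nat => ('a \<times> 'a) set" and u assume B: "decseq B" "(\<Inter>i. B i) = {}"
 show "(%i. dbl (ind (B i)) u) \<longlonglongrightarrow> 0"
 proof (cases "size u = 2")
  case True
  then obtain x y where "u = {#x, y#}" using size_two by blast
  then show ?thesis using tendsto_add[OF indicator_decseq_tendsto[OF B, of "(x, y)"] indicator_decseq_tendsto[OF B, of "(y, x)"]] by simp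
 qed (simp add: dbl_def)
qed auto

definition \<rho> :: "real => 'a measure" where
 "\<rho> t = (SOME \<rho>. finite_measure \<rho> & sets \<rho> = sets PA \<and>
   (ALL f:{f : BM PA. EX c. ALL x:space PA. \<bar>f x\<bar> <= c}. R 1 (sing f) t = (LINT x|\<rho>. f x)))"

context
 fixes t assumes t: "0 <= t" "t <= T"
begin

lemma \<rho>_props: "finite_measure (\<rho> t)" "sets (\<rho> t) = sets PA" using someI_ex[OF ex_\<rho>[OF t]] unfolding \<rho>_def[symmetric] by auto

lemma R_sing:
 assumes "f : BM PA" "!!x. x : A ==> \<bar>f x\<bar> <= c"
 shows "R 1 (sing f) t = (LINT x|(\<rho> t). f x)"
proof -
 have "f : {f : BM PA. EX c. ALL x:space PA. \<bar>f x\<bar> <= c}" using assms by auto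
 then show ?thesis using someI_ex[OF ex_\<rho>[OF t]] unfolding \<rho>_def[symmetric] by blast
qed

lemma \<rho>_space: "space (\<rho> t) = A" using sets_eq_imp_space_eq[OF \<rho>_props(2)] by simp

lemma \<rho>_pair_sets: "sets (\<rho> t <*> \<rho> t) = sets (PA <*> PA)" by (intro sets_pair_measure_cong \<rho>_props)

text \<open>Propagation of chaos: the second moment measure factorizes in the limit.\<close>

lemma R_dbl:
 assumes \<phi>: "\<phi> : BM (PA <*> PA)" "!!x y. x : A ==> y : A ==> \<bar>\<phi> (x, y)\<bar> <= c"
 shows "R 2 (dbl \<phi>) t = (LINT p|(\<rho> t <*> \<rho> t). \<phi> p)"
proof -
 interpret \<rho>: finite_measure "\<rho> t" by (rule \<rho>_props)
 obtain \<rho>2 where fin: "finite_measure \<rho>2" and sets2: "sets \<rho>2 = sets (PA <*> PA)"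
  and R2': "\<forall>\<phi>\<in>{f : BM (PA <*> PA). EX c. ALL x:space (PA <*> PA). \<bar>f x\<bar> <= c}. R 2 (dbl \<phi>) t = (LINT x|\<rho>2. \<phi> x)" using ex_\<rho>2[OF t] by blast
 have R2: "R 2 (dbl \<phi>) t = (LINT x|\<rho>2. \<phi> x)"
  if "\<phi> : BM (PA <*> PA)" "!!p. p : space (PA <*> PA) ==> \<bar>\<phi> p\<bar> <= c" for \<phi> c using R2' that by blast
 interpret \<rho>2: finite_measure \<rho>2 by (rule fin)
 \<comment> \<open>It suffices to compare rectangles. For B \<times> C the function
   \<open>dbl\<close> of the indicator is the convolution of the one-particle functions of
   \<open>B\<close> and of \<open>C\<close>, and \<open>R_conv\<close> factorizes.\<close>
 have "\<rho> t <*> \<rho> t = \<rho>2"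
 proof (rule pair_measure_eqI)
  fix B C assume BC: "B : sets (\<rho> t)" "C : sets (\<rho> t)"
  then have BC': "B : sets PA" "C : sets PA" by (simp_all add: \<rho>_props)
  have P: "B \<times> C : sets (PA <*> PA)" using BC' by (rule pair_measureI)
  let ?f = "ind B :: 'a => real" and ?g = "ind C :: 'a => real"
  have sb: "tame (sing (ind D))" "!!u. pts u ==> \<bar>sing (ind D) u\<bar> <= 1 * W 1 1 u" if "D : sets PA" for D
   using that by (auto intro!: tame_sing[of _ 1] sing_bound[of _ 1, simplified] mass_pos[simplified] simp: indicator_def)
  have R1: "R 1 (sing (ind D)) t = measure (\<rho> t) D" if "D : sets PA" for D
   using that sets.sets_into_space[of D "\<rho> t"] by (subst R_sing[where c = 1]) (auto simp: \<rho>_props Int_absorb2 indicator_def[of _ "_ :: 'a"])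
  have "measure \<rho>2 (B \<times> C) = R 2 (dbl (ind (B \<times> C))) t"
   using P sets2 sets.sets_into_space[of "B \<times> C" \<rho>2] by (subst R2[where c = 1]) (auto simp: Int_absorb2 indicator_def[of _ "(_, _)"])
  also have "dbl (ind (B \<times> C)) u = conv (sing ?f) (sing ?g) u" for u
  proof (cases "size u = 2")
   case True
   then obtain x y where "u = {#x, y#}" using size_two by blast
   then show ?thesis by (simp add: conv_add_mset sing_def indicator_times)
  next
   case False
   have "conv (sing ?f) (sing ?g) u = 0"
   proof -
    have "conv g h u = 0" if "!!u. size u ~= i ==> g u = 0" "!!u. size u ~= j ==> h u = 0" "size u ~= i + j" for g h :: "'a multiset => real" and i j using that
    proof (induction u arbitrary: g h i j)
     case (add x u)
     have "conv (%v. g (add_mset x v)) h u = 0"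
     proof (cases i)
      case 0
      then have "g (add_mset x v) = 0" for v using add.prems(1) by simp
      then show ?thesis by simp
     qed (use add.prems in \<open>intro add.IH[of "i - 1" _ j]; auto\<close>)
     moreover have "conv g (%v. h (add_mset x v)) u = 0"
     proof (cases j)
      case 0
      then have "h (add_mset x v) = 0" for v using add.prems(2) by simp
      then show ?thesis by (simp add: conv_commute[of g])
     qed (use add.prems in \<open>intro add.IH[of i _ "j - 1"]; auto\<close>)
     ultimately show ?case by (simp add: conv_add_mset)
    qed auto
    from this[of 1 "sing ?f" 1 "sing ?g"] show ?thesis using False by (simp add: sing_def)
   qed
   then show ?thesis using False by (simp add: dbl_def)
  qed
  then have "R 2 (dbl (ind (B \<times> C))) t = R (1 + 1) (conv (sing ?f) (sing ?g)) t" by (intro arg_cong3[where f = R]) auto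
  also have "\<dots> = R 1 (sing ?f) t * R 1 (sing ?g) t" by (rule R_conv[where c = 1 and d = 1]) (use t sb[OF BC'(1)] sb[OF BC'(2)] in \<open>auto simp: sing_def\<close>)
  also have "R 1 (sing ?f) t = measure (\<rho> t) B" using R1[OF BC'(1)] .
  also have "R 1 (sing ?g) t = measure (\<rho> t) C" using R1[OF BC'(2)] .
  finally show "emeasure (\<rho> t) B * emeasure (\<rho> t) C = emeasure \<rho>2 (B \<times> C)" by (simp add: \<rho>.emeasure_eq_measure \<rho>2.emeasure_eq_measure ennreal_mult'')
 qed (auto simp: sets2 \<rho>_pair_sets intro: \<rho>.sigma_finite_measure_axioms)
 then show ?thesis using R2[OF \<phi>(1), of c] \<phi>(2) by (auto simp: space_pair_measure)
qed

text \<open>The truncations of the mass at \<open>n\<close> are bounded, hence integrals of them are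
  values of \<open>R\<close>, and as one-particle functions they lie below \<open>W 1 0\<close>
  uniformly in \<open>n\<close>.\<close>

lemma nn_integral_mass: "(NN x|(\<rho> t). of_nat (mass x)) <= ennreal (S 1 0)"
proof -
 interpret \<rho>: finite_measure "\<rho> t" by (rule \<rho>_props)
 let ?f = "%n x. real (min n (mass x))"
 have m: "?f n : BM PA" for n by (rule mcomp[OF mass_measurable]) simp
 have m': "?f n : BM (\<rho> t)" for n using m by (simp cong: measurable_cong_sets add: \<rho>_props)
 have "(NN x|(\<rho> t). of_nat (mass x)) = (NN x|(\<rho> t). (SUP n. ennreal (?f n x)))"
 proof (intro NN_cong antisym)
  fix x
  show "of_nat (mass x) <= (SUP n. ennreal (?f n x))" by (rule SUP_upper2[of "mass x"]) (simp_all add: ennreal_of_nat_eq_real_of_nat)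
  show "(SUP n. ennreal (?f n x)) <= of_nat (mass x)" by (rule SUP_least) (simp add: ennreal_of_nat_eq_real_of_nat)
 qed
 also have "\<dots> = (SUP n. NN x|(\<rho> t). ennreal (?f n x))" using m' by (intro nn_integral_monotone_convergence_SUP) (auto simp: incseq_def le_fun_def)
 also have "\<dots> <= ennreal (S 1 0)"
 proof (rule SUP_least)
  fix n
  have "integrable (\<rho> t) (?f n)" by (rule \<rho>.integrable_const_bound[of _ n]) (use m' in auto)
  then have "(NN x|(\<rho> t). ennreal (?f n x)) = ennreal (R 1 (sing (?f n)) t)" using R_sing[OF m, of n n] by (simp add: nn_integral_eq_integral)
  also have "R 1 (sing (?f n)) t <= S 1 0"
  proof -
   have le: "\<bar>sing (?f n) u\<bar> <= 1 * W 1 i u" if "pts u" for u i by (rule sing_bound[OF _ _ that]) auto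
   have "tame (sing (?f n))" by (rule tame_sing[OF m, of n 1]) auto
   then have "\<bar>R 1 (sing (?f n)) t\<bar> <= 1 * S 1 0" by (rule R_le[OF _ order_refl _ le t _ le]) auto
   then show ?thesis by simp
  qed
  finally show "(NN x|(\<rho> t). ennreal (?f n x)) <= ennreal (S 1 0)" by (simp add: ennreal_leI)
 qed
 finally show ?thesis .
qed

lemma mass_integrable: "integrable (\<rho> t) (%x. real (mass x))"
proof (rule integrableI_nonneg)
 show "(%x. real (mass x)) : BM (\<rho> t)" using mcomp[OF mass_measurable, of real borel] by (simp cong: measurable_cong_sets add: \<rho>_props)
 show "(NN x|(\<rho> t). ennreal (real (mass x))) < \<infinity>" using le_less_trans[OF nn_integral_mass] by (simp add: ennreal_of_nat_eq_real_of_nat)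
qed simp

text \<open>Truncate \<phi> to pairs of total mass at most \<open>n\<close>. On the left the
  truncation error lives on total mass above \<open>n\<close>, where a factor (total mass) / n
  raises the exponent of the weight from 1 to 2 and gains 1/n. On the right dominated convergence
  applies, the mass being integrable.\<close>

lemma R_dbl_unbounded:
 assumes \<phi>: "\<phi> : BM (PA <*> PA)" and c: "0 <= c"
  and le: "!!x y. x : A ==> y : A ==> \<bar>\<phi> (x, y)\<bar> <= c * (real (mass x) * real (mass y))"
 shows "integrable (\<rho> t <*> \<rho> t) \<phi>" "R 2 (dbl \<phi>) t = (LINT p|(\<rho> t <*> \<rho> t). \<phi> p)"
proof -
 interpret \<rho>: finite_measure "\<rho> t" by (rule \<rho>_props)
 interpret P: pair_sigma_finite "\<rho> t" "\<rho> t" by unfold_locales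
 let ?P = "\<rho> t <*> \<rho> t" and ?m = "%(x, y). real (mass x) * real (mass y)"
 have mm: "(%p. real (mass (fst p))) : BM (PA <*> PA)" "(%p. real (mass (snd p))) : BM (PA <*> PA)"
  using mcomp[OF measurable_fst mcomp[OF mass_measurable, of real borel]] mcomp[OF measurable_snd mcomp[OF mass_measurable, of real borel]] by auto
 have mP: "(f : BM ?P) = (f : BM (PA <*> PA))" for f :: "'a \<times> 'a => real" using measurable_cong_sets[OF \<rho>_pair_sets refl] by blast
 have sp: "space ?P = A \<times> A" by (simp add: space_pair_measure \<rho>_space)
 have im: "integrable ?P (%p. c * ?m p)"
 proof (intro integrable_mult_right P.Fubini_integrable)
  show "?m : BM ?P" using mm by (simp add: mP case_prod_beta')
  show "integrable (\<rho> t) (%x. LINT y|(\<rho> t). norm (?m (x, y)))" using mass_integrable by (simp add: abs_mult)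
  show "AE x in \<rho> t. integrable (\<rho> t) (%y. ?m (x, y))" using mass_integrable by simp
 qed
 show i\<phi>: "integrable ?P \<phi>" by (rule Bochner_Integration.integrable_bound[OF im]) (use le \<phi> sp c in \<open>auto simp: mP intro!: AE_I2\<close>)
 define \<psi> where "\<psi> n p = (if mass (fst p) + mass (snd p) <= n then \<phi> p else 0)" for n p
 have \<psi>m: "\<psi> n : BM (PA <*> PA)" for n
 proof -
  have "(%p. if real (mass (fst p)) + real (mass (snd p)) <= real n then \<phi> p else 0) : BM (PA <*> PA)" using mm \<phi> by measurable
  then show ?thesis by (simp add: \<psi>_def[abs_def] flip: of_nat_add)
 qed
 have \<psi>le: "\<bar>\<psi> n (x, y)\<bar> <= c * (real (mass x) * real (mass y))" if "x : A" "y : A" for n x y using le[OF that] c by (simp add: \<psi>_def)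
 have lim1: "(%n. LINT p|?P. \<psi> n p) \<longlonglongrightarrow> (LINT p|?P. \<phi> p)"
 proof (rule integral_dominated_convergence[OF _ _ im])
  show "AE p in ?P. (%n. \<psi> n p) \<longlonglongrightarrow> \<phi> p"
  proof (rule AE_I2, rule tendsto_eventually)
   show "\<forall>\<^sub>F n in sequentially. \<psi> n p = \<phi> p" for p by (rule eventually_sequentiallyI[of "mass (fst p) + mass (snd p)"]) (simp add: \<psi>_def)
  qed
 qed (use \<psi>m \<phi> \<psi>le sp in \<open>auto simp: mP intro!: AE_I2\<close>)
 have t2: "tame (dbl f)" "!!u. pts u ==> \<bar>dbl f u\<bar> <= c * W 2 1 u"
  if "f : BM (PA <*> PA)" "!!x y. x : A ==> y : A ==> \<bar>f (x, y)\<bar> <= c * (real (mass x) * real (mass y))" for f using tame_dbl[OF that c] dbl_bound[OF that(2) c] by auto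
 let ?d = "%n p. \<phi> p + -1 * \<psi> n p"
 have dm: "?d n : BM (PA <*> PA)" for n using \<phi> \<psi>m by simp
 have dle: "\<bar>?d n (x, y)\<bar> <= c * (real (mass x) * real (mass y))" if "x : A" "y : A" for n x y using le[OF that] c by (simp add: \<psi>_def)
 have bd: "\<bar>R 2 (dbl \<phi>) t - (LINT p|?P. \<psi> n p)\<bar> <= c / real n * S 2 2" if n: "0 < n" for n
 proof -
  have "\<bar>\<psi> n (x, y)\<bar> <= c * (real n * real n)" if "x : A" "y : A" for x y
  proof (cases "mass x + mass y <= n")
   case True
   then have "c * (real (mass x) * real (mass y)) <= c * (real n * real n)" using c by (intro mult_left_mono mult_mono) auto
   then show ?thesis using \<psi>le[OF that, of n] by linarith
  qed (simp add: \<psi>_def c)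
  then have "(LINT p|?P. \<psi> n p) = R 2 (dbl (\<psi> n)) t" by (intro R_dbl[OF \<psi>m, symmetric])
  moreover have "R 2 (%u. dbl (?d n) u + dbl (\<psi> n) u) t = R 2 (dbl (?d n)) t + R 2 (dbl (\<psi> n)) t"
   by (rule R_add[OF _ t t2(1)[OF dm dle] c t2(2)[OF dm dle] t2(1)[OF \<psi>m \<psi>le] c t2(2)[OF \<psi>m \<psi>le]]) auto
  moreover have "(%u. dbl (?d n) u + dbl (\<psi> n) u) = dbl \<phi>" unfolding dbl_def[abs_def] by (auto simp: pair_sum_add[symmetric] simp flip: distrib_left)
  moreover have "\<bar>R 2 (dbl (?d n)) t\<bar> <= c / real n * S 2 2"
  proof (rule R_le[OF t2(1)[OF dm dle] _ c t2(2)[OF dm dle] t])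
   show "\<bar>dbl (?d n) u\<bar> <= c / real n * W 2 2 u" if u: "pts u" for u
   proof (cases "total u <= n")
    case True
    have "dbl (?d n) u = 0"
    proof (cases "size u = 2")
     case s: True
     then obtain x y where "u = {#x, y#}" using size_two by blast
     then show ?thesis using True by (simp add: \<psi>_def)
    qed (simp add: dbl_def)
    then show ?thesis using c W_nonneg[of 2 2 u] by simp
   next
    case False
    have "\<bar>dbl (?d n) u\<bar> <= c * W 2 1 u" by (rule t2(2)[OF dm dle u])
    also have "\<dots> <= c * (W 2 1 u * (real (total u) / real n))" using False n c W_nonneg[of 2 1 u] mult_left_mono[of 1 "real (total u) / real n" "W 2 1 u"] by (intro mult_left_mono) simp_all
    also have "\<dots> = c / real n * W 2 2 u" by (simp add: W_def power2_eq_square)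
    finally show ?thesis .
   qed
  qed (use c n in auto)
  ultimately show ?thesis by simp
 qed
 have "(%n. R 2 (dbl \<phi>) t - (LINT p|?P. \<psi> n p)) \<longlonglongrightarrow> 0"
 proof (rule Lim_null_comparison)
  show "\<forall>\<^sub>F n in sequentially. norm (R 2 (dbl \<phi>) t - (LINT p|?P. \<psi> n p)) <= c / real n * S 2 2" unfolding real_norm_def by (rule eventually_sequentiallyI[of 1], rule bd) simp
  show "(%n. c / real n * S 2 2) \<longlonglongrightarrow> 0" using lim_const_over_n[of "c * S 2 2"] by simp
 qed
 from tendsto_diff[OF tendsto_const[of "R 2 (dbl \<phi>) t"] this]
 have "(%n. LINT p|?P. \<psi> n p) \<longlonglongrightarrow> R 2 (dbl \<phi>) t" by simp
 then show "R 2 (dbl \<phi>) t = (LINT p|?P. \<phi> p)" using LIMSEQ_unique lim1 by blast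
qed

end

text \<open>The derivative of \<open>R 1\<close> is \<open>R 2\<close> after \<open>L\<close>, and
  \<open>L\<close> of a one-particle function is half the two-particle function of its jump effect.
  The jump effect of a bounded function grows like the product of the masses, hence the use of
  \<open>R_dbl_unbounded\<close>.\<close>

theorem limit_derivative:
 assumes f: "f : BM PA" "!!x. x : A ==> \<bar>f x\<bar> <= c" and t: "0 <= t" "t <= T" and T: "0 < T"
 shows "((%s. LINT x|(\<rho> s). f x) has_real_derivative 1 / 2 * (LINT p|(\<rho> t <*> \<rho> t). jump_effect f p)) (at t within {0..T})"
  "integrable (\<rho> t <*> \<rho> t) (jump_effect f)"
proof -
 have c: "0 <= c | A = {}" using f(2) by force
 have c0: "0 <= max 0 c" by simp
 have fb: "\<bar>f x\<bar> <= max 0 c" if "x : A" for x using f(2)[OF that] by simp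
 have fm: "\<bar>f x\<bar> <= max 0 c * real (mass x)" if "x : A" for x by (rule bounded_by_mass[of f x "max 0 c", OF fb[OF that] c0 that])
 have ts: "tame (sing f)" by (rule tame_sing[OF f(1) fm c0])
 have je: "\<bar>jump_effect f (x, y)\<bar> <= (3 * max 0 c * H) * (real (mass x) * real (mass y))" if "x : A" "y : A" for x y by (rule jump_effect_bound[OF f(1) fb that])
 have j0: "0 <= 3 * max 0 c * H" using H_nonneg by simp
 note J = jump_effect_measurable[OF f(1)]
 show "integrable (\<rho> t <*> \<rho> t) (jump_effect f)" by (rule R_dbl_unbounded[OF t J j0 je])
 have "(R 1 (sing f) has_real_derivative R (Suc 1) (L (sing f)) t) (at t within {0..T})" by (rule R_derivative[OF ts order_refl c0 sing_bound[OF fm c0] t T])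
 also have "R (Suc 1) (L (sing f)) t = R 2 (%u. 1 / 2 * dbl (jump_effect f) u) t" unfolding numeral_2_eq_2 One_nat_def[symmetric] by (rule R_cong) (rule L_sing)
 also have "\<dots> = 1 / 2 * R 2 (dbl (jump_effect f)) t" by (rule R_cmult[OF _ t tame_dbl[OF J je j0] j0 dbl_bound[OF je j0]]) simp_all
 also have "R 2 (dbl (jump_effect f)) t = (LINT p|(\<rho> t <*> \<rho> t). jump_effect f p)" by (rule R_dbl_unbounded[OF t J j0 je])
 finally have D: "(R 1 (sing f) has_real_derivative 1 / 2 * (LINT p|(\<rho> t <*> \<rho> t). jump_effect f p)) (at t within {0..T})" .
 show "((%s. LINT x|(\<rho> s). f x) has_real_derivative 1 / 2 * (LINT p|(\<rho> t <*> \<rho> t). jump_effect f p)) (at t within {0..T})"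
  by (rule has_derivative_transform[OF _ _ D[unfolded has_field_derivative_def], folded has_field_derivative_def]) (use t R_sing[OF _ _ f] in auto)
qed

end

section \<open>Step paths and Borel measurability in Skorohod space\<close>

text \<open>\<open>D\<close> contains the possible jump times. That it is tested on the interval
  open at \<open>t\<close> and closed at t' says that a jump at s is visible at s itself, so the
  path is right-continuous.\<close>

definition step_path :: "real => 'e set => (real => 'e) => bool" where
 "step_path T M f <-> f : {0..T} \<rightarrow>\<^sub>E M & (EX D. finite D & D \<subseteq> {0<..T} \<and>
   (ALL t t'. 0 <= t --> t <= t' --> t' <= T --> D \<inter> {t<..t'} = {} --> f t = f t'))"

lemma step_path_cadlag:
 assumes "step_path T (topspace E) f"
 shows "f : cadlag_paths T E"
proof -
 obtain D where D: "finite D" "!!t t'. 0 <= t ==> t <= t' ==> t' <= T ==> D \<inter> {t<..t'} = {} ==> f t = f t'"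
  and f: "f : {0..T} \<rightarrow>\<^sub>E topspace E" using assms unfolding step_path_def by blast
 have "limitin E f (f t) (at_right t)" if t: "t : {0..<T}" for t
 proof (rule limitin_eventually)
  let ?b = "Min (insert T {s : D. t < s})"
  have "t < ?b" using D(1) t by simp
  moreover have "f s = f t" if "t < s" "s < ?b" for s using that D(1) t by (intro D(2)[symmetric]) force+
  ultimately show "\<forall>\<^sub>F s in at_right t. f s = f t" unfolding eventually_at_right[OF \<open>t < ?b\<close>] by blast
 qed (use f t in auto)
 moreover have "EX l. limitin E f l (at_left t)" if t: "t : {0<..T}" for t
 proof (intro exI limitin_eventually)
  let ?a = "Max (insert 0 {s : D. s < t})"
  have a: "?a < t" "0 <= ?a" using D(1) t by simp_all
  moreover have "f s = f ?a" if "?a < s" "s < t" for s using that D(1) t a by (intro D(2)[symmetric]) force+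
  ultimately show "\<forall>\<^sub>F s in at_left t. f s = f ?a" unfolding eventually_at_left[OF a(1)] by blast
  show "f ?a : topspace E" using a t f by auto
 qed
 ultimately show ?thesis using f unfolding cadlag_paths_def by blast
qed

text \<open>The value of the path read off on the grid of mesh \<open>T / n\<close>.\<close>

definition grid_path :: "real => nat => (nat => 'e) => real => 'e" where
 "grid_path T n v = (\<lambda>t\<in>{0..T}. v (nat \<lfloor>t * real n / T\<rfloor>))"

lemma grid_index:
 assumes "0 < T" "0 < n" "t : {0..T}"
 shows "0 <= \<lfloor>t * real n / T\<rfloor>" "nat \<lfloor>t * real n / T\<rfloor> <= n"
proof -
 have "t * real n / T <= real n" using assms by (simp add: divide_le_eq mult.commute)
 then have "\<lfloor>t * real n / T\<rfloor> <= int n" by linarith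
 then show "nat \<lfloor>t * real n / T\<rfloor> <= n" by simp
qed (use assms in simp)

lemma grid_le_iff:
 assumes "0 < T" "0 < n"
 shows "of_int i * T / real n <= t <-> of_int i <= t * real n / T" "t <= of_int i * T / real n <-> t * real n / T <= of_int i"
  "t < of_int i * T / real n <-> t * real n / T < of_int i" "of_int i * T / real n < t <-> of_int i < t * real n / T" using assms by (simp_all add: field_simps)

lemma grid_step_path:
 assumes T: "0 < T" "0 < n" and v: "!!i. i <= n ==> v i : M"
 shows "step_path T M (grid_path T n v)" unfolding step_path_def
proof (intro conjI exI)
 let ?D = "(%i. real i * T / real n) ` {1..n}"
 show "grid_path T n v : {0..T} \<rightarrow>\<^sub>E M" unfolding grid_path_def using v grid_index[OF T] by auto
 show "finite ?D" by simp
 show "?D \<subseteq> {0<..T}" using T by (auto simp: divide_le_eq mult.commute)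
 show "ALL t t'. 0 <= t --> t <= t' --> t' <= T --> ?D \<inter> {t<..t'} = {} --> grid_path T n v t = grid_path T n v t'"
 proof (intro allI impI)
  fix t t' assume t: "0 <= t" "t <= t'" "t' <= T" "?D \<inter> {t<..t'} = {}"
  have le: "\<lfloor>t * real n / T\<rfloor> <= \<lfloor>t' * real n / T\<rfloor>" using t T by (intro floor_mono divide_right_mono mult_right_mono) auto
  have "\<lfloor>t * real n / T\<rfloor> = \<lfloor>t' * real n / T\<rfloor>"
  proof (rule ccontr)
   assume "\<lfloor>t * real n / T\<rfloor> ~= \<lfloor>t' * real n / T\<rfloor>"
   then have lt: "\<lfloor>t * real n / T\<rfloor> < \<lfloor>t' * real n / T\<rfloor>" using le by simp
   define i where "i = nat \<lfloor>t' * real n / T\<rfloor>"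
   have i: "real i = of_int \<lfloor>t' * real n / T\<rfloor>" "i <= n" unfolding i_def using grid_index[OF T, of t'] t by simp_all
   have "0 <= \<lfloor>t * real n / T\<rfloor>" using t T by simp
   then have "1 <= i" using lt unfolding i_def by linarith
   moreover have "t < real i * T / real n" using lt unfolding i(1) grid_le_iff[OF T] by (simp add: floor_less_iff)
   moreover have "real i * T / real n <= t'" unfolding i(1) grid_le_iff[OF T] by simp
   ultimately have "real i * T / real n : ?D \<inter> {t<..t'}" using i(2) by auto
   then show False using t(4) by blast
  qed
  then show "grid_path T n v t = grid_path T n v t'" using t by (simp add: grid_path_def)
 qed
qed

lemma finite_separated:
 fixes P :: "real set"
 assumes "finite P"
 obtains w where "0 < w" "!!x y. x : P ==> y : P ==> x ~= y ==> w <= \<bar>x - y\<bar>"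
proof
 let ?Q = "insert 1 ((%(x, y). \<bar>x - y\<bar>) ` {(x, y) : P \<times> P. x ~= y})"
 have fin: "finite ?Q" using assms by (intro finite.insertI finite_imageI finite_subset[OF _ finite_cartesian_product[OF assms assms]]) auto
 show "0 < Min ?Q" using fin by (subst Min_gr_iff) auto
 show "Min ?Q <= \<bar>x - y\<bar>" if "x : P" "y : P" "x ~= y" for x y by (rule Min_le[OF fin]) (use that in force)
qed

text \<open>The time change moves every jump time to the next grid point, interpolating by tents
  around the jump times; along it the grid path reproduces \<open>f\<close> exactly, not just
  approximately. On a fine grid the shifts are so small that time remains strictly
  increasing.\<close>

lemma grid_approximation:
 assumes T: "0 < T" and f: "step_path T M f" and r: "0 < r"
 shows "\<forall>\<^sub>F n in sequentially. \<exists>\<tau>\<in>time_changes T. ALL t:{0..T}. \<bar>\<tau> t - t\<bar> <= r \<and>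
  grid_path T n (%i. f (real i * T / real n)) (\<tau> t) = f t"
proof -
 obtain D where D: "finite D" "D \<subseteq> {0<..T}" "!!t t'. 0 <= t ==> t <= t' ==> t' <= T ==> D \<inter> {t<..t'} = {} ==> f t = f t'" using f unfolding step_path_def by blast
 obtain w where w: "0 < w" "!!x y. x : insert 0 (insert T D) ==> y : insert 0 (insert T D) ==> x ~= y ==> w <= \<bar>x - y\<bar>" using finite_separated[of "insert 0 (insert T D)"] D(1) by auto
 \<comment> \<open>A tent of width \<open>w\<close>, the least distance between distinct points
   among 0, \<open>T\<close> and the jump times. At a jump time only its own tent is present, and at
   0 none. A jump at \<open>T\<close> is not moved, \<open>T\<close> being a grid point.\<close>
 define hat :: "real => real" where "hat x = max 0 (1 - \<bar>x\<bar> / w)" for x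
 have hat: "0 <= hat x" "hat x <= 1" "hat 0 = 1" "w <= \<bar>x\<bar> ==> hat x = 0" for x using w(1) by (auto simp: hat_def)
 have hat_lip: "\<bar>hat x - hat y\<bar> <= \<bar>x - y\<bar> / w" for x y
 proof -
  have "\<bar>hat x - hat y\<bar> <= \<bar>\<bar>x\<bar> / w - \<bar>y\<bar> / w\<bar>" unfolding hat_def by linarith
  also have "\<dots> <= \<bar>x - y\<bar> / w" using w(1) by (simp add: diff_divide_distrib[symmetric] abs_divide divide_right_mono abs_triangle_ineq3)
  finally show ?thesis .
 qed
 have hat_cont: "continuous_on S (%t. hat (t - s))" for S s unfolding hat_def using w(1) by (intro continuous_intros) auto
 \<comment> \<open>A jump is moved by at most T/n. The first term keeps the Lipschitz constant of
   the displacement below 1, the second its size below \<open>r\<close>.\<close>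
 obtain n0 :: nat where n0: "real (card D) * T / w + real (card D) * T / r < n0" using reals_Archimedean2 by blast
 have main: "\<exists>\<tau>\<in>time_changes T. ALL t:{0..T}. \<bar>\<tau> t - t\<bar> <= r & grid_path T n (%i. f (real i * T / real n)) (\<tau> t) = f t" if n: "max 1 n0 <= n" for n
 proof -
  have n1: "0 < n" using n by simp
  have nn: "real (card D) * T / w < n" "real (card D) * T / r < n"
  proof -
   have "real n0 <= real n" "0 <= real (card D) * T / w" "0 <= real (card D) * T / r" using n T w(1) r by auto
   then show "real (card D) * T / w < n" "real (card D) * T / r < n" using n0 by linarith+
  qed
  define up where "up s = of_int \<lceil>s * real n / T\<rceil> * T / real n" for s
  have up: "s <= up s" "up s - s <= T / n" for s
  proof -
   have 1: "s * real n / T <= of_int \<lceil>s * real n / T\<rceil>" "of_int \<lceil>s * real n / T\<rceil> <= s * real n / T + 1" by linarith+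
   show "s <= up s" using 1(1) unfolding up_def grid_le_iff[OF T n1] .
   have "(s + T / n) * real n / T = s * real n / T + 1" using T n1 by (simp add: field_simps)
   then have "up s <= s + T / n" using 1(2) unfolding up_def grid_le_iff(1)[OF T n1] by simp
   then show "up s - s <= T / n" by simp
  qed
  define p where "p t = (\<Sum>s\<in>D. (up s - s) * hat (t - s))" for t
  define \<tau> where "\<tau> t = t + p t" for t
  have p_abs: "\<bar>p t\<bar> <= r" for t
  proof -
   have "\<bar>p t\<bar> <= (\<Sum>s\<in>D. \<bar>(up s - s) * hat (t - s)\<bar>)" unfolding p_def by (rule sum_abs)
   also have "\<dots> <= (\<Sum>s\<in>D. T / n * 1)"
   proof (rule sum_mono)
    show "\<bar>(up s - s) * hat (t - s)\<bar> <= T / n * 1" for s unfolding abs_mult using up[of s] hat(1,2)[of "t - s"] T by (intro mult_mono) auto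
   qed
   also have "\<dots> <= r" using nn(2) r n1 by (simp add: field_simps)
   finally show ?thesis .
  qed
  have p_lip: "\<bar>p t - p t'\<bar> < \<bar>t - t'\<bar>" if "t ~= t'" for t t'
  proof -
   have "\<bar>p t - p t'\<bar> = \<bar>\<Sum>s\<in>D. (up s - s) * (hat (t - s) - hat (t' - s))\<bar>" unfolding p_def by (simp add: sum_subtractf right_diff_distrib)
   also have "\<dots> <= (\<Sum>s\<in>D. \<bar>(up s - s) * (hat (t - s) - hat (t' - s))\<bar>)" by (rule sum_abs)
   also have "\<dots> <= (\<Sum>s\<in>D. T / n * (\<bar>t - t'\<bar> / w))"
   proof (rule sum_mono)
    fix s
    show "\<bar>(up s - s) * (hat (t - s) - hat (t' - s))\<bar> <= T / n * (\<bar>t - t'\<bar> / w)" unfolding abs_mult using up[of s] hat_lip[of "t - s" "t' - s"] T by (intro mult_mono) auto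
   qed
   also have "\<dots> = (real (card D) * T / w) * \<bar>t - t'\<bar> / n" by (simp add: ac_simps)
   also have "\<dots> < real n * \<bar>t - t'\<bar> / n" using nn(1) n1 that by (intro divide_strict_right_mono mult_strict_right_mono) auto
   finally show ?thesis using n1 by simp
  qed
  have mono: "\<tau> t < \<tau> t'" if "t < t'" for t t' using p_lip[of t t'] that by (auto simp: \<tau>_def)
  have mono': "\<tau> t <= \<tau> t'" if "t <= t'" for t t' using mono[of t t'] that by (cases "t = t'") auto
  have \<tau>D: "\<tau> s = up s" if s: "s : D" for s
  proof -
   have "p s = (\<Sum>s'\<in>D. if s' = s then up s - s else 0)" unfolding p_def using w(2)[of s] hat s by (intro sum.cong) auto
   then show ?thesis using D(1) s by (simp add: \<tau>_def)
  qed
  have \<tau>0: "\<tau> 0 = 0"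
  proof -
   have "p 0 = 0" unfolding p_def using w(2)[of 0] D(2) hat by (intro sum.neutral) fastforce
   then show ?thesis by (simp add: \<tau>_def)
  qed
  have \<tau>T: "\<tau> T = T"
  proof -
   have "up T = T" using T n1 by (simp add: up_def)
   then have "p T = 0" unfolding p_def using w(2)[of T] D(2) hat(4) by (intro sum.neutral ballI) (metis insertI1 insertI2 mult_eq_0_iff right_minus_eq)
   then show ?thesis by (simp add: \<tau>_def)
  qed
  have cont: "continuous_on {0..T} \<tau>" unfolding \<tau>_def p_def by (intro continuous_intros hat_cont)
  have \<tau>: "\<tau> : time_changes T" unfolding time_changes_def
  proof (intro CollectI conjI cont equalityI subsetI)
   show "strict_mono_on {0..T} \<tau>" using mono by (auto simp: strict_mono_on_def)
   show "y : {0..T}" if "y : \<tau> ` {0..T}" for y using that mono'[of 0] mono'[of _ T] by (auto simp: \<tau>0 \<tau>T)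
   show "y : \<tau> ` {0..T}" if "y : {0..T}" for y using IVT'[of \<tau> 0 y T] that T cont by (force simp: \<tau>0 \<tau>T)
  qed
  have "grid_path T n (%i. f (real i * T / real n)) (\<tau> t) = f t" if t: "t : {0..T}" for t
  proof -
   have \<tau>t: "\<tau> t : {0..T}" using \<tau> t unfolding time_changes_def by blast
   let ?i = "\<lfloor>\<tau> t * real n / T\<rfloor>"
   define y where "y = of_int ?i * T / real n"
   have i0: "0 <= ?i" using grid_index(1)[OF T n1 \<tau>t] .
   have y: "0 <= y" "y <= \<tau> t" unfolding y_def grid_le_iff[OF T n1] using i0 T by simp_all
   \<comment> \<open>\<open>y\<close> is the grid point where the grid path is read at time
     \<open>\<tau> t\<close>. Since \<open>\<tau>\<close> maps each jump time to a grid point,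
     \<open>y\<close> and \<open>t\<close> lie on the same side of every jump, whence f y = f
     t.\<close>
   have sep: "s <= t <-> s <= y" if s: "s : D" for s
   proof
    assume "s <= t"
    then have "up s <= \<tau> t" using mono'[of s t] \<tau>D[OF s] by simp
    then have "of_int \<lceil>s * real n / T\<rceil> <= \<tau> t * real n / T" unfolding up_def grid_le_iff[OF T n1] .
    then have "\<lceil>s * real n / T\<rceil> <= ?i" by (simp add: le_floor_iff)
    then have "up s <= y" unfolding up_def y_def using T by (intro divide_right_mono mult_right_mono) auto
    then show "s <= y" using up(1)[of s] by linarith
   next
    assume "s <= y"
    show "s <= t"
    proof (rule ccontr)
     assume "\<not> s <= t"
     then have "\<tau> t < up s" using mono[of t s] \<tau>D[OF s] by simp
     then have "\<tau> t * real n / T < of_int \<lceil>s * real n / T\<rceil>" unfolding up_def grid_le_iff[OF T n1] .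
     then have "?i < \<lceil>s * real n / T\<rceil>" by (simp add: floor_less_iff)
     then have "of_int ?i < s * real n / T" by (simp add: less_ceiling_iff)
     then have "y < s" unfolding y_def grid_le_iff[OF T n1] .
     then show False using \<open>s <= y\<close> by simp
    qed
   qed
   have yT: "y <= T" using y \<tau>t by auto
   have "f y = f t"
   proof (cases "y <= t")
    case True
    have "D \<inter> {y<..t} = {}" using sep by fastforce
    then show ?thesis using D(3)[OF y(1) True] t by simp
   next
    case False
    have "D \<inter> {t<..y} = {}" using sep by fastforce
    then show ?thesis using D(3)[of t y] False t yT by simp
   qed
   then show ?thesis using \<tau>t i0 by (simp add: grid_path_def y_def)
  qed
  then show ?thesis using \<tau> p_abs by (intro bexI[of _ \<tau>]) (auto simp: \<tau>_def)
 qed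
 then show ?thesis by (rule eventually_sequentiallyI)
qed

text \<open>Closeness of paths up to a time change; unlike \<^const>\<open>skorohod_dist\<close> it does not involve
 an infimum over a possibly empty set.\<close>

definition skorohod_close :: "real => ('e => 'e => real) => real => (real => 'e) => (real => 'e) => bool" where
 "skorohod_close T d r f g <-> (\<exists>\<tau>\<in>time_changes T. ALL t:{0..T}. \<bar>\<tau> t - t\<bar> <= r & d (f t) (g (\<tau> t)) <= r)"

lemma skorohod_dist_le:
 assumes "0 < r" "skorohod_close T d r f g"
 shows "skorohod_dist T d f g <= r" unfolding skorohod_dist_def by (rule cInf_lower) (use assms in \<open>auto simp: skorohod_close_def intro!: bdd_belowI[of _ 0]\<close>)

lemma time_change_id: "(%t. t) : time_changes T" by (simp add: time_changes_def strict_mono_on_def)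

lemma time_change_comp:
 assumes "\<tau> : time_changes T" "\<upsilon> : time_changes T"
 shows "(%t. \<upsilon> (\<tau> t)) : time_changes T"
proof -
 have 1: "\<tau> ` {0..T} = {0..T}" "\<upsilon> ` {0..T} = {0..T}" using assms by (auto simp: time_changes_def)
 then have "(%t. \<upsilon> (\<tau> t)) ` {0..T} = {0..T}" by (metis image_image)
 moreover have "continuous_on {0..T} (%t. \<upsilon> (\<tau> t))" using assms 1 by (intro continuous_on_compose2[of "{0..T}" \<upsilon> "{0..T}" \<tau>]) (auto simp: time_changes_def)
 moreover have "strict_mono_on {0..T} (%t. \<upsilon> (\<tau> t))" using assms 1 unfolding time_changes_def strict_mono_on_def by (smt (verit) image_eqI mem_Collect_eq)
 ultimately show ?thesis by (simp add: time_changes_def)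
qed

lemma time_change_inverse:
 assumes "\<tau> : time_changes T"
 obtains \<upsilon> where "\<upsilon> : time_changes T" "!!t. t : {0..T} ==> \<tau> (\<upsilon> t) = t"
proof
 let ?\<upsilon> = "the_inv_into {0..T} \<tau>"
 have sm: "strict_mono_on {0..T} \<tau>" and im: "\<tau> ` {0..T} = {0..T}" and cont: "continuous_on {0..T} \<tau>" using assms by (auto simp: time_changes_def)
 have inj: "inj_on \<tau> {0..T}" using sm by (rule strict_mono_on_imp_inj_on)
 show inv: "\<tau> (?\<upsilon> t) = t" if "t : {0..T}" for t using f_the_inv_into_f[OF inj] im that by blast
 have vim: "?\<upsilon> t : {0..T}" if "t : {0..T}" for t using the_inv_into_into[OF inj, of t "{0..T}"] im that by blast
 have "continuous_on (\<tau> ` {0..T}) ?\<upsilon>" by (rule continuous_on_inv[OF cont]) (use the_inv_into_f_f[OF inj] in auto)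
 moreover have "?\<upsilon> ` {0..T} = {0..T}" using the_inv_into_onto[OF inj] im by simp
 moreover have "strict_mono_on {0..T} ?\<upsilon>"
 proof (rule strict_mono_onI)
  fix s t assume st: "s : {0..T}" "t : {0..T}" "s < t"
  show "?\<upsilon> s < ?\<upsilon> t"
  proof (rule ccontr)
   assume "\<not> ?\<upsilon> s < ?\<upsilon> t"
   then have "\<tau> (?\<upsilon> t) <= \<tau> (?\<upsilon> s)" using strict_mono_on_leD[OF sm vim[OF st(2)] vim[OF st(1)]] by simp
   then show False using inv st by simp
  qed
 qed
 ultimately show "?\<upsilon> : time_changes T" using im by (simp add: time_changes_def)
qed

lemma skorohod_close_trans:
 assumes M: "Metric_space M d" and f: "f : {0..T} \<rightarrow> M" and g: "g : {0..T} \<rightarrow> M" and h: "h : {0..T} \<rightarrow> M"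
  and "skorohod_close T d r f g" "skorohod_close T d s g h"
 shows "skorohod_close T d (r + s) f h"
proof -
 interpret Metric_space M d by (rule M)
 obtain \<tau> where \<tau>: "\<tau> : time_changes T" "!!t. t : {0..T} ==> \<bar>\<tau> t - t\<bar> <= r & d (f t) (g (\<tau> t)) <= r" using assms(5) unfolding skorohod_close_def by blast
 obtain \<upsilon> where \<upsilon>: "\<upsilon> : time_changes T" "!!t. t : {0..T} ==> \<bar>\<upsilon> t - t\<bar> <= s & d (g t) (h (\<upsilon> t)) <= s"
  using assms(6) unfolding skorohod_close_def by blast
 have im: "\<tau> t : {0..T}" "\<upsilon> t : {0..T}" if "t : {0..T}" for t using \<tau>(1) \<upsilon>(1) that unfolding time_changes_def by blast+
 have "\<bar>\<upsilon> (\<tau> t) - t\<bar> <= r + s & d (f t) (h (\<upsilon> (\<tau> t))) <= r + s" if t: "t : {0..T}" for t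
 proof -
  have "d (f t) (h (\<upsilon> (\<tau> t))) <= d (f t) (g (\<tau> t)) + d (g (\<tau> t)) (h (\<upsilon> (\<tau> t)))"
   by (rule triangle[OF funcset_mem[OF f t] funcset_mem[OF g im(1)[OF t]] funcset_mem[OF h im(2)[OF im(1)[OF t]]]])
  then show ?thesis using \<tau>(2)[OF t] \<upsilon>(2)[OF im(1)[OF t]] by linarith
 qed
 then show ?thesis unfolding skorohod_close_def by (intro bexI[OF _ time_change_comp[OF \<tau>(1) \<upsilon>(1)]] ballI)
qed

lemma skorohod_close_sym:
 assumes M: "Metric_space M d" and "skorohod_close T d r f g"
 shows "skorohod_close T d r g f"
proof -
 interpret Metric_space M d by (rule M)
 obtain \<tau> where \<tau>: "\<tau> : time_changes T" "!!t. t : {0..T} ==> \<bar>\<tau> t - t\<bar> <= r & d (f t) (g (\<tau> t)) <= r" using assms(2) unfolding skorohod_close_def by blast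
 obtain \<upsilon> where \<upsilon>: "\<upsilon> : time_changes T" "!!t. t : {0..T} ==> \<tau> (\<upsilon> t) = t" using time_change_inverse[OF \<tau>(1)] by blast
 have "\<upsilon> t : {0..T}" if "t : {0..T}" for t using \<upsilon>(1) that unfolding time_changes_def by blast
 then have "\<bar>\<upsilon> t - t\<bar> <= r & d (g t) (f (\<upsilon> t)) <= r" if t: "t : {0..T}" for t
  using \<tau>(2)[of "\<upsilon> t"] \<upsilon>(2)[OF t] t by (simp add: commute abs_minus_commute)
 then show ?thesis unfolding skorohod_close_def using \<upsilon>(1) by blast
qed

lemma openin_skorohod_close:
 assumes "openin (skorohod_topology T E) U" "f : U"
 obtains r where "0 < r" "!!g. g : cadlag_paths T E ==> skorohod_close T (compatible_metric E) r f g ==> g : U"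
proof -
 obtain r where r: "0 < r" "ALL g:cadlag_paths T E. skorohod_dist T (compatible_metric E) f g < r --> g : U" using assms unfolding openin_skorohod_topology by blast
 show ?thesis
 proof (rule that[of "r / 2"])
  fix g assume g: "g : cadlag_paths T E" "skorohod_close T (compatible_metric E) (r / 2) f g"
  then have "skorohod_dist T (compatible_metric E) f g <= r / 2" using r(1) by (intro skorohod_dist_le) auto
  then show "g : U" using r g(1) by auto
 qed (use r in simp)
qed

lemma topspace_skorohod: "topspace (skorohod_topology T E) = cadlag_paths T E"
proof
 have "openin (skorohod_topology T E) (cadlag_paths T E)" unfolding openin_skorohod_topology by (auto intro: exI[of _ 1])
 then show "cadlag_paths T E \<subseteq> topspace (skorohod_topology T E)" by (rule openin_subset)
 show "topspace (skorohod_topology T E) \<subseteq> cadlag_paths T E" using openin_topspace[of "skorohod_topology T E"] unfolding openin_skorohod_topology by blast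
qed

text \<open>The paths are limits of grid paths, which depend on finitely many values of the path. A
  grid path at small distance need not inherit membership in an open set \<open>U\<close>, so
  \<open>U\<close> is exhausted by sets \<open>Uk k\<close> with a margin; the path is in
  \<open>U\<close> exactly if for some \<open>k\<close> the grid paths are eventually in
  \<open>Uk k\<close>.\<close>

lemma (in bump_space) step_path_measurable:
 fixes Z :: "'w => real => 'a measure"
 assumes T: "0 < T" and step: "!!w. w : space Om ==> step_path T (FM A) (Z w)"
  and meas: "!!t i. t : {0..T} ==> (%w. coords (Z w t) i) : BM Om"
 shows "Z : Om ->M borel_of (skorohod_topology T (WT A))"
proof (rule measurable_borel_of)
 let ?E = "WT A" and ?M = "FM A"
 let ?d = "compatible_metric ?E"
 note MS = compatible_metric_weak(1)
 interpret Metric_space ?M ?d by (rule MS)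
 have cad: "f : cadlag_paths T ?E" if "step_path T ?M f" for f using that by (intro step_path_cadlag) (simp add: topspace_weak)
 have pi: "f : {0..T} \<rightarrow> ?M" if "f : cadlag_paths T ?E" for f using that by (auto simp: cadlag_paths_def topspace_weak)
 show "Z w : topspace (skorohod_topology T ?E)" if "w : space Om" for w using cad[OF step[OF that]] by (simp add: topspace_skorohod)
 fix U assume U: "openin (skorohod_topology T ?E) U"
 let ?close = "skorohod_close T ?d"
 \<comment> \<open>Paths around which a neighbourhood of radius strictly larger than 1/(k+1) lies in
   \<open>U\<close>. The strict inequality leaves room for perturbing the values of a grid
   path.\<close>
 define Uk where "Uk k = {f : cadlag_paths T ?E. EX r>1 / real (Suc k). ALL g:cadlag_paths T ?E. ?close r f g --> g : U}" for k
 define grid where "grid n w = (%i. Z w (real i * T / real n))" for n w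
 have gridM: "grid n w i : ?M" if "w : space Om" "i <= n" "0 < n" for n w i
 proof -
  have "real i * T / real n : {0..T}" using that T by (auto simp: divide_le_eq mult.commute)
  then show ?thesis using step[OF that(1)] by (auto simp: grid_def step_path_def)
 qed
 have eq: "w : Z -` U <-> (EX k n0. ALL n>=n0. grid_path T (Suc n) (grid (Suc n) w) : Uk k)" if w: "w : space Om" for w
 proof -
  let ?Zn = "%n. grid_path T (Suc n) (grid (Suc n) w)"
  have cZ: "Z w : cadlag_paths T ?E" using cad step w by blast
  have cZn: "?Zn n : cadlag_paths T ?E" for n using gridM[OF w] T by (intro cad grid_step_path) auto
  have conv: "EX n0. ALL n>=n0. ?close r (Z w) (?Zn n)" if r: "0 < r" for r
  proof -
   obtain n0 where n0: "!!n. n0 <= n ==> \<exists>\<tau>\<in>time_changes T. ALL t:{0..T}. \<bar>\<tau> t - t\<bar> <= r & grid_path T n (grid n w) (\<tau> t) = Z w t"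
    using grid_approximation[OF T step[OF w] r] unfolding eventually_sequentially grid_def by blast
   have "?close r (Z w) (?Zn n)" if "n0 <= n" for n using n0[of "Suc n"] that pi[OF cZ] r unfolding skorohod_close_def by (fastforce simp: Pi_iff)
   then show ?thesis by blast
  qed
  show ?thesis
  proof
   assume "w : Z -` U"
   then obtain r where r: "0 < r" "!!g. g : cadlag_paths T ?E ==> ?close r (Z w) g ==> g : U" using openin_skorohod_close[OF U, of "Z w"] by blast
   obtain k where k: "1 / real (Suc k) < r / 2" using r(1) nat_approx_posE[of "r / 2"] by auto
   obtain n0 where n0: "!!n. n0 <= n ==> ?close (r / 2) (Z w) (?Zn n)" using conv[of "r / 2"] r(1) by auto
   have "?Zn n : Uk k" if "n0 <= n" for n unfolding Uk_def
   proof (intro CollectI conjI exI[of _ "r / 2"] k cZn ballI impI r(2))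
    fix g assume g: "g : cadlag_paths T ?E" "?close (r / 2) (?Zn n) g"
    show "?close r (Z w) g" using skorohod_close_trans[OF MS pi[OF cZ] pi[OF cZn] pi[OF g(1)] n0[OF that] g(2)] by simp
   qed
   then show "EX k n0. ALL n>=n0. ?Zn n : Uk k" by blast
  next
   assume "EX k n0. ALL n>=n0. ?Zn n : Uk k"
   then obtain k n0 where k: "!!n. n0 <= n ==> ?Zn n : Uk k" by blast
   obtain n1 where n1: "!!n. n1 <= n ==> ?close (1 / real (Suc k)) (Z w) (?Zn n)" using conv[of "1 / real (Suc k)"] by auto
   let ?n = "max n0 n1"
   obtain r where r: "1 / real (Suc k) < r" "!!g. g : cadlag_paths T ?E ==> ?close r (?Zn ?n) g ==> g : U" using k[of ?n] by (auto simp: Uk_def)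
   have "?close (1 / real (Suc k)) (?Zn ?n) (Z w)" by (rule skorohod_close_sym[OF MS n1]) simp
   then have "?close r (?Zn ?n) (Z w)" using r(1) unfolding skorohod_close_def by (meson less_imp_le order_trans)
   then show "w : Z -` U" using r(2)[OF cZ] by blast
  qed
 qed
 have ms: "{w : space Om. grid_path T n (grid n w) : Uk k} : sets Om" if n: "0 < n" for n k
 proof -
  let ?box = "%V. {x :: nat => nat => real. ALL i<=n. x i : V i}"
  \<comment> \<open>Products of open sets of coordinates on which the grid path is forced into
    \<open>Uk k\<close>. Their union is open, and by the choice of \<delta> below it captures all
    grid paths in \<open>Uk k\<close>.\<close>
  define \<V> where "\<V> = {V. (ALL i. open (V i)) & (ALL v. (ALL i<=n. v i : ?M & coords (v i) : V i) --> grid_path T n v : Uk k)}"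
  have "open (?box V)" if "V : \<V>" for V
  proof -
   have "?box V = (\<Inter>i\<in>{..n}. (%x. x i) -` V i)" by auto
   moreover have "open \<dots>" using that unfolding \<V>_def by (intro open_INT ballI open_vimage continuous_on_product_coordinates) auto
   ultimately show ?thesis by simp
  qed
  then have op: "open (\<Union>V\<in>\<V>. ?box V)" by (intro open_UN ballI)
  have iff: "grid_path T n v : Uk k <-> (%i. coords (v i)) : (\<Union>V\<in>\<V>. ?box V)" if v: "!!i. i <= n ==> v i : ?M" for v
  proof
   assume "(%i. coords (v i)) : (\<Union>V\<in>\<V>. ?box V)"
   then show "grid_path T n v : Uk k" using v unfolding \<V>_def by blast
  next
   assume "grid_path T n v : Uk k"
   then obtain r where r: "1 / real (Suc k) < r" "!!g. g : cadlag_paths T ?E ==> ?close r (grid_path T n v) g ==> g : U" by (auto simp: Uk_def)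
   define \<delta> where "\<delta> = (r - 1 / real (Suc k)) / 2"
   have \<delta>: "0 < \<delta>" "1 / real (Suc k) < r - \<delta>" unfolding \<delta>_def using r(1) by (auto simp only: half_gt_zero_iff diff_gt_0_iff_gt) argo
   have "EX V. open V & mball (v i) \<delta> = {u : ?M. coords u : V}" for i using openin_mball[of "v i" \<delta>] unfolding compatible_metric_weak(2) openin_weak_iff .
   then obtain V where V: "!!i. open (V i)" "!!i. mball (v i) \<delta> = {u : ?M. coords u : V i}" by metis
   have "grid_path T n u : Uk k" if u: "ALL i<=n. u i : ?M & coords (u i) : V i" for u unfolding Uk_def
   proof (intro CollectI conjI exI[of _ "r - \<delta>"] \<delta> ballI impI r(2))
    show cu: "grid_path T n u : cadlag_paths T ?E" using u T n by (intro cad grid_step_path) auto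
    have cv: "grid_path T n v : cadlag_paths T ?E" using v T n by (intro cad grid_step_path) auto
    have "?d (v i) (u i) <= \<delta>" if "i <= n" for i
    proof -
     have "u i : mball (v i) \<delta>" using u that V(2) by blast
     then show ?thesis by simp
    qed
    then have "?close \<delta> (grid_path T n v) (grid_path T n u)" unfolding skorohod_close_def using \<delta>(1) grid_index(2)[OF T n] by (intro bexI[OF _ time_change_id]) (auto simp: grid_path_def)
    then show "?close r (grid_path T n v) g" if "g : cadlag_paths T ?E" "?close (r - \<delta>) (grid_path T n u) g" for g
     using skorohod_close_trans[OF MS pi[OF cv] pi[OF cu] pi[OF that(1)] _ that(2)] by fastforce
   qed
   then have "V : \<V>" unfolding \<V>_def using V(1) by blast
   moreover have "coords (v i) : V i" if "i <= n" for i
   proof -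
    have "v i : mball (v i) \<delta>" using v[OF that] \<delta>(1) by simp
    then show ?thesis using V(2) by blast
   qed
   ultimately show "(%i. coords (v i)) : (\<Union>V\<in>\<V>. ?box V)" by blast
  qed
  let ?x = "%w i. coords (grid n w (min i n))"
  have "?x : BM Om" unfolding grid_def using T n by (intro measurable_coordinatewise_then_product meas) (auto simp: divide_le_eq mult.commute min_def)
  then have "?x -` (\<Union>V\<in>\<V>. ?box V) \<inter> space Om : sets Om" using op by (intro measurable_sets) auto
  moreover have "?x -` (\<Union>V\<in>\<V>. ?box V) \<inter> space Om = {w : space Om. grid_path T n (grid n w) : Uk k}"
  proof -
   have a: "?x w : (\<Union>V\<in>\<V>. ?box V) <-> (%i. coords (grid n w i)) : (\<Union>V\<in>\<V>. ?box V)" for w by (simp add: min_def)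
   have b: "(%i. coords (grid n w i)) : (\<Union>V\<in>\<V>. ?box V) <-> grid_path T n (grid n w) : Uk k" if "w : space Om" for w by (rule iff[symmetric]) (rule gridM[OF that _ n])
   show ?thesis
   proof (rule set_eqI)
    fix w
    show "w : ?x -` (\<Union>V\<in>\<V>. ?box V) \<inter> space Om <-> w : {w : space Om. grid_path T n (grid n w) : Uk k}"
     by (cases "w : space Om") (simp_all only: Int_iff vimage_eq mem_Collect_eq a b simp_thms)
   qed
  qed
  ultimately show ?thesis by simp
 qed
 have "Z -` U \<inter> space Om = (\<Union>k. \<Union>n0. \<Inter>n\<in>{n0..}. {w : space Om. grid_path T (Suc n) (grid (Suc n) w) : Uk k})"
 proof (rule set_eqI)
  fix w
  show "w : Z -` U \<inter> space Om <-> w : (\<Union>k. \<Union>n0. \<Inter>n\<in>{n0..}. {w : space Om. grid_path T (Suc n) (grid (Suc n) w) : Uk k})"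
  proof (cases "w : space Om")
   case True
   then show ?thesis using eq[OF True] by simp (simp add: Ball_def)
  next
   case False
   then show ?thesis by auto
  qed
 qed
 also have "\<dots> : sets Om" by (intro sets.countable_UN' sets.countable_INT' ms image_subsetI) auto
 finally show "Z -` U \<inter> space Om : sets Om" .
qed

section \<open>Concentration at the limit, uniformly in time\<close>

lemma tendsto_fun_iff:
 fixes f :: "'b => 'i => 'c::topological_space"
 assumes "!!i. ((%x. f x i) \<longlongrightarrow> l i) F"
 shows "(f \<longlongrightarrow> l) F" using assms limitin_componentwise[of "%_. euclidean" UNIV f l F] unfolding euclidean_product_topology limitin_canonical_iff by simp

lemma conv_assoc: "conv (conv f g) h u = conv f (conv g h) u" by (induction u arbitrary: f g h) (simp_all add: conv_add_mset conv_add_left conv_add_right)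

text \<open>At time \<open>T\<close> the process is in its \<open>n\<close>-th state for some
  \<open>n\<close>, so only the first \<open>n\<close> jump times can lie in (0, T].\<close>

lemma (in jump_process) X_step:
 assumes w: "w : space Om" and T: "0 <= T"
 obtains D where "finite D" "D \<subseteq> {0<..T}"
  "!!t t'. 0 <= t ==> t <= t' ==> t' <= T ==> D \<inter> {t<..t'} = {} ==> X t w = X t' w"
proof -
 obtain n where n: "w : at_state n T" using X_eq(1)[OF w T] by blast
 let ?D = "(%i. enn2real (\<tau> i w)) ` {..n} \<inter> {0<..T}"
 have "X t w = X t' w" if t: "0 <= t" "t <= t'" "t' <= T" "?D \<inter> {t<..t'} = {}" for t t'
 proof -
  obtain i where i: "w : at_state i t" using X_eq(1)[OF w t(1)] by blast
  obtain j where j: "w : at_state j t'" using X_eq(1)[OF w, of t'] t by auto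
  have "i = j"
  proof (rule ccontr)
   assume "i ~= j"
   then have "Suc i <= j" using at_state_mono[OF i j t(2)] by simp
   then have le: "\<tau> (Suc i) w <= ennreal t'" using \<tau>_mono[of "Suc i" j w] j by (auto intro: order_trans)
   define z where "z = enn2real (\<tau> (Suc i) w)"
   have z: "\<tau> (Suc i) w = ennreal z" "0 <= z" unfolding z_def using le le_less_trans[OF le, of top] by (auto simp: ennreal_enn2real)
   have "ennreal t < ennreal z" "ennreal z <= ennreal t'" using i le by (auto simp flip: z(1))
   then have "t < z" "z <= t'" using t by (auto simp: ennreal_less_iff ennreal_le_iff)
   moreover have "Suc i <= n" using \<open>Suc i <= j\<close> at_state_mono[OF j n t(3)] by simp
   ultimately show False using t unfolding z_def by force
  qed
  then show ?thesis using X_eq(2)[OF w t(1) i] X_eq(2)[OF w _ j] t by simp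
 qed
 then show ?thesis by (intro that[of ?D]) auto
qed

context coag_kernel
begin

lemma conv_sing_left: "conv (sing h) F u = sub_sum (%x v. h x * F v) u"
proof (induction u arbitrary: F)
 case (add x u)
 have unit: "conv (%v. sing h (add_mset x v)) F u = h x * F u" for F
 proof -
  have "conv (%v. sing h (add_mset x v)) F u = h x * conv (%v. if v = {#} then 1 else 0) F u" unfolding conv_cmult_left[symmetric] by (intro conv_cong) (auto simp: sing_def)
  also have "conv (%v. if v = {#} then 1 else 0) F u = F u" by (induction u arbitrary: F) (simp_all add: conv_add_mset)
  finally show ?thesis .
 qed
 show ?case unfolding conv_add_mset unit add.IH by (simp add: sub_sum_add_mset)
qed (simp add: sing_def)

lemma conv_sing_one: "conv (sing h) (%_. 1) u = (\<Sum>x\<in>#u. h x)" unfolding conv_sing_left by (simp add: sub_sum_def)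

text \<open>\<open>conv\<close> picks distinct particles, so the square of the sum appears without
  its diagonal.\<close>

lemma conv_sing_sing_one: "conv (conv (sing h) (sing h)) (%_. 1) u = (\<Sum>x\<in>#u. h x)\<^sup>2 - (\<Sum>x\<in>#u. (h x)\<^sup>2)"
proof -
 have "conv (sing h) (%_. 1) = (%u. \<Sum>x\<in>#u. h x)" by (rule ext) (rule conv_sing_one)
 then have "conv (conv (sing h) (sing h)) (%_. 1) u = sub_sum (%x v. h x * (\<Sum>y\<in>#v. h y)) u" unfolding conv_assoc conv_sing_left by simp
 also have "\<dots> = (\<Sum>x\<in>#u. h x * ((\<Sum>y\<in>#u. h y) - h x))" unfolding sub_sum_def
 proof (intro arg_cong[where f = sum_mset] image_mset_cong)
  fix x assume "x \<in># u"
  then obtain v where "u = add_mset x v" by (metis mset_add)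
  then show "h x * (\<Sum>y\<in>#u - {#x#}. h y) = h x * ((\<Sum>y\<in>#u. h y) - h x)" by simp
 qed
 also have "\<dots> = (\<Sum>x\<in>#u. h x)\<^sup>2 - (\<Sum>x\<in>#u. (h x)\<^sup>2)"
 proof -
  have "(\<Sum>x\<in>#\<eta>. h x * (s - h x)) = s * (\<Sum>x\<in>#\<eta>. h x) - (\<Sum>x\<in>#\<eta>. (h x)\<^sup>2)" for s \<eta>
   by (induction \<eta>) (simp_all add: algebra_simps power2_eq_square)
  then show ?thesis by (simp add: power2_eq_square)
 qed
 finally show ?thesis .
qed

lemma conv_sing_sing_size: "size u ~= 2 ==> conv (sing f) (sing g) u = 0" unfolding conv_sing_left sub_sum_def by (intro sum_mset.neutral) (auto simp: sing_def size_Diff_singleton)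

lemma conv_sing_sing: "conv (sing f) (sing g) u = dbl (%(x, y). f x * g y) u"
proof (cases "size u = 2")
 case True
 then obtain x y where "u = {#x, y#}" using size_two by blast
 then show ?thesis by (simp add: conv_add_mset sing_def)
qed (simp add: conv_sing_sing_size dbl_def)

lemma conv_scaled_size:
 assumes "!!u. size u ~= k ==> h u = 0"
 shows "conv (scaled N h) F u = conv h F u / N ^ k"
proof -
 have "conv (scaled N h) F u = 1 / N ^ k * conv h F u" unfolding conv_cmult_left[symmetric]
 proof (rule conv_cong)
  show "scaled N h v = 1 / N ^ k * h v" for v using assms[of v] by (cases "size v = k") (auto simp: scaled_def)
 qed simp
 then show ?thesis by simp
qed

end

context coag_limit
begin

text \<open>Expanding the square, the second factorial moment tends to the square of the limiting
  mean by \<open>R_conv\<close>, the diagonal is a first moment divided by N, and the mixed term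
  converges by \<open>mn_tendsto\<close>; the limits cancel.\<close>

lemma chebyshev:
 assumes h: "h : BM PA" "!!x. x : A ==> \<bar>h x\<bar> <= c" and c: "0 <= c" and t: "0 <= t" "t <= T"
 shows "(%N. LINT w|(Om N). ((\<Sum>x\<in>#X N t w. h x) / N - (LINT x|(\<rho> t). h x))\<^sup>2) \<longlonglongrightarrow> 0"
  "0 < N ==> integrable (Om N) (%w. ((\<Sum>x\<in>#X N t w. h x) / N - (LINT x|(\<rho> t). h x))\<^sup>2)"
proof -
 let ?a = "LINT x|(\<rho> t). h x" and ?h2 = "%x. (h x)\<^sup>2"
 have h2: "?h2 : BM PA" "!!x. x : A ==> \<bar>?h2 x\<bar> <= c\<^sup>2" using h by (auto simp: abs_le_square_iff[symmetric] c)
 have c2: "0 <= c\<^sup>2" by simp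
 have b: "tame (sing f)" "!!u. pts u ==> \<bar>sing f u\<bar> <= d * W 1 1 u" "(%N. mn N (sing f) t) \<longlonglongrightarrow> (LINT x|(\<rho> t). f x)"
  if f: "f : BM PA" "!!x. x : A ==> \<bar>f x\<bar> <= d" and d: "0 <= d" for f d
 proof -
  have m: "\<bar>f x\<bar> <= d * real (mass x)" if "x : A" for x by (rule bounded_by_mass[of f x d, OF f(2)[OF that] d that])
  show 1: "tame (sing f)" "!!u. pts u ==> \<bar>sing f u\<bar> <= d * W 1 1 u" by (rule tame_sing[OF f(1) m d], assumption) (rule sing_bound[OF m d], assumption+)
  show "(%N. mn N (sing f) t) \<longlonglongrightarrow> (LINT x|(\<rho> t). f x)" using mn_tendsto[OF 1(1) order_refl d 1(2) t] R_sing[OF t f] by simp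
 qed
 note b1 = b[OF h c] and b2 = b[OF h2 c2]
 let ?q = "conv (sing h) (sing h)"
 have q: "?q = dbl (%(x, y). h x * h y)" by (rule ext) (rule conv_sing_sing)
 have qb: "\<bar>?q u\<bar> <= c\<^sup>2 * W 2 1 u" if "pts u" for u unfolding q
 proof (rule dbl_bound[OF _ c2 that])
  fix x y assume xy: "x : A" "y : A"
  have "\<bar>h x * h y\<bar> <= c * c" unfolding abs_mult using h(2) xy c by (intro mult_mono) auto
  then show "\<bar>(%(x, y). h x * h y) (x, y)\<bar> <= c\<^sup>2 * (real (mass x) * real (mass y))" by (intro bounded_by_mass2[OF _ c2 xy]) (simp add: power2_eq_square)
 qed
 have qt: "tame ?q" by (rule tame_conv[OF b1(1) b1(1)])
 have "R (1 + 1) ?q t = R 1 (sing h) t * R 1 (sing h) t" by (rule R_conv[OF b1(1) order_refl c b1(2) _ b1(1) order_refl c b1(2) _ t]) (simp_all add: sing_def)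
 then have Rq: "R 2 ?q t = ?a\<^sup>2" using R_sing[OF t h] by (simp add: power2_eq_square numeral_2_eq_2)
 have lim2: "(%N. mn N ?q t) \<longlonglongrightarrow> ?a\<^sup>2" using mn_tendsto[OF qt _ c2 qb t] Rq by simp
 have sq: "((\<Sum>x\<in>#u. h x) / N - ?a)\<^sup>2 = conv (scaled N ?q) (%_. 1) u + conv (scaled N (sing ?h2)) (%_. 1) u / N -
   2 * ?a * conv (scaled N (sing h)) (%_. 1) u + ?a\<^sup>2" if "0 < N" for u and N :: nat
 proof -
  have s1: "conv (scaled N (sing f)) (%_. 1) u = (\<Sum>x\<in>#u. f x) / N" for f using conv_scaled_size[of 1 "sing f"] by (simp add: sing_def conv_sing_one[symmetric])
  have s2: "conv (scaled N ?q) (%_. 1) u = ((\<Sum>x\<in>#u. h x)\<^sup>2 - (\<Sum>x\<in>#u. (h x)\<^sup>2)) / N\<^sup>2"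
   using conv_scaled_size[of 2 ?q, OF conv_sing_sing_size] by (simp add: conv_sing_sing_one)
  show ?thesis unfolding s1 s2 using that by (simp add: power2_eq_square field_simps)
 qed
 have int: "integrable (Om N) (%w. conv (scaled N ?q) (%_. 1) (X N t w))"
  "integrable (Om N) (%w. conv (scaled N (sing ?h2)) (%_. 1) (X N t w))"
  "integrable (Om N) (%w. conv (scaled N (sing h)) (%_. 1) (X N t w))" if "0 < N" for N
  using mn_bounds(1)[OF that qt _ c2 qb t] mn_bounds(1)[OF that b2(1) order_refl c2 b2(2) t] mn_bounds(1)[OF that b1(1) order_refl c b1(2) t] by auto
 have const: "integrable (Om N) (%_. d :: real)" "(LINT w|(Om N). d) = d" if "0 < N" for N and d :: real
 proof -
  interpret P: coag_short_process A \<B> K J mass H \<nu> T "Om N" N "Y N" "\<sigma> N" "X N" by (rule short_process[OF that])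
  show "integrable (Om N) (%_. d)" "(LINT w|(Om N). d) = d" by (simp_all add: P.prob_space)
 qed
 show "integrable (Om N) (%w. ((\<Sum>x\<in>#X N t w. h x) / N - ?a)\<^sup>2)" if N: "0 < N" unfolding sq[OF N] using int[OF N] const[OF N] by simp
 have "(%N. mn N ?q t + mn N (sing ?h2) t * (1 / real N) - 2 * ?a * mn N (sing h) t + ?a\<^sup>2) \<longlonglongrightarrow> ?a\<^sup>2 + (LINT x|(\<rho> t). ?h2 x) * 0 - 2 * ?a * ?a + ?a\<^sup>2"
  by (intro tendsto_intros lim2 b1(3) b2(3) lim_1_over_n)
 then have "(%N. mn N ?q t + mn N (sing ?h2) t * (1 / real N) - 2 * ?a * mn N (sing h) t + ?a\<^sup>2) \<longlonglongrightarrow> 0" by (simp add: power2_eq_square)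
 then show "(%N. LINT w|(Om N). ((\<Sum>x\<in>#X N t w. h x) / N - ?a)\<^sup>2) \<longlonglongrightarrow> 0"
 proof (rule Lim_transform_eventually, intro eventually_sequentiallyI[of 1])
  fix N :: nat assume "1 <= N"
  then have N: "0 < N" by simp
  show "mn N ?q t + mn N (sing ?h2) t * (1 / real N) - 2 * ?a * mn N (sing h) t + ?a\<^sup>2 = (LINT w|(Om N). ((\<Sum>x\<in>#X N t w. h x) / N - ?a)\<^sup>2)"
   unfolding sq[OF N] mn_def using int[OF N] const[OF N] by simp
 qed
qed

lemma tame_sum:
 assumes "h : BM PA" "!!x. x : A ==> \<bar>h x\<bar> <= c" "0 <= c"
 shows "tame (%u. \<Sum>x\<in>#u. h x)"
proof -
 have "tame (conv (sing h) (%_. 1))" by (rule tame_conv_one[OF tame_sing[OF assms(1) bounded_by_mass[of h _ c, OF assms(2,3)] assms(3)]])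
 then show ?thesis unfolding ext[of "conv (sing h) (%_. 1)", OF conv_sing_one] .
qed

text \<open>A merger replaces h a + h b by h z, which is not larger, so jumps that increase the sum
  have rate 0.\<close>

lemma AE_sum_decreasing:
 assumes h: "h : BM PA" "!!a b z. a : A ==> b : A ==> z : A ==> h z <= h a + h b" and N: "0 < N"
 shows "AE w in Om N. ALL s t. 0 <= s --> s <= t --> (\<Sum>x\<in>#X N t w. h x :: real) <= (\<Sum>x\<in>#X N s w. h x)"
proof -
 interpret P: coag_process A \<B> K J mass H \<nu> "Om N" N "Y N" "\<sigma> N" "X N" by (rule process[OF N])
 show ?thesis
 proof (rule P.AE_decreasing[OF sum_measurable[OF h(1)]])
  fix u and c :: real assume u: "u : space PM" "(\<Sum>x\<in>#u. h x) <= c"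
  have "rate (real N) u {v : space PM. c < (\<Sum>x\<in>#v. h x)} = pair_sum (%a b v. 0) u" unfolding rate_def
  proof (rule pair_sum_cong)
   fix a b v assume eq: "add_mset a (add_mset b v) = u"
   then have ab: "a : A" "b : A" using pairD[OF eq u(1)] by auto
   have e: "{z : A. add_mset z v : {v : space PM. c < (\<Sum>x\<in>#v. h x)}} = {}"
   proof -
    have "(\<Sum>x\<in>#add_mset z v. h x) <= c" if "z : A" for z using h(2)[OF ab that] u(2) eq by auto
    then show ?thesis by (auto simp: not_less[symmetric] simp del: image_mset_add_mset)
   qed
   show "K a b / real N * measure (J a b) {z : A. add_mset z v : {v : space PM. c < (\<Sum>x\<in>#v. h x)}} = 0" unfolding e by simp
  qed
  then show "rate (real N) u {v : space PM. c < (\<Sum>x\<in>#v. h x)} = 0" by (simp add: pair_sum_zero)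
 qed
qed

context
 assumes T: "0 < T"
begin

lemma \<rho>_continuous:
 fixes f :: "'a => real"
 assumes "f : BM PA" "!!x. x : A ==> \<bar>f x\<bar> <= c"
 shows "continuous_on {0..T} (%s. LINT x|(\<rho> s). f x)"
proof (rule DERIV_continuous_on)
 fix t assume t: "t : {0..T}"
 show "((%s. LINT x|(\<rho> s). f x) has_real_derivative 1/2 * (LINT p|(\<rho> t <*> \<rho> t). jump_effect f p)) (at t within {0..T})" using t T by (intro limit_derivative(1)[of f c] assms) auto
qed

text \<open>Subadditivity makes the sum over the particles decreasing in time. If such a path is
  close to a uniformly continuous function at the points of a fine grid, it is squeezed between its
  values at the neighbouring grid points everywhere else. Only finitely many times remain, which
  \<open>chebyshev\<close> handles through Markov's inequality.\<close>

lemma sup_control: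
 assumes h: "h : BM PA" "!!x. x : A ==> \<bar>h x\<bar> <= c" and c: "0 <= c"
  and sub: "!!a b z. a : A ==> b : A ==> z : A ==> h z <= h a + h b" and \<eta>: "0 < \<eta>" and \<delta>: "0 < \<delta>"
 shows "\<forall>\<^sub>F N in sequentially. EX B:sets (Om N). measure (Om N) B <= \<delta> \<and>
  (AE w in Om N. w \<notin> B --> (ALL t:{0..T}. \<bar>(\<Sum>x\<in>#X N t w. h x) / N - (LINT x|(\<rho> t). h x)\<bar> <= \<eta>))"
proof -
 let ?g = "%t. LINT x|(\<rho> t). h x" and ?s = "%N t w. (\<Sum>x\<in>#X N t w. h x) / real N"
 have "uniformly_continuous_on {0..T} ?g" by (intro compact_uniformly_continuous \<rho>_continuous[OF h]) auto
 then obtain e where e: "0 < e" "!!s t. s : {0..T} ==> t : {0..T} ==> \<bar>t - s\<bar> < e ==> \<bar>?g t - ?g s\<bar> < \<eta> / 2"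
  unfolding uniformly_continuous_on_def dist_real_def using \<eta> by (metis half_gt_zero abs_minus_commute)
 obtain m :: nat where m: "T / e < m" using reals_Archimedean2 by blast
 then have m0: "0 < m" using T e(1) by (metis divide_pos_pos less_trans of_nat_0_less_iff)
 let ?t = "%j. real j * T / real m"
 have tj: "?t j : {0..T}" if "j <= m" for j using that T m0 by (auto simp: divide_le_eq mult.commute)
 have lim: "(%N. \<Sum>j\<le>m. (LINT w|(Om N). (?s N (?t j) w - ?g (?t j))\<^sup>2) / (\<eta> / 2)\<^sup>2) \<longlonglongrightarrow> (\<Sum>j\<le>m. 0 / (\<eta> / 2)\<^sup>2)"
  using tj \<eta> by (intro tendsto_intros chebyshev(1)[OF h c]) auto
 then have "\<forall>\<^sub>F N in sequentially. (\<Sum>j\<le>m. (LINT w|(Om N). (?s N (?t j) w - ?g (?t j))\<^sup>2) / (\<eta> / 2)\<^sup>2) < \<delta>"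
  using \<delta> by (intro order_tendstoD(2)[OF lim]) simp
 then show ?thesis using eventually_gt_at_top[of 0]
 proof eventually_elim
  case (elim N)
  note N = elim(2)
  interpret P: coag_process A \<B> K J mass H \<nu> "Om N" N "Y N" "\<sigma> N" "X N" by (rule process[OF N])
  have sm: "(%w. ?s N t w) : BM (Om N)" if "0 <= t" for t using mcomp[OF P.X_measurable[OF that] sum_measurable[OF h(1)]] by simp
  let ?B = "%j. {w : space (Om N). \<eta> / 2 <= \<bar>?s N (?t j) w - ?g (?t j)\<bar>}"
  have Bs: "?B j : sets (Om N)" if "j <= m" for j
  proof -
   have "{w : space (Om N). \<eta> / 2 <= \<bar>u w - a\<bar>} : sets (Om N)" if "u : BM (Om N)" for u and a :: real using that by measurable
   then show ?thesis using sm[of "?t j"] tj[OF that] by auto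
  qed
  have dec: "AE w in Om N. ALL s t. 0 <= s --> s <= t --> (\<Sum>x\<in>#X N t w. h x) <= (\<Sum>x\<in>#X N s w. h x)" by (rule AE_sum_decreasing[OF h(1) _ N]) (rule sub)
  have "P.prob (\<Union>j\<le>m. ?B j) <= (\<Sum>j\<le>m. P.prob (?B j))" using Bs by (intro P.finite_measure_subadditive_finite) auto
  also have "\<dots> <= (\<Sum>j\<le>m. (LINT w|(Om N). (?s N (?t j) w - ?g (?t j))\<^sup>2) / (\<eta> / 2)\<^sup>2)"
  proof (rule sum_mono)
   fix j assume "j : {..m}"
   then have t: "0 <= ?t j" "?t j <= T" using tj by auto
   have eq: "?B j = {w : space (Om N). (\<eta> / 2)\<^sup>2 <= (?s N (?t j) w - ?g (?t j))\<^sup>2}" using \<eta> by (intro Collect_cong conj_cong refl) (simp add: abs_le_square_iff[symmetric])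
   show "P.prob (?B j) <= (LINT w|(Om N). (?s N (?t j) w - ?g (?t j))\<^sup>2) / (\<eta> / 2)\<^sup>2"
    unfolding eq using \<eta> by (intro integral_Markov_inequality_measure[where A = "{}"] chebyshev(2)[OF h c t N]) auto
  qed
  finally have "P.prob (\<Union>j\<le>m. ?B j) <= \<delta>" using elim(1) by linarith
  moreover have "AE w in Om N. w \<notin> (\<Union>j\<le>m. ?B j) --> (ALL t:{0..T}. \<bar>?s N t w - ?g t\<bar> <= \<eta>)" using dec AE_space
  proof eventually_elim
   case (elim w)
   show ?case
   proof (intro impI ballI)
    fix t assume good: "w \<notin> (\<Union>j\<le>m. ?B j)" and t: "t : {0..T}"
    have g: "\<bar>?s N (?t j) w - ?g (?t j)\<bar> < \<eta> / 2" if "j <= m" for j using good that elim(2) by fastforce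
    have dec: "?s N t' w <= ?s N s w" if "0 <= s" "s <= t'" for s t' using elim(1) that by (simp add: divide_right_mono)
    let ?i = "\<lfloor>t * real m / T\<rfloor>"
    define j where "j = nat ?i"
    note i = grid_index[OF T m0 t, folded j_def]
    have j1: "?t j <= t" using i(1) grid_le_iff(1)[OF T m0, of ?i t] unfolding j_def by simp
    have j2: "t < of_int (?i + 1) * T / real m" unfolding grid_le_iff(3)[OF T m0] by linarith
    have mesh: "T / real m < e" using m e(1) m0 by (simp add: field_simps)
    have d1: "\<bar>t - ?t j\<bar> < e" using j1 j2 i(1) mesh unfolding j_def by (simp add: distrib_right add_divide_distrib)
    have up: "?s N t w <= ?g t + \<eta>" using dec[of "?t j" t] j1 tj[OF i(2)] g[OF i(2)] e(2)[OF tj[OF i(2)] t d1] unfolding atLeastAtMost_iff by linarith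
    have low: "?g t - \<eta> <= ?s N t w"
    proof (cases "j = m")
     case True
     then have "t = T" using j1 t m0 by simp
     then have "?t m = t" using m0 by simp
     then show ?thesis using g[of m] \<eta> by (simp only: abs_less_iff) linarith
    next
     case False
     then have sj: "Suc j <= m" using i(2) by simp
     have eq: "?t (Suc j) = of_int (?i + 1) * T / real m" using i(1) unfolding j_def by simp
     have d2: "\<bar>t - ?t (Suc j)\<bar> < e" using j1 j2 i(1) mesh unfolding eq by (simp add: j_def distrib_right add_divide_distrib)
     show ?thesis using dec[of t "?t (Suc j)"] j2 t g[OF sj] e(2)[OF tj[OF sj] t d2] unfolding eq atLeastAtMost_iff by linarith
    qed
    show "\<bar>?s N t w - ?g t\<bar> <= \<eta>" using up low by linarith
   qed
  qed
  ultimately show ?case using Bs by (intro bexI[of _ "\<Union>j\<le>m. ?B j"]) auto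
 qed
qed

text \<open>Both 3c + f and 3c - f take values in [2c, 4c], so any two values add up to at least a
  third one and \<open>sup_control\<close> applies. Half the difference of the two estimates is the
  estimate for \<open>f\<close>.\<close>

lemma sup_control_bounded:
 assumes f: "f : BM PA" "!!x. x : A ==> \<bar>f x\<bar> <= c" and c: "0 <= c" and \<eta>: "0 < \<eta>" and \<delta>: "0 < \<delta>"
 shows "\<forall>\<^sub>F N in sequentially. EX B:sets (Om N). measure (Om N) B <= \<delta> \<and>
  (AE w in Om N. w \<notin> B --> (ALL t:{0..T}. \<bar>(\<Sum>x\<in>#X N t w. f x) / N - (LINT x|(\<rho> t). f x)\<bar> <= \<eta>))"
proof -
 let ?p = "%x. 3 * c + f x" and ?m = "%x. 3 * c - f x"
 let ?P = "%h \<delta> \<eta> N. EX B:sets (Om N). measure (Om N) B <= \<delta> \<and>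
  (AE w in Om N. w \<notin> B --> (ALL t:{0..T}. \<bar>(\<Sum>x\<in>#X N t w. h x) / N - (LINT x|(\<rho> t). h x)\<bar> <= \<eta>))"
 have fb: "- c <= f x" "f x <= c" if "x : A" for x using f(2)[OF that] by auto
 have "\<forall>\<^sub>F N in sequentially. ?P ?p (\<delta> / 2) \<eta> N"
  by (rule sup_control[where c = "4 * c"]) (use f(1) c \<eta> \<delta> fb in \<open>auto simp: abs_le_iff\<close>, (smt (verit) fb)+)
 moreover have "\<forall>\<^sub>F N in sequentially. ?P ?m (\<delta> / 2) \<eta> N"
  by (rule sup_control[where c = "4 * c"]) (use f(1) c \<eta> \<delta> fb in \<open>auto simp: abs_le_iff\<close>, (smt (verit) fb)+)
 ultimately show ?thesis using eventually_gt_at_top[of 0]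
 proof eventually_elim
  case (elim N)
  interpret P: coag_process A \<B> K J mass H \<nu> "Om N" N "Y N" "\<sigma> N" "X N" by (rule process[OF elim(3)])
  obtain B where B: "B : sets (Om N)" "P.prob B <= \<delta> / 2"
   "AE w in Om N. w \<notin> B --> (ALL t:{0..T}. \<bar>(\<Sum>x\<in>#X N t w. ?p x) / N - (LINT x|(\<rho> t). ?p x)\<bar> <= \<eta>)" using elim(1) by blast
  obtain C where C: "C : sets (Om N)" "P.prob C <= \<delta> / 2"
   "AE w in Om N. w \<notin> C --> (ALL t:{0..T}. \<bar>(\<Sum>x\<in>#X N t w. ?m x) / N - (LINT x|(\<rho> t). ?m x)\<bar> <= \<eta>)" using elim(2) by blast
  have "P.prob (B \<union> C) <= \<delta>" using measure_Un_le[OF B(1) C(1)] B(2) C(2) by linarith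
  moreover have "AE w in Om N. w \<notin> B \<union> C --> (ALL t:{0..T}. \<bar>(\<Sum>x\<in>#X N t w. f x) / N - (LINT x|(\<rho> t). f x)\<bar> <= \<eta>)" using B(3) C(3)
  proof eventually_elim
   case (elim w)
   show ?case
   proof (intro impI ballI)
    fix t assume w: "w \<notin> B \<union> C" and t: "t : {0..T}"
    then have t': "0 <= t" "t <= T" by auto
    interpret \<rho>: finite_measure "\<rho> t" by (rule \<rho>_props[OF t'])
    have fi: "integrable (\<rho> t) f" by (rule \<rho>.integrable_const_bound[of _ c]) (use f \<rho>_space[OF t'] \<rho>_props[OF t'] in \<open>auto simp: cong: measurable_cong_sets\<close>)
    have i: "(LINT x|(\<rho> t). ?p x) = (LINT x|(\<rho> t). 3 * c) + (LINT x|(\<rho> t). f x)" "(LINT x|(\<rho> t). ?m x) = (LINT x|(\<rho> t). 3 * c) - (LINT x|(\<rho> t). f x)" using fi by simp_all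
    have s: "(\<Sum>x\<in>#u. ?p x) / N = (\<Sum>x\<in>#u. 3 * c) / N + (\<Sum>x\<in>#u. f x) / N" "(\<Sum>x\<in>#u. ?m x) / N = (\<Sum>x\<in>#u. 3 * c) / N - (\<Sum>x\<in>#u. f x) / N" for u
     by (induction u) (simp_all add: add_divide_distrib diff_divide_distrib)
    have "\<bar>(\<Sum>x\<in>#X N t w. ?p x) / N - (LINT x|(\<rho> t). ?p x)\<bar> <= \<eta>" "\<bar>(\<Sum>x\<in>#X N t w. ?m x) / N - (LINT x|(\<rho> t). ?m x)\<bar> <= \<eta>"
     using elim w t by blast+
    then show "\<bar>(\<Sum>x\<in>#X N t w. f x) / N - (LINT x|(\<rho> t). f x)\<bar> <= \<eta>" unfolding s i by linarith
   qed
  qed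
  ultimately show ?case using B(1) C(1) by (intro bexI[of _ "B \<union> C"]) auto
 qed
qed

end

end

section \<open>Convergence in distribution of the rescaled paths\<close>

lemma integral_scale_measure:
 fixes g :: "'a => real"
 assumes "0 <= c" "g : BM M"
 shows "(LINT x|(scale_measure (ennreal c) M). g x) = c * (LINT x|M. g x)"
proof -
 have "scale_measure (ennreal c) M = density M (%_. ennreal c)" by (rule measure_eqI) (simp_all add: emeasure_density nn_integral_cmult_indicator)
 then show ?thesis using assms by (simp add: integral_density)
qed

context coag_limit
begin

context
 assumes T: "0 < T"
begin

lemma \<rho>_finite: "t : {0..T} ==> \<rho> t : FM A" using \<rho>_props by (auto simp: finite_measures_def)

lemma test_fun_measurable: "test_fun i : BM PA" by (rule borel_measurable_continuous_on_restrict[OF continuous_on_subset[OF test_fun_cont]]) simp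

lemma test_fun_le: obtains c where "0 <= c" "!!y. \<bar>test_fun i y\<bar> <= c" using test_fun_bounded[of i] abs_ge_zero order_trans by metis

lemma coords_\<rho>_continuous: "continuous_on {0..T} (%s. coords (\<rho> s))"
proof -
 have "continuous_on {0..T} (%s. coords (\<rho> s) i)" for i
 proof -
  obtain c where "!!y. \<bar>test_fun i y\<bar> <= c" using test_fun_le by blast
  then show ?thesis unfolding coords_def by (intro \<rho>_continuous[OF T, of _ c] test_fun_measurable) auto
 qed
 then show ?thesis unfolding continuous_on_def by (auto intro: tendsto_fun_iff)
qed

lemma \<rho>_path: "(\<lambda>t\<in>{0..T}. \<rho> t) : cadlag_paths T (WT A)"
proof -
 let ?E = "WT A"
 have lim: "limitin ?E (\<lambda>t\<in>{0..T}. \<rho> t) (\<rho> t) F" if t: "t : {0..T}" and F: "\<forall>\<^sub>F s in F. s : {0..T}" "F <= at t within {0..T}" for t F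
  unfolding limitin_def topspace_weak
 proof (intro conjI allI impI \<rho>_finite t)
  fix U assume U: "openin ?E U & \<rho> t : U"
  then obtain V where V: "open V" "U = {v : FM A. coords v : V}" unfolding openin_weak_iff by blast
  have "((%s. coords (\<rho> s)) \<longlongrightarrow> coords (\<rho> t)) F" using coords_\<rho>_continuous t F(2) unfolding continuous_on_def by (blast intro: tendsto_mono)
  then have "\<forall>\<^sub>F s in F. coords (\<rho> s) : V" using V U by (intro topological_tendstoD) auto
  then show "\<forall>\<^sub>F s in F. (\<lambda>t\<in>{0..T}. \<rho> t) s : U" using F(1) by eventually_elim (use \<rho>_finite V in auto)
 qed
 have "limitin ?E (\<lambda>t\<in>{0..T}. \<rho> t) (\<rho> t) (at_right t)" if t: "t : {0..<T}" for t
 proof (rule lim)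
  have "at_right t = at t within {t..T}" using t by (simp add: at_within_Icc_at_right)
  then show "at_right t <= at t within {0..T}" using t by (auto intro: at_le)
  show "\<forall>\<^sub>F s in at_right t. s : {0..T}" using eventually_at_right_real[of t T] t by (auto elim: eventually_mono)
 qed (use t in auto)
 moreover have "limitin ?E (\<lambda>t\<in>{0..T}. \<rho> t) (\<rho> t) (at_left t)" if t: "t : {0<..T}" for t
 proof (rule lim)
  have "at_left t = at t within {0..t}" using t by (simp add: at_within_Icc_at_left)
  then show "at_left t <= at t within {0..T}" using t by (auto intro: at_le)
  show "\<forall>\<^sub>F s in at_left t. s : {0..T}" using eventually_at_left_real[of 0 t] t by (auto elim: eventually_mono)
 qed (use t in auto)
 ultimately show ?thesis using \<rho>_finite unfolding cadlag_paths_def topspace_weak by auto blast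
qed

text \<open>\<open>compatible_metric\<close> is an arbitrary metric for the weak topology, so its
  relation to the coordinates is not quantitative. Otherwise there were times t(n) and measures v(n)
  agreeing with \<rho>(t(n)) in more and more coordinates but at distance above \<epsilon>; at a
  limit point of the times both sequences converge to the same measure, a contradiction.\<close>

lemma \<rho>_neighbourhood:
 assumes \<epsilon>: "0 < \<epsilon>"
 shows "EX m \<eta>. 0 < \<eta> & (ALL t:{0..T}. ALL v:FM A. (ALL i<m. \<bar>coords v i - coords (\<rho> t) i\<bar> <= \<eta>) \<longrightarrow>
  compatible_metric (WT A) (\<rho> t) v <= \<epsilon>)"
proof (rule ccontr)
 let ?d = "compatible_metric (WT A)"
 interpret Metric_space "FM A" ?d by (rule compatible_metric_weak(1))
 assume no: "\<not> ?thesis"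
 have "EX t v. t : {0..T} & v : FM A & (ALL i<n. \<bar>coords v i - coords (\<rho> t) i\<bar> <= 1 / real (Suc n)) & \<epsilon> < ?d (\<rho> t) v" for n
  using no[unfolded not_ex, rule_format, of "1 / real (Suc n)" n] by (auto simp: not_le)
 then obtain t v where tv: "!!n. t n : {0..T}" "!!n. v n : FM A"
  "!!n i. i < n ==> \<bar>coords (v n) i - coords (\<rho> (t n)) i\<bar> <= 1 / real (Suc n)" "!!n. \<epsilon> < ?d (\<rho> (t n)) (v n)" by metis
 obtain s r where s: "s : {0..T}" "strict_mono r" "(%n. t (r n)) \<longlonglongrightarrow> s" using compact_imp_seq_compact[OF compact_Icc, of 0 T] tv(1) unfolding seq_compact_def o_def by metis
 have \<rho>_lim: "(%n. coords (\<rho> (t (r n)))) \<longlonglongrightarrow> coords (\<rho> s)" using continuous_on_tendsto_compose[OF coords_\<rho>_continuous s(3,1)] tv(1) by simp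
 have v_lim: "(%n. coords (v (r n))) \<longlonglongrightarrow> coords (\<rho> s)"
 proof (rule tendsto_fun_iff)
  fix i
  have "\<forall>\<^sub>F n in sequentially. norm (coords (v (r n)) i - coords (\<rho> (t (r n))) i) <= 1 / real (Suc n)" using eventually_gt_at_top[of i]
  proof eventually_elim
   case (elim n)
   have rn: "n <= r n" by (rule seq_suble[OF s(2)])
   show ?case using tv(3)[of i "r n"] elim rn by (intro order_trans[OF _ divide_left_mono[of "Suc n" "Suc (r n)" 1]]) auto
  qed
  from Lim_null_comparison[OF this LIMSEQ_Suc[OF lim_1_over_n]]
  have "(%n. coords (v (r n)) i - coords (\<rho> (t (r n))) i) \<longlonglongrightarrow> 0" .
  from tendsto_add[OF this continuous_on_tendsto_compose[OF continuous_on_product_coordinates \<rho>_lim, of i]]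
  show "(%n. coords (v (r n)) i) \<longlonglongrightarrow> coords (\<rho> s) i" by simp
 qed
 obtain V where V: "open V" "mball (\<rho> s) (\<epsilon> / 2) = {v : FM A. coords v : V}"
  using openin_mball[of "\<rho> s" "\<epsilon> / 2"] unfolding compatible_metric_weak(2) openin_weak_iff by blast
 have "\<rho> s : mball (\<rho> s) (\<epsilon> / 2)" using \<rho>_finite[OF s(1)] \<epsilon> by simp
 then have sV: "coords (\<rho> s) : V" using V(2) by blast
 have "\<forall>\<^sub>F n in sequentially. coords (\<rho> (t (r n))) : V & coords (v (r n)) : V"
  by (intro eventually_conj topological_tendstoD[OF \<rho>_lim V(1) sV] topological_tendstoD[OF v_lim V(1) sV])
 then obtain n where n: "coords (\<rho> (t (r n))) : V" "coords (v (r n)) : V" unfolding eventually_sequentially by blast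
 then have "\<rho> (t (r n)) : mball (\<rho> s) (\<epsilon> / 2)" "v (r n) : mball (\<rho> s) (\<epsilon> / 2)" using V(2) \<rho>_finite tv by blast+
 then have "?d (\<rho> (t (r n))) (v (r n)) < \<epsilon>" using triangle'[of "\<rho> (t (r n))" "\<rho> s" "v (r n)"] by (auto simp: commute)
 then show False using tv(4)[of "r n"] by simp
qed

text \<open>Finitely many test functions suffice for a given accuracy by
  \<open>\<rho>_neighbourhood\<close>. Outside an exceptional event of small probability the path is
  uniformly close to \<rho>, so with the identity time change \<open>F\<close> differs by less than
  e/4; on the event it differs by at most 2 C.\<close>

theorem converges_to_\<rho>:
 "converges_in_distribution (skorohod_topology T (WT A)) Om
   (%N w. \<lambda>t\<in>{0..T}. scale_measure (1 / of_nat N) (mset_measure A (X N t w)))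
   (return (borel_of (skorohod_topology T (WT A))) (\<lambda>t\<in>{0..T}. \<rho> t))"
proof -
 let ?E = "WT A" and ?p = "\<lambda>t\<in>{0..T}. \<rho> t"
 let ?S = "skorohod_topology T ?E" and ?d = "compatible_metric ?E"
 let ?Z = "%N w. \<lambda>t\<in>{0..T}. scale_measure (1 / of_nat N) (mset_measure A (X N t w))"
 have Z: "step_path T (FM A) (?Z N w)" "t : {0..T} ==> coords (?Z N w t) i = (\<Sum>x\<in>#X N t w. test_fun i x) / N"
  if N: "0 < N" and w: "w : space (Om N)" for N w t i
 proof -
  interpret P: coag_process A \<B> K J mass H \<nu> "Om N" N "Y N" "\<sigma> N" "X N" by (rule process[OF N])
  have c: "1 / of_nat N = ennreal (1 / real N)" using N by (simp add: divide_ennreal[symmetric] ennreal_of_nat_eq_real_of_nat)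
  have sub: "pts (X N t w)" if "0 <= t" for t using measurable_space[OF P.X_measurable[OF that] w] by simp
  show "coords (?Z N w t) i = (\<Sum>x\<in>#X N t w. test_fun i x) / N" if t: "t : {0..T}"
  proof -
   have s: "pts (X N t w)" using sub t by simp
   have "test_fun i : BM (mset_measure A (X N t w))" using test_fun_measurable by (simp cong: measurable_cong_sets add: sets_mset_measure[OF s])
   then show ?thesis using t unfolding c coords_def by (simp add: integral_scale_measure integral_mset_measure[OF s test_fun_measurable])
  qed
  have fin: "?Z N w t : FM A" if "t : {0..T}" for t
  proof -
   have s: "pts (X N t w)" using sub that by simp
   interpret finite_measure "mset_measure A (X N t w)" using finite_measuresD(2)[OF finite_mset_measure[OF s]] .
   have "finite_measure (scale_measure (ennreal (1 / real N)) (mset_measure A (X N t w)))" by (rule finite_measureI) (simp add: space_scale_measure ennreal_mult_eq_top_iff emeasure_eq_measure)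
   then show ?thesis using that by (simp only: finite_measures_def mem_Collect_eq sets_scale_measure sets_mset_measure[OF s] c restrict_apply if_True)
  qed
  obtain D where D: "finite D" "D \<subseteq> {0<..T}" "!!t t'. 0 <= t ==> t <= t' ==> t' <= T ==> D \<inter> {t<..t'} = {} ==> X N t w = X N t' w" using P.X_step[OF w less_imp_le[OF T]] by blast
  have "ALL t t'. 0 <= t --> t <= t' --> t' <= T --> D \<inter> {t<..t'} = {} --> ?Z N w t = ?Z N w t'" using D(3) by simp
  then show "step_path T (FM A) (?Z N w)" unfolding step_path_def using D(1,2) fin by (intro conjI exI[of _ D]) auto
 qed
 have Zm: "?Z N : Om N ->M borel_of ?S" if N: "0 < N" for N
 proof (rule step_path_measurable[OF T Z(1)[OF N]])
  interpret P: coag_process A \<B> K J mass H \<nu> "Om N" N "Y N" "\<sigma> N" "X N" by (rule process[OF N])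
  fix t i assume t: "t : {0..T}"
  have "(%w. (\<Sum>x\<in>#X N t w. test_fun i x) / N) : BM (Om N)" using mcomp[OF P.X_measurable sum_measurable[OF test_fun_measurable]] t by simp
  then show "(%w. coords (?Z N w t) i) : BM (Om N)" by (rule measurable_cong[THEN iffD1, rotated]) (simp only: Z(2)[OF N _ t])
 qed
 have "(%N. LINT f|(distr (Om N) (borel_of ?S) (?Z N)). F f) \<longlonglongrightarrow> (LINT f|(return (borel_of ?S) ?p). F f)"
  if F: "continuous_map ?S euclideanreal F" "bounded (F ` topspace ?S)" for F :: "(real => 'a measure) => real"
 proof -
  have Fm: "F : BM (borel_of ?S)"
  proof (rule borel_measurableI)
   fix U :: "real set" assume "open U"
   then have "openin ?S {f : topspace ?S. F f : U}" by (intro openin_continuous_map_preimage[OF F(1)]) simp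
   then show "F -` U \<inter> space (borel_of ?S) : sets (borel_of ?S)" by (rule back_subst[where P = "%U. U : sets (borel_of ?S)", OF openin_borel_of]) (auto simp: space_borel_of)
  qed
  obtain C where C: "0 < C" "!!f. f : cadlag_paths T ?E ==> \<bar>F f\<bar> <= C" using F(2) unfolding bounded_pos topspace_skorohod by auto
  show ?thesis unfolding integral_return[OF _ Fm, of ?p, unfolded space_borel_of topspace_skorohod, OF \<rho>_path]
  proof (rule LIMSEQ_I)
   fix e :: real assume e: "0 < e"
   let ?U = "{f : topspace ?S. F f : ball (F ?p) (e / 4)}"
   have "openin ?S ?U" by (intro openin_continuous_map_preimage[OF F(1)]) simp
   moreover have "?p : ?U" using e \<rho>_path by (simp add: topspace_skorohod)
   ultimately obtain r where r: "0 < r" "!!g. g : cadlag_paths T ?E ==> skorohod_close T ?d r ?p g ==> g : ?U" by (rule openin_skorohod_close) blast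
   obtain m \<eta> where m: "0 < \<eta>" "!!t v. t : {0..T} ==> v : FM A ==>
     (ALL i<m. \<bar>coords v i - coords (\<rho> t) i\<bar> <= \<eta>) ==> ?d (\<rho> t) v <= r" using \<rho>_neighbourhood[OF r(1)] by blast
   \<comment> \<open>A positive bound for \<open>m\<close>, so that \<delta> is defined also if no
     coordinate has to be controlled.\<close>
   obtain M where M: "real m <= M" "0 < M" by (rule that[of "real m + 1"]) auto
   define \<delta> where "\<delta> = e / (4 * C * M)"
   have \<delta>: "0 < \<delta>" using e C(1) M by (simp add: \<delta>_def)
   have m\<delta>: "2 * C * (real m * \<delta>) <= e / 2"
   proof -
    have "2 * C * (real m * \<delta>) <= 2 * C * (M * \<delta>)" using C(1) \<delta> M by (intro mult_left_mono mult_right_mono) auto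
    also have "\<dots> = e / 2" using C(1) M unfolding \<delta>_def by simp
    finally show ?thesis .
   qed
   have "\<forall>\<^sub>F N in sequentially. ALL i:{..<m}. EX B:sets (Om N). measure (Om N) B <= \<delta> \<and>
    (AE w in Om N. w \<notin> B --> (ALL t:{0..T}. \<bar>(\<Sum>x\<in>#X N t w. test_fun i x) / N - (LINT x|(\<rho> t). test_fun i x)\<bar> <= \<eta>))"
   proof (rule eventually_ball_finite, simp, rule ballI)
    fix i
    obtain c where "0 <= c" "!!y. \<bar>test_fun i y\<bar> <= c" using test_fun_le by blast
    then show "\<forall>\<^sub>F N in sequentially. EX B:sets (Om N). measure (Om N) B <= \<delta> \<and>
     (AE w in Om N. w \<notin> B --> (ALL t:{0..T}. \<bar>(\<Sum>x\<in>#X N t w. test_fun i x) / N - (LINT x|(\<rho> t). test_fun i x)\<bar> <= \<eta>))"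
     by (intro sup_control_bounded[OF T test_fun_measurable _ _ m(1) \<delta>, of i c]) auto
   qed
   then have "\<forall>\<^sub>F N in sequentially. norm ((LINT f|(distr (Om N) (borel_of ?S) (?Z N)). F f) - F ?p) < e" using eventually_gt_at_top[of 0]
   proof eventually_elim
    case (elim N)
    note N = elim(2)
    interpret P: coag_process A \<B> K J mass H \<nu> "Om N" N "Y N" "\<sigma> N" "X N" by (rule process[OF N])
    obtain B where B: "!!i. i < m ==> B i : sets (Om N)" "!!i. i < m ==> P.prob (B i) <= \<delta>"
     "!!i. i < m ==> AE w in Om N. w \<notin> B i --> (ALL t:{0..T}. \<bar>(\<Sum>x\<in>#X N t w. test_fun i x) / N - (LINT x|(\<rho> t). test_fun i x)\<bar> <= \<eta>)"
     using bchoice[OF elim(1)[unfolded Bex_def]] by auto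
    let ?B = "\<Union>i<m. B i"
    have Bs: "?B : sets (Om N)" using B(1) by auto
    have "P.prob ?B <= (\<Sum>i<m. P.prob (B i))" using B(1) by (intro P.finite_measure_subadditive_finite) auto
    also have "\<dots> <= real m * \<delta>" using sum_bounded_above[of "{..<m}" "%i. P.prob (B i)" \<delta>] B(2) by simp
    finally have PB: "P.prob ?B <= real m * \<delta>" .
    have cad: "?Z N w : cadlag_paths T ?E" if "w : space (Om N)" for w by (rule step_path_cadlag, unfold topspace_weak, rule Z(1)[OF N that])
    have FZm: "(%w. F (?Z N w)) : BM (Om N)" by (rule mcomp[OF Zm[OF N] Fm])
    have FZi: "integrable (Om N) (%w. F (?Z N w))" using C(2)[OF cad] by (intro P.integrable_const_bound[of _ C] FZm) auto
    have ae: "AE w in Om N. \<bar>F (?Z N w) - F ?p\<bar> <= e / 4 + 2 * C * ind ?B w"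
    proof -
     have "AE w in Om N. ALL i:{..<m}. w \<notin> B i --> (ALL t:{0..T}. \<bar>(\<Sum>x\<in>#X N t w. test_fun i x) / N - (LINT x|(\<rho> t). test_fun i x)\<bar> <= \<eta>)"
      by (intro AE_finite_allI) (use B(3) in auto)
     then show ?thesis using AE_space
     proof eventually_elim
      case (elim w)
      note cZ = cad[OF elim(2)]
      show ?case
      proof (cases "w : ?B")
       case True
       then show ?thesis using C(2)[OF cZ] C(2)[OF \<rho>_path] e by (simp add: abs_le_iff)
      next
       case False
       have "?d (\<rho> t) (?Z N w t) <= r" if t: "t : {0..T}" for t
       proof (rule m(2)[OF t])
        show "?Z N w t : FM A" using cZ t unfolding cadlag_paths_def topspace_weak by blast
        show "ALL i<m. \<bar>coords (?Z N w t) i - coords (\<rho> t) i\<bar> <= \<eta>" using elim(1) False t unfolding Z(2)[OF N elim(2) t] by (simp add: coords_def)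
       qed
       then have "skorohod_close T ?d r ?p (?Z N w)" unfolding skorohod_close_def using r(1) by (intro bexI[OF _ time_change_id]) auto
       then have "?Z N w : ?U" by (rule r(2)[OF cZ])
       then show ?thesis using False by (simp add: dist_real_def abs_minus_commute)
      qed
     qed
    qed
    have "(LINT f|(distr (Om N) (borel_of ?S) (?Z N)). F f) - F ?p = (LINT w|(Om N). F (?Z N w) - F ?p)" unfolding integral_distr[OF Zm[OF N] Fm] using FZi by (simp add: P.prob_space)
    also have "norm \<dots> <= (LINT w|(Om N). norm (F (?Z N w) - F ?p))" by (rule integral_norm_bound)
    also have "\<dots> <= (LINT w|(Om N). e / 4 + 2 * C * ind ?B w)" using ae FZi Bs by (intro integral_mono_AE) (auto simp: P.emeasure_eq_measure)
    also have "\<dots> = e / 4 + 2 * C * P.prob ?B" using Bs by (simp add: P.prob_space P.emeasure_eq_measure)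
    also have "\<dots> <= e / 4 + 2 * C * (real m * \<delta>)" using PB C(1) by simp
    also have "\<dots> < e" using m\<delta> e by linarith
    finally show ?case .
   qed
   then show "EX n0. ALL N>=n0. norm ((LINT f|(distr (Om N) (borel_of ?S) (?Z N)). F f) - F ?p) < e" unfolding eventually_sequentially .
  qed
 qed
 then show ?thesis unfolding converges_in_distribution_def using Zm by blast
qed

end

end

section \<open>Particles with location and mass as an instance\<close>

abbreviation particle_space :: "('s::topological_space \<times> nat) measure" where
 "particle_space \<equiv> restrict_space borel particles"

definition merged :: "('s \<times> nat => 's \<times> nat => 's::topological_space measure) =>
  's \<times> nat => 's \<times> nat => ('s \<times> nat) measure" where
 "merged \<Upsilon> y y' = distr (\<Upsilon> y y') particle_space (%z. (z, snd y + snd y'))"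

lemma particles_mass: "y : particles <-> 1 <= snd y" by (cases y) (auto simp: particles_def)

lemma space_particle_space[simp]: "space particle_space = particles" by (simp add: space_restrict_space)

lemma measurable_particle:
 fixes f :: "'w => 's::second_countable_topology"
 assumes "f : M ->M borel" "g : M ->M borel" "!!w. w : space M ==> 1 <= (g w :: nat)"
 shows "(%w. (f w, g w)) : M ->M particle_space" using assms unfolding borel_prod[symmetric] by (intro measurable_restrict_space2 measurable_Pair) (auto simp: particles_mass)

lemma snd_particle_measurable: "(snd :: 's::second_countable_topology \<times> nat => nat) : particle_space ->M borel"
 "(fst :: 's \<times> nat => 's) : particle_space ->M borel" unfolding borel_prod[symmetric] by (intro measurable_restrict_space1 measurable_snd measurable_fst)+

lemma particle_ident_measurable: "(%y. y) : particle_space ->M borel" by (rule measurable_restrict_space1) simp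

lemma particle_slice_sets: "UNIV \<times> {m} : sets (borel :: ('s::second_countable_topology \<times> nat) measure)" unfolding borel_prod[symmetric] by (intro pair_measureI) auto

locale spatial_kernel =
 fixes K :: "('s::polish_space \<times> nat) => ('s \<times> nat) => real"
  and \<Upsilon> :: "('s \<times> nat) => ('s \<times> nat) => 's measure"
 assumes K_nonneg: "!!y y'. y : particles ==> y' : particles ==> 0 <= K y y'"
  and K_sym: "!!y y'. y : particles ==> y' : particles ==> K y y' = K y' y"
  and K_cont: "continuous_on (particles \<times> particles) (%(y, y'). K y y')"
  and \<Upsilon>_kernel: "(%(y, y'). \<Upsilon> y y') \<in>
     restrict_space borel (particles \<times> particles) ->M prob_algebra borel"
  and H_finite: "coag_bound K < \<infinity>"
begin

definition H :: real where "H = enn2real (coag_bound K)"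

abbreviation P :: "('s \<times> nat) measure" where "P \<equiv> particle_space"

lemma measurable_pair: "f : restrict_space borel (particles \<times> particles) ->M M ==> f : P <*> P ->M M"
proof -
 have "(%p. (fst p, snd p)) : P <*> P ->M borel <*> borel" by (intro measurable_Pair mcomp[OF measurable_fst particle_ident_measurable]
   mcomp[OF measurable_snd particle_ident_measurable])
 then have "(%p. p) : P <*> P ->M restrict_space borel (particles \<times> particles)" by (intro measurable_restrict_space2) (auto simp: space_pair_measure borel_prod)
 then show "f : restrict_space borel (particles \<times> particles) ->M M ==> f : P <*> P ->M M" by (rule mcomp)
qed

lemma K_measurable: "(%(y, y'). K y y') : BM (P <*> P)" by (rule measurable_pair[OF borel_measurable_continuous_on_restrict[OF K_cont]])

lemma \<Upsilon>_measurable: "(%(y, y'). \<Upsilon> y y') : P <*> P ->M prob_algebra borel" by (rule measurable_pair[OF \<Upsilon>_kernel])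

lemma \<Upsilon>_prob: "y : particles ==> y' : particles ==> prob_space (\<Upsilon> y y') & sets (\<Upsilon> y y') = sets borel"
 using measurable_space[OF \<Upsilon>_measurable, of "(y, y')"] by (simp add: space_pair_measure space_prob_algebra)

lemma merge_measurable:
 assumes "y : particles" "y' : particles"
 shows "(%z. (z, snd y + snd y')) : \<Upsilon> y y' ->M P" using assms \<Upsilon>_prob[OF assms] by (intro measurable_particle) (auto simp: particles_mass cong: measurable_cong_sets)

text \<open>The bound follows by testing the supremum with the Dirac measures of norm one at the two types.\<close>

lemma K_le:
 assumes y: "y : particles" "y' : particles"
 shows "K y y' <= H * (real (snd y) * real (snd y'))"
proof -
 let ?\<delta> = "%y. scale_measure (ennreal (1 / real (snd y))) (return P y)"
 have m: "1 <= snd y" "1 <= snd y'" using y by (auto simp: particles_mass)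
 have \<delta>: "?\<delta> y : FM particles" "norm1 (?\<delta> y) <= 1" if y: "y : particles" for y
 proof -
  show "?\<delta> y : FM particles" unfolding finite_measures_def using sets.top[of P] by (auto intro!: finite_measureI simp: space_scale_measure ennreal_mult_eq_top_iff y)
  have m: "0 < snd y" using y by (simp add: particles_mass)
  have "norm1 (?\<delta> y) = (\<Sum>n\<in>{snd y - 1}. of_nat (Suc n) * emeasure (?\<delta> y) (UNIV \<times> {Suc n}))" unfolding norm1_def
  proof (rule suminf_finite)
   fix n assume n: "n \<notin> {snd y - 1}"
   then have "y \<notin> UNIV \<times> {Suc n}" by (cases y) auto
   moreover have "(UNIV :: 's set) \<times> {Suc n} : sets P" using particle_slice_sets particles_borel by (subst sets_restrict_space_iff) (auto simp: particles_mass)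
   ultimately show "of_nat (Suc n) * emeasure (?\<delta> y) (UNIV \<times> {Suc n}) = 0" by simp
  qed simp
  also have "\<dots> = of_nat (snd y) * emeasure (?\<delta> y) (UNIV \<times> {snd y})" using m by simp
  also have "\<dots> <= of_nat (snd y) * (ennreal (1 / real (snd y)) * 1)" unfolding emeasure_scale_measure using y by (intro mult_left_mono prob_space.emeasure_le_1 prob_space_return) auto
  also have "\<dots> = 1" using m by (simp add: ennreal_of_nat_eq_real_of_nat ennreal_mult[symmetric])
  finally show "norm1 (?\<delta> y) <= 1" .
 qed
 have "ennreal (K y y' / (real (snd y) * real (snd y'))) = (NN a|(?\<delta> y). (NN b|(?\<delta> y'). ennreal (K a b)))"
 proof -
  have Ky: "(%b. ennreal (K a b)) : BM P" if "a : particles" for a using mcomp[OF measurable_Pair1'[of a P P] K_measurable] that by simp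
  have in_int: "(NN b|(?\<delta> y'). ennreal (K a b)) = ennreal (1 / real (snd y')) * ennreal (K a y')" if "a : particles" for a
   using Ky[OF that] y by (simp add: nn_integral_scale_measure nn_integral_return)
  have "(%a. ennreal (K a y')) : BM P" using mcomp[OF measurable_Pair2'[of y' P P] K_measurable] y by simp
  then have "(NN a|(?\<delta> y). ennreal (1 / real (snd y')) * ennreal (K a y')) = ennreal (1 / real (snd y)) * (ennreal (1 / real (snd y')) * ennreal (K y y'))"
   using y by (simp add: nn_integral_scale_measure nn_integral_return)
  moreover have "(NN a|(?\<delta> y). (NN b|(?\<delta> y'). ennreal (K a b))) = (NN a|(?\<delta> y). ennreal (1 / real (snd y')) * ennreal (K a y'))"
   by (intro NN_cong in_int) (simp add: space_scale_measure)
  ultimately show ?thesis using K_nonneg[OF y] by (simp add: ennreal_mult[symmetric] mult.commute)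
 qed
 also have "\<dots> <= coag_bound K" unfolding coag_bound_def using \<delta> y by (intro SUP_upper2[of "(?\<delta> y, ?\<delta> y')"]) auto
 also have "\<dots> = ennreal H" unfolding H_def using H_finite by (simp add: ennreal_enn2real_if)
 finally have "K y y' / (real (snd y) * real (snd y')) <= H" by (simp add: H_def ennreal_le_iff)
 then show ?thesis using m by (simp add: divide_le_eq mult_pos_pos)
qed

lemma coag_kernel:
 assumes "bump_space particles \<B>"
 shows "coag_kernel particles \<B> K (merged \<Upsilon>) snd H"
proof -
 interpret bump_space particles \<B> by fact
 show ?thesis
 proof
  show "(%(a, b). merged \<Upsilon> a b) : P <*> P ->M prob_algebra P"
  proof -
   have "(%(q, z). (z, snd (fst q) + snd (snd q))) : (P <*> P) <*> borel ->M (P :: ('s \<times> nat) measure)" unfolding case_prod_beta'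
   proof (rule measurable_particle)
    show "(%p. snd (fst (fst p)) + snd (snd (fst p))) : BM ((P <*> P) <*> (borel :: 's measure))" by (intro borel_measurable_add mcomp[OF _ snd_particle_measurable(1)]
      mcomp[OF measurable_fst measurable_fst] mcomp[OF measurable_fst measurable_snd])
   qed (auto simp: space_pair_measure particles_mass)
   from measurable_distr_prob_space2[OF \<Upsilon>_measurable this] show ?thesis by (simp add: merged_def[abs_def] case_prod_beta')
  qed
  show "AE z in merged \<Upsilon> a b. snd z = snd a + snd b" if "a : particles" "b : particles" for a b
   unfolding merged_def by (subst AE_distr_iff[OF merge_measurable[OF that]]) (use measurable_sets[OF snd_particle_measurable(1), of "{snd a + snd b}"] in \<open>auto simp: vimage_def Int_def conj_commute\<close>)
  show "snd : P ->M CSU" using snd_particle_measurable(1) measurable_cong_sets[OF refl sets_borel_eq_count_space] by blast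
 qed (use K_measurable K_nonneg K_le in \<open>auto simp: H_def particles_mass\<close>)
qed

lemma coag_rate_eq:
 assumes "bump_space (particles :: ('s \<times> nat) set) \<B>" and u: "u : space (point_measures particles)" and B: "B : sets (point_measures particles)"
 shows "coag_rate (%y y'. 1 / N * K y y') \<Upsilon> u B = coag_kernel.rate particles K (merged \<Upsilon>) N u B"
proof -
 interpret coag_kernel particles \<B> K "merged \<Upsilon>" snd H by (rule coag_kernel[OF assms(1)])
 have "coag_rate (%y y'. 1 / N * K y y') \<Upsilon> u B = pair_sum (%a b v. K a b / N * measure (\<Upsilon> a b) {z. add_mset (z, snd a + snd b) v : B}) u"
  unfolding coag_rate_def pair_sum_def sub_sum_def by (simp add: diff_diff_add_mset add_mset_commute)
 also have "\<dots> = rate N u B" unfolding rate_def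
 proof (rule pair_sum_cong)
  fix a b v assume "add_mset a (add_mset b v) = u"
  then have ab: "a : particles" "b : particles" "set_mset v \<subseteq> particles" using pairD[OF _ u] by blast+
  have "{z : particles. add_mset z v : B} : sets P" using measurable_sets[OF add_measurable[OF ab(3)] B] by (simp add: vimage_def Int_def conj_commute)
  from measure_distr[OF merge_measurable[OF ab(1,2)] this]
  have "measure (merged \<Upsilon> a b) {z : particles. add_mset z v : B} = measure (\<Upsilon> a b) {z. add_mset (z, snd a + snd b) v : B}"
   using ab \<Upsilon>_prob[OF ab(1,2)] sets_eq_imp_space_eq[of "\<Upsilon> a b" borel] unfolding merged_def by (auto simp: particles_mass intro!: arg_cong[where f = "measure _"])
  then show "K a b / N * measure (\<Upsilon> a b) {z. add_mset (z, snd a + snd b) v : B} = K a b / N * measure (merged \<Upsilon> a b) {z : particles. add_mset z v : B}" by simp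
 qed
 finally show ?thesis .
qed

lemma jump_process:
 assumes b: "bump_space (particles :: ('s \<times> nat) set) \<B>" and N: "0 < N"
  and mj: "markov_jump_process (point_measures particles) (coag_rate (%y y'. 1 / real N * K y y') \<Upsilon>) Om X"
 shows "EX Y \<sigma>. jump_process Om (point_measures particles) (coag_kernel.rate particles K (merged \<Upsilon>) (real N)) Y \<sigma> X"
proof -
 interpret coag_kernel particles \<B> K "merged \<Upsilon>" snd H by (rule coag_kernel[OF b])
 note r = coag_rate_eq[OF b]
 obtain Y \<sigma> where Y: "!!n. Y n : Om ->M PM" "!!n. \<sigma> n : BM Om"
  "!!w t. w : space Om ==> 0 <= t ==> EX n. (\<Sum>i<n. \<sigma> i w) <= ennreal t & ennreal t < (\<Sum>i<Suc n. \<sigma> i w) & X t w = Y n w"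
  and law: "!!n A C B s. 0 <= s ==> (ALL i<=n. A i : sets PM) ==> (ALL i<n. C i : sets borel) ==> B : sets PM ==>
   measure Om {w : {w : space Om. (ALL i<=n. Y i w : A i) & (ALL i<n. \<sigma> i w : C i)}. \<sigma> n w <= ennreal s & Y (Suc n) w : B} =
   (LINT w|Om. ind {w : space Om. (ALL i<=n. Y i w : A i) & (ALL i<n. \<sigma> i w : C i)} w *
    ((1 - exp (- coag_rate (%y y'. 1 / real N * K y y') \<Upsilon> (Y n w) (space PM) * s)) *
    (coag_rate (%y y'. 1 / real N * K y y') \<Upsilon> (Y n w) B / coag_rate (%y y'. 1 / real N * K y y') \<Upsilon> (Y n w) (space PM))))" using mj unfolding markov_jump_process_def Let_def by blast
 have J: "0 <= K a b / N * measure (merged \<Upsilon> a b) B" if "add_mset a (add_mset b v) = u" "u : space PM" for a b v u B using K_nonneg pairD[OF that] by simp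
 have "coag_rate (%y y'. K y y' / real N) \<Upsilon> (Y n w) B = rate (real N) (Y n w) B" if "w : space Om" "B : sets PM" for n w B
  using r[OF measurable_space[OF Y(1)[of n] that(1)] that(2), of N] by simp
 note rY = this this[OF _ sets.top, simplified]
 have "jump_process Om PM (rate (real N)) Y \<sigma> X"
 proof (intro jump_process.intro jump_process_axioms.intro Y)
  show "prob_space Om" using mj by (simp add: markov_jump_process_def)
  show pos: "0 <= rate (real N) y B" if "y : space PM" for y B unfolding rate_def using J[OF _ that] by (rule pair_sum_nonneg)
  show "(%u. rate (real N) u B) : BM PM" if "B : sets PM" for B
  proof -
   have "(%u. enn2real (jump (real N) (ind B) u)) : BM PM" using jump_measurable[of "ind B" "real N"] that by simp
   then show ?thesis by (rule measurable_cong[THEN iffD1, rotated])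
     (simp only: jump_indicator[OF of_nat_0_le_iff _ that] enn2real_ennreal pos)
  qed
  show "rate (real N) y B <= rate (real N) y (space PM)" if y: "y : space PM" and "B : sets PM" for y B unfolding rate_def
  proof (intro pair_sum_mono mult_left_mono)
   fix a b v assume "add_mset a (add_mset b v) = y"
   then have ab: "a : particles" "b : particles" "set_mset v \<subseteq> particles" using pairD[OF _ y] by blast+
   interpret prob_space "merged \<Upsilon> a b" by (rule J_prob[OF ab(1,2)])
   have "{z : particles. add_mset z v : space PM} = space (merged \<Upsilon> a b)" using ab J_space by auto
   then show "prob {z : particles. add_mset z v : B} <= prob {z : particles. add_mset z v : space PM}" by (simp add: prob_space)
   show "0 <= K a b / real N" using K_nonneg ab by simp
  qed
  fix n :: nat and A B and C :: "nat => ennreal set" and s :: real assume a: "0 <= s" "!!i. i <= n ==> A i : sets PM" "!!i. i < n ==> C i : sets borel" "B : sets PM"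
  show "measure Om {w : {w : space Om. (ALL i<=n. Y i w : A i) & (ALL i<n. \<sigma> i w : C i)}. \<sigma> n w <= ennreal s & Y (Suc n) w : B} =
   (LINT w|Om. ind {w : space Om. (ALL i<=n. Y i w : A i) & (ALL i<n. \<sigma> i w : C i)} w *
    ((1 - exp (- rate N (Y n w) (space PM) * s)) * (rate N (Y n w) B / rate N (Y n w) (space PM))))" by (rule trans[OF law LINT_cong])
    (use a rY in auto)
 qed
 then show ?thesis by blast
qed

end

context spatial_kernel
begin

lemma measurable_type: "1 <= m ==> (%x. (x, m)) : borel ->M P" by (intro measurable_particle) auto

lemma mass_slice:
 fixes v :: "('s \<times> nat) measure"
 assumes "v : FM particles"
 shows "h : BM borel ==> (LINT x|(mass_slice v m). h x) = (LINT y|v. ind {m} (snd y) * h (fst y) :: real)"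
  and "sets (mass_slice v m) = sets borel" "finite_measure (mass_slice v m)"
proof -
 have v: "sets v = sets P" "space v = particles" using assms sets_eq_imp_space_eq[of v P] by (auto simp: finite_measures_def)
 interpret v: finite_measure v using assms by (simp add: finite_measures_def)
 have s: "UNIV \<times> {m} \<inter> space v : sets v" unfolding v using particle_slice_sets particles_borel by (subst sets_restrict_space_iff) auto
 have "fst : v ->M (borel :: 's measure)" using snd_particle_measurable(2) by (simp cong: measurable_cong_sets add: v)
 then have m: "fst : restrict_space v (UNIV \<times> {m}) ->M (borel :: 's measure)" by (rule measurable_restrict_space1)
 show "(LINT x|(mass_slice v m). h x) = (LINT y|v. ind {m} (snd y) * h (fst y))" if "h : BM borel" unfolding mass_slice_def integral_distr[OF m that] integral_restrict_space[OF s]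
  by (intro LINT_cong) (auto simp: indicator_def)
 show "sets (mass_slice v m) = sets borel" by (simp add: mass_slice_def)
 have "finite_measure (restrict_space v (UNIV \<times> {m}))" using s by (intro finite_measureI) (simp add: emeasure_restrict_space space_restrict_space v.emeasure_eq_measure)
 then show "finite_measure (mass_slice v m)" unfolding mass_slice_def by (rule finite_measure.finite_measure_distr[OF _ m])
qed

text \<open>\<open>f\<close> tests the particles of mass \<open>n\<close>. The merged particle has
  mass \<open>n\<close> exactly if the masses of the pair add up to \<open>n\<close>, which gives
  the gain with its factor 1/2. The two loss terms agree by the symmetry of \<open>K\<close>, so
  that half their sum is the loss once. Integrability over the product, needed to separate the
  terms, comes from the hypothesis on functions growing like the product of the masses.\<close>

lemma smoluchowski_weak_form:
 assumes v: "v : FM particles"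
  and int: "!!\<phi> c. \<phi> : BM (P <*> P) ==> 0 <= c ==>
   (!!x y. x : particles ==> y : particles ==> \<bar>\<phi> (x, y)\<bar> <= c * (real (snd x) * real (snd y))) ==> integrable (v <*> v) (\<phi> :: _ => real)"
  and g: "g : BM borel" "!!x. \<bar>g x\<bar> <= c" and n: "1 <= n"
 defines "f \<equiv> %y. ind {n} (snd y) * g (fst y)"
 shows "1 / 2 * (LINT (y, y')|(v <*> v). K y y' * ((LINT z|(merged \<Upsilon> y y'). f z) - f y - f y')) =
  smoluchowski_gain K \<Upsilon> v n g - smoluchowski_loss K v n g"
proof -
 interpret v: finite_measure v using v by (simp add: finite_measures_def)
 interpret vv: pair_sigma_finite v v ..
 have sv: "sets v = sets P" "space v = particles" using v sets_eq_imp_space_eq[of v P] by (auto simp: finite_measures_def)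
 have svv: "sets (v <*> v) = sets (P <*> P)" by (intro sets_pair_measure_cong sv)
 have spp: "space (v <*> v) = particles \<times> particles" by (simp add: space_pair_measure sv)
 note cong = measurable_cong_sets[OF svv refl] measurable_cong_sets[OF sv(1) refl]
 have c: "0 <= c" using g(2) abs_ge_zero order_trans by blast
 have H: "0 <= H" by (simp add: H_def)
 define G where "G = (%(y, y'). K y y' * (LINT z|(\<Upsilon> y y'). g z))"
 have "(%p. LINT z|(\<Upsilon> (fst p) (snd p)). g z) : BM (P <*> P)" using mcomp[OF measurable_prob_algebraD[OF \<Upsilon>_measurable] integral_measurable_subprob_algebra[OF g(1)]] g(2)
  by (simp add: case_prod_beta')
 then have Gm: "G : BM (P <*> P)" using K_measurable unfolding G_def case_prod_beta' by (rule borel_measurable_times[rotated])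
 have Gb: "\<bar>G (y, y')\<bar> <= (c * H) * (real (snd y) * real (snd y'))" if "y : particles" "y' : particles" for y y'
 proof -
  interpret prob_space "\<Upsilon> y y'" using \<Upsilon>_prob[OF that] by simp
  have "\<bar>LINT z|(\<Upsilon> y y'). g z\<bar> <= (LINT z|(\<Upsilon> y y'). \<bar>g z\<bar>)" by (rule integral_abs_bound)
  also have "\<dots> <= c" using g c \<Upsilon>_prob[OF that] by (intro integral_le_const integrable_const_bound[of _ c] AE_I2) (auto cong: measurable_cong_sets)
  finally have "\<bar>G (y, y')\<bar> <= K y y' * c" using K_nonneg[OF that] by (simp add: G_def abs_mult mult_left_mono)
  also have "\<dots> <= H * (real (snd y) * real (snd y')) * c" by (rule mult_right_mono[OF K_le[OF that] c])
  finally show ?thesis by (simp add: mult.commute mult.left_commute)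
 qed
 have ind: "(%y. ind B (snd y) :: real) : BM P" for B :: "nat set" by (rule mcomp[OF snd_particle_measurable(1)]) (intro borel_measurable_indicator, simp add: sets_borel_eq_count_space)
 have fm: "f : BM P" unfolding f_def by (intro borel_measurable_times ind mcomp[OF snd_particle_measurable(2) g(1)])
 have fb: "\<bar>f y\<bar> <= c" for y using g(2) c by (simp add: f_def indicator_def)
 have fK: "(%p. f (h p) * K (fst p) (snd p)) : BM (P <*> P)" if "h : P <*> P ->M P" for h using mcomp[OF that fm] K_measurable by (simp add: case_prod_beta')
 have fKi: "integrable (v <*> v) (%p. f (h p) * K (fst p) (snd p))" if "h : P <*> P ->M P" for h
 proof (rule int[OF fK[OF that], of "c * H"])
  show "\<bar>f (h (x, y)) * K (fst (x, y)) (snd (x, y))\<bar> <= c * H * (real (snd x) * real (snd y))" if "x : particles" "y : particles" for x y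
   using mult_mono[OF fb K_le[OF that] c K_nonneg[OF that]] K_nonneg[OF that] by (simp add: abs_mult mult.assoc)
 qed (use c H in simp)
 have I: "integrable (v <*> v) (%p. ind B (snd (fst p)) * ind B' (snd (snd p)) * G p)" for B B' :: "nat set"
 proof (rule int[of _ "c * H"])
  show "(%p. ind B (snd (fst p)) * ind B' (snd (snd p)) * G p) : BM (P <*> P)" by (intro borel_measurable_times mcomp[OF measurable_fst ind] mcomp[OF measurable_snd ind] Gm)
  show "\<bar>ind B (snd (fst (x, y))) * ind B' (snd (snd (x, y))) * G (x, y)\<bar> <= c * H * (real (snd x) * real (snd y))"
   if "x : particles" "y : particles" for x y using Gb[OF that] c H by (auto simp: indicator_def)
 qed (use c H in simp)
 have gain: "(LINT x|(mass_slice v m). (LINT x'|(mass_slice v m'). (LINT z|(merge_kernel K \<Upsilon> (x, m) (x', m')). g z))) =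
   (LINT p|(v <*> v). ind {m} (snd (fst p)) * ind {m'} (snd (snd p)) * G p)" if m: "1 <= m" "1 <= m'" for m m'
 proof -
  have "(LINT z|(merge_kernel K \<Upsilon> (x, m) (x', m')). g z) = G ((x, m), (x', m'))" for x x'
  proof -
   have p: "(x, m) : particles" "(x', m') : particles" using m by (auto simp: particles_mass)
   show ?thesis unfolding merge_kernel_def G_def using K_nonneg[OF p] \<Upsilon>_prob[OF p] g(1) by (simp add: integral_scale_measure cong: measurable_cong_sets)
  qed
  moreover have "(LINT x'|(mass_slice v m'). G ((x, m), (x', m'))) = (LINT y'|v. ind {m'} (snd y') * G ((x, m), (fst y', m')))" for x
  proof (rule mass_slice(1)[OF v])
   have "(%x'. ((x, m), (x', m'))) : borel ->M P <*> P" using m by (intro measurable_Pair measurable_type measurable_const) (auto simp: particles_mass)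
   then show "(%x'. G ((x, m), (x', m'))) : BM borel" by (rule mcomp[OF _ Gm])
  qed
  moreover have "(LINT x|(mass_slice v m). (LINT y'|v. ind {m'} (snd y') * G ((x, m), (fst y', m')))) =
    (LINT y|v. ind {m} (snd y) * (LINT y'|v. ind {m'} (snd y') * G ((fst y, m), (fst y', m'))))"
  proof (rule mass_slice(1)[OF v])
   have fst: "fst : BM v" unfolding cong by (rule snd_particle_measurable(2))
   have "(%p. ((fst p, m), (fst (snd p), m'))) : borel <*> v ->M P <*> P" by (intro measurable_Pair mcomp[OF measurable_fst measurable_type[OF m(1)]]
     mcomp[OF mcomp[OF measurable_snd fst] measurable_type[OF m(2)]])
   moreover have "(%y. ind {m'} (snd y) :: real) : BM v" unfolding cong by (rule ind)
   ultimately have "(%(x, y'). ind {m'} (snd y') * G ((x, m), (fst y', m'))) : BM (borel <*> v)"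
    using mcomp[OF _ Gm] unfolding case_prod_beta' by (intro borel_measurable_times mcomp[OF measurable_snd]) auto
   then show "(%x. LINT y'|v. ind {m'} (snd y') * G ((x, m), (fst y', m'))) : BM borel" by (rule v.borel_measurable_lebesgue_integral)
  qed
  moreover have "\<dots> = (LINT y|v. (LINT y'|v. ind {m} (snd (fst (y, y'))) * ind {m'} (snd (snd (y, y'))) * G (y, y')))"
  proof (rule LINT_cong[OF refl])
   fix y
   have "ind {m} (snd y) * (LINT y'|v. ind {m'} (snd y') * G ((fst y, m), (fst y', m'))) =
    (LINT y'|v. ind {m} (snd y) * (ind {m'} (snd y') * G ((fst y, m), (fst y', m'))))" by simp
   also have "\<dots> = (LINT y'|v. ind {m} (snd (fst (y, y'))) * ind {m'} (snd (snd (y, y'))) * G (y, y'))" by (intro LINT_cong) (auto simp: indicator_def)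
   finally show "ind {m} (snd y) * (LINT y'|v. ind {m'} (snd y') * G ((fst y, m), (fst y', m'))) = \<dots>" .
  qed
  moreover have "\<dots> = (LINT p|(v <*> v). ind {m} (snd (fst p)) * ind {m'} (snd (snd p)) * G p)" by (rule vv.integral_fst'[OF I])
  ultimately show ?thesis by simp
 qed
 let ?I = "{(m, m'). 1 <= m & 1 <= m' & m + m' = n}"
 have fin: "finite ?I" by (rule finite_subset[of _ "{..n} \<times> {..n}"]) auto
 have "(\<Sum>(m, m')\<in>?I. LINT x|(mass_slice v m). (LINT x'|(mass_slice v m'). (LINT z|(merge_kernel K \<Upsilon> (x, m) (x', m')). g z))) =
   (\<Sum>(m, m')\<in>?I. (LINT p|(v <*> v). ind {m} (snd (fst p)) * ind {m'} (snd (snd p)) * G p))" by (intro sum.cong refl) (clarsimp simp: gain)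
 also have "\<dots> =
   (LINT p|(v <*> v). (\<Sum>i\<in>?I. ind {fst i} (snd (fst p)) * ind {snd i} (snd (snd p)) * G p))" unfolding case_prod_beta' by (rule Bochner_Integration.integral_sum[symmetric, OF I])
 \<comment> \<open>A pair of particles, both of mass at least 1, matches exactly one splitting of
   its total mass, so the indicators of the splittings of \<open>n\<close> add up to one
   indicator.\<close>
 also have "\<dots> = (LINT p|(v <*> v). ind {n} (snd (fst p) + snd (snd p)) * G p)"
 proof (rule LINT_cong[OF refl])
  fix p assume "p : space (v <*> v)"
  then have p: "1 <= snd (fst p)" "1 <= snd (snd p)" unfolding spp by (auto simp: particles_mass)
  have "(\<Sum>i\<in>?I. ind {fst i} (snd (fst p)) * ind {snd i} (snd (snd p)) * G p) = (\<Sum>i\<in>?I. if i = (snd (fst p), snd (snd p)) then G p else 0)"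
   by (intro sum.cong) (auto simp: indicator_def)
  also have "\<dots> = ind {n} (snd (fst p) + snd (snd p)) * G p" using p fin by (simp add: sum.delta' indicator_def)
  finally show "(\<Sum>i\<in>?I. ind {fst i} (snd (fst p)) * ind {snd i} (snd (snd p)) * G p) = \<dots>" .
 qed
 finally have gain': "smoluchowski_gain K \<Upsilon> v n g = 1 / 2 * (LINT p|(v <*> v). ind {n} (snd (fst p) + snd (snd p)) * G p)" unfolding smoluchowski_gain_def by (rule arg_cong)
 have loss: "smoluchowski_loss K v n g = (LINT p|(v <*> v). f (fst p) * K (fst p) (snd p))"
 proof -
  have "(%p. ((fst p, n), snd p)) : borel <*> v ->M P <*> P"
   using measurable_ident_sets[OF sv(1)] by (intro measurable_Pair mcomp[OF measurable_fst measurable_type[OF n]] mcomp[OF measurable_snd]) auto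
  from mcomp[OF this K_measurable]
  have "(%(x, y'). K (x, n) y') : BM (borel <*> v)" by (simp add: case_prod_beta')
  then have "(%x. g x * (LINT y'|v. K (x, n) y')) : BM borel" by (intro borel_measurable_times g(1) v.borel_measurable_lebesgue_integral)
  from mass_slice(1)[OF v this, of n]
  have "smoluchowski_loss K v n g = (LINT y|v. ind {n} (snd y) * (g (fst y) * (LINT y'|v. K (fst y, n) y')))" unfolding smoluchowski_loss_def .
  also have "\<dots> = (LINT y|v. (LINT y'|v. f (fst (y, y')) * K (fst (y, y')) (snd (y, y'))))" by (intro LINT_cong) (auto simp: f_def indicator_def)
  also have "\<dots> = (LINT p|(v <*> v). f (fst p) * K (fst p) (snd p))" by (rule vv.integral_fst'[OF fKi[OF measurable_fst]])
  finally show ?thesis .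
 qed
 have "(LINT p|(v <*> v). f (snd p) * K (fst p) (snd p)) = (LINT (x, y)|(v <*> v). f (snd (y, x)) * K (fst (y, x)) (snd (y, x)))"
  using fK[OF measurable_snd] by (intro vv.integral_product_swap[symmetric]) (simp add: cong)
 also have "\<dots> = smoluchowski_loss K v n g" unfolding loss by (intro LINT_cong) (auto simp: spp K_sym)
 finally have loss': "(LINT p|(v <*> v). f (snd p) * K (fst p) (snd p)) = smoluchowski_loss K v n g" .
 have "(LINT (y, y')|(v <*> v). K y y' * ((LINT z|(merged \<Upsilon> y y'). f z) - f y - f y')) =
   (LINT p|(v <*> v). ind {n} (snd (fst p) + snd (snd p)) * G p - f (fst p) * K (fst p) (snd p) - f (snd p) * K (fst p) (snd p))"
 proof (rule LINT_cong[OF refl])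
  fix p assume "p : space (v <*> v)"
  then obtain y y' where p: "p = (y, y')" "y : particles" "y' : particles" unfolding spp by blast
  have "(LINT z|(merged \<Upsilon> y y'). f z) = ind {n} (snd y + snd y') * (LINT z|(\<Upsilon> y y'). g z)" unfolding merged_def integral_distr[OF merge_measurable[OF p(2,3)] fm] by (simp add: f_def)
  then show "(case p of (y, y') => K y y' * ((LINT z|(merged \<Upsilon> y y'). f z) - f y - f y')) =
   ind {n} (snd (fst p) + snd (snd p)) * G p - f (fst p) * K (fst p) (snd p) - f (snd p) * K (fst p) (snd p)" by (simp add: p(1) G_def algebra_simps)
 qed
 also have "\<dots> = (LINT p|(v <*> v). ind {n} (snd (fst p) + snd (snd p)) * G p) - smoluchowski_loss K v n g - smoluchowski_loss K v n g"
 proof -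
  have "integrable (v <*> v) (%p. ind {n} (snd (fst p) + snd (snd p)) * G p)"
  proof (rule int[of _ "c * H"])
   have "(%p. snd (fst p) + snd (snd p)) : P <*> P ->M borel" by (intro borel_measurable_add mcomp[OF _ snd_particle_measurable(1)] measurable_fst measurable_snd)
   from mcomp[OF this, of "ind {n} :: nat => real" borel]
   show "(%p. ind {n} (snd (fst p) + snd (snd p)) * G p) : BM (P <*> P)" using Gm by simp
   show "\<bar>ind {n} (snd (fst (x, y)) + snd (snd (x, y))) * G (x, y)\<bar> <= c * H * (real (snd x) * real (snd y))"
    if "x : particles" "y : particles" for x y using Gb[OF that] c H by (auto simp: indicator_def)
  qed (use c H in simp)
  then show ?thesis using fKi[OF measurable_fst] fKi[OF measurable_snd] by (simp add: loss[symmetric] loss')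
 qed
 finally show ?thesis unfolding gain' by simp
qed

end

section \<open>The smallness of the time horizon and the final assembly\<close>

text \<open>With e >= 5/2 and pi / (1 + pi) <= 5/6, the number 3 e times the given bound is at most
  3 / (5/2) * (5/6) = 1; the strict inequality is that of the hypothesis.\<close>

lemma small_time:
 assumes "0 <= H" "0 <= T" "ennreal T * ennreal H < ennreal (1 / exp 2 * (pi / (1 + pi)))"
 shows "3 * exp 1 * (H * T) < 1"
proof -
 have e: "5 / 2 <= exp (1 :: real)" using exp_lower_Taylor_quadratic[of "1 :: real"] by simp
 have pi: "pi / (1 + pi) <= 5 / 6" using pi_less_4 pi_gt_zero by (subst pos_divide_le_eq) (simp_all add: add_pos_pos)
 have "H * T < 1 / exp 2 * (pi / (1 + pi))" using assms by (simp add: ennreal_mult[symmetric] ennreal_less_iff mult.commute)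
 then have "3 * exp 1 * (H * T) < 3 * exp 1 * (1 / exp 2 * (pi / (1 + pi)))" by (rule mult_strict_left_mono) simp
 also have "\<dots> = 3 / exp 1 * (pi / (1 + pi))" using exp_add[of "1 :: real" 1] by simp
 also have "\<dots> <= 3 / (5 / 2) * (5 / 6)" using e pi pi_gt_zero by (intro mult_mono divide_left_mono) auto
 finally show ?thesis by simp
qed

lemma distr_scale_measure:
 assumes "f : M ->M N"
 shows "distr (scale_measure c M) N f = scale_measure c (distr M N f)" using assms by (intro measure_eqI) (auto simp: emeasure_distr space_scale_measure cong: measurable_cong_sets)

theorem lemma2p12:
  fixes K :: "('s::polish_space \<times> nat) \<Rightarrow> ('s \<times> nat) \<Rightarrow> real"
    and \<Upsilon> :: "('s \<times> nat) \<Rightarrow> ('s \<times> nat) \<Rightarrow> 's measure"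
    and \<mu> :: "'s measure"
    and T :: real
    and \<Omega> :: "nat \<Rightarrow> 'w measure"
    and \<Xi> :: "nat \<Rightarrow> real \<Rightarrow> 'w \<Rightarrow> ('s \<times> nat) multiset"
  assumes K_nonneg: "\<And>y y'. y \<in> particles \<Longrightarrow> y' \<in> particles \<Longrightarrow> 0 \<le> K y y'"
    and K_sym: "\<And>y y'. y \<in> particles \<Longrightarrow> y' \<in> particles \<Longrightarrow> K y y' = K y' y"
    and K_cont: "continuous_on (particles \<times> particles) (\<lambda>(y, y'). K y y')"
    and \<Upsilon>_kernel: "(\<lambda>(y, y'). \<Upsilon> y y') \<in>
          restrict_space borel (particles \<times> particles) \<rightarrow>\<^sub>M prob_algebra borel"
    and \<Upsilon>_sym: "\<And>y y'. y \<in> particles \<Longrightarrow> y' \<in> particles \<Longrightarrow> \<Upsilon> y y' = \<Upsilon> y' y"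
    and \<mu>: "sets \<mu> = sets borel" "prob_space \<mu>"
    and H_finite: "coag_bound K < \<infinity>"
    and T_pos: "0 < T"
    and TH: "ennreal T * coag_bound K < ennreal (1 / exp 2 * (pi / (1 + pi)))"
    and \<Xi>: "\<And>N. 0 < N \<Longrightarrow> marcus_lushnikov_Poi (\<lambda>y y'. 1 / real N * K y y') \<Upsilon>
          (scale_measure (of_nat N) \<mu>) (\<Omega> N) (\<Xi> N)"
  shows "\<exists>\<rho>. \<rho> \<in> cadlag_paths T (weak_topology particles) \<and>
      smoluchowski_solution K \<Upsilon> T \<rho> \<and>
      converges_in_distribution (skorohod_topology T (weak_topology particles)) \<Omega>
        (\<lambda>N \<omega>. \<lambda>t\<in>{0..T}. scale_measure (1 / of_nat N) (mset_measure particles (\<Xi> N t \<omega>)))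
        (return (borel_of (skorohod_topology T (weak_topology particles))) \<rho>)"
proof -
 interpret spatial_kernel K \<Upsilon> by unfold_locales (fact K_nonneg K_sym K_cont \<Upsilon>_kernel H_finite)+
 obtain \<B> where \<B>: "bump_space (particles :: ('s \<times> nat) set) \<B>" using ex_bump_space by blast
 define one where "one = (%x :: 's. (x, 1 :: nat))"
 have one: "one : \<mu> ->M P" unfolding one_def using measurable_type[of 1] \<mu>(1) by (simp cong: measurable_cong_sets)
 define \<nu> where "\<nu> = distr \<mu> P one"
 have H: "0 <= H" "coag_bound K = ennreal H" using H_finite by (simp_all add: H_def)
 interpret coag_short particles \<B> K "merged \<Upsilon>" snd H \<nu> T
 proof (intro coag_short.intro coag_initial.intro coag_kernel[OF \<B>] coag_initial_axioms.intro coag_short_axioms.intro)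
  show "prob_space \<nu>" unfolding \<nu>_def by (rule prob_space.prob_space_distr[OF \<mu>(2) one])
  show "AE y in \<nu>. snd y = 1" unfolding \<nu>_def
   by (subst AE_distr_iff[OF one]) (use measurable_sets[OF snd_particle_measurable(1), of "{1}"] in \<open>auto simp: one_def vimage_def Int_def conj_commute\<close>)
  show "3 * exp 1 * (H * T) < 1" using small_time[of H T] H TH T_pos by simp
 qed (use T_pos in \<open>auto simp: \<nu>_def\<close>)
 have "EX k. poisson_point_process (scale_measure (of_nat N) \<mu>) (\<Omega> N) k & (\<forall>\<omega>\<in>space (\<Omega> N). \<Xi> N 0 \<omega> = image_mset one (k \<omega>))" if "0 < N" for N
  using \<Xi>[OF that] unfolding marcus_lushnikov_Poi_def one_def by blast
 then obtain k where k: "!!N. 0 < N ==> poisson_point_process (scale_measure (of_nat N) \<mu>) (\<Omega> N) (k N)"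
  "!!N \<omega>. 0 < N ==> \<omega> : space (\<Omega> N) ==> \<Xi> N 0 \<omega> = image_mset one (k N \<omega>)" by metis
 \<comment> \<open>\<^term>\<open>\<Xi>\<close> is a Poisson process at time 0 only on the sample space, while the
  independence of counts refers to functions on the whole type.\<close>
 define X where "X N t = (if t = 0 then %\<omega>. image_mset one (k N \<omega>) else \<Xi> N t)" for N t
 have X: "X N t \<omega> = \<Xi> N t \<omega>" if "0 < N" "\<omega> : space (\<Omega> N)" for N t \<omega> using k(2)[OF that] by (simp add: X_def)
 have mj: "markov_jump_process PM (coag_rate (%y y'. 1 / real N * K y y') \<Upsilon>) (\<Omega> N) (X N)" if "0 < N" for N
  using \<Xi>[OF that] X[OF that] unfolding marcus_lushnikov_Poi_def marcus_lushnikov_def markov_jump_process_def by simp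
 have "ALL N. EX Y \<sigma>. 0 < N --> jump_process (\<Omega> N) PM (rate (real N)) Y \<sigma> (X N)" using jump_process[OF \<B> _ mj] by blast
 then obtain Y \<sigma> where jp: "!!N. 0 < N ==> jump_process (\<Omega> N) PM (rate (real N)) (Y N) (\<sigma> N) (X N)" unfolding choice_iff by blast
 interpret coag_limit particles \<B> K "merged \<Upsilon>" snd H \<nu> T \<Omega> Y \<sigma> X
 proof (intro coag_limit.intro coag_limit_axioms.intro coag_short_axioms coag_initial_axioms coag_kernel_axioms)
  fix N :: nat assume N: "0 < N"
  have "prob_space (\<Omega> N)" using mj[OF N] by (simp add: markov_jump_process_def)
  from poisson_point_process_image[OF this k(1)[OF N], of one P]
  have "poisson_point_process (scale_measure (of_nat N) \<nu>) (\<Omega> N) (X N 0)" using one unfolding \<nu>_def X_def by (simp add: distr_scale_measure cong: measurable_cong_sets)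
  then show "coag_process particles \<B> K (merged \<Upsilon>) snd H \<nu> (\<Omega> N) N (Y N) (\<sigma> N) (X N)"
   by (intro coag_process.intro coag_process_axioms.intro coag_initial_axioms N jp[OF N])
 qed
 have solution: "smoluchowski_solution K \<Upsilon> T (\<lambda>t\<in>{0..T}. \<rho> t)" unfolding smoluchowski_solution_def
 proof (intro conjI ballI allI impI)
  fix t assume t: "t : {0..T}"
  then have t': "0 <= t" "t <= T" by auto
  note fin = \<rho>_finite[OF T_pos t]
  show "(\<lambda>t\<in>{0..T}. \<rho> t) t : FM particles" using t fin by simp
  fix n :: nat assume n: "1 <= n"
  show "(NN x|(mass_slice ((\<lambda>t\<in>{0..T}. \<rho> t) t) n). (NN y'|((\<lambda>t\<in>{0..T}. \<rho> t) t). ennreal (K (x, n) y'))) < \<infinity>"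
  proof -
   interpret \<rho>: finite_measure "\<rho> t" by (rule \<rho>_props[OF t'])
   interpret slice: finite_measure "mass_slice (\<rho> t) n" by (rule mass_slice(3)[OF fin])
   \<comment> \<open>\<open>K_le\<close> bounds the kernel by H n times the mass of the partner,
     whose integral is at most \<open>S 1 0\<close>; so the inner integral is bounded in
     \<open>x\<close>, and the slice is a finite measure.\<close>
   let ?c = "ennreal (H * real n) * ennreal (S 1 0)"
   have "(NN y'|(\<rho> t). ennreal (K (x, n) y')) <= ?c" for x
   proof -
    have "(NN y'|(\<rho> t). ennreal (K (x, n) y')) <= (NN y'|(\<rho> t). ennreal (H * real n) * of_nat (snd y'))"
    proof (rule nn_integral_mono)
     fix y' assume "y' : space (\<rho> t)"
     then have "K (x, n) y' <= H * (real n * real (snd y'))" using K_le[of "(x, n)" y'] n \<rho>_space[OF t'] by (simp add: particles_mass)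
     then show "ennreal (K (x, n) y') <= ennreal (H * real n) * of_nat (snd y')" using H(1) by (simp add: ennreal_of_nat_eq_real_of_nat ennreal_mult[symmetric] mult.assoc ennreal_leI)
    qed
    also have "\<dots> = ennreal (H * real n) * (NN y'|(\<rho> t). of_nat (snd y'))"
    proof (rule nn_integral_cmult)
     have "(snd :: 's \<times> nat => nat) : \<rho> t ->M CSU" using mass_measurable \<rho>_props(2)[OF t'] by (simp cong: measurable_cong_sets)
     then show "(%y'. of_nat (snd y') :: ennreal) : BM (\<rho> t)" by (rule mcomp) simp
    qed
    also have "\<dots> <= ?c" by (intro mult_left_mono nn_integral_mass[OF t']) simp
    finally show ?thesis .
   qed
   then have "(NN x|(mass_slice (\<rho> t) n). (NN y'|(\<rho> t). ennreal (K (x, n) y'))) <= (NN x|(mass_slice (\<rho> t) n). ?c)" by (intro nn_integral_mono)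
   also have "\<dots> < \<infinity>" by (simp add: slice.emeasure_eq_measure ennreal_mult_less_top)
   finally show ?thesis using t by simp
  qed
 next
  fix n :: nat and g :: "'s => real" and t
  assume n: "1 <= n" and "continuous_on UNIV g" "bounded (range g)" and t: "t : {0..T}"
  then obtain c where g: "g : BM borel" "!!x. \<bar>g x\<bar> <= c" by (auto simp: bounded_iff intro: borel_measurable_continuous_onI)
  from t have t': "0 <= t" "t <= T" by auto
  define f where "f = (%y :: 's \<times> nat. ind {n} (snd y) * g (fst y))"
  have ind: "(%y :: 's \<times> nat. ind {n} (snd y) :: real) : BM P" by (rule mcomp[OF snd_particle_measurable(1)]) simp
  have fm: "f : BM P" unfolding f_def by (intro borel_measurable_times ind mcomp[OF snd_particle_measurable(2) g(1)])
  have fb: "\<bar>f y\<bar> <= c" for y using g(2)[of "fst y"] by (auto simp: f_def indicator_def)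
  have slice: "(LINT x|(mass_slice (\<rho> s) n). g x) = (LINT y|(\<rho> s). f y)" if "s : {0..T}" for s unfolding f_def by (rule mass_slice(1)[OF \<rho>_finite[OF T_pos that] g(1)])
  have eq: "1 / 2 * (LINT p|(\<rho> t <*> \<rho> t). jump_effect f p) = smoluchowski_gain K \<Upsilon> (\<rho> t) n g - smoluchowski_loss K (\<rho> t) n g" unfolding jump_effect_def f_def
   by (rule smoluchowski_weak_form[OF \<rho>_finite[OF T_pos t] R_dbl_unbounded(1)[OF t'] g n])
  from limit_derivative(1)[OF fm fb t' T_pos]
  have "((%s. LINT y|(\<rho> s). f y) has_real_derivative (smoluchowski_gain K \<Upsilon> (\<rho> t) n g - smoluchowski_loss K (\<rho> t) n g)) (at t within {0..T})" unfolding eq .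
  then have "((%s. LINT x|(mass_slice ((\<lambda>t\<in>{0..T}. \<rho> t) s) n). g x) has_real_derivative (smoluchowski_gain K \<Upsilon> (\<rho> t) n g - smoluchowski_loss K (\<rho> t) n g)) (at t within {0..T})"
   by (rule has_field_derivative_transform_within[OF _ zero_less_one t]) (simp add: slice)
  then show "((%s. LINT x|(mass_slice ((\<lambda>t\<in>{0..T}. \<rho> t) s) n). g x) has_real_derivative
    (smoluchowski_gain K \<Upsilon> ((\<lambda>t\<in>{0..T}. \<rho> t) t) n g - smoluchowski_loss K ((\<lambda>t\<in>{0..T}. \<rho> t) t) n g)) (at t within {0..T})" using t by simp
 qed
 let ?S = "skorohod_topology T (WT (particles :: ('s \<times> nat) set))"
 let ?Z = "%\<Xi> N \<omega>. \<lambda>t\<in>{0..T}. scale_measure (1 / of_nat N) (mset_measure (particles :: ('s \<times> nat) set) (\<Xi> N t \<omega>))"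
 have XZ: "?Z X N \<omega> = ?Z \<Xi> N \<omega>" if "0 < N" "\<omega> : space (\<Omega> N)" for N \<omega> using X[OF that] by (intro ext) simp
 have "converges_in_distribution ?S \<Omega> (?Z \<Xi>) (return (borel_of ?S) (\<lambda>t\<in>{0..T}. \<rho> t))" unfolding converges_in_distribution_def
 proof (intro conjI allI impI)
  note conv = converges_to_\<rho>[OF T_pos, unfolded converges_in_distribution_def]
  show "?Z \<Xi> N : \<Omega> N ->M borel_of ?S" if N: "0 < N" for N using conv N by (subst measurable_cong[OF XZ[OF N, symmetric]]) auto
  fix F :: "(real => ('s \<times> nat) measure) => real"
  assume "continuous_map ?S euclideanreal F" "bounded (F ` topspace ?S)"
  then have "(%N. LINT f|(distr (\<Omega> N) (borel_of ?S) (?Z X N)). F f) \<longlonglongrightarrow> (LINT f|(return (borel_of ?S) (\<lambda>t\<in>{0..T}. \<rho> t)). F f)" using conv by blast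
  then show "(%N. LINT f|(distr (\<Omega> N) (borel_of ?S) (?Z \<Xi> N)). F f) \<longlonglongrightarrow> (LINT f|(return (borel_of ?S) (\<lambda>t\<in>{0..T}. \<rho> t)). F f)"
  proof (rule Lim_transform_eventually, intro eventually_sequentiallyI[of 1])
   fix N :: nat assume "1 <= N"
   then have "distr (\<Omega> N) (borel_of ?S) (?Z X N) = distr (\<Omega> N) (borel_of ?S) (?Z \<Xi> N)" by (intro distr_cong refl XZ) auto
   then show "(LINT f|(distr (\<Omega> N) (borel_of ?S) (?Z X N)). F f) = (LINT f|(distr (\<Omega> N) (borel_of ?S) (?Z \<Xi> N)). F f)" by (rule arg_cong)
  qed
 qed
 then show ?thesis using \<rho>_path[OF T_pos] solution by blast
qed

end
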